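(* Let $\mathcal U$ be an $n$-dimensional Thorin measure, $\boldsymbol\mu\in\mathbb R^n$, $\mathbf d\in[0,\infty)^n$ and $\Sigma\in\mathbb R^{n\times n}$ a covariance matrix. If $Y\sim VGG^n(\mathbf d,\boldsymbol\mu,\Sigma,\mathcal U)$, then $Y\sim L^n(\mathbf m_2,\mathbf d\diamond\Sigma,\mathcal Y)$, where $$\mathbf m_2=\mathbf d\diamond\boldsymbol\mu+\int_{\mathbb D_*}\mathbf y\,\mathcal Y(d\mathbf y),$$ $$\mathcal Y=\Big\{\frac{\mathcal U(d\mathbf u)}{\|\mathbf u\|^2}\otimes\mathcal V_{\|\mathbf u\|^2,\mathbf u\diamond\boldsymbol\mu,\mathbf u\diamond\Sigma}(d\mathbf y)\Big\}\circ\big((\mathbf u,\mathbf y)\mapsto\mathbf y\big)^{-1},$$ i.e. $\mathcal Y(A)=\int_{[0,\infty)^n_*}\mathcal V_{\|\mathbf u\|^2,\mathbf u\diamond\boldsymbol\mu,\mathbf u\diamond\Sigma}(A)\,\mathcal U(d\mathbf u)/\|\mathbf u\|^2$ for Borel $A\subseteq\mathbb R^n_*$, and, for $\boldsymbol\theta\in\mathbb R^n$, the characteristic exponent of $Y$ is $$\Psi_Y(\boldsymbol\theta)=i\langle\mathbf d\diamond\boldsymbol\mu,\boldsymbol\theta\rangle-\tfrac12\|\boldsymbol\theta\|^2_{\mathbf d\diamond\Sigma}-\int_{[0,\infty)^n_*}\ln\Big\{\frac{\|\mathbf u\|^2-i\langle\mathbf u\diamond\boldsymbol\mu,\boldsymbol\theta\rangle+\frac12\|\boldsymbol\theta\|^2_{\mathbf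 u\diamond\Sigma}}{\|\mathbf u\|^2}\Big\}\,\mathcal U(d\mathbf u).$$ If, in addition, $\Sigma$ is invertible, then $\mathcal Y=\sum_{\emptyset\neq J\subseteq\{1,\dots,n\}}\mathcal Y_J$ with measures $\mathcal Y_J$ concentrated on $V_J$ (i.e. $\mathcal Y_J(\mathbb R^n_*\setminus V_J)=0$), where $\mathcal Y_J$ is absolutely continuous with respect to the $\#J$-dimensional Lebesgue measure on $\boldsymbol\pi_J(\mathbb R^n)$, having density $v_J(\mathbf y)=\int_{C_J}\nu_J(\mathbf u,\mathbf y)\,\mathcal U(d\mathbf u)$, $\mathbf y\in V_J$, where for $\mathbf u\in C_J$, $\mathbf y\in V_J$ and $c_J=2/(2\pi)^{\#J/2}$, $$\nu_J(\mathbf u,\mathbf y)=c_J\,\frac{\exp\{\langle\mathbf y,\mathbf u\diamond\boldsymbol\mu\rangle_{(\mathbf u\diamond\Sigma)_J^{-1}}\}}{|\mathbf u\diamond\Sigma|_J^{1/2}\,\|\mathbf y\|^{\#J}_{(\mathbf u\diamond\Sigma)_J^{-1}}}\;\mathfrak K_{\#J/2}\Big\{\|\mathbf y\|_{(\mathbf u\diamond\Sigma)_J^{-1}}\big(2\|\mathbf u\|^2+\|\mathbf u\diamond\boldsymbol\mu\|^2_{(\mathbf u\diamond\Sigma)_J^{-1}}\big)^{1/2}\Big\}.$$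
   Context: Basic notation. Elements of $\mathbb R^n$ are row vectors, $'$ denotes transposition, $\langle\mathbf x,\mathbf y\rangle=\mathbf x\mathbf y'$, $\|\cdot\|$ is the Euclidean norm, $\langle\mathbf x,\mathbf y\rangle_\Sigma=\mathbf x\Sigma\mathbf y'$, $\|\mathbf x\|_\Sigma^2=\mathbf x\Sigma\mathbf x'$. $\mathbb D=\{\|\mathbf x\|\le 1\}$ is the closed Euclidean unit ball (in $\mathbb R^n$ or $\mathbb R^{2n}$ according to context), $A_*=A\setminus\{\mathbf 0\}$. $\mathbf e_1,\dots,\mathbf e_n$ is the canonical basis; for $J\subseteq\{1,\dots,n\}$, $\boldsymbol\pi_J(\mathbf x)=\mathbf x\boldsymbol\pi_J=\sum_{j\in J}x_j\mathbf e_j$. $\ln$ is the principal branch of the logarithm on $\mathbb C\setminus(-\infty,0]$. Lévy processes. $X\sim L^n(\boldsymbol\mu,\Sigma,\mathcal X)$ means that $X$ is an $n$-dimensional Lévy process with $\mathbb E e^{i\langle\boldsymbol\theta,X(t)\rangle}=e^{t\Psi_X(\boldsymbol\theta)}$, $\Psi_X(\boldsymbol\theta)=i\langle\boldsymbol\mu,\boldsymbol\theta\rangle-\frac12\|\boldsymbol\theta\|^2_\Sigma+\int_{\mathbb R^n_*}(e^{i\langle\boldsymbol\theta,\mathbf x\rangle}-1-i\langle\boldsymbol\theta,\mathbf x\rangle\mathbf 1_{\mathbb D}(\mathbf x))\mathcal X(d\mathbf x)$. $BM^n(\boldsymbol\mu,\Sigma)=L^n(\boldsymbol\mu,\Sigma,0)$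 is Brownian motion with drift $\boldsymbol\mu$ and covariance $\Sigma$. $S^n(\mathbf d,\mathcal T)$ denotes an $n$-dimensional subordinator (Lévy process with nondecreasing components) with drift $\mathbf d\in[0,\infty)^n$ and Lévy measure $\mathcal T$. For $\mathbf t\in[0,\infty)^n$: $B(\mathbf t)=(B_1(t_1),\dots,B_n(t_n))$, $\mathbf t\diamond\boldsymbol\mu=(t_1\mu_1,\dots,t_n\mu_n)$, $(\mathbf t\diamond\Sigma)_{kl}=\Sigma_{kl}(t_k\wedge t_l)$. Weak subordination of Brownian motion. For $B\sim BM^n(\boldsymbol\mu,\Sigma)$ and $T\sim S^n(\mathbf d,\mathcal T)$, $(T,B\odot T)$ denotes a Lévy process $Z=(Z_1,Z_2)\sim L^{2n}((\mathbf m_1,\mathbf m_2^{Z}),\Theta,\mathcal Z)$ with $\mathbf m_1=\mathbf d+\int_{[0,\infty)^n_*}\mathbf t\,\mathbb P((\mathbf t,B(\mathbf t))\in\mathbb D)\mathcal T(d\mathbf t)$, $\mathbf m_2^{Z}=\mathbf d\diamond\boldsymbol\mu+\int_{[0,\infty)^n_*}\mathbb E[B(\mathbf t)\mathbf 1_{\mathbb D}(\mathbf t,B(\mathbf t))]\mathcal T(d\mathbf t)$, $\Theta=\begin{pmatrix}0&0\\0&\mathbf d\diamond\Sigma\end{pmatrix}$, $\mathcal Z(d\mathbf t,d\mathbf x)=\mathbf 1_{[0,\infty)^n_*\times\mathbb R^n}(\mathbf t,\mathbf x)\mathbb P(B(\mathbf t)\in d\mathbf x)\mathcal T(d\mathbf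 t)$; $B\odot T$ stands for its second component $Z_2$. Thorin subordinators and $VGG^n$. An $n$-dimensional Thorin measure is a nonnegative Borel measure $\mathcal U$ on $[0,\infty)^n_*$ with $\int_{[0,\infty)^n_*}(1+\ln^-\|\mathbf u\|)\wedge(1/\|\mathbf u\|)\,\mathcal U(d\mathbf u)<\infty$, where $\ln^-x=-\mathbf 1_{(0,1]}(x)\ln x$. $T\sim GGC^n_S(\mathbf d,\mathcal U)$ means that $T$ is an $n$-dimensional subordinator with $-\ln\mathbb E e^{-\langle\boldsymbol\lambda,T(t)\rangle}=t\langle\mathbf d,\boldsymbol\lambda\rangle+t\int_{[0,\infty)^n_*}\ln\{(\|\mathbf u\|^2+\langle\boldsymbol\lambda,\mathbf u\rangle)/\|\mathbf u\|^2\}\,\mathcal U(d\mathbf u)$ for $t\ge0$, $\boldsymbol\lambda\in[0,\infty)^n$. $Y\sim VGG^n(\mathbf d,\boldsymbol\mu,\Sigma,\mathcal U)$ means that $Y$ is a Lévy process with $Y\overset{D}{=}B\odot T$ for $B\sim BM^n(\boldsymbol\mu,\Sigma)$, $T\sim GGC^n_S(\mathbf d,\mathcal U)$. Variance-gamma Lévy measure. For $b>0$, $\boldsymbol\mu\in\mathbb R^n$ and a covariance matrix $\Sigma$, $\mathcal V_{b,\boldsymbol\mu,\Sigma}(d\mathbf y)=\int_{(0,\infty)}\mathbb P(B(g)\in d\mathbf y)\,b\,e^{-bg}\,dg/g$ on $\mathbb R^n_*$, with $B\sim BM^n(\boldsymbol\mu,\Sigma)$ (here $g$ is a scalar time). Notation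 for the density. For $\emptyset\ne J\subseteq\{1,\dots,n\}$, $C_J=\{\sum_{j\in J}x_j\mathbf e_j:x_j>0\ \forall j\in J\}$ and $V_J=\{\sum_{j\in J}x_j\mathbf e_j:x_j\ne0\ \forall j\in J\}$. If $\Sigma$ is invertible and $\mathbf u\in C_J$, the restriction $(\mathbf u\diamond\Sigma)_J:\boldsymbol\pi_J(\mathbb R^n)\to\boldsymbol\pi_J(\mathbb R^n)$, $\mathbf x\mapsto\mathbf x(\mathbf u\diamond\Sigma)$, is an invertible linear map, with inverse $(\mathbf u\diamond\Sigma)_J^{-1}$ and determinant $|\mathbf u\diamond\Sigma|_J$. $\mathfrak K_\rho(r)=r^\rho K_\rho(r)$, $\rho\ge0$, $r>0$, where $K_\rho$ is the modified Bessel function of the second kind. $\#J$ is the cardinality of $J$. The $\mathcal Y_J$ in the claim are the summands described there.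
   Formalization: The integral of y over D_* against 𝒴 in m_2 need not converge absolutely; it is read as iterated, first over y against V_{‖u‖²,u⋄μ,u⋄Σ}, then over u against U(du)/‖u‖², and agrees with the displayed integral whenever that one converges. *)

theory Defs
  imports "HOL-Probability.Probability"
begin

section \<open>Vectors, matrices and the diamond operation\<close>

text \<open>Vectors are row vectors, so a matrix \<open>A\<close> acts on \<open>x\<close> by \<open>x v* A\<close>.\<close>

definition qinner :: "real ^ 'n ^ 'n \<Rightarrow> real ^ 'n \<Rightarrow> real ^ 'n \<Rightarrow> real" where
  "qinner A x y = (x v* A) \<bullet> y"

definition covariance_matrix :: "real ^ 'n ^ 'n \<Rightarrow> bool" where
  "covariance_matrix A \<longleftrightarrow> transpose A = A \<and> (\<forall>x. 0 \<le> qinner A x x)"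

definition diamond_vec :: "real ^ 'n \<Rightarrow> real ^ 'n \<Rightarrow> real ^ 'n" (infixl \<open>\<diamond>\<^sub>v\<close> 75) where
  "t \<diamond>\<^sub>v \<mu> = (\<chi> i. t $ i * \<mu> $ i)"

definition diamond_mat :: "real ^ 'n \<Rightarrow> real ^ 'n ^ 'n \<Rightarrow> real ^ 'n ^ 'n" (infixl \<open>\<diamond>\<^sub>m\<close> 75) where
  "t \<diamond>\<^sub>m A = (\<chi> k l. A $ k $ l * min (t $ k) (t $ l))"

definition orthant :: "(real ^ 'n) set" where
  "orthant = {x. \<forall>i. 0 \<le> x $ i}"

definition orthant_star :: "(real ^ 'n) set" where
  "orthant_star = orthant - {0}"

definition borel_star :: "(real ^ 'n) measure" where
  "borel_star = restrict_space borel (- {0})"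

text \<open>\<open>\<real>\<^sup>2\<^sup>n\<close> is represented by \<open>real ^ ('n + 'n)\<close>, whose norm is the Euclidean norm.\<close>

definition vjoin :: "real ^ 'n \<Rightarrow> real ^ 'n \<Rightarrow> real ^ ('n + 'n)" where
  "vjoin x y = (\<chi> k. case k of Inl i \<Rightarrow> x $ i | Inr i \<Rightarrow> y $ i)"

definition vsnd :: "real ^ ('n + 'n) \<Rightarrow> real ^ 'n" where
  "vsnd z = (\<chi> i. z $ Inr i)"

definition lower_block :: "real ^ 'n ^ 'n \<Rightarrow> real ^ ('n + 'n) ^ ('n + 'n)" where
  "lower_block A = (\<chi> k l. case (k, l) of (Inr i, Inr j) \<Rightarrow> A $ i $ j | _ \<Rightarrow> 0)"


section \<open>Mixtures of measures over a kernel\<close>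

text \<open>
  Library \<open>bind\<close> is restricted to sub-probability kernels, whereas the kernels below may be
  infinite measures.  The first definition is \<open>M(dx) \<otimes> K\<^sub>x(dy)\<close>, the second
  \<open>A \<mapsto> \<integral> K\<^sub>x(A) M(dx)\<close>.
\<close>

definition kernel_prod :: "'a measure \<Rightarrow> 'b measure \<Rightarrow> ('a \<Rightarrow> 'b measure) \<Rightarrow> ('a \<times> 'b) measure" where
  "kernel_prod M N K =
     measure_of (space M \<times> space N) (sets (M \<Otimes>\<^sub>M N))
       (\<lambda>C. \<integral>\<^sup>+ x. emeasure (K x) (Pair x -` C) \<partial>M)"

definition kernel_mix :: "'a measure \<Rightarrow> 'b measure \<Rightarrow> ('a \<Rightarrow> 'b measure) \<Rightarrow> 'b measure" where
  "kernel_mix M N K =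
     measure_of (space N) (sets N) (\<lambda>A. \<integral>\<^sup>+ x. emeasure (K x) A \<partial>M)"


section \<open>Levy processes\<close>

text \<open>A process is indexed by \<open>real\<close>; only its values at times \<open>t \<ge> 0\<close> are ever used.\<close>

definition cadlag :: "(real \<Rightarrow> 'a::topological_space) \<Rightarrow> bool" where
  "cadlag f \<longleftrightarrow>
     (\<forall>t\<ge>0. continuous (at_right t) f) \<and> (\<forall>t>0. \<exists>l. (f \<longlongrightarrow> l) (at_left t))"

definition levy_process :: "'w measure \<Rightarrow> (real \<Rightarrow> 'w \<Rightarrow> real ^ 'n) \<Rightarrow> bool" where
  "levy_process M X \<longleftrightarrow>
     prob_space M \<and>
     (\<forall>t\<ge>0. X t \<in> borel_measurable M) \<and>
     (AE \<omega> in M. X 0 \<omega> = 0) \<and>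
     (\<forall>s::nat \<Rightarrow> real. 0 \<le> s 0 \<and> incseq s \<longrightarrow>
        prob_space.indep_vars M (\<lambda>_. borel) (\<lambda>k \<omega>. X (s (Suc k)) \<omega> - X (s k) \<omega>) UNIV) \<and>
     (\<forall>s\<ge>0. \<forall>t\<ge>0. distr M borel (\<lambda>\<omega>. X (s + t) \<omega> - X s \<omega>) = distr M borel (X t)) \<and>
     (AE \<omega> in M. cadlag (\<lambda>t. X t \<omega>))"

definition levy_measure :: "(real ^ 'n) measure \<Rightarrow> bool" where
  "levy_measure \<X> \<longleftrightarrow>
     sets \<X> = sets borel_star \<and> (\<integral>\<^sup>+ x. ennreal (min 1 ((norm x)\<^sup>2)) \<partial>\<X>) < \<infinity>"

definition levy_exponent ::
    "real ^ 'n \<Rightarrow> real ^ 'n ^ 'n \<Rightarrow> (real ^ 'n) measure \<Rightarrow> real ^ 'n \<Rightarrow> complex" where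
  "levy_exponent \<mu> A \<X> \<theta> =
     \<i> * of_real (\<mu> \<bullet> \<theta>) - of_real (qinner A \<theta> \<theta>) / 2
     + (\<integral>x. (iexp (\<theta> \<bullet> x) - 1 - \<i> * of_real (\<theta> \<bullet> x) * indicator (cball 0 1) x) \<partial>\<X>)"

text \<open>\<open>X \<sim> L\<^sup>n(\<mu>, A, \<X>)\<close>\<close>

definition levy_law ::
    "'w measure \<Rightarrow> (real \<Rightarrow> 'w \<Rightarrow> real ^ 'n) \<Rightarrow>
     real ^ 'n \<Rightarrow> real ^ 'n ^ 'n \<Rightarrow> (real ^ 'n) measure \<Rightarrow> bool" where
  "levy_law M X \<mu> A \<X> \<longleftrightarrow>
     levy_process M X \<and> covariance_matrix A \<and> levy_measure \<X> \<and>
     (\<forall>t\<ge>0. \<forall>\<theta>. (\<integral>\<omega>. iexp (\<theta> \<bullet> X t \<omega>) \<partial>M) = exp (of_real t * levy_exponent \<mu> A \<X> \<theta>))"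

definition brownian_motion ::
    "'w measure \<Rightarrow> (real \<Rightarrow> 'w \<Rightarrow> real ^ 'n) \<Rightarrow> real ^ 'n \<Rightarrow> real ^ 'n ^ 'n \<Rightarrow> bool" where
  "brownian_motion M B \<mu> A \<longleftrightarrow> levy_law M B \<mu> A (null_measure borel_star)"

text \<open>
  The law of \<open>B(g)\<close>, \<open>g \<ge> 0\<close> a scalar time, for \<open>B \<sim> BM\<^sup>n(\<mu>, A)\<close>: the unique Borel probability
  measure with characteristic function \<open>exp (g \<Psi>\<^sub>B)\<close>.
\<close>

definition bm_marginal :: "real ^ 'n \<Rightarrow> real ^ 'n ^ 'n \<Rightarrow> real \<Rightarrow> (real ^ 'n) measure" where
  "bm_marginal \<mu> A g =
     (THE N. prob_space N \<and> sets N = sets borel \<and>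
        (\<forall>\<theta>. (\<integral>x. iexp (\<theta> \<bullet> x) \<partial>N)
             = exp (of_real g * levy_exponent \<mu> A (null_measure borel_star) \<theta>)))"

definition equal_in_law ::
    "'v measure \<Rightarrow> (real \<Rightarrow> 'v \<Rightarrow> real ^ 'n) \<Rightarrow> 'w measure \<Rightarrow> (real \<Rightarrow> 'w \<Rightarrow> real ^ 'n) \<Rightarrow> bool" where
  "equal_in_law M X N Y \<longleftrightarrow>
     (\<forall>I. finite I \<and> I \<subseteq> {0..} \<longrightarrow>
        distr M (\<Pi>\<^sub>M t\<in>I. borel) (\<lambda>\<omega>. \<lambda>t\<in>I. X t \<omega>) =
        distr N (\<Pi>\<^sub>M t\<in>I. borel) (\<lambda>\<omega>. \<lambda>t\<in>I. Y t \<omega>))"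


section \<open>Subordinators and weak subordination\<close>

definition subordinator :: "'w measure \<Rightarrow> (real \<Rightarrow> 'w \<Rightarrow> real ^ 'n) \<Rightarrow> bool" where
  "subordinator M T \<longleftrightarrow>
     levy_process M T \<and>
     (AE \<omega> in M. \<forall>s t i. 0 \<le> s \<and> s \<le> t \<longrightarrow> T s \<omega> $ i \<le> T t \<omega> $ i)"

text \<open>
  \<open>T \<sim> S\<^sup>n(d, \<T>)\<close>: the drift \<open>d\<close> is the location parameter with respect to the zero truncation
  function, hence \<open>d + \<integral>\<^bsub>\<bbbD>\<^esub> t \<T>(dt)\<close> is the one with respect to the truncation on the unit ball.
\<close>

definition subordinator_law ::
    "'w measure \<Rightarrow> (real \<Rightarrow> 'w \<Rightarrow> real ^ 'n) \<Rightarrow> real ^ 'n \<Rightarrow> (real ^ 'n) measure \<Rightarrow> bool" where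
  "subordinator_law M T d \<T> \<longleftrightarrow>
     subordinator M T \<and> d \<in> orthant \<and>
     emeasure \<T> (- {0} - orthant) = 0 \<and>
     set_integrable \<T> (cball 0 1) (\<lambda>t. t) \<and>
     levy_law M T (d + (LINT t:cball 0 1|\<T>. t)) 0 \<T>"

text \<open>\<open>B(t) = (B\<^sub>1(t\<^sub>1), \<dots>, B\<^sub>n(t\<^sub>n))\<close> for a vector \<open>t\<close> of times\<close>

definition multi_time :: "(real \<Rightarrow> 'w \<Rightarrow> real ^ 'n) \<Rightarrow> real ^ 'n \<Rightarrow> 'w \<Rightarrow> real ^ 'n" where
  "multi_time B t \<omega> = (\<chi> i. B (t $ i) \<omega> $ i)"

definition weak_sub_measure ::
    "'w measure \<Rightarrow> (real \<Rightarrow> 'w \<Rightarrow> real ^ 'n) \<Rightarrow> (real ^ 'n) measure \<Rightarrow> (real ^ ('n + 'n)) measure" where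
  "weak_sub_measure MB B \<T> =
     kernel_mix (restrict_space \<T> orthant_star) borel_star
       (\<lambda>t. distr MB borel (\<lambda>\<omega>. vjoin t (multi_time B t \<omega>)))"

text \<open>
  \<open>Z\<close> is a version of \<open>(T, B \<odot> T)\<close>, where \<open>B \<sim> BM\<^sup>n(\<mu>, A)\<close>.  The process \<open>Z\<close> need not live on the
  probability space of \<open>B\<close> or \<open>T\<close>.
\<close>

definition weak_subordination ::
    "'b measure \<Rightarrow> (real \<Rightarrow> 'b \<Rightarrow> real ^ 'n) \<Rightarrow> real ^ 'n \<Rightarrow> real ^ 'n ^ 'n \<Rightarrow>
     't measure \<Rightarrow> (real \<Rightarrow> 't \<Rightarrow> real ^ 'n) \<Rightarrow>
     'z measure \<Rightarrow> (real \<Rightarrow> 'z \<Rightarrow> real ^ ('n + 'n)) \<Rightarrow> bool" where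
  "weak_subordination MB B \<mu> A MT T MZ Z \<longleftrightarrow>
     brownian_motion MB B \<mu> A \<and>
     (\<exists>d \<T>. subordinator_law MT T d \<T> \<and>
        levy_law MZ Z
          (vjoin
            (d + (LINT t:orthant_star|\<T>.
                    measure MB {\<omega> \<in> space MB. vjoin t (multi_time B t \<omega>) \<in> cball 0 1} *\<^sub>R t))
            (d \<diamond>\<^sub>v \<mu> + (LINT t:orthant_star|\<T>.
                    (\<integral>\<omega>. indicator (cball 0 1) (vjoin t (multi_time B t \<omega>)) *\<^sub>R multi_time B t \<omega> \<partial>MB))))
          (lower_block (d \<diamond>\<^sub>m A))
          (weak_sub_measure MB B \<T>))"


section \<open>Thorin subordinators and variance generalised gamma convolutions\<close>

definition ln_minus :: "real \<Rightarrow> real" where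
  "ln_minus x = - indicator {0<..1} x * ln x"

definition thorin_measure :: "(real ^ 'n) measure \<Rightarrow> bool" where
  "thorin_measure \<U> \<longleftrightarrow>
     sets \<U> = sets (restrict_space borel orthant_star) \<and>
     (\<integral>\<^sup>+ u. ennreal (min (1 + ln_minus (norm u)) (1 / norm u)) \<partial>\<U>) < \<infinity>"

text \<open>\<open>T \<sim> GGC\<^sup>n\<^sub>S(d, \<U>)\<close>\<close>

definition ggc_subordinator ::
    "'w measure \<Rightarrow> (real \<Rightarrow> 'w \<Rightarrow> real ^ 'n) \<Rightarrow> real ^ 'n \<Rightarrow> (real ^ 'n) measure \<Rightarrow> bool" where
  "ggc_subordinator M T d \<U> \<longleftrightarrow>
     subordinator M T \<and> d \<in> orthant \<and> thorin_measure \<U> \<and>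
     (\<forall>t\<ge>0. \<forall>\<eta>\<in>orthant.
        - ln (\<integral>\<omega>. exp (- (\<eta> \<bullet> T t \<omega>)) \<partial>M) =
        t * (d \<bullet> \<eta>) + t * (\<integral>u. ln (((norm u)\<^sup>2 + \<eta> \<bullet> u) / (norm u)\<^sup>2) \<partial>\<U>))"

text \<open>
  \<open>Y \<sim> VGG\<^sup>n(d, \<mu>, A, \<U>)\<close>.  The processes \<open>B\<close>, \<open>T\<close> and \<open>Z = (T, B \<odot> T)\<close> witnessing this are
  arguments, because an existential quantifier inside the definition could not range over the types
  of their sample spaces.
\<close>

definition vgg_process ::
    "'w measure \<Rightarrow> (real \<Rightarrow> 'w \<Rightarrow> real ^ 'n) \<Rightarrow>
     real ^ 'n \<Rightarrow> real ^ 'n \<Rightarrow> real ^ 'n ^ 'n \<Rightarrow> (real ^ 'n) measure \<Rightarrow>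
     'b measure \<Rightarrow> (real \<Rightarrow> 'b \<Rightarrow> real ^ 'n) \<Rightarrow>
     't measure \<Rightarrow> (real \<Rightarrow> 't \<Rightarrow> real ^ 'n) \<Rightarrow>
     'z measure \<Rightarrow> (real \<Rightarrow> 'z \<Rightarrow> real ^ ('n + 'n)) \<Rightarrow> bool" where
  "vgg_process M Y d \<mu> A \<U> MB B MT T MZ Z \<longleftrightarrow>
     levy_process M Y \<and>
     brownian_motion MB B \<mu> A \<and>
     ggc_subordinator MT T d \<U> \<and>
     weak_subordination MB B \<mu> A MT T MZ Z \<and>
     equal_in_law M Y MZ (\<lambda>t \<omega>. vsnd (Z t \<omega>))"

definition vg_measure :: "real \<Rightarrow> real ^ 'n \<Rightarrow> real ^ 'n ^ 'n \<Rightarrow> (real ^ 'n) measure" where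
  "vg_measure b \<mu> A =
     kernel_mix (density (restrict_space lborel {0<..}) (\<lambda>g. ennreal (b * exp (- b * g) / g)))
       borel_star (bm_marginal \<mu> A)"

definition vg_kernel :: "real ^ 'n \<Rightarrow> real ^ 'n ^ 'n \<Rightarrow> real ^ 'n \<Rightarrow> (real ^ 'n) measure" where
  "vg_kernel \<mu> A u = vg_measure ((norm u)\<^sup>2) (u \<diamond>\<^sub>v \<mu>) (u \<diamond>\<^sub>m A)"

definition vgg_levy_measure ::
    "real ^ 'n \<Rightarrow> real ^ 'n ^ 'n \<Rightarrow> (real ^ 'n) measure \<Rightarrow> (real ^ 'n) measure" where
  "vgg_levy_measure \<mu> A \<U> =
     distr (kernel_prod (density \<U> (\<lambda>u. ennreal (1 / (norm u)\<^sup>2))) borel_star (vg_kernel \<mu> A))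
       borel_star snd"

text \<open>
  The integral of \<open>y\<close> over the punctured unit ball against \<open>vgg_levy_measure\<close>, taken first in \<open>y\<close>
  for fixed \<open>u\<close> and then in \<open>u\<close>.  It need not converge absolutely as an integral over \<open>y\<close> alone
  (jumps may have infinite variation), in which case the library integral would be \<open>0\<close>; when it
  does, both agree by Fubini.
\<close>

definition vgg_small_jump_mean ::
    "real ^ 'n \<Rightarrow> real ^ 'n ^ 'n \<Rightarrow> (real ^ 'n) measure \<Rightarrow> real ^ 'n" where
  "vgg_small_jump_mean \<mu> A \<U> =
     (\<integral>u. (1 / (norm u)\<^sup>2) *\<^sub>R (LINT y:cball 0 1|vg_kernel \<mu> A u. y) \<partial>\<U>)"


section \<open>Ingredients of the density\<close>

definition coord_space :: "'n set \<Rightarrow> (real ^ 'n) set" where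
  "coord_space J = {x. \<forall>i. i \<notin> J \<longrightarrow> x $ i = 0}"

definition C_set :: "'n set \<Rightarrow> (real ^ 'n) set" where
  "C_set J = {x \<in> coord_space J. \<forall>j\<in>J. 0 < x $ j}"

definition V_set :: "'n set \<Rightarrow> (real ^ 'n) set" where
  "V_set J = {x \<in> coord_space J. \<forall>j\<in>J. x $ j \<noteq> 0}"

text \<open>Inverse and determinant of \<open>x \<mapsto> x A\<close> as an endomorphism of \<open>coord_space J\<close>; the determinant
  is the Leibniz formula in the basis \<open>e\<^sub>j\<close>, \<open>j \<in> J\<close>.\<close>

definition inv_on :: "'n set \<Rightarrow> real ^ 'n ^ 'n \<Rightarrow> real ^ 'n \<Rightarrow> real ^ 'n" where
  "inv_on J A = the_inv_into (coord_space J) (\<lambda>x. x v* A)"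

definition det_on :: "'n set \<Rightarrow> real ^ 'n ^ 'n \<Rightarrow> real" where
  "det_on J A = (\<Sum>p | p permutes J. of_int (sign p) * (\<Prod>i\<in>J. A $ i $ p i))"

definition inner_inv_on :: "'n set \<Rightarrow> real ^ 'n ^ 'n \<Rightarrow> real ^ 'n \<Rightarrow> real ^ 'n \<Rightarrow> real" where
  "inner_inv_on J A x y = inv_on J A x \<bullet> y"

definition norm_inv_on :: "'n set \<Rightarrow> real ^ 'n ^ 'n \<Rightarrow> real ^ 'n \<Rightarrow> real" where
  "norm_inv_on J A x = sqrt (inner_inv_on J A x x)"

text \<open>The \<open>#J\<close>-dimensional Lebesgue measure on \<open>coord_space J\<close>, as a measure on \<open>borel_star\<close>.\<close>

definition coord_lebesgue :: "'n set \<Rightarrow> (real ^ 'n) measure" where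
  "coord_lebesgue J =
     restrict_space
       (distr (\<Pi>\<^sub>M j\<in>J. lborel) borel (\<lambda>x. \<chi> i. if i \<in> J then x i else 0)) (- {0})"

text \<open>Modified Bessel function of the second kind for real order and \<open>r > 0\<close>
  (standard integral representation, DLMF 10.32.9).\<close>

definition bessel_K :: "real \<Rightarrow> real \<Rightarrow> real" where
  "bessel_K \<rho> r = (LBINT t:{0<..}. exp (- r * cosh t) * cosh (\<rho> * t))"

definition frak_K :: "real \<Rightarrow> real \<Rightarrow> real" where
  "frak_K \<rho> r = r powr \<rho> * bessel_K \<rho> r"

definition vgg_nu ::
    "real ^ 'n \<Rightarrow> real ^ 'n ^ 'n \<Rightarrow> 'n set \<Rightarrow> real ^ 'n \<Rightarrow> real ^ 'n \<Rightarrow> real" where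
  "vgg_nu \<mu> A J u y =
     2 / (2 * pi) powr (real (card J) / 2)
     * (exp (inner_inv_on J (u \<diamond>\<^sub>m A) y (u \<diamond>\<^sub>v \<mu>))
        / (sqrt (det_on J (u \<diamond>\<^sub>m A)) * norm_inv_on J (u \<diamond>\<^sub>m A) y ^ card J))
     * frak_K (real (card J) / 2)
         (norm_inv_on J (u \<diamond>\<^sub>m A) y
          * sqrt (2 * (norm u)\<^sup>2 + (norm_inv_on J (u \<diamond>\<^sub>m A) (u \<diamond>\<^sub>v \<mu>))\<^sup>2))"

text \<open>The density \<open>v\<^sub>J\<close>, with values in \<open>[0, \<infinity>]\<close> and extended by \<open>0\<close> off \<open>V_set J\<close>.\<close>

definition vgg_density ::
    "real ^ 'n \<Rightarrow> real ^ 'n ^ 'n \<Rightarrow> (real ^ 'n) measure \<Rightarrow> 'n set \<Rightarrow> real ^ 'n \<Rightarrow> ennreal" where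
  "vgg_density \<mu> A \<U> J y =
     (\<integral>\<^sup>+ u\<in>C_set J. ennreal (vgg_nu \<mu> A J u y) \<partial>\<U>) * indicator (V_set J) y"

end

theory Submission
  imports Defs "HOL-Complex_Analysis.Conformal_Mappings" "HOL-Real_Asymp.Real_Asymp"
begin

text \<open>
  The Laplace transform of the subordinator continues analytically to its characteristic function, and
  Levy measures are determined by their characteristic exponents.  Hence the Levy measure of \<open>T\<close> is the
  image of \<open>U(du) \<otimes> exp (- g \<bar>u\<bar>\<^sup>2) dg / g\<close> under \<open>(u, g) \<mapsto> g u\<close>, and that of the weakly subordinated
  process is the image of the product with the law of \<open>B\<close> under \<open>(u, g, B) \<mapsto> (g u, B(g u))\<close>.  Integrating
  out \<open>g\<close> first, the characteristic function of \<open>B(g u)\<close> is \<open>exp (g z)\<close> with \<open>Re z \<le> 0\<close>, and the Frullani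
  integral turns it into the logarithm in the exponent.  If \<open>\<Sigma>\<close> is invertible, \<open>B(g u)\<close> with \<open>u \<in> C\<^sub>J\<close> has a
  Gaussian density on the coordinate subspace of \<open>J\<close>, and its integral over \<open>g\<close> is a Bessel function.
\<close>

section \<open>Uniqueness of Fourier transforms and of Levy measures\<close>

text \<open>The Laplace hypothesis lives on the orthant only, while
  \<open>weak_subordination\<close> hides an unspecified drift and Levy measure behind an
  existential; the uniqueness results serve to identify these with \<open>d\<close> and an explicit
  image measure. Levy measures are infinite, so each one is presented as an image of a sigma-finite
  product (\<open>thorin_mix U\<close>, then its product with \<open>MB\<close>), and computing with
  it becomes Fubini on that product. Two obstacles shape the rest. Paths are cadlag only almost
  surely, so (t, omega) -> B(t)(omega) is replaced by a jointly measurable version \<open>b\<close>.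
  And E |B(t)| is of order sqrt |t| for small t, which need not be integrable over the jumps,
  whereas the truncated mean of B(t) is O(min 1 |t|), which is. Small jumps are therefore
  compensated after averaging over B. This also reconciles the truncation in the unit ball of the
  joint space with the one in that of Y: each compensator converges by itself and cancels against
  the location parameter of its own process.\<close>

lemma real_measure_eqI_cf:
  fixes M N :: "real measure"
  assumes M: "finite_measure M" "sets M = sets borel" and N: "finite_measure N" "sets N = sets borel"
    and cf: "\<And>t. (\<integral>x. iexp (t * x) \<partial>M) = (\<integral>x. iexp (t * x) \<partial>N)"
  shows "M = N"
proof -
  interpret M: finite_measure M by fact
  interpret N: finite_measure N by fact
  have spc: "space M = UNIV" "space N = UNIV"
    using M(2) N(2) by (auto dest: sets_eq_imp_space_eq)
  define c where "c = measure M UNIV"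
  have cN: "measure N UNIV = c"
    using cf[of 0] by (simp add: c_def spc)
  have c0: "c \<ge> 0" by (simp add: c_def)
  have emM: "emeasure M UNIV = ennreal c" and emN: "emeasure N UNIV = ennreal c"
    using M.emeasure_eq_measure N.emeasure_eq_measure by (auto simp: c_def cN[unfolded c_def])
  show ?thesis
  \<comment> \<open>The zero measure cannot be normalised and is treated apart. Otherwise dividing
    by the common mass c, read off from the transform at 0, gives probability measures to which
    \<open>Levy_uniqueness\<close> applies.\<close>
  proof (cases "c = 0")
    case True
    show ?thesis
    proof (rule measure_eqI)
      fix X assume "X \<in> sets M"
      have "emeasure M X \<le> emeasure M UNIV" "emeasure N X \<le> emeasure N UNIV"
        using emeasure_space[of M X] emeasure_space[of N X] by (auto simp: spc)
      then show "emeasure M X = emeasure N X" using emM emN True by simp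
    qed (simp add: M N)
  next
    case False
    with c0 have c: "c > 0" by simp
    have real_distr: "real_distribution (density L (\<lambda>_. ennreal (1 / c)))"
      if L: "sets L = sets borel" "emeasure L UNIV = ennreal c" for L :: "real measure"
    proof -
      have sp: "space L = UNIV" using L(1) by (auto dest: sets_eq_imp_space_eq)
      have [measurable]: "UNIV \<in> sets L" using L(1) by simp
      have "emeasure (density L (\<lambda>_. ennreal (1 / c))) (space L) = 1"
        using L(2) c sp
        by (subst emeasure_density) (auto simp: nn_integral_cmult_indicator ennreal_mult[symmetric])
      then show ?thesis
        unfolding real_distribution_def real_distribution_axioms_def
        using L sp by (auto intro!: prob_spaceI)
    qed
    have ch: "char (density L (\<lambda>_. ennreal (1 / c))) t = (1 / c) *\<^sub>R (\<integral>x. iexp (t * x) \<partial>L)"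
      if "sets L = sets borel" for L :: "real measure" and t
      unfolding char_def using c that
      by (subst integral_density)
         (auto simp: measurable_cong_sets[OF that refl] intro!: borel_measurable_continuous_onI continuous_intros)
    have "density M (\<lambda>_. ennreal (1 / c)) = density N (\<lambda>_. ennreal (1 / c))"
      by (rule Levy_uniqueness) (auto intro!: real_distr M N emM emN simp del: of_real_mult simp: fun_eq_iff ch M N cf)
    then have "density (density M (\<lambda>_. ennreal (1 / c))) (\<lambda>_. ennreal c)
             = density (density N (\<lambda>_. ennreal (1 / c))) (\<lambda>_. ennreal c)" by simp
    moreover have "ennreal (1 / c) * ennreal c = 1"
      using c by (simp add: ennreal_mult[symmetric])
    ultimately show ?thesis
      by (subst (asm) (1 2) density_density_eq) (auto simp: density_1)
  qed
qed

text \<open>Weighting by g and projecting to coordinate i gives a finite measure on the line whose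
  characteristic function is the integral in \<open>cf\<close>, so uniqueness on the line applies.
  The weight has to be nonnegative to produce a measure.\<close>

lemma cf_imp_weighted_indicator:
  fixes M N :: "(real ^ 'n) measure" and g :: "real ^ 'n \<Rightarrow> real"
  assumes M: "finite_measure M" "sets M = sets borel" and N: "finite_measure N" "sets N = sets borel"
    and g [measurable]: "g \<in> borel_measurable borel" and gb: "\<And>x. 0 \<le> g x" "\<And>x. g x \<le> K"
    and cf: "\<And>t. (\<integral>x. of_real (g x) * iexp (t * x $ i) \<partial>M) = (\<integral>x. of_real (g x) * iexp (t * x $ i) \<partial>N)"
    and X [measurable]: "X \<in> sets borel"
  shows "(\<integral>x. g x * indicator X (x $ i) \<partial>M) = (\<integral>x. g x * indicator X (x $ i) \<partial>N)"
proof -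
  define D where "D L = distr (density L (\<lambda>x. ennreal (g x))) borel (\<lambda>x. x $ i)" for L :: "(real ^ 'n) measure"
  have fin: "finite_measure (D L)"
    if L: "finite_measure L" "sets L = sets borel" for L
  proof -
    note [measurable_cong] = L(2)
    interpret L: finite_measure L by fact
    have "(\<integral>\<^sup>+x. ennreal (g x) \<partial>L) \<le> (\<integral>\<^sup>+x. ennreal K \<partial>L)"
      by (intro nn_integral_mono ennreal_leI gb)
    also have "\<dots> < \<infinity>"
      using L.emeasure_finite[of "space L"] by (simp add: ennreal_mult_less_top less_top[symmetric] ennreal_mult_eq_top_iff)
    finally have *: "(\<integral>\<^sup>+x. ennreal (g x) \<partial>L) < \<infinity>" .
    have "finite_measure (density L (\<lambda>x. ennreal (g x)))"
      using * by (intro finite_measureI) (auto simp: emeasure_density less_top cong: nn_integral_cong_simp)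
    then show ?thesis unfolding D_def
      by (rule finite_measure.finite_measure_distr) (simp add: measurable_cong_sets[OF L(2) refl])
  qed
  have sD: "sets (D L) = sets borel" for L by (simp add: D_def)
  have int: "(\<integral>x. h x \<partial>D L) = (\<integral>x. g x *\<^sub>R h (x $ i) \<partial>L)"
    if L: "sets L = sets borel" and h [measurable]: "h \<in> borel_measurable borel"
    for L and h :: "real \<Rightarrow> 'b::{banach,second_countable_topology}"
  proof -
    note [measurable_cong] = L
    show ?thesis unfolding D_def
      by (subst integral_distr) (auto intro!: integral_density simp: gb)
  qed
  have ie [measurable]: "(\<lambda>x. iexp (t * x)) \<in> borel_measurable borel" for t :: real
    by (intro borel_measurable_continuous_onI continuous_intros)
  have "D M = D N"
  proof (rule real_measure_eqI_cf)
    fix t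
    show "(\<integral>x. iexp (t * x) \<partial>D M) = (\<integral>x. iexp (t * x) \<partial>D N)"
      using cf[of t] by (simp add: int[OF M(2) ie] int[OF N(2) ie] scaleR_conv_of_real del: of_real_mult)
  qed (auto intro!: fin M N simp: sD)
  then have "(\<integral>x. indicator X x \<partial>D M) = (\<integral>x. indicator X x \<partial>D N :: real)" by simp
  then show ?thesis
    using int[OF M(2), of "indicator X :: real \<Rightarrow> real"] int[OF N(2), of "indicator X :: real \<Rightarrow> real"]
    by (auto simp only: borel_measurable_indicator X real_scaleR_def)
qed

lemma integrable_bounded_cexp:
  fixes M :: "(real ^ 'n) measure" and f :: "real ^ 'n \<Rightarrow> real"
  assumes M: "finite_measure M" "sets M = sets borel"
    and f [measurable]: "f \<in> borel_measurable borel" and fb: "\<And>x. \<bar>f x\<bar> \<le> K"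
  shows "integrable M (\<lambda>x. of_real (f x) * iexp (\<theta> \<bullet> x))"
proof -
  note [measurable_cong] = M(2)
  interpret finite_measure M by fact
  show ?thesis
    by (rule integrable_const_bound[where B=K]) (auto simp: norm_mult fb)
qed

text \<open>Localising one coordinate at a time reduces the multivariate case to \<open>Levy_uniqueness\<close>: the
  complex weight left over by the other coordinates becomes a nonnegative one after adding \<open>1\<close> to
  its real and imaginary parts.\<close>

lemma measure_eqI_cf:
  fixes M N :: "(real ^ 'n) measure"
  assumes M: "finite_measure M" "sets M = sets borel" and N: "finite_measure N" "sets N = sets borel"
    and cf: "\<And>\<theta>. (\<integral>x. iexp (\<theta> \<bullet> x) \<partial>M) = (\<integral>x. iexp (\<theta> \<bullet> x) \<partial>N)"
  shows "M = N"
proof -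
  interpret M: finite_measure M by fact
  interpret N: finite_measure N by fact
  note [measurable_cong] = M(2) N(2)
  have spc: "space M = UNIV" "space N = UNIV"
    using M(2) N(2) by (auto dest: sets_eq_imp_space_eq)
  \<comment> \<open>The transform of L weighted by indicators of the coordinates in S. The induction
    enlarges S; for S = UNIV at frequency 0 only the mass of a box is left.\<close>
  define I :: "(real ^ 'n) measure \<Rightarrow> 'n set \<Rightarrow> ('n \<Rightarrow> real set) \<Rightarrow> real ^ 'n \<Rightarrow> complex"
    where "I L S X \<theta> = (\<integral>x. of_real (\<Prod>j\<in>S. indicator (X j) (x $ j)) * iexp (\<theta> \<bullet> x) \<partial>L)" for L S X \<theta>
  have key: "\<forall>X. (\<forall>j. X j \<in> sets borel) \<longrightarrow> (\<forall>\<theta>. I M S X \<theta> = I N S X \<theta>)" for S :: "'n set"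
  proof (induction S rule: finite_induct[OF finite])
    case 1 show ?case by (simp add: I_def cf)
  next
    case (2 i S)
    show ?case
    proof (intro allI impI)
      fix X :: "'n \<Rightarrow> real set" and \<theta> :: "real ^ 'n" assume X: "\<forall>j. X j \<in> sets borel"
      then have [measurable]: "X j \<in> sets borel" for j by simp
      define f :: "real ^ 'n \<Rightarrow> real" where "f x = (\<Prod>j\<in>S. indicator (X j) (x $ j))" for x
      have [measurable]: "f \<in> borel_measurable borel"
        unfolding f_def by measurable
      have f01: "0 \<le> f x" "f x \<le> 1" for x
        unfolding f_def by (auto intro!: prod_nonneg prod_le_1)
      have IH: "(\<integral>x. of_real (f x) * iexp (\<eta> \<bullet> x) \<partial>M) = (\<integral>x. of_real (f x) * iexp (\<eta> \<bullet> x) \<partial>N)" for \<eta>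
        using "2.IH" X by (simp add: I_def f_def)
      have intf: "integrable L (\<lambda>x. of_real (f x) * iexp (\<eta> \<bullet> x))"
        if "finite_measure L" "sets L = sets borel" for L \<eta>
        by (rule integrable_bounded_cexp[where K=1]) (use that f01 in \<open>auto simp: abs_le_iff order_trans[OF _ f01(1)]\<close>)
      have tx: "t * x $ i = (t *\<^sub>R axis i 1) \<bullet> x" for t :: real and x :: "real ^ 'n"
        by (simp add: inner_axis' )
      have base: "(\<integral>x. f x * indicator (X i) (x $ i) \<partial>M) = (\<integral>x. f x * indicator (X i) (x $ i) \<partial>N)"
        by (rule cf_imp_weighted_indicator[OF M N, where K=1]) (auto simp only: f01 tx IH borel_measurable_const X \<open>f \<in> borel_measurable borel\<close>)
      \<comment> \<open>The weight 1 + cos is nonnegative, hence admissible in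
        \<open>cf_imp_weighted_indicator\<close>. Written in characters it only shifts frequencies
        by plus or minus theta, and IH covers all of them.\<close>
      have expand: "(\<integral>x. of_real (f x * (1 + cos (\<theta> \<bullet> x + \<phi>))) * iexp (t * x $ i) \<partial>L) =
          (\<integral>x. of_real (f x) * iexp ((t *\<^sub>R axis i 1) \<bullet> x) \<partial>L)
          + cis \<phi> / 2 * (\<integral>x. of_real (f x) * iexp ((t *\<^sub>R axis i 1 + \<theta>) \<bullet> x) \<partial>L)
          + cis (-\<phi>) / 2 * (\<integral>x. of_real (f x) * iexp ((t *\<^sub>R axis i 1 - \<theta>) \<bullet> x) \<partial>L)"
        if L: "finite_measure L" "sets L = sets borel" for L \<phi> t
      proof -
        have *: "of_real (f x * (1 + cos (\<theta> \<bullet> x + \<phi>))) * iexp (t * x $ i) =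
            of_real (f x) * iexp ((t *\<^sub>R axis i 1) \<bullet> x)
            + cis \<phi> / 2 * (of_real (f x) * iexp ((t *\<^sub>R axis i 1 + \<theta>) \<bullet> x))
            + cis (-\<phi>) / 2 * (of_real (f x) * iexp ((t *\<^sub>R axis i 1 - \<theta>) \<bullet> x))" for x
        proof -
          have c: "complex_of_real (cos (\<theta> \<bullet> x + \<phi>)) = (cis (\<theta> \<bullet> x) * cis \<phi> + cis (-(\<theta> \<bullet> x)) * cis (-\<phi>)) / 2"
            using cos_minus[of "\<theta> \<bullet> x + \<phi>"] sin_minus[of "\<theta> \<bullet> x + \<phi>"]
            by (simp add: complex_eq_iff cis_mult)
          have e1: "iexp ((t *\<^sub>R axis i 1 + \<theta>) \<bullet> x) = iexp ((t *\<^sub>R axis i 1) \<bullet> x) * cis (\<theta> \<bullet> x)"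
            unfolding cis_conv_exp exp_add[symmetric] inner_add_left of_real_add distrib_left ..
          have e2: "iexp ((t *\<^sub>R axis i 1 - \<theta>) \<bullet> x) = iexp ((t *\<^sub>R axis i 1) \<bullet> x) * cis (- (\<theta> \<bullet> x))"
            unfolding cis_conv_exp exp_add[symmetric] inner_diff_left by (simp add: algebra_simps)
          show ?thesis
            unfolding of_real_mult of_real_add of_real_1 c e1 e2 tx[symmetric]
            by (simp add: algebra_simps add_divide_distrib)
        qed
        show ?thesis
          unfolding * by (simp add: intf[OF L] del: inner_scaleR_left of_real_mult)
      qed
      have wt: "(\<integral>x. f x * (1 + cos (\<theta> \<bullet> x + \<phi>)) * indicator (X i) (x $ i) \<partial>M) =
               (\<integral>x. f x * (1 + cos (\<theta> \<bullet> x + \<phi>)) * indicator (X i) (x $ i) \<partial>N)" for \<phi>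
      proof (rule cf_imp_weighted_indicator[OF M N, where K=2])
        fix x
        have "-1 \<le> cos (\<theta> \<bullet> x + \<phi>)" by simp
        then show "0 \<le> f x * (1 + cos (\<theta> \<bullet> x + \<phi>))"
          by (intro mult_nonneg_nonneg f01) linarith
        have "f x * (1 + cos (\<theta> \<bullet> x + \<phi>)) \<le> 1 * 2"
          by (intro mult_mono f01) (use cos_le_one[of "\<theta> \<bullet> x + \<phi>"] cos_ge_minus_one[of "\<theta> \<bullet> x + \<phi>"] in linarith)+
        then show "f x * (1 + cos (\<theta> \<bullet> x + \<phi>)) \<le> 2" by simp
      next
        show "(\<integral>x. of_real (f x * (1 + cos (\<theta> \<bullet> x + \<phi>))) * iexp (t * x $ i) \<partial>M) =
              (\<integral>x. of_real (f x * (1 + cos (\<theta> \<bullet> x + \<phi>))) * iexp (t * x $ i) \<partial>N)" for t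
          unfolding expand[OF M] expand[OF N] IH ..
      qed measurable
      have intr: "integrable L (\<lambda>x. f x * indicator (X i) (x $ i))"
        "integrable L (\<lambda>x. f x * cos (\<theta> \<bullet> x + \<phi>) * indicator (X i) (x $ i))"
        if L: "finite_measure L" "sets L = sets borel" for L \<phi>
      proof -
        note [measurable_cong] = L(2)
        have "\<bar>f x * indicator (X i) (x $ i)\<bar> \<le> 1" for x
          using f01[of x] by (auto simp: indicator_def)
        then show "integrable L (\<lambda>x. f x * indicator (X i) (x $ i))"
          by (intro finite_measure.integrable_const_bound[OF L(1), where B=1]) auto
        have "\<bar>f x * cos (\<theta> \<bullet> x + \<phi>) * indicator (X i) (x $ i)\<bar> \<le> 1" for x
          using mult_le_one[of "f x" "\<bar>cos (\<theta> \<bullet> x + \<phi>)\<bar>"] f01[of x] by (auto simp: indicator_def abs_mult)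
        then show "integrable L (\<lambda>x. f x * cos (\<theta> \<bullet> x + \<phi>) * indicator (X i) (x $ i))"
          by (intro finite_measure.integrable_const_bound[OF L(1), where B=1]) auto
      qed
      have cosint: "(\<integral>x. f x * cos (\<theta> \<bullet> x + \<phi>) * indicator (X i) (x $ i) \<partial>M) =
               (\<integral>x. f x * cos (\<theta> \<bullet> x + \<phi>) * indicator (X i) (x $ i) \<partial>N)" for \<phi>
        using wt[of \<phi>] base by (simp add: distrib_left distrib_right intr M N)
      \<comment> \<open>The phase 0 gives the real part and the phase - pi / 2 the imaginary part,
        since cos (x - pi / 2) = sin x.\<close>
      have split: "I L (insert i S) X \<theta> =
           of_real (\<integral>x. f x * cos (\<theta> \<bullet> x + 0) * indicator (X i) (x $ i) \<partial>L)
         + \<i> * of_real (\<integral>x. f x * cos (\<theta> \<bullet> x + (- pi / 2)) * indicator (X i) (x $ i) \<partial>L)"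
        if L: "finite_measure L" "sets L = sets borel" for L
      proof -
        have dec: "of_real (\<Prod>j\<in>insert i S. indicator (X j) (x $ j)) * iexp (\<theta> \<bullet> x) =
            complex_of_real (f x * cos (\<theta> \<bullet> x + 0) * indicator (X i) (x $ i))
            + \<i> * complex_of_real (f x * cos (\<theta> \<bullet> x + (- pi / 2)) * indicator (X i) (x $ i))" for x
          using "2.hyps" by (simp add: f_def complex_eq_iff cis_conv_exp[symmetric] cos_diff indicator_def)
        show ?thesis
          unfolding I_def dec
          by (subst Bochner_Integration.integral_add)
             (auto intro!: integrable_mult_right integrable_of_real intr[OF L] simp only: integral_mult_right_zero integral_complex_of_real)
      qed
      show "I M (insert i S) X \<theta> = I N (insert i S) X \<theta>"
        unfolding split[OF M] split[OF N] cosint ..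
    qed
  qed
  have box: "emeasure M (box a b) = emeasure N (box a b)" for a b :: "real ^ 'n"
  proof -
    have ind: "(\<Prod>j\<in>UNIV. indicator {a $ j <..< b $ j} (x $ j)) = (indicator (box a b) x :: real)" for x
      by (auto simp: indicator_def box_def Basis_vec_def inner_axis prod_zero_iff split: if_splits)
    have "I L UNIV (\<lambda>j. {a $ j <..< b $ j}) 0 = of_real (measure L (box a b))"
      if L: "finite_measure L" "sets L = sets borel" for L
    proof -
      note [measurable_cong] = L(2)
      have "space L = UNIV" using L(2) by (auto dest: sets_eq_imp_space_eq)
      then show ?thesis unfolding I_def ind by simp
    qed
    note IM = this[OF M, symmetric] and IN = this[OF N]
    note IM
    also have "I M UNIV (\<lambda>j. {a $ j <..< b $ j}) 0 = I N UNIV (\<lambda>j. {a $ j <..< b $ j}) 0"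
      using key[of UNIV] by auto
    also note IN
    finally have "measure M (box a b) = measure N (box a b)" by (simp only: of_real_eq_iff)
    then show ?thesis by (simp add: M.emeasure_eq_measure N.emeasure_eq_measure)
  qed
  show ?thesis
  proof (rule measure_eqI_generator_eq[where E="range (\<lambda>(a, b). box a b)" and \<Omega>=UNIV
        and A="\<lambda>i. box (- (real i *\<^sub>R One)) (real i *\<^sub>R One)"])
    show "Int_stable (range (\<lambda>(a, b). box a b :: (real ^ 'n) set))"
      by (auto simp: Int_stable_def box_Int_box)
    show "sets M = sigma_sets UNIV (range (\<lambda>(a, b). box a b))"
      "sets N = sigma_sets UNIV (range (\<lambda>(a, b). box a b))"
      using M(2) N(2) by (simp_all add: borel_eq_box)
    show "(\<Union>i. box (- (real i *\<^sub>R One)) (real i *\<^sub>R One)) = (UNIV :: (real ^ 'n) set)"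
      using UN_box_eq_UNIV by simp
  qed (auto simp: box N.emeasure_eq_measure)
qed

section \<open>Levy measures and the uniqueness of their exponents\<close>

lemma levy_measure_trunc_integrable:
  fixes f :: "real ^ 'n \<Rightarrow> 'b::{banach,second_countable_topology}"
  assumes X: "levy_measure X" and f [measurable]: "f \<in> borel_measurable borel_star"
    and fb: "\<And>x. norm (f x) \<le> K * min 1 ((norm x)\<^sup>2)"
  shows "integrable X f"
proof -
  have s [measurable_cong]: "sets X = sets borel_star" using X by (simp add: levy_measure_def)
  have [measurable]: "(\<lambda>x. min 1 ((norm x)\<^sup>2)) \<in> borel_measurable borel_star"
    unfolding borel_star_def by (intro measurable_restrict_space1) simp
  have "integrable X (\<lambda>x. min 1 ((norm x)\<^sup>2))"
    using X by (intro integrableI_nonneg) (auto simp: levy_measure_def)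
  then have "integrable X (\<lambda>x. K * min 1 ((norm x)\<^sup>2))" by simp
  then show ?thesis
    by (rule Bochner_Integration.integrable_bound)
       (auto intro!: AE_I2 order_trans[OF fb] simp: measurable_cong_sets[OF s refl])
qed

text \<open>Inside the unit ball this is the second-order Taylor remainder, outside it the trivial
  bound 2; these are the two branches of min 1 |x|^2.\<close>

lemma iexp_trunc_bound:
  fixes \<theta> x :: "real ^ 'n"
  shows "cmod (iexp (\<theta> \<bullet> x) - 1 - \<i> * of_real (\<theta> \<bullet> x) * indicator (cball 0 1) x)
     \<le> (2 + (norm \<theta>)\<^sup>2) * min 1 ((norm x)\<^sup>2)"
proof (cases "norm x \<le> 1")
  case True
  then have m: "min 1 ((norm x)\<^sup>2) = (norm x)\<^sup>2" by (simp add: abs_square_le_1)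
  have "cmod (iexp (\<theta> \<bullet> x) - (\<Sum>k\<le>1. (\<i> * of_real (\<theta> \<bullet> x)) ^ k / fact k)) \<le> \<bar>\<theta> \<bullet> x\<bar> ^ Suc 1 / fact (Suc 1)"
    by (rule iexp_approx1)
  then have "cmod (iexp (\<theta> \<bullet> x) - 1 - \<i> * of_real (\<theta> \<bullet> x)) \<le> \<bar>\<theta> \<bullet> x\<bar>\<^sup>2 / 2"
    by (simp add: algebra_simps power2_eq_square)
  also have "\<dots> \<le> (norm \<theta> * norm x)\<^sup>2 / 2"
    by (intro divide_right_mono power_mono Cauchy_Schwarz_ineq2) auto
  also have "\<dots> \<le> (2 + (norm \<theta>)\<^sup>2) * (norm x)\<^sup>2"
    by (simp add: power_mult_distrib distrib_right)
  finally show ?thesis using True m by simp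
next
  case False
  then have m: "min 1 ((norm x)\<^sup>2) = 1" by simp
  have "cmod (iexp (\<theta> \<bullet> x) - 1) \<le> 2"
    using norm_triangle_ineq4[of "iexp (\<theta> \<bullet> x)" 1] by simp
  then show ?thesis using False m by (simp add: add_increasing2)
qed

lemma levy_integrand_measurable [measurable]:
  fixes \<theta> :: "real ^ 'n"
  shows "(\<lambda>x. iexp (\<theta> \<bullet> x) - 1 - \<i> * of_real (\<theta> \<bullet> x) * indicator (cball 0 1) x)
     \<in> borel_measurable borel"
proof -
  have [measurable]: "cball 0 1 \<in> sets (borel :: (real ^ 'n) measure)" by simp
  show ?thesis by measurable
qed

lemma levy_integrand_integrable:
  assumes "levy_measure X"
  shows "integrable X (\<lambda>x. iexp (\<theta> \<bullet> x) - 1 - \<i> * of_real (\<theta> \<bullet> x) * indicator (cball 0 1) x)"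
  by (rule levy_measure_trunc_integrable[OF assms _ iexp_trunc_bound])
     (simp add: borel_star_def measurable_restrict_space1)

text \<open>Otherwise x and sqrt 2 x would be nonzero multiples of 2 pi and sqrt 2 would be
  rational; in 2 m^2 = n^2 the exponent of 2 is odd on the left and even on the right. A single
  frequency would leave the zeros of 1 - cos x at all multiples of 2 pi.\<close>

lemma cos_both_1_imp_0:
  fixes x :: real
  assumes "cos x = 1" "cos (sqrt 2 * x) = 1"
  shows "x = 0"
proof (rule ccontr)
  assume x: "x \<noteq> 0"
  obtain m n :: int where m: "x = of_int m * 2 * pi" and n: "sqrt 2 * x = of_int n * 2 * pi"
    using assms cos_one_2pi_int by metis
  have "sqrt 2 * of_int m = of_int n" using m n by (auto simp: field_simps)
  then have "(sqrt 2 * of_int m)\<^sup>2 = (of_int n)\<^sup>2" by simp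
  then have "real_of_int (2 * m\<^sup>2) = real_of_int (n\<^sup>2)" by (simp add: power_mult_distrib)
  then have eq: "2 * m\<^sup>2 = n\<^sup>2" by (simp only: of_int_eq_iff)
  have m0: "m \<noteq> 0" and n0: "n \<noteq> 0" using m n x by auto
  have "multiplicity 2 (2 * m\<^sup>2) = 1 + 2 * multiplicity 2 m"
    using m0 by (simp add: prime_elem_multiplicity_mult_distrib prime_elem_multiplicity_power_distrib)
  moreover have "multiplicity 2 (n\<^sup>2) = 2 * multiplicity 2 n"
    using n0 by (simp add: prime_elem_multiplicity_power_distrib)
  ultimately have "1 + 2 * multiplicity 2 m = 2 * multiplicity 2 n" by (simp only: eq)
  then show False by arith
qed

text \<open>The second difference of the exponent in direction \<open>h\<close> is the Fourier transform of the finite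
  measure \<open>(1 - cos (h \<bullet> x)) X(dx)\<close> up to a constant, and finitely many such weights, with \<open>h\<close> running
  over \<open>e\<^sub>i\<close> and \<open>\<surd>2 e\<^sub>i\<close>, already add up to a weight that only vanishes at \<open>0\<close>.\<close>

lemma levy_exponent_second_difference:
  assumes X: "levy_measure X"
  shows "levy_exponent \<mu> A X \<theta> - (levy_exponent \<mu> A X (\<theta> + h) + levy_exponent \<mu> A X (\<theta> - h)) / 2
    = of_real (qinner A h h) / 2 + (\<integral>x. of_real (1 - cos (h \<bullet> x)) * iexp (\<theta> \<bullet> x) \<partial>X)"
proof -
  define f where "f \<theta> x = iexp (\<theta> \<bullet> x) - 1 - \<i> * of_real (\<theta> \<bullet> x) * indicator (cball 0 1) x"
    for \<theta> x :: "real ^ 'a"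
  have int: "integrable X (f \<theta>)" for \<theta>
    unfolding f_def by (rule levy_integrand_integrable[OF X])
  have "f \<theta> x - (f (\<theta> + h) x + f (\<theta> - h) x) / 2 = of_real (1 - cos (h \<bullet> x)) * iexp (\<theta> \<bullet> x)" for x
  proof -
    have c: "complex_of_real (cos (h \<bullet> x)) = (cis (h \<bullet> x) + cis (- (h \<bullet> x))) / 2"
      by (simp add: complex_eq_iff)
    show ?thesis
      unfolding f_def inner_add_left inner_diff_left of_real_diff of_real_1 c
      by (simp add: cis_conv_exp algebra_simps exp_add exp_minus exp_diff divide_simps)
  qed
  then have "(\<integral>x. of_real (1 - cos (h \<bullet> x)) * iexp (\<theta> \<bullet> x) \<partial>X)
      = (\<integral>x. f \<theta> x - (f (\<theta> + h) x + f (\<theta> - h) x) / 2 \<partial>X)" by simp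
  also have "\<dots> = (\<integral>x. f \<theta> x \<partial>X) - ((\<integral>x. f (\<theta> + h) x \<partial>X) + (\<integral>x. f (\<theta> - h) x \<partial>X)) / 2"
    using int by simp
  finally show ?thesis
    unfolding levy_exponent_def f_def[symmetric]
    by (simp add: qinner_def inner_add_left inner_diff_left inner_add_right inner_diff_right
        vector_matrix_left_distrib algebra_simps add_divide_distrib diff_divide_distrib)
qed

text \<open>A second difference annihilates the drift and turns the Gaussian term into a constant
  depending on A alone. The drifts may thus differ, while the common A cancels, and only the
  weighted Levy measures are compared.\<close>

theorem levy_exponent_eq_imp_measure_eq:
  assumes X: "levy_measure X" and X': "levy_measure X'"
    and eq: "\<And>\<theta>. levy_exponent \<mu> A X \<theta> = levy_exponent \<mu>' A X' \<theta>"
  shows "X = X'"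
proof -
  have s [measurable_cong]: "sets X = sets borel_star" "sets X' = sets borel_star"
    using X X' by (auto simp: levy_measure_def)
  have space_star: "space borel_star = - {0 :: real ^ 'a}"
    by (simp add: borel_star_def space_restrict_space)
  have [measurable]: "(\<lambda>x. x) \<in> borel_star \<rightarrow>\<^sub>M borel"
    unfolding borel_star_def by (rule measurable_restrict_space1) simp
  define g where "g x = (\<Sum>i\<in>UNIV. (1 - cos (axis i 1 \<bullet> x)) + (1 - cos (axis i (sqrt 2) \<bullet> x)))" for x :: "real ^ 'a"
  have [measurable]: "g \<in> borel_measurable borel" unfolding g_def by measurable
  have nn: "0 \<le> (1 - cos (axis i 1 \<bullet> x)) + (1 - cos (axis i (sqrt 2) \<bullet> x))" for i and x :: "real ^ 'a"
    by (intro add_nonneg_nonneg) (simp_all add: cos_le_one)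
  have g0: "g x \<ge> 0" for x unfolding g_def by (intro sum_nonneg nn)
  have gpos: "g x > 0" if x: "x \<noteq> 0" for x
  proof -
    obtain i where i: "x $ i \<noteq> 0" using x by (metis vec_eq_iff zero_index)
    have "cos (x $ i) \<noteq> 1 \<or> cos (sqrt 2 * x $ i) \<noteq> 1"
      using cos_both_1_imp_0 i by blast
    then have "cos (x $ i) + cos (sqrt 2 * x $ i) < 2"
      using cos_le_one[of "x $ i"] cos_le_one[of "sqrt 2 * x $ i"] by linarith
    then have "(1 - cos (axis i 1 \<bullet> x)) + (1 - cos (axis i (sqrt 2) \<bullet> x)) > 0"
      by (simp add: inner_axis')
    then show ?thesis unfolding g_def
      by (intro sum_pos2[of _ i]) (use nn in auto)
  qed
  have one_minus_cos: "0 \<le> 1 - cos y" "1 - cos y \<le> 2" "1 - cos y \<le> y\<^sup>2 / 2" for y :: real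
  proof -
    show "0 \<le> 1 - cos y" "1 - cos y \<le> 2"
      using cos_le_one[of y] cos_ge_minus_one[of y] by linarith+
    have "(sin (y / 2))\<^sup>2 \<le> y\<^sup>2 / 4"
      using power_mono[OF abs_sin_x_le_abs_x[of "y / 2"] abs_ge_zero, of 2]
      by (simp only: power2_abs) (simp add: power_divide)
    moreover have "cos y = 1 - 2 * (sin (y / 2))\<^sup>2"
      using cos_double_sin[of "y / 2"] by simp
    ultimately show "1 - cos y \<le> y\<^sup>2 / 2" by linarith
  qed
  have cosb: "\<bar>1 - cos (h \<bullet> x)\<bar> \<le> (2 + (norm h)\<^sup>2) * min 1 ((norm x)\<^sup>2)" for h x :: "real ^ 'a"
  proof -
    have "(h \<bullet> x)\<^sup>2 \<le> (norm h)\<^sup>2 * (norm x)\<^sup>2"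
      by (metis Cauchy_Schwarz_ineq2 abs_ge_zero power2_abs power_mono power_mult_distrib)
    then have 1: "1 - cos (h \<bullet> x) \<le> (norm h)\<^sup>2 * (norm x)\<^sup>2"
      using one_minus_cos(3)[of "h \<bullet> x"] zero_le_power2[of "h \<bullet> x"] by linarith
    have "1 - cos (h \<bullet> x) \<le> (2 + (norm h)\<^sup>2) * min 1 ((norm x)\<^sup>2)"
    proof (cases "(norm x)\<^sup>2 \<le> 1")
      case True
      with 1 show ?thesis by (simp add: distrib_right add_increasing)
    next
      case False
      with one_minus_cos(2)[of "h \<bullet> x"] show ?thesis by (simp add: add_increasing2)
    qed
    then show ?thesis using one_minus_cos(1)[of "h \<bullet> x"] by simp
  qed
  have intc: "integrable L (\<lambda>x. of_real (1 - cos (h \<bullet> x)) * iexp (\<theta> \<bullet> x))"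
    and intr: "integrable L (\<lambda>x. 1 - cos (h \<bullet> x))" if "levy_measure L" for L and h \<theta> :: "real ^ 'a"
    by (rule levy_measure_trunc_integrable[OF that, where K="2 + (norm h)\<^sup>2"];
        use cosb in \<open>auto simp: norm_mult simp flip: of_real_diff simp del: of_real_diff\<close>)+
  have diff: "(\<integral>x. of_real (1 - cos (h \<bullet> x)) * iexp (\<theta> \<bullet> x) \<partial>X) = (\<integral>x. of_real (1 - cos (h \<bullet> x)) * iexp (\<theta> \<bullet> x) \<partial>X')" for h \<theta>
    using levy_exponent_second_difference[OF X, of \<mu> A \<theta> h] levy_exponent_second_difference[OF X', of \<mu>' A \<theta> h]
    by (simp add: eq)
  have gint: "(\<integral>x. of_real (g x) * iexp (\<theta> \<bullet> x) \<partial>L) =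
     (\<Sum>i\<in>UNIV. (\<integral>x. of_real (1 - cos (axis i 1 \<bullet> x)) * iexp (\<theta> \<bullet> x) \<partial>L)
      + (\<integral>x. of_real (1 - cos (axis i (sqrt 2) \<bullet> x)) * iexp (\<theta> \<bullet> x) \<partial>L))" if "levy_measure L" for L \<theta>
    unfolding g_def of_real_sum sum_distrib_right of_real_add distrib_right
    by (subst Bochner_Integration.integral_sum)
       (auto intro!: Bochner_Integration.integrable_add intc[OF that] Bochner_Integration.integral_add sum.cong
             simp del: of_real_diff)
  have gint_real: "integrable L g" if "levy_measure L" for L
    unfolding g_def
    by (intro Bochner_Integration.integrable_sum Bochner_Integration.integrable_add intr that)
  define D where "D L = distr (density L (\<lambda>x. ennreal (g x))) borel (\<lambda>x. x)" for L
  have "D X = D X'"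
  proof (rule measure_eqI_cf)
    have fin: "finite_measure (D L)" if L: "levy_measure L" for L
    proof -
      have [measurable_cong]: "sets L = sets borel_star" using L by (simp add: levy_measure_def)
      have "finite_measure (density L (\<lambda>x. ennreal (g x)))"
        using gint_real[OF L] g0
        by (intro finite_measureI) (auto simp: emeasure_density integrable_iff_bounded less_top cong: nn_integral_cong_simp)
      then show ?thesis unfolding D_def by (rule finite_measure.finite_measure_distr) simp
    qed
    show "finite_measure (D X)" "finite_measure (D X')" by (intro fin X X')+
    fix \<theta>
    have "(\<integral>x. iexp (\<theta> \<bullet> x) \<partial>D L) = (\<integral>x. of_real (g x) * iexp (\<theta> \<bullet> x) \<partial>L)" if L: "levy_measure L" for L
    proof -
      have [measurable_cong]: "sets L = sets borel_star" using L by (simp add: levy_measure_def)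
      show ?thesis unfolding D_def
        by (subst integral_distr) (auto simp: integral_density g0 scaleR_conv_of_real)
    qed
    then show "(\<integral>x. iexp (\<theta> \<bullet> x) \<partial>D X) = (\<integral>x. iexp (\<theta> \<bullet> x) \<partial>D X')"
      by (simp add: X X' gint diff del: of_real_diff)
  qed (auto simp: D_def)
  show ?thesis
  proof (rule measure_eqI)
    fix C assume C: "C \<in> sets X"
    then have C': "C \<in> sets borel" "0 \<notin> C" using space_star
      by (auto simp: s borel_star_def sets_restrict_space)
    have "emeasure L C = (\<integral>\<^sup>+x. ennreal (1 / g x) * indicator C x \<partial>D L)" if L: "levy_measure L" for L
    proof -
      have sL [measurable_cong]: "sets L = sets borel_star" using L by (simp add: levy_measure_def)
      have [measurable]: "C \<in> sets L" "C \<in> sets borel_star" using C by (auto simp: s sL)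
      note C'(1) [measurable]
      \<comment> \<open>The weight g is positive off the origin and C avoids the origin, so g can be
        divided out: the finite measure with density g determines the Levy measure.\<close>
      have "ennreal (g x) * (ennreal (1 / g x) * indicator C x) = indicator C x" for x
        using C'(2) gpos[of x] by (cases "x = 0") (auto simp: indicator_def ennreal_mult[symmetric])
      then show ?thesis unfolding D_def
        by (subst nn_integral_distr) (auto simp: nn_integral_density)
    qed
    then show "emeasure X C = emeasure X' C" using X X' \<open>D X = D X'\<close> by simp
  qed (simp add: s)
qed

section \<open>Parameter integrals and the Frullani integral\<close>

text \<open>On a convex S the mean value inequality bounds every difference quotient by the majorant
  h of the derivative, so dominated convergence applies along sequences tending to z.\<close>

lemma has_field_derivative_integral:
  fixes f f' :: "complex \<Rightarrow> 'a \<Rightarrow> complex"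
  assumes S: "open S" "convex S" "z \<in> S"
    and int: "\<And>w. w \<in> S \<Longrightarrow> integrable M (f w)"
    and der: "\<And>w x. w \<in> S \<Longrightarrow> x \<in> space M \<Longrightarrow> ((\<lambda>w. f w x) has_field_derivative f' w x) (at w)"
    and meas: "f' z \<in> borel_measurable M"
    and bound: "\<And>w x. w \<in> S \<Longrightarrow> x \<in> space M \<Longrightarrow> norm (f' w x) \<le> h x"
    and h: "integrable M h"
  shows "((\<lambda>w. \<integral>x. f w x \<partial>M) has_field_derivative (\<integral>x. f' z x \<partial>M)) (at z)"
proof -
  have "((\<lambda>y. ((\<integral>x. f y x \<partial>M) - (\<integral>x. f z x \<partial>M)) / (y - z)) \<longlongrightarrow> (\<integral>x. f' z x \<partial>M)) (at z within S)"
    unfolding tendsto_at_iff_sequentially comp_def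
  proof (intro allI impI)
    fix X :: "nat \<Rightarrow> complex" assume X: "\<forall>i. X i \<in> S - {z}" "X \<longlonglongrightarrow> z"
    have "(\<lambda>i. \<integral>x. (f (X i) x - f z x) / (X i - z) \<partial>M) \<longlonglongrightarrow> (\<integral>x. f' z x \<partial>M)"
    proof (rule integral_dominated_convergence[where w=h])
      show "AE x in M. (\<lambda>i. (f (X i) x - f z x) / (X i - z)) \<longlonglongrightarrow> f' z x"
      proof (intro AE_I2)
        fix x assume "x \<in> space M"
        then have "((\<lambda>y. (f y x - f z x) / (y - z)) \<longlongrightarrow> f' z x) (at z)"
          using der S(3) by (simp add: has_field_derivative_iff)
        then show "(\<lambda>i. (f (X i) x - f z x) / (X i - z)) \<longlonglongrightarrow> f' z x"
          using X unfolding tendsto_at_iff_sequentially comp_def by auto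
      qed
      show "AE x in M. norm ((f (X i) x - f z x) / (X i - z)) \<le> h x" for i
      proof (intro AE_I2)
        fix x assume x: "x \<in> space M"
        have "norm (f (X i) x - f z x) \<le> h x * norm (X i - z)"
        proof (rule field_differentiable_bound[OF S(2), where f'="\<lambda>w. f' w x"])
          show "((\<lambda>w. f w x) has_field_derivative f' w x) (at w within S)" if "w \<in> S" for w
            by (rule has_field_derivative_at_within[OF der[OF that x]])
          show "norm (f' w x) \<le> h x" if "w \<in> S" for w
            by (rule bound[OF that x])
        qed (use X S in auto)
        then show "norm ((f (X i) x - f z x) / (X i - z)) \<le> h x"
          using X by (simp add: norm_divide divide_le_eq)
      qed
    qed (use int X S meas h in auto)
    moreover have "(\<integral>x. (f (X i) x - f z x) / (X i - z) \<partial>M)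
        = ((\<integral>x. f (X i) x \<partial>M) - (\<integral>x. f z x \<partial>M)) / (X i - z)" for i
      using int X S by (auto simp: Bochner_Integration.integral_diff)
    ultimately show "(\<lambda>i. ((\<integral>x. f (X i) x \<partial>M) - (\<integral>x. f z x \<partial>M)) / (X i - z)) \<longlonglongrightarrow> (\<integral>x. f' z x \<partial>M)"
      by (simp only:)
  qed
  then show ?thesis
    using at_within_open[OF S(3,1)] by (simp add: has_field_derivative_iff)
qed

text \<open>On a space whose points are positive, g > 0 is a fact about the space instead of an
  indicator in every integrand.\<close>

definition pos_lborel :: "real measure" where
  "pos_lborel = restrict_space lborel {0<..}"

lemma space_pos_lborel [simp]: "space pos_lborel = {0<..}"
  by (simp add: pos_lborel_def space_restrict_space)

lemma measurable_pos_lborel: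
  "f \<in> borel_measurable borel \<Longrightarrow> f \<in> borel_measurable pos_lborel"
  by (simp add: pos_lborel_def measurable_restrict_space1)

lemma measurable_ident_pos_lborel [measurable]: "(\<lambda>x. x) \<in> borel_measurable pos_lborel"
  by (rule measurable_pos_lborel) simp

lemma sigma_finite_pos_lborel: "sigma_finite_measure pos_lborel"
  unfolding pos_lborel_def by (intro sigma_finite_measure_restrict_space sigma_finite_lborel) simp

lemma nn_integral_pos_lborel:
  "(\<integral>\<^sup>+x. f x \<partial>pos_lborel) = (\<integral>\<^sup>+x. f x * indicator {0<..} x \<partial>lborel)"
  unfolding pos_lborel_def by (simp add: nn_integral_restrict_space)

lemma integral_pos_lborel:
  fixes f :: "real \<Rightarrow> 'b::{banach,second_countable_topology}"
  shows "(\<integral>x. f x \<partial>pos_lborel) = (LBINT x:{0<..}. f x)"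
  unfolding pos_lborel_def set_lebesgue_integral_def by (simp add: integral_restrict_space)

lemma integrable_pos_lborel:
  fixes f :: "real \<Rightarrow> 'b::{banach,second_countable_topology}"
  shows "integrable pos_lborel f \<longleftrightarrow> set_integrable lborel {0<..} f"
  unfolding pos_lborel_def set_integrable_def by (simp add: integrable_restrict_space)

lemma nn_integral_exp_pos:
  assumes "0 < (c::real)"
  shows "(\<integral>\<^sup>+g. ennreal (exp (- c * g)) \<partial>pos_lborel) = ennreal (1 / c)"
proof -
  have "(\<integral>\<^sup>+g. ennreal (exp (- c * g)) \<partial>pos_lborel) = (\<integral>\<^sup>+g. ennreal (exp (- c * g)) * indicator {0..} g \<partial>lborel)"
    unfolding nn_integral_pos_lborel
    by (intro nn_integral_cong_AE AE_I[where N="{0}"]) (auto simp: indicator_def)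
  also have "\<dots> = ennreal (0 - (- exp (- c * 0) / c))"
  proof (rule nn_integral_FTC_atLeast)
    show "((\<lambda>g. - exp (- c * g) / c) has_field_derivative exp (- c * x)) (at x)" for x
      using assms by (auto intro!: derivative_eq_intros)
    show "((\<lambda>g. - exp (- c * g) / c) \<longlongrightarrow> 0) at_top"
      using assms by real_asymp
  qed auto
  finally show ?thesis by simp
qed

lemma integrable_exp_pos:
  assumes "0 < (c::real)"
  shows "integrable pos_lborel (\<lambda>g. exp (- c * g))"
  using nn_integral_exp_pos[OF assms] by (intro integrableI_nonneg) auto

lemma integral_cexp_pos:
  fixes z :: complex
  assumes z: "Re z < 0"
  shows "(\<integral>g. exp (of_real g * z) \<partial>pos_lborel) = - 1 / z"
proof -
  have z0: "z \<noteq> 0" using z by auto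
  have nexp: "norm (exp (of_real g * z)) = exp (- (- Re z) * g)" for g
    by (simp add: mult.commute)
  have int: "integrable pos_lborel (\<lambda>g. exp (of_real g * z))"
    by (rule Bochner_Integration.integrable_bound[OF integrable_exp_pos[of "- Re z"]])
       (use z in \<open>auto simp: nexp simp del: norm_exp_eq_Re\<close>)
  have ei: "einterval 0 \<infinity> = {0<..}" by (auto simp: einterval_def)
  have "(\<integral>g. exp (of_real g * z) \<partial>pos_lborel) = (LBINT g=0..\<infinity>. exp (of_real g * z))"
    by (simp add: integral_pos_lborel interval_lebesgue_integral_def ei)
  also have "\<dots> = 0 - 1 / z"
  proof (rule interval_integral_FTC_integrable[where F="\<lambda>g. exp (of_real g * z) / z"])
    show "((\<lambda>g. exp (of_real g * z) / z) has_vector_derivative exp (of_real x * z)) (at x)" for x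
    proof -
      have "((\<lambda>w. exp (w * z) / z) has_field_derivative exp (of_real x * z)) (at (of_real x))"
        using z0 by (auto intro!: derivative_eq_intros)
      then show ?thesis
        using has_vector_derivative_real_field by force
    qed
    show "set_integrable lborel (einterval 0 \<infinity>) (\<lambda>g. exp (of_real g * z))"
      using int by (simp add: ei integrable_pos_lborel)
    have "((\<lambda>x. exp (of_real x * z) / z) \<longlongrightarrow> exp (of_real 0 * z) / z) (at_right 0)"
      by (intro tendsto_intros z0)
    then show "(((\<lambda>g. exp (of_real g * z) / z) \<circ> real_of_ereal) \<longlongrightarrow> 1 / z) (at_right 0)"
      unfolding zero_ereal_def ereal_tendsto_simps by simp
    have "((\<lambda>x. exp (Re z * x)) \<longlongrightarrow> 0) at_top"
      using z by real_asymp
    then have "((\<lambda>x. norm (exp (of_real x * z))) \<longlongrightarrow> 0) at_top"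
      by (simp add: mult.commute)
    then have "((\<lambda>x. exp (of_real x * z)) \<longlongrightarrow> 0) at_top"
      by (rule tendsto_norm_zero_cancel)
    then have "((\<lambda>x. exp (of_real x * z) / z) \<longlongrightarrow> 0 / z) at_top"
      by (intro tendsto_divide tendsto_const z0)
    then show "(((\<lambda>g. exp (of_real g * z) / z) \<circ> real_of_ereal) \<longlongrightarrow> 0) (at_left \<infinity>)"
      unfolding ereal_tendsto_simps by simp
  qed (auto intro!: continuous_intros)
  finally show ?thesis by simp
qed

text \<open>The half plane Re w <= c is convex, contains both 0 and z, and the derivative of exp is
  bounded by exp c on it.\<close>

lemma cmod_exp_minus_1_le:
  assumes "Re z \<le> c" "0 \<le> c"
  shows "cmod (exp z - 1) \<le> exp c * cmod z"
proof -
  have "cmod (exp z - exp 0) \<le> exp c * cmod (z - 0)"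
    by (rule field_differentiable_bound[of "{w. Re w \<le> c}" _ exp])
       (use assms in \<open>auto intro!: convex_halfspace_Re_le derivative_eq_intros\<close>)
  then show ?thesis by simp
qed

text \<open>Near 0 the difference exp (g z) - 1 is O(g) and cancels 1 / g. Half of the decay exp (-
  b g) pays for the growth of exp (g z), which is where b / 2 comes from; the room beyond Re z <= 0
  provides an open set to differentiate in.\<close>

lemma frullani_integrable:
  fixes z :: complex
  assumes b: "0 < b" and z: "Re z \<le> b / 2"
  shows "integrable pos_lborel (\<lambda>g. of_real (exp (- b * g) / g) * (exp (of_real g * z) - 1))"
proof (rule Bochner_Integration.integrable_bound)
  show "integrable pos_lborel (\<lambda>g. cmod z * exp (- (b / 2) * g))"
    using b by (intro integrable_mult_right integrable_exp_pos) auto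
  show "AE g in pos_lborel. norm (of_real (exp (- b * g) / g) * (exp (of_real g * z) - 1))
      \<le> norm (cmod z * exp (- (b / 2) * g))"
  proof (rule AE_I2)
    fix g assume "g \<in> space pos_lborel"
    then have g: "g > 0" by simp
    have "cmod (exp (of_real g * z) - 1) \<le> exp (g * b / 2) * cmod (of_real g * z)"
      using g b z by (intro cmod_exp_minus_1_le) (auto simp: mult_left_mono)
    then have "exp (- b * g) / g * cmod (exp (of_real g * z) - 1)
        \<le> exp (- b * g) / g * (exp (g * b / 2) * (g * cmod z))"
      using g by (intro mult_left_mono) (auto simp: norm_mult)
    also have "\<dots> = cmod z * (exp (- b * g) * exp (g * b / 2))"
      using g by simp
    also have "exp (- b * g) * exp (g * b / 2) = exp (- (b / 2) * g)"
      by (simp flip: exp_add)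
    finally show "norm (of_real (exp (- b * g) / g) * (exp (of_real g * z) - 1))
      \<le> norm (cmod z * exp (- (b / 2) * g))"
      using g by (simp add: norm_mult norm_divide)
  qed
qed measurable

text \<open>Both sides vanish at 0 and have derivative 1 / (b - w) on the half plane Re w < b / 2,
  which contains z. There Re (1 - w / b) > 0, so the principal branch is holomorphic.\<close>

lemma frullani_complex:
  fixes z :: complex
  assumes b: "0 < b" and z: "Re z \<le> 0"
  shows "(\<integral>g. of_real (exp (- b * g) / g) * (exp (of_real g * z) - 1) \<partial>pos_lborel) = - Ln (1 - z / of_real b)"
proof -
  define S where "S = {w. Re w < b / 2}"
  define H where "H w = (\<integral>g. of_real (exp (- b * g) / g) * (exp (of_real g * w) - 1) \<partial>pos_lborel)" for w :: complex
  have S: "open S" "convex S" unfolding S_def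
    by (rule open_halfspace_Re_lt convex_halfspace_Re_lt)+
  have H': "(H has_field_derivative 1 / (of_real b - w)) (at w)" if w: "w \<in> S" for w
  proof -
    have ne: "Re w < b" using w b by (simp add: S_def)
    have "(H has_field_derivative (\<integral>g. exp (of_real g * (w - of_real b)) \<partial>pos_lborel)) (at w)"
      unfolding H_def
    proof (rule has_field_derivative_integral[OF S w, where h="\<lambda>g. exp (- (b / 2) * g)"])
      fix v g assume v: "v \<in> S" and "g \<in> space pos_lborel"
      then have g: "g > 0" by simp
      show "((\<lambda>w. of_real (exp (- b * g) / g) * (exp (of_real g * w) - 1)) has_field_derivative
          exp (of_real g * (v - of_real b))) (at v)"
      proof -
        have "exp (of_real g * (v - of_real b)) = exp (of_real (- b * g)) * exp (of_real g * v)"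
          unfolding exp_add[symmetric] by (simp add: algebra_simps)
        then have e: "exp (of_real g * (v - of_real b)) = of_real (exp (- b * g)) * exp (of_real g * v)"
          by (simp only: exp_of_real)
        have "((\<lambda>w. of_real (exp (- b * g) / g) * (exp (of_real g * w) - 1)) has_field_derivative
          of_real (exp (- b * g) / g) * (exp (of_real g * v) * of_real g)) (at v)"
          by (auto intro!: derivative_eq_intros)
        also have "of_real (exp (- b * g) / g) * (exp (of_real g * v) * of_real g) = exp (of_real g * (v - of_real b))"
          unfolding e using g by simp
        finally show ?thesis .
      qed
      have "g * (Re v - b) \<le> - (b / 2 * g)"
        using v g b mult_left_mono[of "Re v - b" "- b / 2" g] by (auto simp: S_def algebra_simps)
      then show "norm (exp (of_real g * (v - of_real b))) \<le> exp (- (b / 2) * g)"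
        by simp
    next
      show "integrable pos_lborel (\<lambda>g. of_real (exp (- b * g) / g) * (exp (of_real g * v) - 1))" if "v \<in> S" for v
        using that by (intro frullani_integrable b) (simp add: S_def)
      show "integrable pos_lborel (\<lambda>g. exp (- (b / 2) * g))"
        using b by (intro integrable_exp_pos) simp
      show "(\<lambda>g. exp (of_real g * (w - of_real b))) \<in> borel_measurable pos_lborel"
        by measurable
    qed
    also have "(\<integral>g. exp (of_real g * (w - of_real b)) \<partial>pos_lborel) = 1 / (of_real b - w)"
      using ne by (subst integral_cexp_pos) (auto simp: minus_divide_right)
    finally show ?thesis .
  qed
  have L': "((\<lambda>w. - Ln (1 - w / of_real b)) has_field_derivative 1 / (of_real b - w)) (at w)" if w: "w \<in> S" for w
  proof -
    have "Re w / b < 1" using w b by (simp add: S_def divide_less_eq)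
    then have "Re (1 - w / of_real b) > 0" by simp
    then have "1 - w / of_real b \<notin> \<real>\<^sub>\<le>\<^sub>0" using complex_nonpos_Reals_iff by auto
    moreover have "w \<noteq> of_real b" using w b by (auto simp: S_def)
    ultimately show ?thesis
      using b by (auto intro!: derivative_eq_intros simp: divide_simps)
  qed
  have "\<exists>c. \<forall>w\<in>S. H w - (- Ln (1 - w / of_real b)) = c"
  proof (rule has_field_derivative_zero_constant[OF S(2)])
    fix w assume "w \<in> S"
    from DERIV_diff[OF H'[OF this] L'[OF this]]
    show "((\<lambda>w. H w - (- Ln (1 - w / of_real b))) has_field_derivative 0) (at w within S)"
      by (auto intro: has_field_derivative_at_within)
  qed
  then obtain c where c: "\<And>w. w \<in> S \<Longrightarrow> H w - (- Ln (1 - w / of_real b)) = c" by blast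
  have "0 \<in> S" "z \<in> S" using b z by (auto simp: S_def)
  from c[OF this(1)] c[OF this(2)] have "H z = - Ln (1 - z / of_real b)"
    by (simp add: H_def eq_neg_iff_add_eq_0)
  then show ?thesis by (simp add: H_def)
qed

lemma frullani_real:
  assumes b: "0 < b" and a: "0 \<le> a"
  shows "integrable pos_lborel (\<lambda>g. (exp (- b * g) / g) * (1 - exp (- g * a)))"
    and "(\<integral>g. (exp (- b * g) / g) * (1 - exp (- g * a)) \<partial>pos_lborel) = ln ((b + a) / b)"
proof -
  have eq: "of_real (exp (- b * g) / g) * (exp (of_real g * (- of_real a)) - 1) =
      complex_of_real (- ((exp (- b * g) / g) * (1 - exp (- g * a))))" for g
  proof -
    have "exp (of_real g * (- of_real a)) = complex_of_real (exp (- g * a))"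
      unfolding exp_of_real[symmetric] by simp
    then show ?thesis by (simp add: right_diff_distrib diff_divide_distrib)
  qed
  have i: "integrable pos_lborel (\<lambda>g. complex_of_real (- ((exp (- b * g) / g) * (1 - exp (- g * a)))))"
    using frullani_integrable[OF b, of "- of_real a"] a b unfolding eq by simp
  then have "integrable pos_lborel (\<lambda>g. - ((exp (- b * g) / g) * (1 - exp (- g * a))))"
    by (simp only: complex_of_real_integrable_eq)
  from integrable_minus[OF this]
  show "integrable pos_lborel (\<lambda>g. (exp (- b * g) / g) * (1 - exp (- g * a)))"
    by (simp only: minus_minus)
  have "complex_of_real (- (\<integral>g. (exp (- b * g) / g) * (1 - exp (- g * a)) \<partial>pos_lborel)) = - Ln (1 - (- of_real a) / of_real b)"
    using frullani_complex[OF b, of "- of_real a"] a unfolding eq integral_complex_of_real by simp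
  also have "1 - (- of_real a) / of_real b = complex_of_real ((b + a) / b)"
    using b by (simp add: add_divide_distrib)
  also have "- Ln (complex_of_real ((b + a) / b)) = of_real (- ln ((b + a) / b))" using a b by (subst Ln_of_real) auto
  finally show "(\<integral>g. (exp (- b * g) / g) * (1 - exp (- g * a)) \<partial>pos_lborel) = ln ((b + a) / b)"
    by (simp only: of_real_eq_iff)
qed

text \<open>E |B(g u)| is of order sqrt g for small g, so the first absolute moment of a
  variance-gamma kernel leads to sqrt g / g = 1 / sqrt g. The majorant is 1 / sqrt g on (0, 1) plus
  exp (- b g).\<close>

lemma integrable_exp_div_sqrt_pos:
  assumes b: "0 < (b::real)"
  shows "integrable pos_lborel (\<lambda>g. exp (- b * g) / sqrt g)"
proof -
  have ei: "einterval 0 1 = {0<..<1}" 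
    unfolding einterval_def zero_ereal_def one_ereal_def less_ereal.simps by auto
  have "set_integrable lborel (einterval 0 1) (\<lambda>g. 1 / sqrt g)"
  proof (rule interval_integral_FTC_nonneg[where F="\<lambda>g. 2 * sqrt g"])
    show "((\<lambda>g. 2 * sqrt g) has_field_derivative 1 / sqrt x) (at x)" if "0 < ereal x" for x
      using that by (auto intro!: derivative_eq_intros simp: inverse_eq_divide)
    show "isCont (\<lambda>g. 1 / sqrt g) x" if "0 < ereal x" for x
      using that by (auto intro!: continuous_intros)
    have "((\<lambda>g. 2 * sqrt g) \<longlongrightarrow> 2 * sqrt 0) (at_right 0)" by (intro tendsto_intros)
    then show "(((\<lambda>g. 2 * sqrt g) \<circ> real_of_ereal) \<longlongrightarrow> 0) (at_right 0)"
      unfolding zero_ereal_def ereal_tendsto_simps by simp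
    have "((\<lambda>g. 2 * sqrt g) \<longlongrightarrow> 2 * sqrt 1) (at_left 1)" by (intro tendsto_intros)
    then show "(((\<lambda>g. 2 * sqrt g) \<circ> real_of_ereal) \<longlongrightarrow> 2) (at_left 1)"
      unfolding one_ereal_def ereal_tendsto_simps by simp
  qed simp_all
  then have "integrable lborel (\<lambda>g. indicator {0<..<1} g *\<^sub>R (1 / sqrt g))"
    by (simp add: ei set_integrable_def)
  then have "integrable pos_lborel (\<lambda>g. indicator {0<..<1} g *\<^sub>R (1 / sqrt g))"
    unfolding integrable_pos_lborel set_integrable_def
    
    by (rule Bochner_Integration.integrable_bound) (auto intro!: AE_I2 simp: indicator_def)
  note Bochner_Integration.integrable_add[OF this integrable_exp_pos[OF b]]
  then show ?thesis
  proof (rule Bochner_Integration.integrable_bound)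
    show "AE g in pos_lborel. norm (exp (- b * g) / sqrt g) \<le> norm (indicator {0<..<1} g *\<^sub>R (1 / sqrt g) + exp (- b * g))"
    proof (rule AE_I2)
      fix g assume "g \<in> space pos_lborel"
      then have g: "g > 0" by simp
      show "norm (exp (- b * g) / sqrt g) \<le> norm (indicator {0<..<1} g *\<^sub>R (1 / sqrt g) + exp (- b * g))"
      proof (cases "g < 1")
        case True
        have "exp (- b * g) / sqrt g \<le> 1 / sqrt g" using g b by (intro divide_right_mono) auto
        then show ?thesis using True g by (simp add: add_increasing2)
      next
        case False
        then have "1 \<le> sqrt g" by simp
        then have "exp (- b * g) / sqrt g \<le> exp (- b * g)" using mult_left_mono[of 1 "sqrt g" "exp (- b * g)"] g by (simp add: divide_le_eq)
        then show ?thesis using False g by simp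
      qed
    qed
  next
    show "(\<lambda>g. exp (- b * g) / sqrt g) \<in> borel_measurable pos_lborel"
      by (intro measurable_pos_lborel) simp
  qed
qed

declare measurable_ident_pos_lborel [measurable del]

section \<open>Brownian motion at a vector of times\<close>

lemma qinner_sum: "qinner A x y = (\<Sum>k\<in>UNIV. \<Sum>l\<in>UNIV. A $ k $ l * (x $ k * y $ l))"
  unfolding qinner_def vector_matrix_mult_def inner_vec_def
  by (simp add: sum_distrib_right) (subst sum.swap, simp add: algebra_simps)

lemma levy_exponent_null:
  "levy_exponent \<mu> A (null_measure borel_star) \<theta> = \<i> * of_real (\<mu> \<bullet> \<theta>) - of_real (qinner A \<theta> \<theta>) / 2"
  by (simp add: levy_exponent_def)

lemma brownian_increment_cf:
  fixes B :: "real \<Rightarrow> 'b \<Rightarrow> real ^ 'n"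
  assumes B: "brownian_motion MB B \<mu> A" and s: "0 \<le> s" "s \<le> s'"
  shows "(\<integral>\<omega>. iexp (c \<bullet> (B s' \<omega> - B s \<omega>)) \<partial>MB)
    = exp (of_real (s' - s) * (\<i> * of_real (\<mu> \<bullet> c) - of_real (qinner A c c) / 2))"
proof -
  have L: "levy_process MB B"
    and cf: "\<And>t \<theta>. t \<ge> 0 \<Longrightarrow> (\<integral>\<omega>. iexp (\<theta> \<bullet> B t \<omega>) \<partial>MB)
        = exp (of_real t * (\<i> * of_real (\<mu> \<bullet> \<theta>) - of_real (qinner A \<theta> \<theta>) / 2))"
    using B by (auto simp: brownian_motion_def levy_law_def levy_exponent_null)
  have m: "B t \<in> borel_measurable MB" if "t \<ge> 0" for t using L that by (simp add: levy_process_def)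
  note [measurable] = m[of s] m[of s'] m[of "s' - s"]
  have "distr MB borel (\<lambda>\<omega>. B (s + (s' - s)) \<omega> - B s \<omega>) = distr MB borel (B (s' - s))"
  proof -
    have "\<forall>s\<ge>0. \<forall>t\<ge>0. distr MB borel (\<lambda>\<omega>. B (s + t) \<omega> - B s \<omega>) = distr MB borel (B t)"
      using L by (simp add: levy_process_def)
    from this[rule_format, of s "s' - s"] show ?thesis using s by simp
  qed
  then have d: "distr MB borel (\<lambda>\<omega>. B s' \<omega> - B s \<omega>) = distr MB borel (B (s' - s))" by simp
  have "(\<integral>\<omega>. iexp (c \<bullet> (B s' \<omega> - B s \<omega>)) \<partial>MB) = (\<integral>x. iexp (c \<bullet> x) \<partial>distr MB borel (\<lambda>\<omega>. B s' \<omega> - B s \<omega>))"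
    using s by (subst integral_distr) auto
  also have "\<dots> = (\<integral>\<omega>. iexp (c \<bullet> B (s' - s) \<omega>) \<partial>MB)"
    unfolding d using s by (subst integral_distr) auto
  also have "\<dots> = exp (of_real (s' - s) * (\<i> * of_real (\<mu> \<bullet> c) - of_real (qinner A c c) / 2))"
    using s by (intro cf) simp
  finally show ?thesis .
qed

text \<open>The prefix is a condition inside a sum over a common range, so that the sums belonging
  to different coordinates can be interchanged.\<close>

lemma prefix_telescope:
  fixes f :: "nat \<Rightarrow> 'a::ab_group_add"
  assumes "p \<le> m"
  shows "(\<Sum>j<m. if j < p then f (Suc j) - f j else 0) = f p - f 0"
proof -
  have "(\<Sum>j<m. if j < p then f (Suc j) - f j else 0) = (\<Sum>j\<in>{..<m} \<inter> {j. j < p}. f (Suc j) - f j)"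
    by (simp add: sum.inter_restrict)
  also have "{..<m} \<inter> {j. j < p} = {..<p}" using assms by auto
  finally show ?thesis by (simp add: sum_lessThan_telescope)
qed

text \<open>With \<open>s 0 = 0 < s 1 < \<dots>\<close> the sorted entries of \<open>t\<close>, every \<open>B\<^sub>k(t\<^sub>k)\<close> is a sum of the first \<open>p k\<close>
  increments, and the same telescoping applied to \<open>s\<close> itself yields \<open>min (t\<^sub>k) (t\<^sub>l)\<close>.\<close>

lemma sorted_times:
  fixes t :: "real ^ 'n"
  assumes t: "t \<in> orthant"
  obtains s :: "nat \<Rightarrow> real" and m :: nat and p :: "'n \<Rightarrow> nat"
  where "incseq s" "s 0 = 0" "\<And>k. p k \<le> m" "\<And>k. s (p k) = t $ k"
proof -
  define S where "S = insert 0 (range (\<lambda>i. t $ i))"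
  define xs where "xs = sorted_list_of_set S"
  have S: "finite S" "\<And>x. x \<in> S \<Longrightarrow> 0 \<le> x" using t by (auto simp: S_def orthant_def)
  have xs: "set xs = S" "sorted xs" unfolding xs_def using S by auto
  have len: "length xs > 0" using xs(1) by (auto simp: S_def)
  \<comment> \<open>With 0 among the values, s starts at time 0. The cap at the last index keeps s
    monotone on all of nat, since the partitions in \<open>levy_process\<close> are infinite
    sequences.\<close>
  define s where "s j = xs ! (min j (length xs - 1))" for j
  have inc: "incseq s"
    unfolding s_def by (intro monoI sorted_nth_mono[OF xs(2)]) (use len in \<open>auto simp: min_less_iff_disj\<close>)
  obtain j0 where "j0 < length xs" "xs ! j0 = 0"
    using xs(1) by (metis S_def in_set_conv_nth insertI1)
  then have "s 0 \<le> 0" using sorted_nth_mono[OF xs(2), of 0 j0] by (simp add: s_def)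
  moreover have "s 0 \<ge> 0"
    using S(2)[of "xs ! 0"] nth_mem[OF len] xs(1) by (simp add: s_def)
  ultimately have s0: "s 0 = 0" by simp
  have "\<exists>p. p < length xs \<and> xs ! p = t $ k" for k
    using xs(1) by (metis S_def in_set_conv_nth insertI2 rangeI)
  then obtain p where p: "\<And>k. p k < length xs" "\<And>k. xs ! p k = t $ k" by metis
  show ?thesis
  proof (rule that[OF inc s0, of p "length xs"])
    show "p k \<le> length xs" for k using p(1)[of k] by simp
    show "s (p k) = t $ k" for k
    proof -
      have "min (p k) (length xs - 1) = p k" using p(1)[of k] by (intro min_absorb1) linarith
      then show ?thesis using p(2) by (simp add: s_def)
    qed
  qed
qed

text \<open>The entry (k, l) takes part in step j exactly when j lies below both p k and p l, and by
  monotonicity s (min (p k) (p l)) is the smaller of the two times. The left-hand side is a sum of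
  nonnegative terms when A is a covariance matrix, which is how \<open>diamond_mat_psd\<close>
  follows.\<close>

lemma qinner_diamond_telescope:
  fixes s :: "nat \<Rightarrow> real" and t \<theta> :: "real ^ 'n"
  assumes s: "incseq s" "s 0 = 0" "\<And>k. p k \<le> m" "\<And>k. s (p k) = t $ k"
  defines "c \<equiv> \<lambda>j. \<chi> k. if j < p k then \<theta> $ k else 0"
  shows "(\<Sum>j<m. (s (Suc j) - s j) * qinner A (c j) (c j)) = qinner (t \<diamond>\<^sub>m A) \<theta> \<theta>"
proof -
  have "(\<Sum>j<m. (s (Suc j) - s j) * qinner A (c j) (c j))
      = (\<Sum>j<m. \<Sum>k\<in>UNIV. \<Sum>l\<in>UNIV. A $ k $ l * (\<theta> $ k * \<theta> $ l) * (if j < min (p k) (p l) then s (Suc j) - s j else 0))"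
    by (auto simp: qinner_sum c_def sum_distrib_left intro!: sum.cong)
  also have "\<dots> = (\<Sum>k\<in>UNIV. \<Sum>l\<in>UNIV. A $ k $ l * (\<theta> $ k * \<theta> $ l) * (\<Sum>j<m. (if j < min (p k) (p l) then s (Suc j) - s j else 0)))"
    unfolding sum_distrib_left by (subst sum.swap, rule sum.cong[OF refl], rule sum.swap)
  also have "\<dots> = (\<Sum>k\<in>UNIV. \<Sum>l\<in>UNIV. A $ k $ l * (\<theta> $ k * \<theta> $ l) * (s (min (p k) (p l)) - s 0))"
    by (subst prefix_telescope) (simp_all add: s(3) min.coboundedI1)
  also have "\<dots> = qinner (t \<diamond>\<^sub>m A) \<theta> \<theta>"
    unfolding qinner_sum diamond_mat_def min_of_mono[OF s(1), symmetric] s(4) s(2)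
    by (simp add: algebra_simps)
  finally show ?thesis .
qed

lemma measurable_vec_nth_comp [measurable (raw)]:
  fixes f :: "'a \<Rightarrow> real ^ 'n"
  shows "f \<in> borel_measurable M \<Longrightarrow> (\<lambda>x. f x $ i) \<in> borel_measurable M"
  by (rule measurable_compose[where g="\<lambda>x. x $ i"]) (auto intro!: borel_measurable_continuous_onI continuous_intros)

lemma borel_measurable_vec_lambda:
  fixes f :: "'n::finite \<Rightarrow> 'a \<Rightarrow> real"
  assumes "\<And>i. f i \<in> borel_measurable M"
  shows "(\<lambda>x. \<chi> i. f i x) \<in> borel_measurable M"
  using assms by (subst borel_measurable_euclidean_space) (auto simp: Basis_vec_def inner_axis)

lemma measurable_multi_time:
  assumes L: "levy_process MB B" and t: "t \<in> orthant"
  shows "multi_time B t \<in> borel_measurable MB"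
proof -
  have [measurable]: "B (t $ i) \<in> borel_measurable MB" for i
    using L t by (simp add: levy_process_def orthant_def)
  show ?thesis unfolding multi_time_def[abs_def] by (rule borel_measurable_vec_lambda) measurable
qed

text \<open>Let c j keep those coordinates of theta that are still running in the j-th interval.
  Then theta . B(t) is the sum of c j . (j-th increment of B), and independence of the increments
  factors the expectation.\<close>

lemma multi_time_cf:
  fixes B :: "real \<Rightarrow> 'b \<Rightarrow> real ^ 'n"
  assumes B: "brownian_motion MB B \<mu> A" and t: "t \<in> orthant"
  shows "(\<integral>\<omega>. iexp (\<theta> \<bullet> multi_time B t \<omega>) \<partial>MB)
    = exp (\<i> * of_real ((t \<diamond>\<^sub>v \<mu>) \<bullet> \<theta>) - of_real (qinner (t \<diamond>\<^sub>m A) \<theta> \<theta>) / 2)"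
proof -
  have L: "levy_process MB B" using B by (simp add: brownian_motion_def levy_law_def)
  then interpret P: prob_space MB by (simp add: levy_process_def)
  have m: "B t \<in> borel_measurable MB" if "t \<ge> 0" for t using L that by (simp add: levy_process_def)
  obtain s m p where s: "incseq s" "s 0 = 0" "\<And>k. p k \<le> m" "\<And>k. s (p k) = t $ k"
    using sorted_times[OF t] by metis
  have spos: "0 \<le> s j" for j using incseqD[OF s(1), of 0 j] s(2) by simp
  note [measurable] = m[OF spos]
  define c :: "nat \<Rightarrow> real ^ 'n" where "c j = (\<chi> k. if j < p k then \<theta> $ k else 0)" for j
  define X where "X j \<omega> = iexp (c j \<bullet> (B (s (Suc j)) \<omega> - B (s j) \<omega>))" for j \<omega>
  have ind: "P.indep_vars (\<lambda>_. borel) (\<lambda>k \<omega>. B (s (Suc k)) \<omega> - B (s k) \<omega>) UNIV"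
    using L s spos[of 0] unfolding levy_process_def by blast
  have [measurable]: "X j \<in> borel_measurable MB" for j
    unfolding X_def by measurable
  have indX: "P.indep_vars (\<lambda>_. borel) X {..<m}"
    unfolding X_def
    by (rule P.indep_vars_compose2[OF P.indep_vars_subset[OF ind subset_UNIV], where Y="\<lambda>j x. iexp (c j \<bullet> x)"]) simp
  have dot: "\<theta> \<bullet> multi_time B t \<omega> = (\<Sum>j<m. c j \<bullet> (B (s (Suc j)) \<omega> - B (s j) \<omega>))" if "B 0 \<omega> = 0" for \<omega>
  proof -
    have "(\<Sum>j<m. c j \<bullet> (B (s (Suc j)) \<omega> - B (s j) \<omega>))
        = (\<Sum>j<m. \<Sum>k\<in>UNIV. \<theta> $ k * (if j < p k then B (s (Suc j)) \<omega> $ k - B (s j) \<omega> $ k else 0))"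
      by (auto simp: inner_vec_def c_def intro!: sum.cong)
    also have "\<dots> = (\<Sum>k\<in>UNIV. \<theta> $ k * (\<Sum>j<m. (if j < p k then B (s (Suc j)) \<omega> $ k - B (s j) \<omega> $ k else 0)))"
      by (subst sum.swap) (simp add: sum_distrib_left)
    also have "\<dots> = (\<Sum>k\<in>UNIV. \<theta> $ k * (B (s (p k)) \<omega> $ k - B (s 0) \<omega> $ k))"
      by (subst prefix_telescope[OF s(3), where f="\<lambda>j. B (s j) \<omega> $ _"]) simp
    finally show ?thesis by (simp add: s that multi_time_def inner_vec_def)
  qed
  have "AE \<omega> in MB. B 0 \<omega> = 0" using L by (simp add: levy_process_def)
  then have "(\<integral>\<omega>. iexp (\<theta> \<bullet> multi_time B t \<omega>) \<partial>MB) = (\<integral>\<omega>. (\<Prod>j<m. X j \<omega>) \<partial>MB)"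
  proof (intro integral_cong_AE)
    show "(\<lambda>\<omega>. iexp (\<theta> \<bullet> multi_time B t \<omega>)) \<in> borel_measurable MB"
      using measurable_multi_time[OF L t] by measurable
    show "(\<lambda>\<omega>. \<Prod>j<m. X j \<omega>) \<in> borel_measurable MB" unfolding X_def by measurable
    show "AE \<omega> in MB. iexp (\<theta> \<bullet> multi_time B t \<omega>) = (\<Prod>j<m. X j \<omega>)" if "AE \<omega> in MB. B 0 \<omega> = 0"
      using that by eventually_elim (simp add: dot X_def exp_sum sum_distrib_left)
  qed
  also have "\<dots> = (\<Prod>j<m. \<integral>\<omega>. X j \<omega> \<partial>MB)"
    by (rule P.indep_vars_lebesgue_integral[OF _ indX])
       (auto simp: X_def[symmetric] intro!: P.integrable_const_bound[where B=1] AE_I2, simp add: X_def)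
  also have "\<dots> = (\<Prod>j<m. exp (of_real (s (Suc j) - s j) * (\<i> * of_real (\<mu> \<bullet> c j) - of_real (qinner A (c j) (c j)) / 2)))"
    unfolding X_def
    by (intro prod.cong refl brownian_increment_cf[OF B] spos incseq_SucD s)
  also have "\<dots> = exp (\<i> * of_real (\<Sum>j<m. (s (Suc j) - s j) * (\<mu> \<bullet> c j))
       - of_real (\<Sum>j<m. (s (Suc j) - s j) * qinner A (c j) (c j)) / 2)"
    by (simp add: exp_sum[symmetric] sum_subtractf[symmetric] sum_distrib_left sum_divide_distrib algebra_simps)
  also have "(\<Sum>j<m. (s (Suc j) - s j) * (\<mu> \<bullet> c j)) = (t \<diamond>\<^sub>v \<mu>) \<bullet> \<theta>"
  proof -
    have "(\<Sum>j<m. (s (Suc j) - s j) * (\<mu> \<bullet> c j))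
        = (\<Sum>j<m. \<Sum>k\<in>UNIV. \<mu> $ k * \<theta> $ k * (if j < p k then s (Suc j) - s j else 0))"
      by (auto simp: inner_vec_def c_def sum_distrib_left intro!: sum.cong)
    also have "\<dots> = (\<Sum>k\<in>UNIV. \<mu> $ k * \<theta> $ k * (\<Sum>j<m. (if j < p k then s (Suc j) - s j else 0)))"
      by (subst sum.swap) (simp add: sum_distrib_left)
    also have "\<dots> = (t \<diamond>\<^sub>v \<mu>) \<bullet> \<theta>"
      by (subst prefix_telescope[OF s(3)]) (simp add: s diamond_vec_def inner_vec_def algebra_simps)
    finally show ?thesis .
  qed
  also have "(\<Sum>j<m. (s (Suc j) - s j) * qinner A (c j) (c j)) = qinner (t \<diamond>\<^sub>m A) \<theta> \<theta>"
    unfolding c_def by (rule qinner_diamond_telescope[OF s])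
  finally show ?thesis .
qed

lemma diamond_mat_psd:
  assumes A: "covariance_matrix A" and t: "t \<in> orthant"
  shows "covariance_matrix (t \<diamond>\<^sub>m A)"
proof -
  obtain s m p where s: "incseq s" "s 0 = 0" "\<And>k. p k \<le> m" "\<And>k. s (p k) = t $ k"
    using sorted_times[OF t] by metis
  have "0 \<le> qinner (t \<diamond>\<^sub>m A) \<theta> \<theta>" for \<theta>
    unfolding qinner_diamond_telescope[OF s, symmetric]
    using A incseq_SucD[OF s(1)] by (auto simp: covariance_matrix_def intro!: sum_nonneg mult_nonneg_nonneg)
  moreover have "transpose (t \<diamond>\<^sub>m A) = t \<diamond>\<^sub>m A"
    using A by (auto simp: covariance_matrix_def diamond_mat_def transpose_def vec_eq_iff min.commute)
  ultimately show ?thesis by (simp add: covariance_matrix_def)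
qed

text \<open>\<open>bm_marginal\<close> is a definite description, so it acquires a meaning only
  through a witness and uniqueness. The law of B(g u) is the witness, because the diamond products
  are homogeneous under g >= 0; \<open>measure_eqI_cf\<close> gives uniqueness.\<close>

lemma bm_marginal_eq:
  fixes B :: "real \<Rightarrow> 'b \<Rightarrow> real ^ 'n"
  assumes B: "brownian_motion MB B \<mu> A" and u: "u \<in> orthant" and g: "0 \<le> g"
  shows "bm_marginal (u \<diamond>\<^sub>v \<mu>) (u \<diamond>\<^sub>m A) g = distr MB borel (multi_time B (g *\<^sub>R u))"
proof -
  have L: "levy_process MB B" using B by (simp add: brownian_motion_def levy_law_def)
  then interpret P: prob_space MB by (simp add: levy_process_def)
  have gu: "g *\<^sub>R u \<in> orthant" using u g by (simp add: orthant_def)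
  note [measurable] = measurable_multi_time[OF L gu]
  have scale: "(g *\<^sub>R u) \<diamond>\<^sub>v \<mu> = g *\<^sub>R (u \<diamond>\<^sub>v \<mu>)" "(g *\<^sub>R u) \<diamond>\<^sub>m A = g *\<^sub>R (u \<diamond>\<^sub>m A)"
    using min_mult_distrib_left[of g] g by (simp_all add: vec_eq_iff diamond_vec_def diamond_mat_def)
  have q: "qinner (g *\<^sub>R (u \<diamond>\<^sub>m A)) \<theta> \<theta> = g * qinner (u \<diamond>\<^sub>m A) \<theta> \<theta>" for \<theta>
    by (simp add: qinner_sum sum_distrib_left algebra_simps)
  have cf: "(\<integral>x. iexp (\<theta> \<bullet> x) \<partial>distr MB borel (multi_time B (g *\<^sub>R u)))
      = exp (of_real g * levy_exponent (u \<diamond>\<^sub>v \<mu>) (u \<diamond>\<^sub>m A) (null_measure borel_star) \<theta>)" for \<theta>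
    by (subst integral_distr) (simp_all add: multi_time_cf[OF B gu] scale q levy_exponent_null algebra_simps del: of_real_mult inner_scaleR_left, simp_all add: algebra_simps)
  show ?thesis unfolding bm_marginal_def
  proof (rule the_equality)
    fix N assume N: "prob_space N \<and> sets N = sets borel \<and>
        (\<forall>\<theta>. (\<integral>x. iexp (\<theta> \<bullet> x) \<partial>N) = exp (of_real g * levy_exponent (u \<diamond>\<^sub>v \<mu>) (u \<diamond>\<^sub>m A) (null_measure borel_star) \<theta>))"
    then interpret N: prob_space N by simp
    interpret D: prob_space "distr MB borel (multi_time B (g *\<^sub>R u))" by (rule P.prob_space_distr) simp
    show "N = distr MB borel (multi_time B (g *\<^sub>R u))"
      by (rule measure_eqI_cf) (use N cf N.finite_measure_axioms D.finite_measure_axioms in auto)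
  next
    show "prob_space (distr MB borel (multi_time B (g *\<^sub>R u))) \<and> sets (distr MB borel (multi_time B (g *\<^sub>R u))) = sets borel \<and>
        (\<forall>\<theta>. (\<integral>x. iexp (\<theta> \<bullet> x) \<partial>distr MB borel (multi_time B (g *\<^sub>R u))) =
          exp (of_real g * levy_exponent (u \<diamond>\<^sub>v \<mu>) (u \<diamond>\<^sub>m A) (null_measure borel_star) \<theta>))"
      using cf by (auto intro!: P.prob_space_distr)
  qed
qed

text \<open>The + 1 puts the grid points strictly to the right of x, where a cadlag path is
  continuous. As a function of x each approximation takes only countably many values, which is what
  joint measurability will use.\<close>

lemma cadlag_dyadic_limit:
  fixes f :: "real \<Rightarrow> 'a::topological_space"
  assumes f: "cadlag f" and x: "0 \<le> x"
  shows "(\<lambda>m. f ((real (nat \<lfloor>x * real (Suc m)\<rfloor>) + 1) / real (Suc m))) \<longlonglongrightarrow> f x"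
proof -
  define d where "d m = (real (nat \<lfloor>x * real (Suc m)\<rfloor>) + 1) / real (Suc m)" for m
  have nn: "real (nat \<lfloor>x * real (Suc m)\<rfloor>) = of_int \<lfloor>x * real (Suc m)\<rfloor>" for m
    using x by simp
  have lo: "x < d m" for m
    unfolding d_def nn using floor_correct[of "x * real (Suc m)"] by (simp add: field_simps)
  have hi: "d m \<le> x + 1 / real (Suc m)" for m
  proof -
    have "d m \<le> (x * real (Suc m) + 1) / real (Suc m)"
      unfolding d_def nn by (intro divide_right_mono add_right_mono of_int_floor_le) simp
    then show ?thesis by (simp only: add_divide_distrib nonzero_mult_div_cancel_right of_nat_eq_0_iff nat.simps simp_thms)
  qed
  have "(\<lambda>m. x + 1 / real (Suc m)) \<longlonglongrightarrow> x + 0"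
    by (intro tendsto_intros LIMSEQ_inverse_real_of_nat[unfolded inverse_eq_divide])
  then have "d \<longlonglongrightarrow> x"
    using lo hi by (intro tendsto_sandwich[OF _ _ tendsto_const, of x d]) (auto intro!: always_eventually less_imp_le)
  then have "filterlim d (at_right x) sequentially"
    using lo by (auto simp: filterlim_at intro!: always_eventually)
  moreover have "(f \<longlongrightarrow> f x) (at_right x)"
    using f x by (auto simp: cadlag_def continuous_within)
  ultimately show ?thesis unfolding d_def[symmetric] by (rule filterlim_compose[rotated])
qed

text \<open>At a fixed resolution m the time runs through countably many values, so B at that time
  is jointly measurable, and so is the limit in m. On cadlag paths the limit is B(t) itself, hence
  almost surely.\<close>

lemma multi_time_jointly_measurable:
  fixes B :: "real \<Rightarrow> 'b \<Rightarrow> real ^ 'n"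
  assumes L: "levy_process MB B"
  obtains b where "(\<lambda>(t, \<omega>). b t \<omega>) \<in> borel_measurable (borel \<Otimes>\<^sub>M MB)"
    "\<And>t. t \<in> orthant \<Longrightarrow> AE \<omega> in MB. b t \<omega> = multi_time B t \<omega>"
proof -
  define d where "d m k = (real k + 1) / real (Suc m)" for m k :: nat
  define b where "b t \<omega> = (\<chi> i. lim (\<lambda>m. B (d m (nat \<lfloor>t $ i * real (Suc m)\<rfloor>)) \<omega> $ i))" for t \<omega>
  have [measurable]: "B (d m k) \<in> borel_measurable MB" for m k
    using L by (simp add: levy_process_def d_def)
  have [measurable]: "(\<lambda>x. B (d m (nat \<lfloor>fst x $ i * real (Suc m)\<rfloor>)) (snd x) $ i) \<in> borel_measurable (borel \<Otimes>\<^sub>M MB)" for m i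
    by (rule measurable_compose_countable[where f="\<lambda>k x. B (d m k) (snd x) $ i"]) measurable
  show ?thesis
  proof (rule that[of b])
    show "(\<lambda>(t, \<omega>). b t \<omega>) \<in> borel_measurable (borel \<Otimes>\<^sub>M MB)"
      unfolding b_def case_prod_beta
      by (rule borel_measurable_vec_lambda, rule borel_measurable_lim_metric) measurable
    fix t :: "real ^ 'n" assume t: "t \<in> orthant"
    have "AE \<omega> in MB. cadlag (\<lambda>t. B t \<omega>)" using L by (simp add: levy_process_def)
    then show "AE \<omega> in MB. b t \<omega> = multi_time B t \<omega>"
    proof eventually_elim
      fix \<omega> assume "cadlag (\<lambda>t. B t \<omega>)"
      then have "(\<lambda>m. B (d m (nat \<lfloor>t $ i * real (Suc m)\<rfloor>)) \<omega>) \<longlonglongrightarrow> B (t $ i) \<omega>" for i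
        unfolding d_def using t by (intro cadlag_dyadic_limit) (auto simp: orthant_def)
      then have "(\<lambda>m. B (d m (nat \<lfloor>t $ i * real (Suc m)\<rfloor>)) \<omega> $ i) \<longlonglongrightarrow> B (t $ i) \<omega> $ i" for i
        by (intro tendsto_vec_nth)
      then show "b t \<omega> = multi_time B t \<omega>"
        by (simp add: b_def multi_time_def vec_eq_iff limI)
    qed
  qed
qed

text \<open>Restricted to multiples of a basis vector, \<open>multi_time_cf\<close> is the
  characteristic function of an affine image of a standard normal variable, whose moments are known.
  The diagonal entries of A are values of its quadratic form.\<close>

lemma multi_time_moments:
  fixes B :: "real \<Rightarrow> 'b \<Rightarrow> real ^ 'n"
  assumes B: "brownian_motion MB B \<mu> A" and A: "covariance_matrix A" and t: "t \<in> orthant"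
  shows "integrable MB (\<lambda>\<omega>. multi_time B t \<omega> $ i)"
    and "(\<integral>\<omega>. multi_time B t \<omega> $ i \<partial>MB) = t $ i * \<mu> $ i"
    and "integrable MB (\<lambda>\<omega>. (multi_time B t \<omega> $ i)\<^sup>2)"
    and "(\<integral>\<omega>. (multi_time B t \<omega> $ i)\<^sup>2 \<partial>MB) = (t $ i * \<mu> $ i)\<^sup>2 + t $ i * A $ i $ i"
    and "0 \<le> A $ i $ i"
proof -
  have L: "levy_process MB B" using B by (simp add: brownian_motion_def levy_law_def)
  then interpret P: prob_space MB by (simp add: levy_process_def)
  interpret N: real_distribution std_normal_distribution by (rule real_dist_normal_dist)
  note [measurable] = measurable_multi_time[OF L t]
  have axis: "qinner (t \<diamond>\<^sub>m A) (x *\<^sub>R axis i 1) (x *\<^sub>R axis i 1) = t $ i * A $ i $ i * x\<^sup>2"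
    "qinner A (axis i 1) (axis i 1) = A $ i $ i"
    for x by (simp_all add: qinner_sum axis_def diamond_mat_def if_distrib[of "\<lambda>x. _ * x"] if_distrib[of "\<lambda>x. x * _"] power2_eq_square cong: if_cong)
  show Aii: "0 \<le> A $ i $ i" using A axis(2) unfolding covariance_matrix_def by metis
  have ti: "0 \<le> t $ i" using t by (simp add: orthant_def)
  define \<sigma> where "\<sigma> = sqrt (t $ i * A $ i $ i)"
  have \<sigma>: "\<sigma>\<^sup>2 = t $ i * A $ i $ i" using ti Aii by (simp add: \<sigma>_def)
  have "distr MB borel (\<lambda>\<omega>. multi_time B t \<omega> $ i) = distr std_normal_distribution borel (\<lambda>z. t $ i * \<mu> $ i + \<sigma> * z)" (is "?L = ?R")
  proof (rule real_measure_eqI_cf)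
    show "finite_measure ?L" by (rule P.finite_measure_distr) simp
    show "finite_measure ?R" by (rule N.finite_measure_distr) simp
    fix x :: real
    have "(\<integral>y. iexp (x * y) \<partial>?L) = (\<integral>\<omega>. iexp ((x *\<^sub>R axis i 1) \<bullet> multi_time B t \<omega>) \<partial>MB)"
      by (subst integral_distr) (auto simp: inner_axis')
    also have "\<dots> = exp (\<i> * of_real (x * (t $ i * \<mu> $ i)) - of_real (\<sigma>\<^sup>2 * x\<^sup>2) / 2)"
      unfolding multi_time_cf[OF B t] axis \<sigma> by (simp add: inner_axis diamond_vec_def)
    also have "\<dots> = iexp (x * (t $ i * \<mu> $ i)) * char std_normal_distribution (x * \<sigma>)"
      unfolding char_std_normal_distribution exp_of_real[symmetric] exp_add[symmetric]
      by (simp add: power_mult_distrib mult.commute)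
    also have "\<dots> = (\<integral>z. iexp (x * (t $ i * \<mu> $ i)) * iexp (x * \<sigma> * z) \<partial>std_normal_distribution)"
      unfolding char_def by simp
    also have "\<dots> = (\<integral>z. iexp (x * (t $ i * \<mu> $ i + \<sigma> * z)) \<partial>std_normal_distribution)"
      by (intro Bochner_Integration.integral_cong refl) (simp add: exp_add[symmetric] algebra_simps)
    also have "\<dots> = (\<integral>y. iexp (x * y) \<partial>?R)"
      by (subst integral_distr) auto
    finally show "(\<integral>y. iexp (x * y) \<partial>?L) = (\<integral>y. iexp (x * y) \<partial>?R)" .
  qed auto
  note D = this
  note mom = integrable_std_normal_distribution_moment[of 1] integrable_std_normal_distribution_moment[of 2]
    integral_std_normal_distribution_moment_odd[of 1] std_normal_distribution_even_moments(1)[of 1]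
  have mom: "integrable std_normal_distribution (\<lambda>x. x)" "integrable std_normal_distribution (\<lambda>x. x\<^sup>2)"
    "(\<integral>x. x \<partial>std_normal_distribution) = 0" "(\<integral>x. x\<^sup>2 \<partial>std_normal_distribution) = 1"
    using mom by simp_all
  have tr: "integrable MB (\<lambda>\<omega>. h (multi_time B t \<omega> $ i)) \<longleftrightarrow> integrable std_normal_distribution (\<lambda>z. h (t $ i * \<mu> $ i + \<sigma> * z))"
    "(\<integral>\<omega>. h (multi_time B t \<omega> $ i) \<partial>MB) = (\<integral>z. h (t $ i * \<mu> $ i + \<sigma> * z) \<partial>std_normal_distribution)"
    if [measurable]: "h \<in> borel_measurable borel" for h :: "real \<Rightarrow> real"
    using arg_cong[OF D, of "\<lambda>M. integrable M h"] arg_cong[OF D, of "\<lambda>M. integral\<^sup>L M h"]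
    by (simp_all add: integrable_distr_eq integral_distr)
  have sq: "(c + \<sigma> * z)\<^sup>2 = c\<^sup>2 + (2 * c * \<sigma>) * z + \<sigma>\<^sup>2 * z\<^sup>2" for c z
    by (simp add: power2_eq_square algebra_simps)
  have N1: "measure std_normal_distribution UNIV = 1"
    using N.prob_space by simp
  show "integrable MB (\<lambda>\<omega>. multi_time B t \<omega> $ i)"
    by (rule iffD2[OF tr(1)[of "\<lambda>x. x"]], simp)
       (intro Bochner_Integration.integrable_add integrable_mult_right mom N.integrable_const)
  have "(\<integral>z. t $ i * \<mu> $ i + \<sigma> * z \<partial>std_normal_distribution) = t $ i * \<mu> $ i"
    by (subst Bochner_Integration.integral_add) (auto simp: mom(3) N1 intro: mom(1))
  then show "(\<integral>\<omega>. multi_time B t \<omega> $ i \<partial>MB) = t $ i * \<mu> $ i"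
    by (rule trans[OF tr(2)[of "\<lambda>x. x"], rotated]) simp
  show "integrable MB (\<lambda>\<omega>. (multi_time B t \<omega> $ i)\<^sup>2)"
    by (rule iffD2[OF tr(1)[of "\<lambda>x. x\<^sup>2"]], simp, unfold sq)
       (intro Bochner_Integration.integrable_add integrable_mult_right mom N.integrable_const)
  have "(\<integral>z. (t $ i * \<mu> $ i + \<sigma> * z)\<^sup>2 \<partial>std_normal_distribution) = (t $ i * \<mu> $ i)\<^sup>2 + t $ i * A $ i $ i"
    unfolding sq
    by (subst Bochner_Integration.integral_add; (subst Bochner_Integration.integral_add)?)
       (auto simp: mom(3,4) N1 \<sigma> intro!: Bochner_Integration.integrable_add mom(1,2))
  then show "(\<integral>\<omega>. (multi_time B t \<omega> $ i)\<^sup>2 \<partial>MB) = (t $ i * \<mu> $ i)\<^sup>2 + t $ i * A $ i $ i"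
    by (rule trans[OF tr(2)[of "\<lambda>x. x\<^sup>2"], rotated]) simp
qed

section \<open>Linear changes of variables and Gaussian densities\<close>

lemma measurable_vec_lambda_PiM [measurable]:
  "(\<lambda>x. \<chi> i. x i) \<in> borel_measurable (\<Pi>\<^sub>M i\<in>UNIV. (lborel :: real measure))"
  by (rule borel_measurable_vec_lambda) measurable

lemma Basis_vec_eq_range: "(Basis :: (real ^ 'n) set) = range (\<lambda>i. axis i 1)"
  by (auto simp: Basis_vec_def)

lemma prod_Basis_vec: "(\<Prod>b\<in>Basis. f b) = (\<Prod>i\<in>UNIV. f (axis i 1 :: real ^ 'n))"
  unfolding Basis_vec_eq_range by (subst prod.reindex) (auto simp: inj_on_def axis_eq_axis)

lemma sum_Basis_vec: "(\<Sum>b\<in>Basis. f b) = (\<Sum>i\<in>UNIV. f (axis i 1 :: real ^ 'n))"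
  unfolding Basis_vec_eq_range by (subst sum.reindex) (auto simp: inj_on_def axis_eq_axis)

text \<open>Gives access to single coordinates: shears are integrated coordinate by coordinate, and
  Gaussian integrals factor.\<close>

lemma lborel_vec_eq_PiM:
  "(lborel :: (real ^ 'n) measure) = distr (\<Pi>\<^sub>M i\<in>UNIV. lborel) borel (\<lambda>x. \<chi> i. x i)"
proof (rule lborel_eqI)
  interpret product_sigma_finite "\<lambda>_::'n. lborel :: real measure" ..
  fix l u :: "real ^ 'n" assume le: "\<And>b. b \<in> Basis \<Longrightarrow> l \<bullet> b \<le> u \<bullet> b"
  have le': "l $ i \<le> u $ i" for i using le[of "axis i 1"] by (simp add: axis_in_Basis_iff inner_axis)
  have "emeasure (distr (\<Pi>\<^sub>M i\<in>UNIV. lborel) borel (\<lambda>x. \<chi> i. x i)) (box l u)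
      = emeasure (\<Pi>\<^sub>M i\<in>UNIV. lborel) (\<Pi>\<^sub>E i\<in>UNIV. {l $ i <..< u $ i})"
    by (subst emeasure_distr, simp, simp, rule arg_cong[where f="emeasure _"])
       (auto simp: box_def Basis_vec_def inner_axis space_PiM PiE_iff)
  also have "\<dots> = (\<Prod>i\<in>UNIV. ennreal (u $ i - l $ i))"
    using le' by (subst emeasure_PiM) auto
  also have "\<dots> = (\<Prod>b\<in>Basis. (u - l) \<bullet> b)"
    using le' by (simp add: prod_ennreal inner_axis prod_Basis_vec)
  finally show "emeasure (distr (\<Pi>\<^sub>M i\<in>UNIV. lborel) borel (\<lambda>x. \<chi> i. x i)) (box l u) = (\<Prod>b\<in>Basis. (u - l) \<bullet> b)" .
qed simp

lemma nn_integral_lborel_shift: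
  fixes f :: "real \<Rightarrow> ennreal"
  assumes [measurable]: "f \<in> borel_measurable borel"
  shows "(\<integral>\<^sup>+y. f (c + y) \<partial>lborel) = (\<integral>\<^sup>+y. f y \<partial>lborel)"
proof -
  have "(\<integral>\<^sup>+y. f y \<partial>lborel) = (\<integral>\<^sup>+y. f y \<partial>distr lborel borel ((+) c))"
    by (simp add: lborel_distr_plus)
  then show ?thesis by (simp add: nn_integral_distr)
qed

lemma measurable_matrix_vector_mult [measurable]:
  "(\<lambda>x. (A :: real ^ 'n ^ 'm) *v x) \<in> borel_measurable borel"
  by (intro borel_measurable_continuous_onI linear_continuous_on) (simp add: matrix_vector_mul_bounded_linear)

text \<open>With the other coordinates held fixed, the shear translates coordinate m by a constant,
  so integrating over that coordinate first leaves the integral unchanged.\<close>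

lemma nn_integral_shear:
  fixes f :: "real ^ 'n \<Rightarrow> ennreal"
  assumes [measurable]: "f \<in> borel_measurable borel" and mn: "m \<noteq> n"
  shows "(\<integral>\<^sup>+x. f ((\<chi> i j. if i = m \<and> j = n then c else of_bool (i = j)) *v x) \<partial>lborel) = (\<integral>\<^sup>+x. f x \<partial>lborel)"
proof -
  interpret product_sigma_finite "\<lambda>_::'n. lborel :: real measure" ..
  have U: "UNIV = insert m (UNIV - {m})" by auto
  define h where "h x = f (\<chi> i. x i)" for x
  have [measurable]: "h \<in> borel_measurable (\<Pi>\<^sub>M i\<in>UNIV. lborel)" unfolding h_def by measurable
  have hm [measurable]: "h \<in> borel_measurable (\<Pi>\<^sub>M i\<in>insert m (UNIV - {m}). lborel)" unfolding U[symmetric] by measurable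
  have mult: "(\<chi> i j. if i = m \<and> j = n then c else of_bool (i = j)) *v (\<chi> i. x i)
      = (\<chi> i. (x(m := x m + c * x n)) i)" for x :: "'n \<Rightarrow> real"
  proof -
    have "(\<Sum>j\<in>UNIV. (if i = m \<and> j = n then c else of_bool (i = j)) * x j)
        = (\<Sum>j\<in>UNIV. (if j = n then (if i = m then c * x n else 0) else 0) + (if j = i then x i else 0))" for i
      using mn by (intro sum.cong) auto
    then show ?thesis
      by (auto simp: vec_eq_iff matrix_vector_mult_def sum.distrib)
  qed
  have [measurable]: "(\<lambda>x. x(m := x m + c * x n)) \<in> (\<Pi>\<^sub>M i\<in>UNIV. lborel) \<rightarrow>\<^sub>M (\<Pi>\<^sub>M i\<in>(UNIV::'n set). (lborel :: real measure))"
    by (subst (2) U, rule measurable_fun_upd[where J=UNIV]) auto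
  have "(\<integral>\<^sup>+x. f ((\<chi> i j. if i = m \<and> j = n then c else of_bool (i = j)) *v x) \<partial>lborel)
      = (\<integral>\<^sup>+x. h (x(m := x m + c * x n)) \<partial>(\<Pi>\<^sub>M i\<in>UNIV. lborel))"
    by (subst lborel_vec_eq_PiM, subst nn_integral_distr) (simp_all add: mult h_def del: fun_upd_apply)
  also have "\<dots> = (\<integral>\<^sup>+x. h (x(m := x m + c * x n)) \<partial>(\<Pi>\<^sub>M i\<in>insert m (UNIV - {m}). lborel))"
    using U by simp
  also have "\<dots> = (\<integral>\<^sup>+x. \<integral>\<^sup>+y. h (x(m := c * x n + y)) \<partial>lborel \<partial>(\<Pi>\<^sub>M i\<in>UNIV - {m}. lborel))"
    using mn by (subst product_nn_integral_insert) (auto simp: U[symmetric] add.commute)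
  also have "\<dots> = (\<integral>\<^sup>+x. \<integral>\<^sup>+y. h (x(m := y)) \<partial>lborel \<partial>(\<Pi>\<^sub>M i\<in>UNIV - {m}. lborel))"
  proof (rule nn_integral_cong)
    fix x :: "'n \<Rightarrow> real" assume x: "x \<in> space (\<Pi>\<^sub>M i\<in>UNIV - {m}. lborel)"
    have "(\<lambda>y. h (x(m := y))) \<in> borel_measurable lborel"
      by (rule measurable_compose[OF _ hm], rule measurable_component_update[OF x]) simp
    then show "(\<integral>\<^sup>+y. h (x(m := c * x n + y)) \<partial>lborel) = (\<integral>\<^sup>+y. h (x(m := y)) \<partial>lborel)"
      by (intro nn_integral_lborel_shift[where f="\<lambda>y. h (x(m := y))"]) simp
  qed
  also have "\<dots> = (\<integral>\<^sup>+x. h x \<partial>(\<Pi>\<^sub>M i\<in>insert m (UNIV - {m}). lborel))"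
    by (subst product_nn_integral_insert) auto
  also have "\<dots> = (\<integral>\<^sup>+x. f x \<partial>lborel)"
    by (subst lborel_vec_eq_PiM, subst nn_integral_distr) (simp_all add: h_def[abs_def] U[symmetric])
  finally show ?thesis .
qed

lemma nn_integral_swap_coords:
  fixes f :: "real ^ 'n \<Rightarrow> ennreal"
  assumes [measurable]: "f \<in> borel_measurable borel"
  shows "(\<integral>\<^sup>+x. f ((\<chi> i j. mat 1 $ i $ Transposition.transpose m n j) *v x) \<partial>lborel) = (\<integral>\<^sup>+x. f x \<partial>lborel)"
proof -
  define \<tau> where "\<tau> = Transposition.transpose m n"
  define T where "T x = (\<chi> i. x $ \<tau> i)" for x :: "real ^ 'n"
  have T: "(\<chi> i j. mat 1 $ i $ Transposition.transpose m n j) *v x = T x" for x :: "real ^ 'n"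
  proof -
    have "(\<Sum>j\<in>UNIV. (if i = \<tau> j then 1 else 0) * x $ j) = x $ \<tau> i" for i
    proof -
      have "(i = \<tau> j) = (j = \<tau> i)" for j by (auto simp: \<tau>_def)
      then show ?thesis by (simp add: if_distrib[of "\<lambda>z. z * _"] cong: if_cong)
    qed
    then show ?thesis by (simp add: vec_eq_iff matrix_vector_mult_def mat_def T_def \<tau>_def)
  qed
  have [measurable]: "T \<in> borel_measurable borel"
    unfolding T_def[abs_def] by (rule borel_measurable_vec_lambda) measurable
  have "lborel = distr lborel borel T"
  proof (rule lborel_eqI)
    fix l u :: "real ^ 'n" assume le: "\<And>b. b \<in> Basis \<Longrightarrow> l \<bullet> b \<le> u \<bullet> b"
    have le': "l $ i \<le> u $ i" for i using le[of "axis i 1"] by (simp add: axis_in_Basis_iff inner_axis)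
    have pB: "(\<Prod>b\<in>Basis. (u - l) \<bullet> b) = (\<Prod>i\<in>UNIV. u $ i - l $ i)" for u l :: "real ^ 'n"
      by (simp add: inner_axis prod_Basis_vec)
    have inv: "\<tau> (\<tau> i) = i" for i by (simp add: \<tau>_def)
    have "T -` box l u \<inter> space lborel = box (T l) (T u)"
      by (auto simp: box_def Basis_vec_def inner_axis T_def) (metis inv)+
    then have "emeasure (distr lborel borel T) (box l u) = emeasure lborel (box (T l) (T u))"
      by (simp add: emeasure_distr)
    also have "\<dots> = (\<Prod>b\<in>Basis. (T u - T l) \<bullet> b)"
      by (rule emeasure_lborel_box) (use le' in \<open>auto simp: Basis_vec_def inner_axis T_def\<close>)
    also have "(\<Prod>b\<in>Basis. (T u - T l) \<bullet> b) = (\<Prod>i\<in>UNIV. u $ \<tau> i - l $ \<tau> i)"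
      unfolding pB by (simp add: T_def)
    also have "\<dots> = (\<Prod>i\<in>UNIV. u $ i - l $ i)"
      by (rule prod.reindex_bij_betw[of \<tau>]) (auto simp: \<tau>_def)
    finally show "emeasure (distr lborel borel T) (box l u) = (\<Prod>b\<in>Basis. (u - l) \<bullet> b)" by (simp add: pB)
  qed simp
  then have "(\<integral>\<^sup>+x. f x \<partial>lborel) = (\<integral>\<^sup>+x. f x \<partial>distr lborel borel T)" by simp
  then show ?thesis by (simp add: nn_integral_distr T)
qed

lemma nn_integral_diagonal:
  fixes f :: "real ^ 'n \<Rightarrow> ennreal"
  assumes [measurable]: "f \<in> borel_measurable borel" and diag: "\<And>i j. i \<noteq> j \<Longrightarrow> A $ i $ j = 0"
    and d: "det A \<noteq> 0"
  shows "ennreal \<bar>det A\<bar> * (\<integral>\<^sup>+x. f (A *v x) \<partial>lborel) = (\<integral>\<^sup>+x. f x \<partial>lborel)"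
proof -
  define c where "c j = (A *v j) \<bullet> j" for j :: "real ^ 'n"
  have ca: "c (axis i 1) = A $ i $ i" for i
    by (simp add: c_def inner_axis matrix_vector_mult_basis column_def)
  have A: "det A = (\<Prod>i\<in>UNIV. A $ i $ i)" by (rule det_diagonal[OF diag])
  have c0: "c j \<noteq> 0" if "j \<in> Basis" for j
    using that d by (auto simp: Basis_vec_def ca A)
  have Av: "A *v x = 0 + (\<Sum>j\<in>Basis. (c j * (x \<bullet> j)) *\<^sub>R j)" for x
  proof -
    have "(\<Sum>j\<in>Basis. (c j * (x \<bullet> j)) *\<^sub>R j) = (\<Sum>i\<in>UNIV. (A $ i $ i * x $ i) *\<^sub>R axis i 1)"
      by (simp add: sum_Basis_vec ca inner_axis)
    moreover have "(A *v x) $ k = (\<Sum>i\<in>UNIV. (A $ i $ i * x $ i) *\<^sub>R axis i 1) $ k" for k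
    proof -
      have "(\<Sum>j\<in>UNIV. A $ k $ j * x $ j) = (\<Sum>j\<in>UNIV. if j = k then A $ k $ k * x $ k else 0)"
        by (rule sum.cong) (auto simp: diag)
      then have "(A *v x) $ k = (\<Sum>j\<in>UNIV. if j = k then A $ k $ k * x $ k else 0)"
        by (simp add: matrix_vector_mult_def)
      then show ?thesis by (simp add: sum_component axis_def if_distrib[of "\<lambda>z. _ * z"] cong: if_cong)
    qed
    ultimately show ?thesis by (simp add: vec_eq_iff)
  qed
  have pc: "(\<Prod>j\<in>Basis. \<bar>c j\<bar>) = \<bar>det A\<bar>"
    by (simp add: A abs_prod prod_Basis_vec ca)
  have "lborel = density (distr lborel borel (\<lambda>x. A *v x)) (\<lambda>_. ennreal \<bar>det A\<bar>)"
    using lborel_affine_euclidean[of c 0, OF c0] unfolding Av[symmetric] pc by simp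
  then have "(\<integral>\<^sup>+x. f x \<partial>lborel) = (\<integral>\<^sup>+x. f x \<partial>density (distr lborel borel (\<lambda>x. A *v x)) (\<lambda>_. ennreal \<bar>det A\<bar>))" by simp
  also have "\<dots> = ennreal \<bar>det A\<bar> * (\<integral>\<^sup>+x. f (A *v x) \<partial>lborel)"
    by (simp add: nn_integral_density nn_integral_distr nn_integral_cmult)
  finally show ?thesis ..
qed

text \<open>Every matrix is a product of elementary ones: swaps and shears preserve Lebesgue
  measure, diagonal matrices scale it, and a zero row contradicts the nonzero determinant.\<close>

theorem nn_integral_linear_change:
  fixes f :: "real ^ 'n \<Rightarrow> ennreal"
  assumes "f \<in> borel_measurable borel" and "det A \<noteq> 0"
  shows "ennreal \<bar>det A\<bar> * (\<integral>\<^sup>+x. f (A *v x) \<partial>lborel) = (\<integral>\<^sup>+x. f x \<partial>lborel)"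
proof -
  have "\<forall>f. f \<in> borel_measurable borel \<longrightarrow> det A \<noteq> 0 \<longrightarrow>
      ennreal \<bar>det A\<bar> * (\<integral>\<^sup>+x. f (A *v x) \<partial>lborel) = (\<integral>\<^sup>+x. f x \<partial>lborel)"
  proof (induction A rule: induct_matrix_elementary)
    case (1 A B)
    show ?case
    proof (intro allI impI)
      fix f :: "real ^ 'n \<Rightarrow> ennreal" assume f [measurable]: "f \<in> borel_measurable borel" and d: "det (A ** B) \<noteq> 0"
      then have dA: "det A \<noteq> 0" and dB: "det B \<noteq> 0" by (auto simp: det_mul)
      have "ennreal \<bar>det (A ** B)\<bar> * (\<integral>\<^sup>+x. f ((A ** B) *v x) \<partial>lborel)
          = ennreal \<bar>det A\<bar> * (ennreal \<bar>det B\<bar> * (\<integral>\<^sup>+x. f (A *v (B *v x)) \<partial>lborel))"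
        by (simp add: det_mul abs_mult ennreal_mult mult.assoc matrix_vector_mul_assoc)
      also have "\<dots> = ennreal \<bar>det A\<bar> * (\<integral>\<^sup>+x. f (A *v x) \<partial>lborel)"
        using 1(2)[rule_format, of "\<lambda>x. f (A *v x)"] dB by simp
      also have "\<dots> = (\<integral>\<^sup>+x. f x \<partial>lborel)" using 1(1) f dA by blast
      finally show "ennreal \<bar>det (A ** B)\<bar> * (\<integral>\<^sup>+x. f ((A ** B) *v x) \<partial>lborel) = (\<integral>\<^sup>+x. f x \<partial>lborel)" .
    qed
  next
    case (2 A i) then show ?case by (simp add: det_zero_row)
  next
    case (3 A) then show ?case by (auto intro: nn_integral_diagonal)
  next
    case (4 m n)
    let ?P = "(\<chi> i j. mat 1 $ i $ Transposition.transpose m n j) :: real ^ 'n ^ 'n"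
    have "det ?P = of_int (sign (Transposition.transpose m n)) * det (mat 1 :: real ^ 'n ^ 'n)"
      by (rule det_permute_columns) (simp add: permutes_swap_id)
    then have "\<bar>det ?P\<bar> = 1" by (simp add: sign_def)
    then show ?case using nn_integral_swap_coords[of _ m n] by simp
  next
    case (5 m n c)
    let ?P = "(\<chi> i j. if i = m \<and> j = n then c else of_bool (i = j)) :: real ^ 'n ^ 'n"
    have "?P = (\<chi> k. if k = m then row m (mat 1) + c *s row n (mat 1) else row k (mat 1))"
      using 5 by (auto simp: vec_eq_iff row_def mat_def)
    then have "det ?P = 1" using det_row_operation[OF 5, of "mat 1 :: real ^ 'n ^ 'n" c] by simp
    then show ?case using nn_integral_shear[OF _ 5, of _ c] by simp
  qed
  with assms show ?thesis by blast
qed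

section \<open>Positive definite forms and Gaussian densities of full rank\<close>

lemma qinner_bilinear:
  "qinner A (x + y) z = qinner A x z + qinner A y z"
  "qinner A z (x + y) = qinner A z x + qinner A z y"
  "qinner A (x - y) z = qinner A x z - qinner A y z"
  "qinner A z (x - y) = qinner A z x - qinner A z y"
  "qinner A (r *\<^sub>R x) z = r * qinner A x z"
  "qinner A z (r *\<^sub>R x) = r * qinner A z x"
  by (simp_all add: qinner_sum sum_distrib_left algebra_simps sum.distrib sum_subtractf)

lemma qinner_sum_left: "qinner A (\<Sum>j\<in>I. f j) z = (\<Sum>j\<in>I. qinner A (f j) z)"
  by (simp add: qinner_def vector_matrix_mult_def inner_vec_def sum_distrib_right sum.swap[of _ I])

lemma qinner_sym: "transpose A = A \<Longrightarrow> qinner A x y = qinner A y x"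
  unfolding qinner_sum by (subst sum.swap) (simp add: transpose_def vec_eq_iff mult.commute)

lemma qinner_matrix_vector: "qinner A x y = x \<bullet> (A *v y)"
  unfolding qinner_sum inner_vec_def matrix_vector_mult_def by (simp add: sum_distrib_left algebra_simps)

text \<open>Gram-Schmidt for the inner product \<open>qinner S\<close>; the rows of P form an
  S-orthonormal family. A vector outside the span of the rows already found exists by
  dimension.\<close>

lemma posdef_orthonormal_rows:
  fixes S :: "real ^ 'n ^ 'n"
  assumes sym: "transpose S = S" and pd: "\<And>x. x \<noteq> 0 \<Longrightarrow> 0 < qinner S x x"
  obtains P :: "real ^ 'n ^ 'n" where "P ** S ** transpose P = mat 1"
proof -
  have "\<exists>b :: 'n \<Rightarrow> real ^ 'n. \<forall>i\<in>I. \<forall>j\<in>I. qinner S (b i) (b j) = (if i = j then 1 else 0)" for I :: "'n set"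
  proof (induction I rule: finite_induct[OF finite])
    case 1 show ?case by simp
  next
    case (2 i I)
    then obtain b where b: "\<And>k j. k \<in> I \<Longrightarrow> j \<in> I \<Longrightarrow> qinner S (b k) (b j) = (if k = j then 1 else 0)" by blast
    have "card I < CARD('n)"
      using "2.hyps" by (intro psubset_card_mono) auto
    then have "dim (b ` I) < DIM(real ^ 'n)"
      using dim_le_card'[of "b ` I"] card_image_le[of I b] "2.hyps" by simp
    then have "span (b ` I) \<noteq> UNIV"
      by (metis dim_UNIV dim_span less_irrefl)
    then obtain x where x: "x \<notin> span (b ` I)" by blast
    define y where "y = x - (\<Sum>j\<in>I. qinner S x (b j) *\<^sub>R b j)"
    have "y \<noteq> 0"
    proof
      assume "y = 0"
      then have "x = (\<Sum>j\<in>I. qinner S x (b j) *\<^sub>R b j)" by (simp add: y_def)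
      also have "\<dots> \<in> span (b ` I)" by (intro span_sum span_scale span_base) auto
      finally show False using x by simp
    qed
    then have yy: "0 < qinner S y y" by (rule pd)
    have yb: "qinner S y (b k) = 0" if "k \<in> I" for k
    proof -
      have "(\<Sum>j\<in>I. qinner S x (b j) * qinner S (b j) (b k)) = (\<Sum>j\<in>I. if j = k then qinner S x (b k) else 0)"
        using that by (intro sum.cong) (auto simp: b)
      also have "\<dots> = qinner S x (b k)" using that "2.hyps" by simp
      finally show ?thesis
        by (simp add: y_def qinner_bilinear qinner_sum_left)
    qed
    define c where "c = (1 / sqrt (qinner S y y)) *\<^sub>R y"
    have cc: "qinner S c c = 1" using yy by (simp add: c_def qinner_bilinear)
    have cb: "qinner S c (b k) = 0" "qinner S (b k) c = 0" if "k \<in> I" for k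
      using yb[OF that] qinner_sym[OF sym, of c "b k"] by (simp_all add: c_def qinner_bilinear)
    show ?case
      by (rule exI[of _ "b(i := c)"]) (use 2(2) in \<open>auto simp: b cc cb\<close>)
  qed
  from this[of UNIV] obtain b :: "'n \<Rightarrow> real ^ 'n"
    where b: "\<And>i j. qinner S (b i) (b j) = (if i = j then 1 else 0)" by auto
  have "((\<chi> i. b i) ** S ** transpose (\<chi> i. b i)) $ i $ j = qinner S (b i) (b j)" for i j
    by (simp add: matrix_matrix_mult_def transpose_def qinner_def vector_matrix_mult_def inner_vec_def)
  then have "(\<chi> i. b i) ** S ** transpose (\<chi> i. b i) = mat 1"
    by (simp add: vec_eq_iff b mat_def)
  then show ?thesis by (rule that)
qed

definition std_gauss :: "real ^ 'n \<Rightarrow> real" where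
  "std_gauss x = (\<Prod>i\<in>UNIV. std_normal_density (x $ i))"

lemma std_gauss_eq: "std_gauss (x :: real ^ 'n) = exp (- (x \<bullet> x) / 2) / sqrt (2 * pi) ^ CARD('n)"
  unfolding std_gauss_def std_normal_density_def inner_vec_def
  by (simp add: prod_dividef exp_sum[symmetric] sum_negf sum_divide_distrib power2_eq_square)

lemma std_gauss_nonneg: "0 \<le> std_gauss x"
  by (simp add: std_gauss_eq)

lemma borel_measurable_std_gauss [measurable]: "std_gauss \<in> borel_measurable borel"
  unfolding std_gauss_def[abs_def] by measurable

lemma std_gauss_cf:
  fixes \<theta> :: "real ^ 'n"
  shows "(\<integral>x. std_gauss x *\<^sub>R iexp (\<theta> \<bullet> x) \<partial>lborel) = exp (- of_real (\<theta> \<bullet> \<theta>) / 2)"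
proof -
  interpret product_sigma_finite "\<lambda>_::'n. lborel :: real measure" ..
  have "(\<integral>x. std_gauss x *\<^sub>R iexp (\<theta> \<bullet> x) \<partial>lborel)
      = (\<integral>x. (\<Prod>i\<in>UNIV. std_normal_density (x i) *\<^sub>R iexp (\<theta> $ i * x i)) \<partial>(\<Pi>\<^sub>M i\<in>UNIV. lborel))"
    unfolding lborel_vec_eq_PiM
    by (subst integral_distr)
       (simp_all add: std_gauss_def inner_vec_def scaleR_conv_of_real prod.distrib exp_sum sum_distrib_left)
  also have "\<dots> = (\<Prod>i\<in>UNIV. \<integral>x. std_normal_density x *\<^sub>R iexp (\<theta> $ i * x) \<partial>lborel)"
  proof (rule product_integral_prod)
    fix i :: 'n
    have "integrable lborel (\<lambda>x. std_normal_density x)" by (rule integrable_normal_density) simp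
    then show "integrable lborel (\<lambda>x. std_normal_density x *\<^sub>R iexp (\<theta> $ i * x))"
      by (rule Bochner_Integration.integrable_bound) (auto intro!: AE_I2)
  qed simp
  also have "\<dots> = (\<Prod>i\<in>UNIV. exp (- of_real ((\<theta> $ i)\<^sup>2) / 2))"
  proof (rule prod.cong[OF refl])
    fix i
    have "(\<integral>x. std_normal_density x *\<^sub>R iexp (\<theta> $ i * x) \<partial>lborel) = char std_normal_distribution (\<theta> $ i)"
      unfolding char_def by (subst integral_density) (auto intro!: AE_I2)
    then show "(\<integral>x. std_normal_density x *\<^sub>R iexp (\<theta> $ i * x) \<partial>lborel) = exp (- of_real ((\<theta> $ i)\<^sup>2) / 2)"
      unfolding char_std_normal_distribution exp_of_real[symmetric] by simp
  qed
  also have "\<dots> = exp (- of_real (\<theta> \<bullet> \<theta>) / 2)"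
    by (simp add: exp_sum[symmetric] inner_vec_def sum_negf sum_divide_distrib power2_eq_square)
  finally show ?thesis .
qed

lemma nn_integral_std_gauss: "(\<integral>\<^sup>+x. ennreal (std_gauss (x :: real ^ 'n)) \<partial>lborel) = 1"
proof -
  interpret product_sigma_finite "\<lambda>_::'n. lborel :: real measure" ..
  have n1: "(\<integral>\<^sup>+x. ennreal (std_normal_density x) \<partial>lborel) = 1"
    using prob_space.emeasure_space_1[OF prob_space_normal_density[of 1 0]] by (simp add: emeasure_density)
  have "(\<integral>\<^sup>+x. ennreal (std_gauss (x :: real ^ 'n)) \<partial>lborel)
      = (\<integral>\<^sup>+x. (\<Prod>i\<in>UNIV. ennreal (std_normal_density (x i))) \<partial>(\<Pi>\<^sub>M i\<in>(UNIV::'n set). lborel))"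
    unfolding lborel_vec_eq_PiM
    by (subst nn_integral_distr) (simp_all add: std_gauss_def prod_ennreal)
  also have "\<dots> = (\<Prod>i\<in>(UNIV::'n set). \<integral>\<^sup>+x. ennreal (std_normal_density x) \<partial>lborel)"
    by (rule product_nn_integral_prod) auto
  finally show ?thesis by (simp add: n1)
qed

lemma nn_integral_lborel_vec_shift:
  fixes f :: "'a::euclidean_space \<Rightarrow> ennreal"
  assumes [measurable]: "f \<in> borel_measurable borel"
  shows "(\<integral>\<^sup>+y. f (c + y) \<partial>lborel) = (\<integral>\<^sup>+y. f y \<partial>lborel)"
proof -
  have "(\<integral>\<^sup>+y. f y \<partial>lborel) = (\<integral>\<^sup>+y. f y \<partial>distr lborel borel ((+) c))"
    by (simp add: lborel_distr_plus)
  then show ?thesis by (simp add: nn_integral_distr)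
qed

text \<open>If \<open>P S P\<^sup>T = 1\<close> then \<open>S = L L\<^sup>T\<close> with \<open>L = P\<^sup>-\<^sup>1\<close>, so an affine image of the standard Gaussian has
  covariance \<open>S\<close>.\<close>

lemma gaussian_density_full:
  fixes S P :: "real ^ 'n ^ 'n" and m :: "real ^ 'n"
  assumes P: "P ** S ** transpose P = mat 1"
  defines "N \<equiv> density lborel (\<lambda>y. ennreal (\<bar>det P\<bar> * std_gauss (P *v (y - m))))"
  shows "prob_space N"
    and "(\<integral>y. iexp (\<theta> \<bullet> y) \<partial>N) = exp (\<i> * of_real (m \<bullet> \<theta>) - of_real (qinner S \<theta> \<theta>) / 2)"
    and "det P * det P * det S = 1"
    and "(transpose P ** P) ** S = mat 1" and "S ** (transpose P ** P) = mat 1"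
proof -
  define L where "L = S ** transpose P"
  have PL: "P ** L = mat 1" using P by (simp add: L_def matrix_mul_assoc)
  then have LP: "L ** P = mat 1" using matrix_left_right_inverse by blast
  have dPL: "det P * det L = 1" using arg_cong[OF PL, of det] by (simp add: det_mul)
  then have abs1: "\<bar>det P\<bar> * \<bar>det L\<bar> = 1" by (simp flip: abs_mult)
  have dP0: "det P \<noteq> 0" and dL0: "det L \<noteq> 0" using dPL by auto
  show "det P * det P * det S = 1"
    using dPL by (simp add: L_def det_mul algebra_simps)
  have SPP: "S ** (transpose P ** P) = mat 1" using LP by (simp add: L_def matrix_mul_assoc)
  then show "S ** (transpose P ** P) = mat 1" .
  then show "(transpose P ** P) ** S = mat 1" using matrix_left_right_inverse by blast
  have S: "S = L ** transpose L"
  proof -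
    have "transpose P ** transpose L = mat 1"
      using LP by (metis matrix_transpose_mul transpose_mat)
    then have "S ** (transpose P ** transpose L) = S" by simp
    then show ?thesis by (simp add: L_def matrix_mul_assoc)
  qed
  have mPv [measurable]: "(\<lambda>y. P *v (y - m)) \<in> borel_measurable borel"
    by (rule measurable_compose[OF _ measurable_matrix_vector_mult]) simp
  have mLv [measurable]: "(\<lambda>y. m + L *v y) \<in> borel_measurable borel" by measurable
  let ?G = "density lborel (\<lambda>x. ennreal (std_gauss x))"
  have PG: "prob_space ?G"
    by (rule prob_spaceI) (simp add: emeasure_density nn_integral_std_gauss)
  have N: "N = distr ?G borel (\<lambda>x. m + L *v x)"
  proof (rule measure_eqI)
    fix X assume "X \<in> sets N"
    then have [measurable]: "X \<in> sets borel" by (simp add: N_def)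
    have [measurable]: "(\<lambda>y. ennreal (std_gauss (P *v y)) * indicator X (m + y)) \<in> borel_measurable borel"
      by measurable
    have "emeasure N X = (\<integral>\<^sup>+y. ennreal (\<bar>det P\<bar> * std_gauss (P *v (y - m))) * indicator X y \<partial>lborel)"
      unfolding N_def by (simp add: emeasure_density)
    also have "\<dots> = (\<integral>\<^sup>+y. ennreal (\<bar>det P\<bar> * std_gauss (P *v (m + y - m))) * indicator X (m + y) \<partial>lborel)"
      by (rule nn_integral_lborel_vec_shift[symmetric]) measurable
    also have "\<dots> = ennreal \<bar>det P\<bar> * (\<integral>\<^sup>+y. ennreal (std_gauss (P *v y)) * indicator X (m + y) \<partial>lborel)"
      by (subst nn_integral_cmult[symmetric]) (simp_all add: ennreal_mult std_gauss_nonneg mult.assoc)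
    also have "(\<integral>\<^sup>+y. ennreal (std_gauss (P *v y)) * indicator X (m + y) \<partial>lborel)
        = ennreal \<bar>det L\<bar> * (\<integral>\<^sup>+x. ennreal (std_gauss (P *v (L *v x))) * indicator X (m + L *v x) \<partial>lborel)"
      by (rule nn_integral_linear_change[OF _ dL0, symmetric]) measurable
    also have "\<dots> = ennreal \<bar>det L\<bar> * (\<integral>\<^sup>+x. ennreal (std_gauss x) * indicator X (m + L *v x) \<partial>lborel)"
      by (simp add: matrix_vector_mul_assoc PL)
    also have "(\<integral>\<^sup>+x. ennreal (std_gauss x) * indicator X (m + L *v x) \<partial>lborel) = emeasure (distr ?G borel (\<lambda>x. m + L *v x)) X"
    proof -
      have [measurable]: "(\<lambda>x. m + L *v x) -` X \<in> sets borel"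
        using measurable_sets_borel[OF mLv, of X] by simp
      show ?thesis
        by (simp add: emeasure_distr) (simp add: emeasure_density indicator_def vimage_def)
    qed
    finally show "emeasure N X = emeasure (distr ?G borel (\<lambda>x. m + L *v x)) X"
      using abs1 by (simp add: mult.assoc[symmetric] ennreal_mult[symmetric])
  qed (simp add: N_def)
  show "prob_space N"
    unfolding N by (rule prob_space.prob_space_distr[OF PG]) simp
  have q: "(transpose L *v \<theta>) \<bullet> (transpose L *v \<theta>) = qinner S \<theta> \<theta>"
    unfolding qinner_matrix_vector S by (simp add: matrix_vector_mul_assoc[symmetric] dot_lmul_matrix[symmetric])
  have "(\<integral>y. iexp (\<theta> \<bullet> y) \<partial>N) = (\<integral>x. std_gauss x *\<^sub>R iexp (\<theta> \<bullet> (m + L *v x)) \<partial>lborel)"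
    unfolding N by (subst integral_distr) (auto simp: integral_density std_gauss_nonneg)
  also have "\<dots> = (\<integral>x. iexp (\<theta> \<bullet> m) * (std_gauss x *\<^sub>R iexp ((transpose L *v \<theta>) \<bullet> x)) \<partial>lborel)"
    by (intro Bochner_Integration.integral_cong refl)
       (simp add: inner_add_right distrib_left exp_add dot_lmul_matrix[symmetric])
  also have "\<dots> = iexp (\<theta> \<bullet> m) * exp (- of_real (qinner S \<theta> \<theta>) / 2)"
    by (simp only: integral_mult_right_zero std_gauss_cf q)
  finally show "(\<integral>y. iexp (\<theta> \<bullet> y) \<partial>N) = exp (\<i> * of_real (m \<bullet> \<theta>) - of_real (qinner S \<theta> \<theta>) / 2)"
    unfolding exp_add[symmetric] by (simp add: inner_commute)
qed

section \<open>Gaussian laws on coordinate subspaces\<close>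

definition coord_proj :: "'n set \<Rightarrow> real ^ 'n \<Rightarrow> real ^ 'n" where
  "coord_proj J x = (\<chi> i. if i \<in> J then x $ i else 0)"

definition coord_emb :: "'n set \<Rightarrow> ('n \<Rightarrow> real) \<Rightarrow> real ^ 'n" where
  "coord_emb J a = (\<chi> i. if i \<in> J then a i else 0)"

text \<open>This is \<open>coord_lebesgue\<close> before the origin is removed, so that probability
  laws on the whole space can have densities against it.\<close>

definition coord_lborel :: "'n set \<Rightarrow> (real ^ 'n) measure" where
  "coord_lborel J = distr (\<Pi>\<^sub>M j\<in>J. lborel) borel (coord_emb J)"

lemma sets_coord_lborel [measurable_cong, simp]: "sets (coord_lborel J) = sets borel"
  and space_coord_lborel [simp]: "space (coord_lborel J) = UNIV"
  by (simp_all add: coord_lborel_def)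

lemma measurable_coord_emb [measurable]:
  "coord_emb J \<in> borel_measurable (\<Pi>\<^sub>M j\<in>J. (lborel :: real measure))"
  unfolding coord_emb_def[abs_def]
proof (rule borel_measurable_vec_lambda)
  fix i show "(\<lambda>x. if i \<in> J then x i else 0) \<in> borel_measurable (\<Pi>\<^sub>M j\<in>J. (lborel :: real measure))"
    by (cases "i \<in> J") simp_all
qed

lemma measurable_coord_proj [measurable]:
  fixes J :: "'n::finite set"
  shows "coord_proj J \<in> borel_measurable borel"
  unfolding coord_proj_def[abs_def]
proof (rule borel_measurable_vec_lambda)
  fix i show "(\<lambda>x :: real ^ 'n. if i \<in> J then x $ i else 0) \<in> borel_measurable borel"
    by (cases "i \<in> J") simp_all
qed

lemma coord_emb_in_coord_space [simp]: "coord_emb J a \<in> coord_space J"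
  by (simp add: coord_emb_def coord_space_def)

lemma nn_integral_lborel_split:
  fixes f :: "real ^ 'n \<Rightarrow> ennreal"
  assumes [measurable]: "f \<in> borel_measurable borel"
  shows "(\<integral>\<^sup>+x. f x \<partial>lborel) = (\<integral>\<^sup>+a. \<integral>\<^sup>+b. f (coord_emb J a + coord_emb (- J) b) \<partial>(\<Pi>\<^sub>M j\<in>- J. lborel) \<partial>(\<Pi>\<^sub>M j\<in>J. lborel))"
proof -
  interpret product_sigma_finite "\<lambda>_::'n. lborel :: real measure" ..
  have m: "(\<lambda>x. f (\<chi> i. x i)) \<in> borel_measurable (\<Pi>\<^sub>M i\<in>J \<union> - J. lborel)" by simp
  have e: "(\<chi> i. merge J (- J) (a, b) i) = coord_emb J a + coord_emb (- J) b" for a b :: "'n \<Rightarrow> real"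
    by (auto simp: vec_eq_iff merge_def coord_emb_def)
  have "(\<integral>\<^sup>+x. f x \<partial>lborel) = (\<integral>\<^sup>+x. f (\<chi> i. x i) \<partial>(\<Pi>\<^sub>M i\<in>J \<union> - J. lborel))"
    unfolding lborel_vec_eq_PiM by (subst nn_integral_distr) simp_all
  also have "\<dots> = (\<integral>\<^sup>+a. \<integral>\<^sup>+b. f (\<chi> i. merge J (- J) (a, b) i) \<partial>(\<Pi>\<^sub>M j\<in>- J. lborel) \<partial>(\<Pi>\<^sub>M j\<in>J. lborel))"
    by (rule product_nn_integral_fold[OF _ _ _ m]) auto
  finally show ?thesis by (simp add: e)
qed

text \<open>Turns a form that is definite only on \<open>coord_space J\<close> into a definite
  matrix of full size, to which determinants, Cramer's rule and the full Gaussian density apply.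
  Probabilistically it adds independent standard normal coordinates outside J.\<close>

definition block_ext :: "'n set \<Rightarrow> real ^ 'n ^ 'n \<Rightarrow> real ^ 'n ^ 'n" where
  "block_ext J S = (\<chi> i j. if i \<in> J \<and> j \<in> J then S $ i $ j else of_bool (i = j))"

text \<open>Cramer's rule for the extension of \<open>S\<close> by the identity; unlike \<open>inv_on\<close> it is visibly measurable.\<close>

definition cramer_inv :: "'n set \<Rightarrow> real ^ 'n ^ 'n \<Rightarrow> real ^ 'n \<Rightarrow> real ^ 'n" where
  "cramer_inv J S y = (\<chi> k. det (\<chi> i j. if j = k then y $ i else block_ext J S $ i $ j) / det_on J S)"

text \<open>A permutation moving some index outside J picks an off-diagonal zero there, so only
  permutations of J contribute to the Leibniz sum.\<close>

lemma det_block_ext: "det (block_ext J S) = det_on J (S :: real ^ 'n ^ 'n)"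
proof -
  have "det (block_ext J S) = (\<Sum>p | p permutes UNIV. of_int (sign p) * (\<Prod>i\<in>UNIV. block_ext J S $ i $ p i))"
    by (simp add: det_def)
  also have "\<dots> = (\<Sum>p | p permutes J. of_int (sign p) * (\<Prod>i\<in>UNIV. block_ext J S $ i $ p i))"
  proof (rule sum.mono_neutral_right)
    show "finite {p. p permutes (UNIV :: 'n set)}" by (rule finite_permutations) simp
    show "{p. p permutes J} \<subseteq> {p. p permutes UNIV}" by (auto intro: permutes_subset)
    show "\<forall>p\<in>{p. p permutes UNIV} - {p. p permutes J}. of_int (sign p) * (\<Prod>i\<in>UNIV. block_ext J S $ i $ p i) = 0"
    proof
      fix p :: "'n \<Rightarrow> 'n" assume "p \<in> {p. p permutes UNIV} - {p. p permutes J}"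
      then obtain i where i: "i \<notin> J" "p i \<noteq> i"
        unfolding permutes_def by auto
      then have "block_ext J S $ i $ p i = 0" by (simp add: block_ext_def)
      then show "of_int (sign p) * (\<Prod>i\<in>UNIV. block_ext J S $ i $ p i) = 0"
        by (metis (mono_tags, lifting) UNIV_I finite mult_zero_right prod_zero)
    qed
  qed
  also have "\<dots> = det_on J S"
    unfolding det_on_def
  proof (rule sum.cong[OF refl])
    fix p assume p: "p \<in> {p. p permutes J}"
    have "(\<Prod>i\<in>UNIV. block_ext J S $ i $ p i) = (\<Prod>i\<in>J. block_ext J S $ i $ p i)"
      by (rule prod.mono_neutral_right) (use p in \<open>auto simp: block_ext_def permutes_not_in\<close>)
    also have "\<dots> = (\<Prod>i\<in>J. S $ i $ p i)"
      by (rule prod.cong) (use p in \<open>auto simp: block_ext_def permutes_in_image\<close>)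
    finally show "of_int (sign p) * (\<Prod>i\<in>UNIV. block_ext J S $ i $ p i) = of_int (sign p) * (\<Prod>i\<in>J. S $ i $ p i)" by simp
  qed
  finally show ?thesis .
qed

lemma coord_proj_split: "x = coord_proj J x + coord_proj (- J) x"
  by (auto simp: vec_eq_iff coord_proj_def)

lemma coord_proj_in [simp]: "coord_proj J x \<in> coord_space J"
  by (simp add: coord_proj_def coord_space_def)

text \<open>The situation of u diamond Sigma for u in C_J: supported on the coordinates in J and
  definite on their span.\<close>

locale coord_posdef =
  fixes J :: "'n::finite set" and S :: "real ^ 'n ^ 'n"
  assumes sym: "transpose S = S"
    and supp: "\<And>i j. i \<notin> J \<Longrightarrow> S $ i $ j = 0"
    and pd: "\<And>x. x \<in> coord_space J \<Longrightarrow> x \<noteq> 0 \<Longrightarrow> 0 < qinner S x x"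
begin

lemma S_sym: "S $ i $ j = S $ j $ i"
proof -
  have "transpose S $ i $ j = S $ j $ i" by (simp add: transpose_def)
  then show ?thesis by (simp add: sym)
qed

lemma supp': "j \<notin> J \<Longrightarrow> S $ i $ j = 0"
  using supp[of j i] S_sym[of i j] by simp

lemma block_sym: "transpose (block_ext J S) = block_ext J S"
  using sym by (auto simp: block_ext_def transpose_def vec_eq_iff)

lemma qinner_block: "qinner (block_ext J S) x x = qinner S x x + coord_proj (- J) x \<bullet> coord_proj (- J) x"
proof -
  have "block_ext J S $ k $ l * (x $ k * x $ l) = S $ k $ l * (x $ k * x $ l) + (if l = k then (if k \<in> J then 0 else x $ k * x $ k) else 0)" for k l
    using supp[of k l] supp'[of l k] by (auto simp: block_ext_def)
  then have "qinner (block_ext J S) x x = qinner S x x + (\<Sum>k\<in>UNIV. if k \<in> J then 0 else x $ k * x $ k)"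
    by (simp add: qinner_sum sum.distrib)
  also have "(\<Sum>k\<in>UNIV. if k \<in> J then 0 else x $ k * x $ k) = coord_proj (- J) x \<bullet> coord_proj (- J) x"
    by (auto simp: inner_vec_def coord_proj_def intro!: sum.cong)
  finally show ?thesis .
qed

lemma qinner_coord_proj: "qinner S x y = qinner S (coord_proj J x) (coord_proj J y)"
  unfolding qinner_sum by (intro sum.cong refl) (auto simp: coord_proj_def supp supp')

lemma block_pd: "x \<noteq> 0 \<Longrightarrow> 0 < qinner (block_ext J S) x x"
proof -
  assume x: "x \<noteq> 0"
  show ?thesis
  proof (cases "coord_proj J x = 0")
    case True
    then have "coord_proj (- J) x = x" using coord_proj_split[of x J] by simp
    moreover have "qinner S x x = 0" using qinner_coord_proj[of x x] True by (simp add: qinner_sum)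
    ultimately show ?thesis using x by (simp add: qinner_block)
  next
    case False
    then have "0 < qinner S x x" using pd[of "coord_proj J x"] qinner_coord_proj[of x x] by simp
    then show ?thesis by (simp add: qinner_block add_pos_nonneg)
  qed
qed

text \<open>For an orthonormalising P the square of det P times the determinant of the block
  extension is 1. This forces the determinant to be positive and makes Cramer's rule
  available.\<close>

lemma det_pos: "0 < det_on J S"
  and cramer_inv_eq: "block_ext J S *v x = y \<longleftrightarrow> x = cramer_inv J S y"
proof -
  obtain P :: "real ^ 'n ^ 'n" where P: "P ** block_ext J S ** transpose P = mat 1"
    by (rule posdef_orthonormal_rows[OF block_sym block_pd])
  have d1: "det P * det P * det (block_ext J S) = 1" using gaussian_density_full(3)[OF P] .
  have "0 < det (block_ext J S)"
  proof (rule ccontr)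
    assume "\<not> 0 < det (block_ext J S)"
    then have "det P * det P * det (block_ext J S) \<le> 0"
      by (intro mult_nonneg_nonpos) auto
    with d1 show False by simp
  qed
  then show "0 < det_on J S" by (simp add: det_block_ext)
  then show "block_ext J S *v x = y \<longleftrightarrow> x = cramer_inv J S y"
    using cramer[of "block_ext J S" x y] by (simp add: cramer_inv_def det_block_ext)
qed

lemma block_mult_coord:
  assumes x: "x \<in> coord_space J"
  shows "block_ext J S *v x = x v* S"
proof -
  have eq: "block_ext J S $ i $ j * x $ j = x $ j * S $ j $ i" for i j
    using x supp[of j i] supp'[of i j] S_sym[of i j] by (cases "j \<in> J"; cases "i \<in> J") (auto simp: block_ext_def coord_space_def)
  show ?thesis
    by (simp only: vec_eq_iff matrix_vector_mult_def vector_matrix_mult_def vec_lambda_beta eq simp_thms)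
qed

lemma block_mult_compl: "x \<in> coord_space (- J) \<Longrightarrow> block_ext J S *v x = x"
proof -
  assume x: "x \<in> coord_space (- J)"
  have "(\<Sum>j\<in>UNIV. block_ext J S $ i $ j * x $ j) = (\<Sum>j\<in>UNIV. if j = i then x $ i else 0)" for i
    by (rule sum.cong) (use x in \<open>auto simp: block_ext_def coord_space_def\<close>)
  then show ?thesis by (simp add: vec_eq_iff matrix_vector_mult_def)
qed

lemma cramer_inv_coord:
  assumes y: "y \<in> coord_space J"
  shows "cramer_inv J S y \<in> coord_space J"
proof -
  have e: "block_ext J S *v cramer_inv J S y = y" by (simp add: cramer_inv_eq)
  have "cramer_inv J S y $ i = 0" if i: "i \<notin> J" for i
  proof -
    have "(\<Sum>j\<in>UNIV. block_ext J S $ i $ j * cramer_inv J S y $ j) = (\<Sum>j\<in>UNIV. if j = i then cramer_inv J S y $ i else 0)"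
      by (rule sum.cong) (use i in \<open>auto simp: block_ext_def\<close>)
    then have "(block_ext J S *v cramer_inv J S y) $ i = cramer_inv J S y $ i"
      by (simp add: matrix_vector_mult_def)
    then show ?thesis using e y i by (simp add: coord_space_def)
  qed
  then show ?thesis by (simp add: coord_space_def)
qed

text \<open>Connects the inverse of the restricted map, as in the density formula, with Cramer's
  formula. Injectivity is inherited from the block extension, which acts on
  \<open>coord_space J\<close> as x v* S.\<close>

lemma inv_on_eq: "y \<in> coord_space J \<Longrightarrow> inv_on J S y = cramer_inv J S y"
  unfolding inv_on_def
proof (rule the_inv_into_f_eq)
  assume y: "y \<in> coord_space J"
  show "inj_on (\<lambda>x. x v* S) (coord_space J)"
  proof (rule inj_onI)
    fix x x' assume xx: "x \<in> coord_space J" "x' \<in> coord_space J" and e: "x v* S = x' v* S"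
    then have "block_ext J S *v x = x' v* S" "block_ext J S *v x' = x' v* S"
      by (simp_all add: block_mult_coord)
    then show "x = x'" unfolding cramer_inv_eq by simp
  qed
  show "cramer_inv J S y v* S = y"
    using block_mult_coord[OF cramer_inv_coord[OF y]] cramer_inv_eq[of "cramer_inv J S y" y] by simp
  show "cramer_inv J S y \<in> coord_space J" by (rule cramer_inv_coord[OF y])
qed

text \<open>Project a full Gaussian with covariance \<open>block_ext J S\<close> to the coordinates
  in J. Its inverse quadratic form splits into the form on J plus a sum of squares, so the other
  coordinates are standard normal and integrate to 1.\<close>

lemma coord_gaussian:
  assumes m: "m \<in> coord_space J"
  defines "N \<equiv> density (coord_lborel J) (\<lambda>y. ennreal (1 / sqrt (2 * pi) ^ card J / sqrt (det_on J S)
                    * exp (- (cramer_inv J S (y - m) \<bullet> (y - m)) / 2)))"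
  shows "prob_space N"
    and "(\<integral>y. iexp (\<theta> \<bullet> y) \<partial>N) = exp (\<i> * of_real (m \<bullet> \<theta>) - of_real (qinner S \<theta> \<theta>) / 2)"
proof -
  interpret product_sigma_finite "\<lambda>_::'n. lborel :: real measure" ..
  obtain P :: "real ^ 'n ^ 'n" where P: "P ** block_ext J S ** transpose P = mat 1"
    by (rule posdef_orthonormal_rows[OF block_sym block_pd])
  define N' where "N' = density lborel (\<lambda>y. ennreal (\<bar>det P\<bar> * std_gauss (P *v (y - m))))"
  note G = gaussian_density_full(1,2)[OF P, where m=m, folded N'_def] gaussian_density_full(3-5)[OF P]
  have [measurable]: "cramer_inv J S \<in> borel_measurable borel"
  proof -
    have "cramer_inv J S y = (transpose P ** P) *v y" for y
      using G(5) cramer_inv_eq[of "(transpose P ** P) *v y" y] by (simp add: matrix_vector_mul_assoc)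
    then show ?thesis by (simp add: measurable_matrix_vector_mult cong: measurable_cong)
  qed
  have [measurable]: "(\<lambda>y. P *v (y - m)) \<in> borel_measurable borel"
    by (rule measurable_compose[OF _ measurable_matrix_vector_mult]) simp
  have PP: "(P *v x) \<bullet> (P *v x) = cramer_inv J S x \<bullet> x" for x
  proof -
    have "block_ext J S *v ((transpose P ** P) *v x) = x"
      using G(5) by (simp add: matrix_vector_mul_assoc)
    then have "(transpose P ** P) *v x = cramer_inv J S x" by (simp add: cramer_inv_eq)
    moreover have "(P *v x) \<bullet> (P *v x) = ((transpose P ** P) *v x) \<bullet> x"
      by (simp add: matrix_vector_mul_assoc[symmetric] dot_lmul_matrix[symmetric] inner_commute)
    ultimately show ?thesis by simp
  qed
  have add: "cramer_inv J S (v + z) \<bullet> (v + z) = cramer_inv J S v \<bullet> v + z \<bullet> z"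
    if v: "v \<in> coord_space J" and z: "z \<in> coord_space (- J)" for v z
  proof -
    have "block_ext J S *v (cramer_inv J S v + z) = v + z"
      using cramer_inv_eq[of "cramer_inv J S v" v] block_mult_compl[OF z] by (simp add: matrix_vector_right_distrib)
    then have "cramer_inv J S (v + z) = cramer_inv J S v + z" by (simp add: cramer_inv_eq)
    moreover have orth: "x \<bullet> z = 0" if x: "x \<in> coord_space J" for x
    proof -
      have "x $ i * z $ i = 0" for i using x z by (cases "i \<in> J") (auto simp: coord_space_def)
      then show ?thesis unfolding inner_vec_def by (intro sum.neutral) auto
    qed
    moreover have "z \<bullet> v = 0" using orth[OF v] by (simp add: inner_commute)
    ultimately show ?thesis using cramer_inv_coord[OF v] by (simp add: inner_add_left inner_add_right)
  qed
  have detP: "\<bar>det P\<bar> = 1 / sqrt (det_on J S)"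
  proof -
    have "(det P)\<^sup>2 * det_on J S = 1" using G(3) by (simp add: det_block_ext power2_eq_square)
    then have "sqrt ((det P)\<^sup>2 * det_on J S) = 1" by simp
    then have "\<bar>det P\<bar> * sqrt (det_on J S) = 1" by (simp add: real_sqrt_mult)
    then show ?thesis using det_pos by (simp add: field_simps)
  qed
  have n1: "(\<integral>\<^sup>+x. ennreal (std_normal_density x) \<partial>lborel) = 1"
    using prob_space.emeasure_space_1[OF prob_space_normal_density[of 1 0]] by (simp add: emeasure_density)
  have card: "CARD('n) = card J + card (- J)"
    using card_Un_disjoint[of J "- J"] by simp
  have dens: "\<bar>det P\<bar> * std_gauss (P *v (coord_emb J a + coord_emb (- J) b - m))
      = (1 / sqrt (2 * pi) ^ card J / sqrt (det_on J S) * exp (- (cramer_inv J S (coord_emb J a - m) \<bullet> (coord_emb J a - m)) / 2))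
        * (\<Prod>i\<in>- J. std_normal_density (b i))" for a b
  proof -
    have v: "coord_emb J a - m \<in> coord_space J" using m by (simp add: coord_space_def coord_emb_def)
    have "std_gauss (P *v (coord_emb J a + coord_emb (- J) b - m))
        = exp (- (cramer_inv J S (coord_emb J a - m) \<bullet> (coord_emb J a - m) + coord_emb (- J) b \<bullet> coord_emb (- J) b) / 2) / sqrt (2 * pi) ^ CARD('n)"
    proof -
      have re: "coord_emb J a + coord_emb (- J) b - m = (coord_emb J a - m) + coord_emb (- J) b" by simp
      show ?thesis unfolding std_gauss_eq PP re add[OF v coord_emb_in_coord_space] ..
    qed
    moreover have "coord_emb (- J) b \<bullet> coord_emb (- J) b = (\<Sum>i\<in>- J. (b i)\<^sup>2)"
      unfolding inner_vec_def by (rule sum.mono_neutral_cong_right) (auto simp: coord_emb_def power2_eq_square)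
    moreover have "(\<Prod>i\<in>- J. std_normal_density (b i)) = exp (- (\<Sum>i\<in>- J. (b i)\<^sup>2) / 2) / sqrt (2 * pi) ^ card (- J)"
      unfolding std_normal_density_def
      by (simp add: prod_dividef exp_sum[symmetric] sum_negf sum_divide_distrib)
    moreover have "exp (- (x + y) / 2) = exp (- x / 2) * exp (- y / 2)" for x y :: real
      unfolding exp_add[symmetric] by (simp add: add_divide_distrib)
    ultimately show ?thesis
      by (simp only: detP card power_add) simp
  qed
  have NN: "N = distr N' borel (coord_proj J)"
  proof (rule measure_eqI)
    fix X assume "X \<in> sets N"
    then have X [measurable]: "X \<in> sets borel" by (simp add: N_def)
    have pe: "coord_proj J (coord_emb J a + coord_emb (- J) b) = coord_emb J a" for a b
      by (auto simp: vec_eq_iff coord_proj_def coord_emb_def)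
    have [measurable]: "coord_proj J -` X \<in> sets borel"
      using measurable_sets_borel[OF measurable_coord_proj X] by simp
    have "emeasure (distr N' borel (coord_proj J)) X = (\<integral>\<^sup>+y. ennreal (\<bar>det P\<bar> * std_gauss (P *v (y - m))) * indicator X (coord_proj J y) \<partial>lborel)"
      unfolding N'_def by (simp add: emeasure_distr emeasure_density) (simp add: indicator_def vimage_def)
    also have "\<dots> = (\<integral>\<^sup>+a. \<integral>\<^sup>+b. ennreal (\<bar>det P\<bar> * std_gauss (P *v (coord_emb J a + coord_emb (- J) b - m))) * indicator X (coord_emb J a)
         \<partial>(\<Pi>\<^sub>M j\<in>- J. lborel) \<partial>(\<Pi>\<^sub>M j\<in>J. lborel))"
      by (subst nn_integral_lborel_split[where J=J]) (simp_all add: pe)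
    also have "\<dots> = (\<integral>\<^sup>+a. ennreal (1 / sqrt (2 * pi) ^ card J / sqrt (det_on J S)
         * exp (- (cramer_inv J S (coord_emb J a - m) \<bullet> (coord_emb J a - m)) / 2)) * indicator X (coord_emb J a) \<partial>(\<Pi>\<^sub>M j\<in>J. lborel))"
    proof (rule nn_integral_cong)
      fix a :: "'n \<Rightarrow> real"
      let ?d = "1 / sqrt (2 * pi) ^ card J / sqrt (det_on J S) * exp (- (cramer_inv J S (coord_emb J a - m) \<bullet> (coord_emb J a - m)) / 2)"
      have d0: "0 \<le> ?d" using det_pos by simp
      have "(\<integral>\<^sup>+b. ennreal (\<bar>det P\<bar> * std_gauss (P *v (coord_emb J a + coord_emb (- J) b - m))) * indicator X (coord_emb J a) \<partial>(\<Pi>\<^sub>M j\<in>- J. lborel))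
          = (\<integral>\<^sup>+b. (ennreal ?d * indicator X (coord_emb J a)) * (\<Prod>i\<in>- J. ennreal (std_normal_density (b i))) \<partial>(\<Pi>\<^sub>M j\<in>- J. lborel))"
      proof (rule nn_integral_cong)
        fix b :: "'n \<Rightarrow> real"
        have "ennreal (?d * (\<Prod>i\<in>- J. std_normal_density (b i))) = ennreal ?d * (\<Prod>i\<in>- J. ennreal (std_normal_density (b i)))"
          by (subst ennreal_mult[OF d0]) (auto intro: prod_nonneg simp: prod_ennreal)
        then show "ennreal (\<bar>det P\<bar> * std_gauss (P *v (coord_emb J a + coord_emb (- J) b - m))) * indicator X (coord_emb J a)
            = (ennreal ?d * indicator X (coord_emb J a)) * (\<Prod>i\<in>- J. ennreal (std_normal_density (b i)))"
          unfolding dens by (simp only: mult_ac)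
      qed
      also have "\<dots> = (ennreal ?d * indicator X (coord_emb J a)) * (\<Prod>i\<in>- J. \<integral>\<^sup>+x. ennreal (std_normal_density x) \<partial>lborel)"
        by (subst nn_integral_cmult, measurable, subst product_nn_integral_prod) auto
      finally show "(\<integral>\<^sup>+b. ennreal (\<bar>det P\<bar> * std_gauss (P *v (coord_emb J a + coord_emb (- J) b - m))) * indicator X (coord_emb J a) \<partial>(\<Pi>\<^sub>M j\<in>- J. lborel))
          = ennreal ?d * indicator X (coord_emb J a)" by (simp add: n1)
    qed
    also have "\<dots> = emeasure N X"
      unfolding N_def by (subst emeasure_density) (simp_all add: coord_lborel_def nn_integral_distr)
    finally show "emeasure N X = emeasure (distr N' borel (coord_proj J)) X" ..
  qed (simp add: N_def)
  have [measurable_cong]: "sets N' = sets borel" by (simp add: N'_def)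
  show "prob_space N" unfolding NN by (rule prob_space.prob_space_distr[OF G(1)]) simp
  have dot: "\<theta> \<bullet> coord_proj J y = coord_proj J \<theta> \<bullet> y" for y
    by (auto simp: inner_vec_def coord_proj_def intro!: sum.cong)
  have mth: "m \<bullet> coord_proj J \<theta> = m \<bullet> \<theta>"
    using m by (auto simp: inner_vec_def coord_proj_def coord_space_def intro!: sum.cong)
  have "coord_proj (- J) (coord_proj J \<theta>) = 0" by (simp add: vec_eq_iff coord_proj_def)
  then have q: "qinner (block_ext J S) (coord_proj J \<theta>) (coord_proj J \<theta>) = qinner S \<theta> \<theta>"
    by (simp add: qinner_block qinner_coord_proj[of \<theta> \<theta>])
  have "(\<integral>y. iexp (\<theta> \<bullet> y) \<partial>N) = (\<integral>y. iexp (coord_proj J \<theta> \<bullet> y) \<partial>N')"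
    unfolding NN by (subst integral_distr) (simp_all add: dot)
  then show "(\<integral>y. iexp (\<theta> \<bullet> y) \<partial>N) = exp (\<i> * of_real (m \<bullet> \<theta>) - of_real (qinner S \<theta> \<theta>) / 2)"
    by (simp only: G(2) mth q)
qed

end

section \<open>The Bessel integral\<close>

lemma nn_integral_lborel_uminus:
  fixes f :: "real \<Rightarrow> ennreal"
  assumes [measurable]: "f \<in> borel_measurable borel"
  shows "(\<integral>\<^sup>+t. f (- t) \<partial>lborel) = (\<integral>\<^sup>+t. f t \<partial>lborel)"
proof -
  have "(\<integral>\<^sup>+t. f t \<partial>lborel) = (\<integral>\<^sup>+t. f t \<partial>distr lborel borel uminus)"
    by (simp add: lborel_distr_uminus)
  then show ?thesis by (simp add: nn_integral_distr)
qed

lemma nn_integral_lborel_even_part: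
  fixes f :: "real \<Rightarrow> ennreal"
  assumes [measurable]: "f \<in> borel_measurable borel"
  shows "(\<integral>\<^sup>+t. f t \<partial>lborel) = (\<integral>\<^sup>+t. f t + f (- t) \<partial>pos_lborel)"
proof -
  have "(\<integral>\<^sup>+t. f t \<partial>lborel) = (\<integral>\<^sup>+t. f t * indicator {0<..} t + f t * indicator {..<0} t \<partial>lborel)"
    by (intro nn_integral_cong_AE AE_I[where N="{0}"]) (auto simp: indicator_def split: if_splits)
  also have "\<dots> = (\<integral>\<^sup>+t. f t * indicator {0<..} t \<partial>lborel) + (\<integral>\<^sup>+t. f t * indicator {..<0} t \<partial>lborel)"
    by (rule nn_integral_add) simp_all
  also have "(\<integral>\<^sup>+t. f t * indicator {..<0} t \<partial>lborel) = (\<integral>\<^sup>+t. f (- t) * indicator {..<0} (- t) \<partial>lborel)"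
    by (rule nn_integral_lborel_uminus[symmetric]) simp
  also have "(\<integral>\<^sup>+t. f (- t) * indicator {..<0} (- t) \<partial>lborel) = (\<integral>\<^sup>+t. f (- t) * indicator {0<..} t \<partial>lborel)"
    by (intro nn_integral_cong) (simp add: indicator_def)
  also have "(\<integral>\<^sup>+t. f t * indicator {0<..} t \<partial>lborel) + (\<integral>\<^sup>+t. f (- t) * indicator {0<..} t \<partial>lborel)
      = (\<integral>\<^sup>+t. f t + f (- t) \<partial>pos_lborel)"
    unfolding nn_integral_pos_lborel distrib_right by (rule nn_integral_add[symmetric]) simp_all
  finally show ?thesis .
qed

text \<open>The substitution g = s exp t is carried out on - n <= t <= n; the images exhaust the
  positive half line, and both sides converge monotonically in n.\<close>

lemma nn_integral_exp_substitution:
  fixes f :: "real \<Rightarrow> real"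
  assumes [measurable]: "f \<in> borel_measurable borel" and f0: "\<And>x. 0 < x \<Longrightarrow> 0 \<le> f x" and s: "0 < s"
  shows "(\<integral>\<^sup>+g. ennreal (f g) \<partial>pos_lborel) = (\<integral>\<^sup>+t. ennreal (f (s * exp t) * (s * exp t)) \<partial>lborel)"
proof -
  define I where "I n = {s * exp (- real n) .. s * exp (real n)}" for n :: nat
  have step: "(\<integral>\<^sup>+x. ennreal (f x) * indicator (I n) x \<partial>lborel)
      = (\<integral>\<^sup>+t. ennreal (f (s * exp t) * (s * exp t)) * indicator {- real n..real n} t \<partial>lborel)" for n
  proof -
    have "(\<integral>\<^sup>+x. ennreal (f x) * indicator (I n) x \<partial>lborel)
        = (\<integral>\<^sup>+x. ennreal (f x * indicator {s * exp (- real n)..s * exp (real n)} x) \<partial>lborel)"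
      by (intro nn_integral_cong) (simp add: I_def indicator_def)
    also have "\<dots> = (\<integral>\<^sup>+t. ennreal (f (s * exp t) * (s * exp t) * indicator {- real n..real n} t) \<partial>lborel)"
    proof (rule nn_integral_substitution)
      show "set_borel_measurable borel {s * exp (- real n)..s * exp (real n)} f"
        unfolding set_borel_measurable_def by measurable
      show "continuous_on {- real n..real n} (\<lambda>t. s * exp t)" by (intro continuous_intros)
      show "((\<lambda>t. s * exp t) has_real_derivative s * exp t) (at t)" for t
        by (auto intro!: derivative_eq_intros)
    qed (use s in auto)
    also have "\<dots> = (\<integral>\<^sup>+t. ennreal (f (s * exp t) * (s * exp t)) * indicator {- real n..real n} t \<partial>lborel)"
      by (intro nn_integral_cong) (simp add: indicator_def)
    finally show ?thesis .
  qed
  have incI: "incseq I" unfolding I_def using s by (intro monoI) auto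
  have UI: "(\<Union>n. I n) = {0<..}"
  proof (intro set_eqI iffI)
    fix x :: real assume "x \<in> {0<..}"
    then have x: "x > 0" by simp
    obtain n :: nat where "\<bar>ln (x / s)\<bar> \<le> real n" using real_arch_simple by blast
    then have "exp (- real n) \<le> x / s" "x / s \<le> exp (real n)"
      using x s by (auto simp: ln_ge_iff[symmetric] ln_le_cancel_iff[of "x/s" "exp (real n)", symmetric] simp del: ln_le_cancel_iff)
    then have "x \<in> I n" using s by (simp add: I_def field_simps)
    then show "x \<in> (\<Union>n. I n)" by blast
  qed (use s in \<open>auto simp: I_def intro: less_le_trans[of 0 "s * exp _"]\<close>)
  have UR: "(\<Union>n. {- real n..real n}) = (UNIV :: real set)"
  proof (intro set_eqI iffI UNIV_I)
    fix x :: real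
    obtain n :: nat where "\<bar>x\<bar> \<le> real n" using real_arch_simple by blast
    then have "x \<in> {- real n..real n}" by auto
    then show "x \<in> (\<Union>n. {- real n..real n})" by blast
  qed
  have lim: "(\<lambda>n. \<integral>\<^sup>+x. h x * indicator (D n) x \<partial>lborel) \<longlonglongrightarrow> (\<integral>\<^sup>+x. h x * indicator (\<Union>n. D n) x \<partial>lborel)"
    if [measurable]: "h \<in> borel_measurable borel" "\<And>n. D n \<in> sets borel" and D: "incseq D" for h :: "real \<Rightarrow> ennreal" and D
  proof -
    have "(\<lambda>n. emeasure (density lborel h) (D n)) \<longlonglongrightarrow> emeasure (density lborel h) (\<Union>n. D n)"
      by (rule Lim_emeasure_incseq) (use D in auto)
    then show ?thesis by (simp add: emeasure_density)
  qed
  have mf: "(\<lambda>t. ennreal (f (s * exp t) * (s * exp t))) \<in> borel_measurable borel" by measurable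
  have "(\<lambda>n. \<integral>\<^sup>+x. ennreal (f x) * indicator (I n) x \<partial>lborel) \<longlonglongrightarrow> (\<integral>\<^sup>+x. ennreal (f x) * indicator {0<..} x \<partial>lborel)"
    unfolding UI[symmetric] by (rule lim[OF _ _ incI]) (simp_all add: I_def)
  moreover have "(\<lambda>n. \<integral>\<^sup>+t. ennreal (f (s * exp t) * (s * exp t)) * indicator {- real n..real n} t \<partial>lborel)
      \<longlonglongrightarrow> (\<integral>\<^sup>+t. ennreal (f (s * exp t) * (s * exp t)) * indicator (\<Union>n. {- real n..real n}) t \<partial>lborel)"
    by (rule lim[OF mf]) (auto intro!: monoI)
  ultimately show ?thesis
    unfolding step UR nn_integral_pos_lborel using LIMSEQ_unique by (auto simp: UR)
qed

lemma bessel_K_integrable: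
  assumes r: "0 < r" and \<rho>: "0 \<le> \<rho>"
  shows "integrable pos_lborel (\<lambda>t. exp (- r * cosh t) * cosh (\<rho> * t))"
proof (rule Bochner_Integration.integrable_bound)
  \<comment> \<open>Comes from completing the square in r t^2 / 4 - (rho + 1) t, after cosh t >= t^2
    / 4. The extra 1 next to rho leaves the integrable factor exp (- t).\<close>
  define C where "C = exp ((\<rho> + 1)\<^sup>2 / r)"
  show "integrable pos_lborel (\<lambda>t. C * exp (- 1 * t))"
    by (intro integrable_mult_right integrable_exp_pos) simp
  show "(\<lambda>t. exp (- r * cosh t) * cosh (\<rho> * t)) \<in> borel_measurable pos_lborel"
    by (intro measurable_pos_lborel borel_measurable_continuous_onI continuous_intros)
  show "AE t in pos_lborel. norm (exp (- r * cosh t) * cosh (\<rho> * t)) \<le> norm (C * exp (- 1 * t))"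
  proof (rule AE_I2)
    fix t assume "t \<in> space pos_lborel"
    then have t: "t > 0" by simp
    have ch: "t\<^sup>2 / 4 \<le> cosh t"
    proof -
      have "1 + t + t\<^sup>2 / 2 \<le> exp t" by (rule exp_lower_Taylor_quadratic) (use t in simp)
      then have "t\<^sup>2 / 2 \<le> exp t" using t by linarith
      moreover have "exp t / 2 \<le> cosh t" by (simp add: cosh_def)
      ultimately show ?thesis by linarith
    qed
    have "0 \<le> (r * t / 2 - (\<rho> + 1))\<^sup>2 / r" using r by simp
    also have "(r * t / 2 - (\<rho> + 1))\<^sup>2 / r = r * (t\<^sup>2 / 4) - (\<rho> + 1) * t + (\<rho> + 1)\<^sup>2 / r"
      using r by (simp add: power2_eq_square field_simps)
    finally have "(\<rho> + 1) * t - (\<rho> + 1)\<^sup>2 / r \<le> r * (t\<^sup>2 / 4)" by linarith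
    also have "\<dots> \<le> r * cosh t" using ch r by (intro mult_left_mono) auto
    finally have e: "- r * cosh t + \<rho> * t \<le> (\<rho> + 1)\<^sup>2 / r + - 1 * t" by (simp add: algebra_simps)
    have "cosh (\<rho> * t) \<le> exp (\<rho> * t)"
    proof -
      have "exp (- (\<rho> * t)) \<le> exp (\<rho> * t)" using \<rho> t by simp
      then show ?thesis by (simp add: cosh_def)
    qed
    then have "exp (- r * cosh t) * cosh (\<rho> * t) \<le> exp (- r * cosh t) * exp (\<rho> * t)"
      by (intro mult_left_mono) auto
    also have "\<dots> = exp (- r * cosh t + \<rho> * t)" by (simp only: exp_add)
    also have "\<dots> \<le> exp ((\<rho> + 1)\<^sup>2 / r + - 1 * t)" using e by simp
    also have "\<dots> = C * exp (- 1 * t)" by (simp only: exp_add C_def)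
    finally show "norm (exp (- r * cosh t) * cosh (\<rho> * t)) \<le> norm (C * exp (- 1 * t))"
      by (simp add: C_def abs_mult cosh_real_pos)
  qed
qed

lemma bessel_K_nn_integral:
  assumes r: "0 < r" and \<rho>: "0 \<le> \<rho>"
  shows "ennreal (bessel_K \<rho> r) = (\<integral>\<^sup>+t. ennreal (exp (- r * cosh t) * cosh (\<rho> * t)) \<partial>pos_lborel)"
  unfolding bessel_K_def integral_pos_lborel[symmetric]
  by (rule nn_integral_eq_integral[symmetric, OF bessel_K_integrable[OF r \<rho>]])
     (auto intro!: AE_I2 mult_nonneg_nonneg less_imp_le[OF cosh_real_pos])

lemma bessel_K_nonneg: "0 \<le> bessel_K \<rho> r"
  unfolding bessel_K_def integral_pos_lborel[symmetric]
  by (intro integral_nonneg_AE AE_I2 mult_nonneg_nonneg less_imp_le[OF cosh_real_pos]) auto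

lemma borel_measurable_bessel_K [measurable]: "bessel_K \<rho> \<in> borel_measurable borel"
proof -
  interpret sigma_finite_measure pos_lborel by (rule sigma_finite_pos_lborel)
  note measurable_ident_pos_lborel [measurable]
  have [measurable]: "cosh \<in> borel_measurable (borel :: real measure)"
    by (intro borel_measurable_continuous_onI continuous_intros)
  have "(\<lambda>r. \<integral>t. exp (- r * cosh t) * cosh (\<rho> * t) \<partial>pos_lborel) \<in> borel_measurable borel"
    by (rule borel_measurable_lebesgue_integral) (simp add: case_prod_beta, measurable)
  then show ?thesis unfolding bessel_K_def[abs_def] integral_pos_lborel[symmetric] .
qed

text \<open>Scaling by s = sqrt (a / kappa) balances the two terms of the exponent, and g = s exp t
  turns them into - sqrt (a kappa) cosh t. Folding the line at 0 then replaces exp (- rho t) by 2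
  cosh (rho t), the integrand of \<open>bessel_K\<close>.\<close>

lemma nn_integral_generalized_inverse_gaussian:
  assumes a: "0 < a" and \<kappa>: "0 < \<kappa>" and \<rho>: "0 \<le> \<rho>"
  shows "(\<integral>\<^sup>+g. ennreal (g powr (- 1 - \<rho>) * exp (- a / (2 * g) - g * \<kappa> / 2)) \<partial>pos_lborel)
      = ennreal (2 * (\<kappa> / a) powr (\<rho> / 2) * bessel_K \<rho> (sqrt (a * \<kappa>)))"
proof -
  define s where "s = sqrt (a / \<kappa>)"
  define r where "r = sqrt (a * \<kappa>)"
  have s: "0 < s" and r: "0 < r" using a \<kappa> by (auto simp: s_def r_def)
  have as: "a / s = r" "s * \<kappa> = r"
    using a \<kappa> by (simp_all add: s_def r_def real_sqrt_divide real_sqrt_mult field_simps)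
  have sp: "s powr (- \<rho>) = (\<kappa> / a) powr (\<rho> / 2)"
    using a \<kappa> by (simp add: s_def powr_half_sqrt[symmetric] powr_powr powr_minus powr_divide field_simps)
  have "(\<integral>\<^sup>+g. ennreal (g powr (- 1 - \<rho>) * exp (- a / (2 * g) - g * \<kappa> / 2)) \<partial>pos_lborel)
      = (\<integral>\<^sup>+t. ennreal ((s * exp t) powr (- 1 - \<rho>) * exp (- a / (2 * (s * exp t)) - (s * exp t) * \<kappa> / 2) * (s * exp t)) \<partial>lborel)"
    by (rule nn_integral_exp_substitution[OF _ _ s]) auto
  also have "\<dots> = (\<integral>\<^sup>+t. ennreal (s powr (- \<rho>)) * ennreal (exp (- r * cosh t) * exp (- \<rho> * t)) \<partial>lborel)"
  proof (rule nn_integral_cong)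
    fix t :: real
    have "- a / (2 * (s * exp t)) - (s * exp t) * \<kappa> / 2 = - (a / s) * (exp (- t) / 2) - (s * \<kappa>) * (exp t / 2)"
      using s by (simp add: exp_minus field_simps)
    also have "\<dots> = - r * cosh t" unfolding as by (simp add: cosh_def field_simps)
    finally have e: "- a / (2 * (s * exp t)) - (s * exp t) * \<kappa> / 2 = - r * cosh t" .
    have "(s * exp t) powr (- 1 - \<rho>) * (s * exp t) = (s * exp t) powr (- 1 - \<rho>) * (s * exp t) powr 1"
      using s by simp
    also have "\<dots> = (s * exp t) powr (- \<rho>)"
      by (simp only: powr_add[symmetric]) simp
    also have "\<dots> = s powr (- \<rho>) * exp (- \<rho> * t)"
      using s by (simp add: powr_mult) (simp add: powr_def)
    finally have p: "(s * exp t) powr (- 1 - \<rho>) * (s * exp t) = s powr (- \<rho>) * exp (- \<rho> * t)" .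
    have "(s * exp t) powr (- 1 - \<rho>) * exp (- a / (2 * (s * exp t)) - (s * exp t) * \<kappa> / 2) * (s * exp t)
        = ((s * exp t) powr (- 1 - \<rho>) * (s * exp t)) * exp (- a / (2 * (s * exp t)) - (s * exp t) * \<kappa> / 2)"
      by (simp only: mult_ac)
    also have "\<dots> = s powr (- \<rho>) * (exp (- r * cosh t) * exp (- \<rho> * t))"
      unfolding p e by (simp only: mult_ac)
    finally show "ennreal ((s * exp t) powr (- 1 - \<rho>) * exp (- a / (2 * (s * exp t)) - (s * exp t) * \<kappa> / 2) * (s * exp t))
        = ennreal (s powr (- \<rho>)) * ennreal (exp (- r * cosh t) * exp (- \<rho> * t))"
      by (simp add: ennreal_mult)
  qed
  also have "\<dots> = ennreal (s powr (- \<rho>)) * (\<integral>\<^sup>+t. ennreal (exp (- r * cosh t) * exp (- \<rho> * t)) \<partial>lborel)"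
    by (rule nn_integral_cmult) (auto intro!: borel_measurable_continuous_onI continuous_intros)
  also have "(\<integral>\<^sup>+t. ennreal (exp (- r * cosh t) * exp (- \<rho> * t)) \<partial>lborel)
      = (\<integral>\<^sup>+t. ennreal (exp (- r * cosh t) * exp (- \<rho> * t)) + ennreal (exp (- r * cosh (- t)) * exp (- \<rho> * (- t))) \<partial>pos_lborel)"
    by (rule nn_integral_lborel_even_part) (auto intro!: borel_measurable_continuous_onI continuous_intros)
  also have "\<dots> = (\<integral>\<^sup>+t. 2 * ennreal (exp (- r * cosh t) * cosh (\<rho> * t)) \<partial>pos_lborel)"
  proof (rule nn_integral_cong)
    fix t :: real
    have "exp (- r * cosh t) * exp (- \<rho> * t) + exp (- r * cosh (- t)) * exp (- \<rho> * (- t)) = 2 * (exp (- r * cosh t) * cosh (\<rho> * t))"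
      by (simp add: cosh_def[of "\<rho> * t"] field_simps)
    then show "ennreal (exp (- r * cosh t) * exp (- \<rho> * t)) + ennreal (exp (- r * cosh (- t)) * exp (- \<rho> * (- t)))
        = 2 * ennreal (exp (- r * cosh t) * cosh (\<rho> * t))"
      by (simp add: ennreal_plus[symmetric] ennreal_mult'[symmetric] del: ennreal_plus flip: ennreal_numeral)
  qed
  also have "\<dots> = 2 * ennreal (bessel_K \<rho> r)"
    unfolding bessel_K_nn_integral[OF r \<rho>]
    by (rule nn_integral_cmult) (auto intro!: measurable_pos_lborel borel_measurable_continuous_onI continuous_intros)
  finally show ?thesis
    unfolding sp r_def by (simp add: ennreal_mult bessel_K_nonneg mult_ac flip: ennreal_numeral)
qed

section \<open>Thorin measures and the Levy measure of a Thorin subordinator\<close>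

lemma space_thorin: "thorin_measure U \<Longrightarrow> space U = orthant_star"
  using sets_eq_imp_space_eq[of U "restrict_space borel orthant_star"]
  by (simp add: thorin_measure_def space_restrict_space)

lemma sets_thorin: "thorin_measure U \<Longrightarrow> sets U = sets (restrict_space borel orthant_star)"
  by (simp add: thorin_measure_def)

lemma measurable_thorin:
  assumes U: "thorin_measure U" and f: "f \<in> borel \<rightarrow>\<^sub>M N"
  shows "f \<in> U \<rightarrow>\<^sub>M N"
  using measurable_restrict_space1[OF f, of orthant_star] measurable_cong_sets[OF sets_thorin[OF U] refl] by blast

lemma borel_measurable_ln_minus [measurable]: "ln_minus \<in> borel_measurable borel"
  unfolding ln_minus_def[abs_def] by measurable

definition thorin_weight :: "real ^ 'n \<Rightarrow> real" where
  "thorin_weight u = min (1 + ln_minus (norm u)) (1 / norm u)"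

lemma borel_measurable_thorin_weight [measurable]: "thorin_weight \<in> borel_measurable borel"
  unfolding thorin_weight_def[abs_def] by measurable

lemma thorin_weight_pos:
  assumes "u \<noteq> 0"
  shows "0 < thorin_weight u"
proof -
  have "0 \<le> ln_minus (norm u)"
    using ln_le_zero_iff[of "norm u"] assms by (auto simp: ln_minus_def indicator_def)
  then show ?thesis using assms by (simp add: thorin_weight_def)
qed

text \<open>The Thorin condition says that a strictly positive weight makes U finite; dividing this
  weight out of the finite measure recovers U as a sigma-finite one.\<close>

lemma thorin_sigma_finite:
  assumes U: "thorin_measure U"
  shows "sigma_finite_measure U"
proof -
  define f where "f u = ennreal (thorin_weight u)" for u :: "real ^ 'a"
  have fm [measurable]: "f \<in> borel_measurable U"
    unfolding f_def by (rule measurable_thorin[OF U]) measurable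
  have gm [measurable]: "(\<lambda>u. ennreal (1 / thorin_weight u)) \<in> borel_measurable U"
    by (rule measurable_thorin[OF U]) measurable
  have fin: "(\<integral>\<^sup>+u. f u \<partial>U) < \<infinity>"
    using U by (simp add: thorin_measure_def f_def thorin_weight_def)
  have "finite_measure (density U f)"
    using fin by (intro finite_measureI) (auto simp: emeasure_density less_top cong: nn_integral_cong_simp)
  then interpret D: finite_measure "density U f" .
  have "sigma_finite_measure (density (density U f) (\<lambda>u. ennreal (1 / thorin_weight u)))"
    by (subst D.sigma_finite_iff_density_finite) auto
  also have "density (density U f) (\<lambda>u. ennreal (1 / thorin_weight u)) = density U (\<lambda>u. f u * ennreal (1 / thorin_weight u))"
    by (rule density_density_eq) measurable
  also have "\<dots> = density U (\<lambda>_. 1)"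
  proof (rule density_cong)
    show "AE u in U. f u * ennreal (1 / thorin_weight u) = 1"
    proof (rule AE_I2)
      fix u assume "u \<in> space U"
      then have "0 < thorin_weight u" using space_thorin[OF U] by (auto simp: orthant_star_def intro: thorin_weight_pos)
      then show "f u * ennreal (1 / thorin_weight u) = 1" by (simp add: f_def ennreal_mult[symmetric])
    qed
  qed measurable
  finally show ?thesis by (simp add: density_1)
qed

definition thorin_density :: "(real ^ 'n) \<times> real \<Rightarrow> real" where
  "thorin_density = (\<lambda>(u, g). exp (- (norm u)\<^sup>2 * g) / g)"

text \<open>For fixed u the weight exp (- |u|^2 g) dg / g is the Levy measure of a gamma process
  with rate |u|^2. Kept as a measure on pairs (u, g), the mixture stays sigma-finite and open to
  Fubini.\<close>

definition thorin_mix :: "(real ^ 'n) measure \<Rightarrow> ((real ^ 'n) \<times> real) measure" where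
  "thorin_mix U = density (U \<Otimes>\<^sub>M pos_lborel) (\<lambda>x. ennreal (thorin_density x))"

locale thorin =
  fixes U :: "(real ^ 'n) measure"
  assumes U: "thorin_measure U"
begin

sublocale Up: pair_sigma_finite U pos_lborel
  using thorin_sigma_finite[OF U] sigma_finite_pos_lborel by (rule pair_sigma_finite.intro)

lemma measurable_ident_U [measurable]: "(\<lambda>x. x) \<in> borel_measurable U"
  by (rule measurable_thorin[OF U]) simp

lemma measurable_fst_U: "fst \<in> borel_measurable (U \<Otimes>\<^sub>M pos_lborel)"
  using measurable_compose[OF measurable_fst measurable_ident_U] by simp

lemma measurable_snd_pos: "snd \<in> borel_measurable (U \<Otimes>\<^sub>M pos_lborel)"
  by (rule measurable_compose[OF measurable_snd measurable_ident_pos_lborel])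

lemma measurable_mix_pair: "(\<lambda>x. x) \<in> (U \<Otimes>\<^sub>M pos_lborel) \<rightarrow>\<^sub>M (borel \<Otimes>\<^sub>M borel)"
  using measurable_Pair[OF measurable_fst_U measurable_snd_pos] by simp

lemma measurable_pair_U:
  assumes "f \<in> (borel \<Otimes>\<^sub>M borel) \<rightarrow>\<^sub>M L"
  shows "f \<in> (U \<Otimes>\<^sub>M pos_lborel) \<rightarrow>\<^sub>M L"
  using measurable_compose[OF measurable_mix_pair assms] .

lemma measurable_mix:
  assumes "f \<in> (borel \<Otimes>\<^sub>M borel) \<rightarrow>\<^sub>M L"
  shows "f \<in> thorin_mix U \<rightarrow>\<^sub>M L"
  using measurable_pair_U[OF assms] by (simp add: thorin_mix_def)

lemma thorin_density_measurable_borel: "thorin_density \<in> borel_measurable ((borel :: (real ^ 'n) measure) \<Otimes>\<^sub>M borel)"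
  unfolding thorin_density_def case_prod_beta by measurable

lemmas thorin_density_measurable [measurable] = measurable_pair_U[OF thorin_density_measurable_borel]

lemma space_mix: "space (thorin_mix U) = orthant_star \<times> {0<..}"
  by (simp add: thorin_mix_def space_pair_measure space_thorin[OF U])

lemma thorin_density_nonneg: "x \<in> space (thorin_mix U) \<Longrightarrow> 0 \<le> thorin_density x"
  by (auto simp: space_mix thorin_density_def)

lemma mix_sigma_finite: "sigma_finite_measure (thorin_mix U)"
  unfolding thorin_mix_def
  by (subst Up.P.sigma_finite_iff_density_finite) (auto simp: Up.P.sigma_finite_iff_density_finite)

lemma nn_integral_mix:
  assumes "f \<in> borel_measurable (U \<Otimes>\<^sub>M pos_lborel)"
  shows "(\<integral>\<^sup>+x. f x \<partial>thorin_mix U) = (\<integral>\<^sup>+u. \<integral>\<^sup>+g. ennreal (exp (- (norm u)\<^sup>2 * g) / g) * f (u, g) \<partial>pos_lborel \<partial>U)"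
proof -
  note [measurable] = assms
  have "(\<integral>\<^sup>+x. f x \<partial>thorin_mix U) = (\<integral>\<^sup>+x. ennreal (thorin_density x) * f x \<partial>(U \<Otimes>\<^sub>M pos_lborel))"
    unfolding thorin_mix_def by (rule nn_integral_density) measurable
  also have "\<dots> = (\<integral>\<^sup>+u. \<integral>\<^sup>+g. ennreal (thorin_density (u, g)) * f (u, g) \<partial>pos_lborel \<partial>U)"
    by (rule Up.M2.nn_integral_fst[symmetric]) measurable
  finally show ?thesis by (simp add: thorin_density_def)
qed

lemma mix_fubini:
  fixes f :: "(real ^ 'n) \<times> real \<Rightarrow> 'b::{banach,second_countable_topology}"
  assumes f: "integrable (thorin_mix U) f"
  shows "integrable U (\<lambda>u. \<integral>g. (exp (- (norm u)\<^sup>2 * g) / g) *\<^sub>R f (u, g) \<partial>pos_lborel)"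
    and "(\<integral>x. f x \<partial>thorin_mix U) = (\<integral>u. \<integral>g. (exp (- (norm u)\<^sup>2 * g) / g) *\<^sub>R f (u, g) \<partial>pos_lborel \<partial>U)"
proof -
  have [measurable]: "f \<in> borel_measurable (U \<Otimes>\<^sub>M pos_lborel)"
    using borel_measurable_integrable[OF f] by (simp add: thorin_mix_def)
  have nn: "AE x in U \<Otimes>\<^sub>M pos_lborel. 0 \<le> thorin_density x"
    by (rule AE_I2) (use thorin_density_nonneg in \<open>simp add: thorin_mix_def\<close>)
  have int: "integrable (U \<Otimes>\<^sub>M pos_lborel) (\<lambda>x. thorin_density x *\<^sub>R f x)"
    using f unfolding thorin_mix_def by (subst (asm) integrable_density[OF _ _ nn]) measurable
  have eq: "(\<integral>x. f x \<partial>thorin_mix U) = (\<integral>x. thorin_density x *\<^sub>R f x \<partial>(U \<Otimes>\<^sub>M pos_lborel))"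
    unfolding thorin_mix_def by (rule integral_density[OF _ _ nn]) measurable
  show "integrable U (\<lambda>u. \<integral>g. (exp (- (norm u)\<^sup>2 * g) / g) *\<^sub>R f (u, g) \<partial>pos_lborel)"
    using Up.integrable_fst'[OF int] by (simp add: thorin_density_def)
  show "(\<integral>x. f x \<partial>thorin_mix U) = (\<integral>u. \<integral>g. (exp (- (norm u)\<^sup>2 * g) / g) *\<^sub>R f (u, g) \<partial>pos_lborel \<partial>U)"
    unfolding eq using Up.integral_fst'[OF int] by (simp add: thorin_density_def)
qed

end

text \<open>Brings the truncation min 1 x into the shape 1 - exp (- x) of a Frullani integral. The
  constant 2 comes from min 1 x <= 2 x / (1 + x).\<close>

lemma min_1_le_exp:
  assumes "0 \<le> (x::real)"
  shows "min 1 x \<le> 2 * (1 - exp (- x))"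
proof -
  have "exp (- x) \<le> 1 / (1 + x)"
    using exp_ge_add_one_self[of x] assms by (simp add: exp_minus field_simps)
  then have "x / (1 + x) \<le> 1 - exp (- x)" using assms by (simp add: field_simps)
  moreover have "min 1 x \<le> 2 * (x / (1 + x))"
    using assms mult_left_mono[of x 1 x] by (auto simp: min_def field_simps)
  ultimately show ?thesis using mult_left_mono[of "x / (1 + x)" "1 - exp (- x)" 2] by simp
qed

text \<open>The quotient is 1 + 1 / r. Always ln (1 + 1 / r) <= 1 / r, and for r <= 1 it equals ln
  (1 + r) - ln r <= 1 - ln r; these two bounds are the two branches of the Thorin weight.\<close>

lemma ln_thorin_bound:
  assumes r: "0 < (r::real)"
  shows "ln ((r\<^sup>2 + r) / r\<^sup>2) \<le> min (1 + ln_minus r) (1 / r)"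
proof -
  have e: "(r\<^sup>2 + r) / r\<^sup>2 = 1 + 1 / r" using r by (simp add: power2_eq_square field_simps)
  have le: "ln (1 + 1 / r) \<le> 1 / r" using r by (intro ln_add_one_self_le_self) simp
  moreover have "ln (1 + 1 / r) \<le> 1 + ln_minus r"
  proof (cases "r \<le> 1")
    case True
    have "ln (1 + 1 / r) = ln ((1 + r) / r)" using r by (simp add: field_simps)
    also have "\<dots> = ln (1 + r) - ln r" using r by (simp add: ln_div)
    also have "ln (1 + r) \<le> 1" using ln_add_one_self_le_self[of r] r True by linarith
    finally show ?thesis using r True by (simp add: ln_minus_def)
  next
    case False
    then have "1 / r \<le> 1" using r by simp
    then have "ln (1 + 1 / r) \<le> 1" using le by linarith
    then show ?thesis using False by (simp add: ln_minus_def)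
  qed
  ultimately show ?thesis by (simp add: e)
qed

context thorin
begin

text \<open>By Frullani with a = |u| the integral over g is at most 2 ln (1 + 1 / |u|), hence at
  most twice the Thorin weight. This expresses that the small jumps g u are summable.\<close>

lemma mix_min_finite: "(\<integral>\<^sup>+x. ennreal (min 1 (snd x * norm (fst x))) \<partial>thorin_mix U) < \<infinity>"
proof -
  have "(\<lambda>x. ennreal (min 1 (snd x * norm (fst x)))) \<in> borel_measurable (U \<Otimes>\<^sub>M pos_lborel)"
    by (rule measurable_pair_U) measurable
  from nn_integral_mix[OF this]
  have "(\<integral>\<^sup>+x. ennreal (min 1 (snd x * norm (fst x))) \<partial>thorin_mix U)
      = (\<integral>\<^sup>+u. \<integral>\<^sup>+g. ennreal (exp (- (norm u)\<^sup>2 * g) / g) * ennreal (min 1 (g * norm u)) \<partial>pos_lborel \<partial>U)"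
    by simp
  also have "\<dots> \<le> (\<integral>\<^sup>+u. 2 * ennreal (thorin_weight u) \<partial>U)"
  proof (rule nn_integral_mono)
    fix u assume "u \<in> space U"
    then have u: "u \<noteq> 0" by (simp add: space_thorin[OF U] orthant_star_def)
    define r where "r = norm u"
    have r: "0 < r" using u by (simp add: r_def)
    note F = frullani_real[of "r\<^sup>2" r]
    have "(\<integral>\<^sup>+g. ennreal (exp (- (norm u)\<^sup>2 * g) / g) * ennreal (min 1 (g * norm u)) \<partial>pos_lborel)
        \<le> (\<integral>\<^sup>+g. ennreal (2 * (exp (- r\<^sup>2 * g) / g * (1 - exp (- g * r)))) \<partial>pos_lborel)"
    proof (rule nn_integral_mono)
      fix g assume "g \<in> space pos_lborel"
      then have g: "0 < g" by simp
      have "exp (- r\<^sup>2 * g) / g * min 1 (g * r) \<le> exp (- r\<^sup>2 * g) / g * (2 * (1 - exp (- (g * r))))"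
        using g r by (intro mult_left_mono min_1_le_exp) auto
      also have "\<dots> = 2 * (exp (- r\<^sup>2 * g) / g * (1 - exp (- g * r)))"
        by (simp only: mult.left_commute minus_mult_left)
      finally have le: "exp (- r\<^sup>2 * g) / g * min 1 (g * r) \<le> 2 * (exp (- r\<^sup>2 * g) / g * (1 - exp (- g * r)))" .
      have "ennreal (exp (- r\<^sup>2 * g) / g) * ennreal (min 1 (g * r)) = ennreal (exp (- r\<^sup>2 * g) / g * min 1 (g * r))"
        using g r by (intro ennreal_mult[symmetric]) auto
      then show "ennreal (exp (- (norm u)\<^sup>2 * g) / g) * ennreal (min 1 (g * norm u))
          \<le> ennreal (2 * (exp (- r\<^sup>2 * g) / g * (1 - exp (- g * r))))"
        unfolding r_def[symmetric] using ennreal_leI[OF le] by simp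
    qed
    also have "\<dots> = ennreal (\<integral>g. 2 * (exp (- r\<^sup>2 * g) / g * (1 - exp (- g * r))) \<partial>pos_lborel)"
    proof (rule nn_integral_eq_integral)
      show "integrable pos_lborel (\<lambda>g. 2 * (exp (- r\<^sup>2 * g) / g * (1 - exp (- g * r))))"
        using F(1) r by (intro integrable_mult_right) auto
      show "AE g in pos_lborel. 0 \<le> 2 * (exp (- r\<^sup>2 * g) / g * (1 - exp (- g * r)))"
        using r by (intro AE_I2 mult_nonneg_nonneg) auto
    qed
    also have "(\<integral>g. 2 * (exp (- r\<^sup>2 * g) / g * (1 - exp (- g * r))) \<partial>pos_lborel) = 2 * ln ((r\<^sup>2 + r) / r\<^sup>2)"
      using F(2) r by (subst integral_mult_right_zero) simp
    also have "ennreal (2 * ln ((r\<^sup>2 + r) / r\<^sup>2)) \<le> ennreal (2 * thorin_weight u)"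
      using ln_thorin_bound[OF r] by (intro ennreal_leI) (simp add: thorin_weight_def r_def)
    also have "\<dots> = 2 * ennreal (thorin_weight u)"
      using thorin_weight_pos[OF u] by (simp add: ennreal_mult)
    finally show "(\<integral>\<^sup>+g. ennreal (exp (- (norm u)\<^sup>2 * g) / g) * ennreal (min 1 (g * norm u)) \<partial>pos_lborel)
        \<le> 2 * ennreal (thorin_weight u)" .
  qed
  also have "\<dots> = 2 * (\<integral>\<^sup>+u. ennreal (thorin_weight u) \<partial>U)"
    by (rule nn_integral_cmult) (rule measurable_thorin[OF U], measurable)
  also have "\<dots> < \<infinity>"
    using U by (simp add: thorin_measure_def thorin_weight_def ennreal_mult_less_top)
  finally show ?thesis .
qed

lemma mix_integrable_min: "integrable (thorin_mix U) (\<lambda>x. min 1 (snd x * norm (fst x)))"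
proof (rule integrableI_nonneg)
  show "(\<lambda>x. min 1 (snd x * norm (fst x))) \<in> borel_measurable (thorin_mix U)"
    by (rule measurable_mix) measurable
  show "AE x in thorin_mix U. 0 \<le> min 1 (snd x * norm (fst x))"
    by (rule AE_I2) (auto simp: space_mix)
  show "(\<integral>\<^sup>+x. ennreal (min 1 (snd x * norm (fst x))) \<partial>thorin_mix U) < \<infinity>" by (rule mix_min_finite)
qed

end

section \<open>From Laplace transforms to characteristic functions\<close>

lemma lipschitz_exp_bound:
  assumes "0 < (\<delta>::real)" "0 \<le> y"
  shows "y * exp (- \<delta> * y) \<le> 1 / \<delta>"
proof -
  have "\<delta> * y \<le> exp (\<delta> * y)" using exp_ge_add_one_self[of "\<delta> * y"] by linarith
  then have "\<delta> * y * exp (- \<delta> * y) \<le> 1" by (simp add: exp_minus field_simps)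
  then show ?thesis using assms by (simp add: field_simps)
qed

lemma orthant_inner_ge:
  fixes x :: "real ^ 'n"
  assumes x: "x \<in> orthant" and \<eta>: "\<And>i. \<delta> \<le> \<eta> $ i" and \<delta>: "0 \<le> \<delta>"
  shows "\<delta> * norm x \<le> \<eta> \<bullet> x"
proof -
  have "norm x \<le> (\<Sum>i\<in>UNIV. \<bar>x $ i\<bar>)" by (rule norm_le_l1_cart)
  then have "\<delta> * norm x \<le> \<delta> * (\<Sum>i\<in>UNIV. \<bar>x $ i\<bar>)" using \<delta> by (rule mult_left_mono)
  also have "\<dots> = (\<Sum>i\<in>UNIV. \<delta> * x $ i)" using x by (simp add: sum_distrib_left orthant_def)
  also have "\<dots> \<le> (\<Sum>i\<in>UNIV. \<eta> $ i * x $ i)"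
    using x \<eta> by (intro sum_mono mult_right_mono) (auto simp: orthant_def)
  finally show ?thesis by (simp add: inner_vec_def)
qed

lemma inner_orthant_nonneg: "x \<in> orthant \<Longrightarrow> \<eta> \<in> orthant \<Longrightarrow> 0 \<le> \<eta> \<bullet> x"
  by (auto simp: inner_vec_def orthant_def intro!: sum_nonneg mult_nonneg_nonneg)

text \<open>Bounds the z-derivative of the Laplace integrand. Staying delta inside the orthant, the
  exponential absorbs the factor |x| for large x, which leaves the majorant min 1 |x| that is
  integrable over jumps.\<close>

lemma cexp_linear_derivative_bound:
  fixes \<eta> \<theta> x :: "real ^ 'n"
  assumes x: "x \<in> orthant" and \<delta>: "0 < \<delta>" and z: "\<And>i. \<delta> \<le> \<eta> $ i + Re z * \<theta> $ i"
  shows "cmod (- of_real (\<theta> \<bullet> x) * exp (- of_real (\<eta> \<bullet> x) - z * of_real (\<theta> \<bullet> x)))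
    \<le> norm \<theta> * max 1 (1 / \<delta>) * min 1 (norm x)"
proof -
  have "\<delta> * norm x \<le> (\<eta> + Re z *\<^sub>R \<theta>) \<bullet> x"
    using x z \<delta> by (intro orthant_inner_ge) auto
  then have e: "exp (- (\<eta> \<bullet> x) - Re z * (\<theta> \<bullet> x)) \<le> exp (- \<delta> * norm x)"
    by (simp add: inner_add_left)
  have "cmod (- of_real (\<theta> \<bullet> x) * exp (- of_real (\<eta> \<bullet> x) - z * of_real (\<theta> \<bullet> x)))
      = \<bar>\<theta> \<bullet> x\<bar> * exp (- (\<eta> \<bullet> x) - Re z * (\<theta> \<bullet> x))"
    by (simp add: norm_mult)
  also have "\<dots> \<le> (norm \<theta> * norm x) * exp (- \<delta> * norm x)"
    using e by (intro mult_mono Cauchy_Schwarz_ineq2) auto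
  also have "\<dots> = norm \<theta> * (norm x * exp (- \<delta> * norm x))" by simp
  also have "\<dots> \<le> norm \<theta> * (max 1 (1 / \<delta>) * min 1 (norm x))"
  proof (rule mult_left_mono)
    show "norm x * exp (- \<delta> * norm x) \<le> max 1 (1 / \<delta>) * min 1 (norm x)"
    proof (cases "norm x \<le> 1")
      case True
      have "norm x * exp (- \<delta> * norm x) \<le> norm x * 1" using \<delta> by (intro mult_left_mono) auto
      also have "\<dots> \<le> max 1 (1 / \<delta>) * norm x" by (simp add: mult_le_cancel_right1 mult.commute[of "norm x"])
      finally show ?thesis using True by simp
    next
      case False
      have "norm x * exp (- \<delta> * norm x) \<le> 1 / \<delta>" using \<delta> by (intro lipschitz_exp_bound) auto
      then show ?thesis using False by simp
    qed
  qed simp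
  finally show ?thesis by (simp add: mult.assoc)
qed

lemma cexp_minus_one_bound:
  fixes \<eta> \<theta> x :: "real ^ 'n"
  assumes re: "0 \<le> \<eta> \<bullet> x + Re z * (\<theta> \<bullet> x)"
  shows "cmod (1 - exp (- of_real (\<eta> \<bullet> x) - z * of_real (\<theta> \<bullet> x))) \<le> (2 + norm \<eta> + cmod z * norm \<theta>) * min 1 (norm x)"
proof -
  define w where "w = - complex_of_real (\<eta> \<bullet> x) - z * of_real (\<theta> \<bullet> x)"
  have Rw: "Re w \<le> 0" using re by (simp add: w_def)
  have "cmod (exp w - 1) \<le> 2"
    using norm_triangle_ineq4[of "exp w" 1] Rw by (simp add: order_trans[of _ "exp (Re w) + 1"])
  moreover have "cmod (exp w - 1) \<le> (norm \<eta> + cmod z * norm \<theta>) * norm x"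
  proof -
    have "cmod (exp w - 1) \<le> cmod w" using cmod_exp_minus_1_le[OF Rw] by simp
    also have "\<dots> \<le> \<bar>\<eta> \<bullet> x\<bar> + cmod z * \<bar>\<theta> \<bullet> x\<bar>"
      unfolding w_def by (rule order_trans[OF norm_triangle_ineq4]) (simp add: norm_mult)
    also have "\<dots> \<le> norm \<eta> * norm x + cmod z * (norm \<theta> * norm x)"
      by (intro add_mono mult_left_mono Cauchy_Schwarz_ineq2) auto
    finally show ?thesis by (simp add: algebra_simps)
  qed
  moreover have "0 \<le> norm \<eta> + cmod z * norm \<theta>" by simp
  ultimately have "cmod (exp w - 1) \<le> (2 + (norm \<eta> + cmod z * norm \<theta>)) * min 1 (norm x)"
    by (cases "norm x \<le> 1") (auto simp: distrib_right intro: order_trans)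
  then show ?thesis by (simp add: w_def norm_minus_commute add.assoc)
qed

text \<open>For \<open>\<eta>\<close> in the interior of the orthant both sides extend holomorphically from real \<open>z\<close> near \<open>0\<close> to
  a vertical strip in \<open>z\<close>; evaluate at \<open>z = -i\<close> and let \<open>\<eta> \<rightarrow> 0\<close>.\<close>

lemma laplace_imp_cf:
  fixes X :: "'w \<Rightarrow> real ^ 'n" and Y :: "'a \<Rightarrow> real ^ 'n" and d :: "real ^ 'n" and c :: real
  assumes P: "prob_space M" and X [measurable]: "X \<in> borel_measurable M" "\<And>\<omega>. \<omega> \<in> space M \<Longrightarrow> X \<omega> \<in> orthant"
    and Y [measurable]: "Y \<in> borel_measurable N" "\<And>x. x \<in> space N \<Longrightarrow> Y x \<in> orthant"
    and Yint: "integrable N (\<lambda>x. min 1 (norm (Y x)))"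
    and lap: "\<And>\<eta>. \<eta> \<in> orthant \<Longrightarrow>
        (\<integral>\<omega>. exp (- (\<eta> \<bullet> X \<omega>)) \<partial>M) = exp (- c * (d \<bullet> \<eta> + (\<integral>x. 1 - exp (- (\<eta> \<bullet> Y x)) \<partial>N)))"
  shows "(\<integral>\<omega>. iexp (\<theta> \<bullet> X \<omega>) \<partial>M) = exp (of_real c * (\<i> * of_real (d \<bullet> \<theta>) + (\<integral>x. iexp (\<theta> \<bullet> Y x) - 1 \<partial>N)))"
proof -
  interpret P: prob_space M by fact
  define E where "E \<eta> z x = exp (- complex_of_real (\<eta> \<bullet> x) - z * of_real (\<theta> \<bullet> x))" for \<eta> z x
  have [measurable]: "E \<eta> z \<in> borel_measurable borel" for \<eta> z
    unfolding E_def by measurable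
  define F where "F \<eta> z = (\<integral>\<omega>. E \<eta> z (X \<omega>) \<partial>M)" for \<eta> z
  define G where "G \<eta> z = exp (- of_real c * (of_real (d \<bullet> \<eta>) + z * of_real (d \<bullet> \<theta>) + (\<integral>x. 1 - E \<eta> z (Y x) \<partial>N)))" for \<eta> z
  have Eder: "((\<lambda>z. E \<eta> z x) has_field_derivative (- of_real (\<theta> \<bullet> x) * E \<eta> z x)) (at z)" for \<eta> z x
    unfolding E_def by (auto intro!: derivative_eq_intros)
  have intY: "integrable N (\<lambda>x. 1 - E \<eta> z (Y x))" if "\<And>x. x \<in> orthant \<Longrightarrow> 0 \<le> \<eta> \<bullet> x + Re z * (\<theta> \<bullet> x)" for \<eta> z
    by (rule Bochner_Integration.integrable_bound[OF integrable_mult_right[OF Yint, of "2 + norm \<eta> + cmod z * norm \<theta>"]])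
       (auto intro!: AE_I2 order_trans[OF cexp_minus_one_bound] that Y simp: E_def)
  have intX: "integrable M (\<lambda>\<omega>. E \<eta> z (X \<omega>))" if *: "\<And>x. x \<in> orthant \<Longrightarrow> 0 \<le> \<eta> \<bullet> x + Re z * (\<theta> \<bullet> x)" for \<eta> z
  proof (rule P.integrable_const_bound[where B=1])
    show "AE \<omega> in M. norm (E \<eta> z (X \<omega>)) \<le> 1"
    proof (rule AE_I2)
      fix \<omega> assume "\<omega> \<in> space M"
      then have "0 \<le> \<eta> \<bullet> X \<omega> + Re z * (\<theta> \<bullet> X \<omega>)" by (intro * X)
      then show "norm (E \<eta> z (X \<omega>)) \<le> 1" by (simp add: E_def)
    qed
  qed measurable
  have FG: "F \<eta> (- \<i>) = G \<eta> (- \<i>)" if \<eta>: "\<And>i. 0 < \<eta> $ i" for \<eta>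
  proof -
    define \<delta> where "\<delta> = (MIN i. \<eta> $ i) / 2"
    have mn: "(MIN i. \<eta> $ i) \<le> \<eta> $ i" for i by (rule Min_le) auto
    have \<delta>: "0 < \<delta>" unfolding \<delta>_def using \<eta> by simp
    have \<delta>2: "2 * \<delta> \<le> \<eta> $ i" for i using mn[of i] by (simp add: \<delta>_def)
    \<comment> \<open>Each coordinate of eta is at least 2 delta, and |Re z| < epsilon moves it by
      at most delta, so at least delta remains throughout the strip S.\<close>
    define \<epsilon> where "\<epsilon> = \<delta> / (1 + norm \<theta>)"
    have \<epsilon>: "0 < \<epsilon>" using \<delta> by (simp add: \<epsilon>_def add_pos_nonneg)
    define S where "S = {z. Re z < \<epsilon>} \<inter> {z. - \<epsilon> < Re z}"
    have S: "open S" "convex S" unfolding S_def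
      using open_halfspace_Re_lt[of \<epsilon>] open_halfspace_Re_gt[of "-\<epsilon>"] convex_halfspace_Re_lt[of \<epsilon>] convex_halfspace_Re_gt[of "-\<epsilon>"]
      by (auto intro: convex_Int)
    have coord: "\<delta> \<le> \<eta> $ i + Re z * \<theta> $ i" if "z \<in> S" for z i
    proof -
      have "\<bar>Re z * \<theta> $ i\<bar> \<le> \<epsilon> * norm \<theta>"
        unfolding abs_mult using that component_le_norm_cart[of \<theta> i] \<epsilon> by (intro mult_mono) (auto simp: S_def)
      also have "\<dots> \<le> \<delta>"
        using \<delta> mult_left_mono[of "norm \<theta>" "1 + norm \<theta>" \<delta>] by (simp add: \<epsilon>_def divide_le_eq add_pos_nonneg)
      finally show ?thesis using \<delta>2[of i] by linarith
    qed
    have pos: "0 \<le> \<eta> \<bullet> x + Re z * (\<theta> \<bullet> x)" if "z \<in> S" "x \<in> orthant" for x z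
    proof -
      have "\<delta> * norm x \<le> (\<eta> + Re z *\<^sub>R \<theta>) \<bullet> x"
        using coord[OF that(1)] that(2) \<delta> by (intro orthant_inner_ge) auto
      moreover have "0 \<le> \<delta> * norm x" using \<delta> by simp
      ultimately show ?thesis by (simp add: inner_add_left)
    qed
    have Ebd: "cmod (- of_real (\<theta> \<bullet> x) * E \<eta> z x) \<le> norm \<theta> * max 1 (1 / \<delta>) * min 1 (norm x)"
      if "z \<in> S" "x \<in> orthant" for z x
      unfolding E_def using that by (intro cexp_linear_derivative_bound \<delta> coord)
    have DF: "(F \<eta> has_field_derivative (\<integral>\<omega>. - of_real (\<theta> \<bullet> X \<omega>) * E \<eta> z (X \<omega>) \<partial>M)) (at z)" if z: "z \<in> S" for z
      unfolding F_def
    proof (rule has_field_derivative_integral[OF S z, where h="\<lambda>_. norm \<theta> * max 1 (1 / \<delta>) * 1"])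
      show "norm (- of_real (\<theta> \<bullet> X \<omega>) * E \<eta> w (X \<omega>)) \<le> norm \<theta> * max 1 (1 / \<delta>) * 1" if "w \<in> S" "\<omega> \<in> space M" for w \<omega>
        by (rule order_trans[OF Ebd[OF that(1) X(2)[OF that(2)]]]) (intro mult_left_mono, auto)
      show "((\<lambda>w. E \<eta> w (X \<omega>)) has_field_derivative - of_real (\<theta> \<bullet> X \<omega>) * E \<eta> w (X \<omega>)) (at w)" for w \<omega>
        by (rule Eder)
    qed (auto intro!: intX pos)
    have DI: "((\<lambda>z. \<integral>x. 1 - E \<eta> z (Y x) \<partial>N) has_field_derivative (\<integral>x. - (- of_real (\<theta> \<bullet> Y x) * E \<eta> z (Y x)) \<partial>N)) (at z)" if z: "z \<in> S" for z
    proof (rule has_field_derivative_integral[OF S z, where h="\<lambda>x. norm \<theta> * max 1 (1 / \<delta>) * min 1 (norm (Y x))"])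
      show "((\<lambda>w. 1 - E \<eta> w (Y x)) has_field_derivative - (- of_real (\<theta> \<bullet> Y x) * E \<eta> w (Y x))) (at w)" for w x
        using DERIV_diff[OF DERIV_const[of 1] Eder[of \<eta> "Y x" w]] by simp
      show "norm (- (- of_real (\<theta> \<bullet> Y x) * E \<eta> w (Y x))) \<le> norm \<theta> * max 1 (1 / \<delta>) * min 1 (norm (Y x))" if "w \<in> S" "x \<in> space N" for w x
        using Ebd[OF that(1) Y(2)[OF that(2)]] by (simp only: norm_minus_cancel)
      show "integrable N (\<lambda>x. norm \<theta> * max 1 (1 / \<delta>) * min 1 (norm (Y x)))"
        by (intro integrable_mult_right Yint)
      show "integrable N (\<lambda>x. 1 - E \<eta> w (Y x))" if "w \<in> S" for w
        by (rule intY) (rule pos[OF that])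
    qed measurable
    have hol: "(\<lambda>z. F \<eta> z - G \<eta> z) holomorphic_on S"
    proof (intro holomorphic_intros)
      show "F \<eta> holomorphic_on S"
        using DF S(1) holomorphic_on_open by blast
      have "(\<lambda>z. \<integral>x. 1 - E \<eta> z (Y x) \<partial>N) holomorphic_on S"
        using DI S(1) holomorphic_on_open by blast
      then show "G \<eta> holomorphic_on S"
        unfolding G_def by (intro holomorphic_intros)
    qed
    have real_eq: "F \<eta> (of_real s) - G \<eta> (of_real s) = 0" if s: "complex_of_real s \<in> S" for s
    proof -
      have o: "\<eta> + s *\<^sub>R \<theta> \<in> orthant"
        using coord[OF s] \<delta> by (auto simp: orthant_def intro: order_trans[of 0 \<delta>])
      have Er: "E \<eta> (of_real s) x = of_real (exp (- ((\<eta> + s *\<^sub>R \<theta>) \<bullet> x)))" for x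
        unfolding E_def exp_of_real[symmetric] by (simp add: inner_add_left)
      have "F \<eta> (of_real s) = of_real (\<integral>\<omega>. exp (- ((\<eta> + s *\<^sub>R \<theta>) \<bullet> X \<omega>)) \<partial>M)"
        unfolding F_def Er by (rule integral_complex_of_real)
      also have "\<dots> = of_real (exp (- c * (d \<bullet> (\<eta> + s *\<^sub>R \<theta>) + (\<integral>x. 1 - exp (- ((\<eta> + s *\<^sub>R \<theta>) \<bullet> Y x)) \<partial>N))))"
        by (subst lap[OF o]) simp
      also have "\<dots> = G \<eta> (of_real s)"
      proof -
        have "(\<integral>x. 1 - E \<eta> (of_real s) (Y x) \<partial>N) = (\<integral>x. complex_of_real (1 - exp (- ((\<eta> + s *\<^sub>R \<theta>) \<bullet> Y x))) \<partial>N)"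
          unfolding Er by simp
        also have "\<dots> = of_real (\<integral>x. 1 - exp (- ((\<eta> + s *\<^sub>R \<theta>) \<bullet> Y x)) \<partial>N)"
          by (rule integral_complex_of_real)
        finally show ?thesis
          unfolding G_def exp_of_real[symmetric] by (simp add: inner_add_right)
      qed
      finally show ?thesis by simp
    qed
    have "F \<eta> (- \<i>) - G \<eta> (- \<i>) = 0"
    proof (rule analytic_continuation[OF hol S(1) convex_connected[OF S(2)]])
      show "of_real ` {- \<epsilon> <..< \<epsilon>} \<subseteq> S" by (auto simp: S_def)
      show "0 \<in> S" "- \<i> \<in> S" using \<epsilon> by (auto simp: S_def)
      show "0 islimpt complex_of_real ` {- \<epsilon> <..< \<epsilon>}"
        unfolding islimpt_approachable
      proof (intro allI impI)
        fix e :: real assume e: "0 < e"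
        define t where "t = min \<epsilon> e / 2"
        have "0 < t" "t < \<epsilon>" "t < e" using \<epsilon> e by (auto simp: t_def)
        then show "\<exists>x'\<in>complex_of_real ` {- \<epsilon> <..< \<epsilon>}. x' \<noteq> 0 \<and> dist x' 0 < e"
          by (intro bexI[of _ "of_real t"]) auto
      qed
      fix z assume "z \<in> complex_of_real ` {- \<epsilon> <..< \<epsilon>}"
      then obtain s where s: "z = of_real s" "- \<epsilon> < s" "s < \<epsilon>" by auto
      then show "F \<eta> z - G \<eta> z = 0" using real_eq[of s] by (simp add: S_def)
    qed
    then show ?thesis by simp
  qed
  \<comment> \<open>Interior points of the orthant tending to 0. At z = - i the integrand has
    modulus exp (- h . x) <= 1, so the majorants involve no delta and can be taken uniform in
    k.\<close>
  define h where "h k = ((\<chi> i. inverse (real (Suc k))) :: real ^ 'n)" for k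
  have h0: "h \<longlonglongrightarrow> 0"
    unfolding h_def by (rule vec_tendstoI) (simp add: LIMSEQ_inverse_real_of_nat del: of_nat_Suc)
  have hpos: "0 < h k $ i" for k i by (simp add: h_def)
  have horth: "h k \<in> orthant" for k by (simp add: orthant_def h_def)
  have re: "0 \<le> h k \<bullet> x + Re (- \<i>) * (\<theta> \<bullet> x)" if "x \<in> orthant" for k x
    using inner_orthant_nonneg[OF that horth] by simp
  have E0: "E 0 (- \<i>) x = iexp (\<theta> \<bullet> x)" for x by (simp add: E_def)
  have Elim: "(\<lambda>k. E (h k) (- \<i>) x) \<longlonglongrightarrow> iexp (\<theta> \<bullet> x)" for x
    unfolding E0[symmetric] unfolding E_def by (intro tendsto_intros h0)
  have hn: "norm (h k) \<le> real CARD('n)" for k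
  proof -
    have "norm (h k) \<le> (\<Sum>i\<in>UNIV. \<bar>h k $ i\<bar>)" by (rule norm_le_l1_cart)
    also have "\<dots> \<le> (\<Sum>i\<in>(UNIV :: 'n set). 1)" by (rule sum_mono) (simp add: h_def field_simps)
    finally show ?thesis by simp
  qed
  have limF: "(\<lambda>k. F (h k) (- \<i>)) \<longlonglongrightarrow> (\<integral>\<omega>. iexp (\<theta> \<bullet> X \<omega>) \<partial>M)"
    unfolding F_def
  proof (rule integral_dominated_convergence[where w="\<lambda>_. 1"])
    show "AE \<omega> in M. (\<lambda>k. E (h k) (- \<i>) (X \<omega>)) \<longlonglongrightarrow> iexp (\<theta> \<bullet> X \<omega>)" by (intro AE_I2 Elim)
    show "AE \<omega> in M. norm (E (h k) (- \<i>) (X \<omega>)) \<le> 1" for k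
      using re[OF X(2)] by (intro AE_I2) (auto simp: E_def)
  qed auto
  have limI: "(\<lambda>k. \<integral>x. 1 - E (h k) (- \<i>) (Y x) \<partial>N) \<longlonglongrightarrow> (\<integral>x. 1 - iexp (\<theta> \<bullet> Y x) \<partial>N)"
  proof (rule integral_dominated_convergence[where w="\<lambda>x. (2 + real CARD('n) + norm \<theta>) * min 1 (norm (Y x))"])
    show "AE x in N. (\<lambda>k. 1 - E (h k) (- \<i>) (Y x)) \<longlonglongrightarrow> 1 - iexp (\<theta> \<bullet> Y x)"
      by (intro AE_I2 tendsto_intros Elim)
    show "AE x in N. norm (1 - E (h k) (- \<i>) (Y x)) \<le> (2 + real CARD('n) + norm \<theta>) * min 1 (norm (Y x))" for k
    proof (rule AE_I2)
      fix x assume "x \<in> space N"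
      then have "norm (1 - E (h k) (- \<i>) (Y x)) \<le> (2 + norm (h k) + cmod (- \<i>) * norm \<theta>) * min 1 (norm (Y x))"
        unfolding E_def by (intro cexp_minus_one_bound re Y)
      also have "\<dots> \<le> (2 + real CARD('n) + norm \<theta>) * min 1 (norm (Y x))"
        using hn[of k] by (intro mult_right_mono) auto
      finally show "norm (1 - E (h k) (- \<i>) (Y x)) \<le> (2 + real CARD('n) + norm \<theta>) * min 1 (norm (Y x))" .
    qed
    show "integrable N (\<lambda>x. (2 + real CARD('n) + norm \<theta>) * min 1 (norm (Y x)))"
      by (intro integrable_mult_right Yint)
  qed measurable
  have limG: "(\<lambda>k. G (h k) (- \<i>)) \<longlonglongrightarrow> exp (- of_real c * (of_real (d \<bullet> 0) + (- \<i>) * of_real (d \<bullet> \<theta>) + (\<integral>x. 1 - iexp (\<theta> \<bullet> Y x) \<partial>N)))"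
    unfolding G_def by (intro tendsto_intros h0 limI)
  have "(\<lambda>k. F (h k) (- \<i>)) = (\<lambda>k. G (h k) (- \<i>))" using FG[OF hpos] by auto
  then have "(\<integral>\<omega>. iexp (\<theta> \<bullet> X \<omega>) \<partial>M) = exp (- of_real c * (of_real (d \<bullet> 0) + (- \<i>) * of_real (d \<bullet> \<theta>) + (\<integral>x. 1 - iexp (\<theta> \<bullet> Y x) \<partial>N)))"
    using limF limG LIMSEQ_unique by metis
  also have "(\<integral>x. 1 - iexp (\<theta> \<bullet> Y x) \<partial>N) = - (\<integral>x. iexp (\<theta> \<bullet> Y x) - 1 \<partial>N)"
    by (subst integral_minus[symmetric]) simp
  finally show ?thesis by (simp add: algebra_simps)
qed

section \<open>Images restricted to the punctured space\<close>

text \<open>Levy measures live on the punctured space, but an image may charge the origin, for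
  instance when a degenerate B stays at 0. The restriction drops that mass, which integrands
  vanishing at 0 do not see.\<close>

definition star_image :: "'a measure \<Rightarrow> ('a \<Rightarrow> real ^ 'n) \<Rightarrow> (real ^ 'n) measure" where
  "star_image N Y = restrict_space (distr N borel Y) (- {0})"

lemma sets_star_image [simp]: "sets (star_image N Y) = sets borel_star"
  unfolding star_image_def borel_star_def by (rule sets_restrict_space_cong) simp

lemma space_star_image [simp]: "space (star_image N Y) = - {0}"
  by (simp add: star_image_def space_restrict_space)

lemma sets_borel_starD: "C \<in> sets borel_star \<Longrightarrow> C \<in> sets borel \<and> 0 \<notin> C"
  by (auto simp: borel_star_def sets_restrict_space)

lemma nn_integral_star_image:
  assumes [measurable]: "Y \<in> borel_measurable N" "f \<in> borel_measurable borel" and f0: "f 0 = 0"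
  shows "(\<integral>\<^sup>+x. f x \<partial>star_image N Y) = (\<integral>\<^sup>+x. f (Y x) \<partial>N)"
proof -
  have "(\<integral>\<^sup>+x. f x \<partial>star_image N Y) = (\<integral>\<^sup>+x. f x * indicator (- {0}) x \<partial>distr N borel Y)"
    unfolding star_image_def by (rule nn_integral_restrict_space) simp
  also have "\<dots> = (\<integral>\<^sup>+x. f x \<partial>distr N borel Y)"
    by (intro nn_integral_cong) (auto simp: indicator_def f0)
  finally show ?thesis by (simp add: nn_integral_distr)
qed

lemma integral_star_image:
  fixes f :: "real ^ 'n \<Rightarrow> 'b::{banach,second_countable_topology}"
  assumes [measurable]: "Y \<in> borel_measurable N" "f \<in> borel_measurable borel" and f0: "f 0 = 0"
  shows "integrable (star_image N Y) f \<longleftrightarrow> integrable N (\<lambda>x. f (Y x))"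
    and "(\<integral>x. f x \<partial>star_image N Y) = (\<integral>x. f (Y x) \<partial>N)"
proof -
  have i: "indicator (- {0}) x *\<^sub>R f x = f x" for x using f0 by (auto simp: indicator_def)
  have "integrable (star_image N Y) f \<longleftrightarrow> integrable (distr N borel Y) (\<lambda>x. indicator (- {0}) x *\<^sub>R f x)"
    unfolding star_image_def by (rule integrable_restrict_space) simp
  then show "integrable (star_image N Y) f \<longleftrightarrow> integrable N (\<lambda>x. f (Y x))"
    unfolding i by (simp add: integrable_distr_eq)
  have "(\<integral>x. f x \<partial>star_image N Y) = (\<integral>x. indicator (- {0}) x *\<^sub>R f x \<partial>distr N borel Y)"
    unfolding star_image_def by (rule integral_restrict_space) simp
  then show "(\<integral>x. f x \<partial>star_image N Y) = (\<integral>x. f (Y x) \<partial>N)"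
    unfolding i by (simp add: integral_distr)
qed

lemma levy_measure_star_image:
  assumes [measurable]: "Y \<in> borel_measurable N" and i: "integrable N (\<lambda>x. min 1 ((norm (Y x))\<^sup>2))"
  shows "levy_measure (star_image N Y)"
  unfolding levy_measure_def using i
  by (subst nn_integral_star_image) (auto simp: integrable_iff_bounded)

text \<open>At a single time the exponent is determined only modulo 2 pi i. At t = 1 / |a - b| the
  number t (a - b) would be a multiple of 2 pi i of modulus 1, which does not exist.\<close>

lemma exp_scale_unique:
  fixes a b :: complex
  assumes "\<And>t. 0 \<le> t \<Longrightarrow> exp (of_real t * a) = exp (of_real t * b)"
  shows "a = b"
proof (rule ccontr)
  assume "a \<noteq> b"
  define t where "t = 1 / cmod (a - b)"
  have t: "0 < t" using \<open>a \<noteq> b\<close> by (simp add: t_def)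
  have "exp (of_real t * (a - b)) = 1"
    using assms[of t] t by (simp add: right_diff_distrib exp_diff)
  then obtain n :: int where re: "Re (of_real t * (a - b)) = 0" and im: "Im (of_real t * (a - b)) = of_int (2 * n) * pi"
    unfolding exp_eq_1 by blast
  have nm: "cmod (of_real t * (a - b)) = 1" using \<open>a \<noteq> b\<close> by (simp add: t_def norm_mult norm_divide)
  then have "\<bar>of_int (2 * n) * pi\<bar> = 1"
    using re im by (simp add: cmod_eq_Im)
  then have "\<bar>real_of_int (2 * n)\<bar> * pi = 1" by (simp add: abs_mult)
  moreover have "n \<noteq> 0" using calculation by auto
  then have "1 \<le> \<bar>real_of_int (2 * n)\<bar>" by linarith
  then have "1 * pi \<le> \<bar>real_of_int (2 * n)\<bar> * pi" by (intro mult_right_mono) auto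
  ultimately show False using pi_gt3 by linarith
qed

context thorin
begin

definition jump :: "(real ^ 'n) \<times> real \<Rightarrow> real ^ 'n" where
  "jump = (\<lambda>(u, g). g *\<^sub>R u)"

lemma jump_measurable_borel: "jump \<in> borel_measurable (borel \<Otimes>\<^sub>M borel)"
  unfolding jump_def case_prod_beta by measurable

lemmas jump_measurable [measurable] = measurable_mix[OF jump_measurable_borel]

lemma jump_orthant: "x \<in> space (thorin_mix U) \<Longrightarrow> jump x \<in> orthant_star"
  by (auto simp: space_mix jump_def orthant_star_def orthant_def)

lemma jump_integrable: "integrable (thorin_mix U) (\<lambda>x. min 1 (norm (jump x)))"
proof -
  have "integrable (thorin_mix U) (\<lambda>x. min 1 (norm (jump x))) \<longleftrightarrow> integrable (thorin_mix U) (\<lambda>x. min 1 (snd x * norm (fst x)))"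
    by (rule Bochner_Integration.integrable_cong[OF refl]) (auto simp: space_mix jump_def)
  then show ?thesis using mix_integrable_min by simp
qed

lemma jump_integrable_bound:
  fixes f :: "(real ^ 'n) \<times> real \<Rightarrow> 'b::{banach,second_countable_topology}"
  assumes "f \<in> borel_measurable (thorin_mix U)" and "\<And>x. x \<in> space (thorin_mix U) \<Longrightarrow> norm (f x) \<le> K * min 1 (norm (jump x))"
  shows "integrable (thorin_mix U) f"
  by (rule Bochner_Integration.integrable_bound[OF integrable_mult_right[OF jump_integrable, of K]])
     (auto intro!: AE_I2 order_trans[OF assms(2)] assms(1))

text \<open>Frullani read backwards: the logarithm is the integral of 1 - exp (- g (eta . u))
  against the gamma Levy measure with rate |u|^2.\<close>

lemma ggc_log_integral:
  assumes \<eta>: "\<eta> \<in> orthant"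
  shows "(\<integral>u. ln (((norm u)\<^sup>2 + \<eta> \<bullet> u) / (norm u)\<^sup>2) \<partial>U) = (\<integral>x. 1 - exp (- (\<eta> \<bullet> jump x)) \<partial>thorin_mix U)"
proof -
  have int: "integrable (thorin_mix U) (\<lambda>x. 1 - exp (- (\<eta> \<bullet> jump x)))"
  proof (rule jump_integrable_bound[where K="1 + norm \<eta>"])
    fix x assume "x \<in> space (thorin_mix U)"
    then have j: "jump x \<in> orthant" using jump_orthant by (auto simp: orthant_star_def)
    have nn: "0 \<le> \<eta> \<bullet> jump x" by (rule inner_orthant_nonneg[OF j \<eta>])
    have "1 - exp (- (\<eta> \<bullet> jump x)) \<le> \<eta> \<bullet> jump x" using exp_ge_add_one_self[of "- (\<eta> \<bullet> jump x)"] by linarith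
    also have "\<dots> \<le> norm \<eta> * norm (jump x)" by (rule norm_cauchy_schwarz)
    finally have 1: "1 - exp (- (\<eta> \<bullet> jump x)) \<le> norm \<eta> * norm (jump x)" .
    have "1 - exp (- (\<eta> \<bullet> jump x)) \<le> (1 + norm \<eta>) * min 1 (norm (jump x))"
    proof (cases "norm (jump x) \<le> 1")
      case True then show ?thesis using 1 by (simp add: distrib_right add_increasing)
    next
      case False
      have "1 - exp (- (\<eta> \<bullet> jump x)) \<le> 1" by simp
      also have "1 \<le> 1 + norm \<eta>" by simp
      finally show ?thesis using False by simp
    qed
    then show "norm (1 - exp (- (\<eta> \<bullet> jump x))) \<le> (1 + norm \<eta>) * min 1 (norm (jump x))" using nn by simp
  qed measurable
  show ?thesis
    unfolding mix_fubini(2)[OF int]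
  proof (rule Bochner_Integration.integral_cong[OF refl])
    fix u assume "u \<in> space U"
    then have u: "u \<noteq> 0" "u \<in> orthant" by (auto simp: space_thorin[OF U] orthant_star_def)
    have "(\<integral>g. (exp (- (norm u)\<^sup>2 * g) / g) * (1 - exp (- g * (\<eta> \<bullet> u))) \<partial>pos_lborel) = ln (((norm u)\<^sup>2 + \<eta> \<bullet> u) / (norm u)\<^sup>2)"
      using u \<eta> by (intro frullani_real(2)) (auto intro: inner_orthant_nonneg)
    then show "ln (((norm u)\<^sup>2 + \<eta> \<bullet> u) / (norm u)\<^sup>2)
        = (\<integral>g. (exp (- (norm u)\<^sup>2 * g) / g) *\<^sub>R (1 - exp (- (\<eta> \<bullet> jump (u, g)))) \<partial>pos_lborel)"
      by (simp add: jump_def)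
  qed
qed

text \<open>Both descriptions of T give its characteristic function at every t >= 0, so the two
  exponents coincide. This determines the Levy measure, hence also the compensator on the unit ball,
  and what is left of the linear term is the drift.\<close>

theorem thorin_subordinator_unique:
  assumes S: "subordinator_law MT T d' \<T>" and G: "ggc_subordinator MT T d U"
  shows "d' = d" and "\<T> = star_image (thorin_mix U) jump"
proof -
  let ?T = "star_image (thorin_mix U) jump"
  have L: "levy_process MT T" using G by (simp add: ggc_subordinator_def subordinator_def)
  then interpret P: prob_space MT by (simp add: levy_process_def)
  have nonneg: "AE \<omega> in MT. T t \<omega> \<in> orthant" if t: "0 \<le> t" for t
  proof -
    have "AE \<omega> in MT. \<forall>s t i. 0 \<le> s \<and> s \<le> t \<longrightarrow> T s \<omega> $ i \<le> T t \<omega> $ i"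
      using G by (simp add: ggc_subordinator_def subordinator_def)
    moreover have "AE \<omega> in MT. T 0 \<omega> = 0" using L by (simp add: levy_process_def)
    ultimately show ?thesis
    proof eventually_elim
      fix \<omega> assume mono: "\<forall>s t i. 0 \<le> s \<and> s \<le> t \<longrightarrow> T s \<omega> $ i \<le> T t \<omega> $ i" and "T 0 \<omega> = 0"
      then show "T t \<omega> \<in> orthant" using mono[rule_format, of 0 t] t by (simp add: orthant_def)
    qed
  qed
  have cf: "(\<integral>\<omega>. iexp (\<theta> \<bullet> T t \<omega>) \<partial>MT) = exp (of_real t * (\<i> * of_real (d \<bullet> \<theta>) + (\<integral>x. iexp (\<theta> \<bullet> jump x) - 1 \<partial>thorin_mix U)))"
    if t: "0 \<le> t" for t \<theta>
  proof -
    have [measurable]: "T t \<in> borel_measurable MT" using L t by (simp add: levy_process_def)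
    \<comment> \<open>T t lies in the orthant only almost surely; its positive part lies there
      everywhere, as \<open>laplace_imp_cf\<close> asks.\<close>
    define X where "X \<omega> = (\<chi> i. max 0 (T t \<omega> $ i))" for \<omega>
    have [measurable]: "X \<in> borel_measurable MT"
      unfolding X_def[abs_def] by (rule borel_measurable_vec_lambda) measurable
    have X: "AE \<omega> in MT. X \<omega> = T t \<omega>"
      using nonneg[OF t] by eventually_elim (auto simp: X_def orthant_def vec_eq_iff)
    have "(\<integral>\<omega>. iexp (\<theta> \<bullet> X \<omega>) \<partial>MT) = exp (of_real t * (\<i> * of_real (d \<bullet> \<theta>) + (\<integral>x. iexp (\<theta> \<bullet> jump x) - 1 \<partial>thorin_mix U)))"
    proof (rule laplace_imp_cf[OF P.prob_space_axioms])
      show "X \<omega> \<in> orthant" for \<omega> by (simp add: X_def orthant_def)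
      show "jump x \<in> orthant" if "x \<in> space (thorin_mix U)" for x
        using jump_orthant[OF that] by (simp add: orthant_star_def)
      show "integrable (thorin_mix U) (\<lambda>x. min 1 (norm (jump x)))" by (rule jump_integrable)
      fix \<eta> :: "real ^ 'n" assume \<eta>: "\<eta> \<in> orthant"
      have Xo: "0 \<le> \<eta> \<bullet> X \<omega>" for \<omega> using \<eta> by (intro inner_orthant_nonneg) (auto simp: X_def orthant_def)
      have eq: "(\<integral>\<omega>. exp (- (\<eta> \<bullet> X \<omega>)) \<partial>MT) = (\<integral>\<omega>. exp (- (\<eta> \<bullet> T t \<omega>)) \<partial>MT)"
        by (rule integral_cong_AE) (use X in \<open>auto\<close>)
      \<comment> \<open>Positivity of the expectation is what allows the Laplace transform to be
        recovered from its logarithm: exp inverts ln on positive reals.\<close>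
      have "integrable MT (\<lambda>\<omega>. exp (- (\<eta> \<bullet> X \<omega>)))"
        using Xo by (intro P.integrable_const_bound[where B=1]) auto
      then have "0 < (\<integral>\<omega>. exp (- (\<eta> \<bullet> X \<omega>)) \<partial>MT)"
        by (rule P.expectation_greater) simp
      moreover have "- ln (\<integral>\<omega>. exp (- (\<eta> \<bullet> T t \<omega>)) \<partial>MT) =
          t * (d \<bullet> \<eta>) + t * (\<integral>u. ln (((norm u)\<^sup>2 + \<eta> \<bullet> u) / (norm u)\<^sup>2) \<partial>U)"
        using G t \<eta> by (simp add: ggc_subordinator_def)
      ultimately have "(\<integral>\<omega>. exp (- (\<eta> \<bullet> X \<omega>)) \<partial>MT) = exp (- (t * (d \<bullet> \<eta>) + t * (\<integral>x. 1 - exp (- (\<eta> \<bullet> jump x)) \<partial>thorin_mix U)))"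
        unfolding ggc_log_integral[OF \<eta>] eq by (metis exp_ln minus_minus)
      then show "(\<integral>\<omega>. exp (- (\<eta> \<bullet> X \<omega>)) \<partial>MT) = exp (- t * (d \<bullet> \<eta> + (\<integral>x. 1 - exp (- (\<eta> \<bullet> jump x)) \<partial>thorin_mix U)))"
        by (simp add: algebra_simps)
    qed measurable
    also have "(\<integral>\<omega>. iexp (\<theta> \<bullet> X \<omega>) \<partial>MT) = (\<integral>\<omega>. iexp (\<theta> \<bullet> T t \<omega>) \<partial>MT)"
      by (rule integral_cong_AE) (use X in \<open>auto\<close>)
    finally show ?thesis .
  qed
  have [measurable]: "cball 0 1 \<in> sets (borel :: (real ^ 'n) measure)" by simp
  have sq: "min 1 (r\<^sup>2) \<le> min 1 r" if "0 \<le> r" for r :: real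
  proof (cases "r \<le> 1")
    case True
    then have "r\<^sup>2 \<le> r" using that mult_left_mono[of r 1 r] by (simp add: power2_eq_square)
    then show ?thesis by linarith
  qed simp
  have LT: "levy_measure ?T"
  proof (rule levy_measure_star_image[OF jump_measurable])
    show "integrable (thorin_mix U) (\<lambda>x. min 1 ((norm (jump x))\<^sup>2))"
    proof (rule jump_integrable_bound[where K=1])
      show "norm (min 1 ((norm (jump x))\<^sup>2)) \<le> 1 * min 1 (norm (jump x))" for x
        using sq[of "norm (jump x)"] by (simp only: real_norm_def mult_1) (simp add: abs_of_nonneg)
    qed measurable
  qed
  \<comment> \<open>The shift from the drift, which belongs to the zero truncation, to the location
    parameter for truncation on the unit ball. It converges because the small jumps are
    summable.\<close>
  define m where "m = (\<integral>x. indicator (cball 0 1) (jump x) *\<^sub>R jump x \<partial>thorin_mix U)"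
  have im: "integrable (thorin_mix U) (\<lambda>x. indicator (cball 0 1) (jump x) *\<^sub>R jump x)"
    by (rule jump_integrable_bound[where K=1]) (auto simp: indicator_def)
  have expo: "\<i> * of_real (d \<bullet> \<theta>) + (\<integral>x. iexp (\<theta> \<bullet> jump x) - 1 \<partial>thorin_mix U) = levy_exponent (d + m) 0 ?T \<theta>" for \<theta>
  proof -
    have bd: "cmod (iexp (\<theta> \<bullet> y) - 1) \<le> (2 + norm \<theta>) * min 1 (norm y)" for y :: "real ^ 'n"
      using cexp_minus_one_bound[of 0 y "- \<i>" \<theta>] by (simp add: norm_minus_commute)
    have ie: "integrable (thorin_mix U) (\<lambda>x. iexp (\<theta> \<bullet> jump x) - 1)"
      by (rule jump_integrable_bound[OF _ bd]) measurable
    have ic: "integrable (thorin_mix U) (\<lambda>x. complex_of_real (\<theta> \<bullet> (indicator (cball 0 1) (jump x) *\<^sub>R jump x)))"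
      by (intro integrable_of_real integrable_inner_right im)
    have "(\<integral>x. iexp (\<theta> \<bullet> x) - 1 - \<i> * of_real (\<theta> \<bullet> x) * indicator (cball 0 1) x \<partial>?T)
        = (\<integral>x. iexp (\<theta> \<bullet> jump x) - 1 - \<i> * of_real (\<theta> \<bullet> jump x) * indicator (cball 0 1) (jump x) \<partial>thorin_mix U)"
      by (rule integral_star_image(2)[OF jump_measurable levy_integrand_measurable]) simp
    also have "\<dots> = (\<integral>x. (iexp (\<theta> \<bullet> jump x) - 1) - \<i> * complex_of_real (\<theta> \<bullet> (indicator (cball 0 1) (jump x) *\<^sub>R jump x)) \<partial>thorin_mix U)"
      by (intro Bochner_Integration.integral_cong refl) (simp add: indicator_def)
    also have "\<dots> = (\<integral>x. iexp (\<theta> \<bullet> jump x) - 1 \<partial>thorin_mix U)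
        - \<i> * (\<integral>x. complex_of_real (\<theta> \<bullet> (indicator (cball 0 1) (jump x) *\<^sub>R jump x)) \<partial>thorin_mix U)"
      by (subst Bochner_Integration.integral_diff[OF ie integrable_mult_right[OF ic]]) (simp only: integral_mult_right_zero)
    also have "(\<integral>x. complex_of_real (\<theta> \<bullet> (indicator (cball 0 1) (jump x) *\<^sub>R jump x)) \<partial>thorin_mix U) = of_real (\<theta> \<bullet> m)"
      unfolding m_def integral_complex_of_real by (subst integral_inner_right) (use im in auto)
    finally show ?thesis
      by (simp add: levy_exponent_def qinner_sum inner_add_left inner_commute algebra_simps)
  qed
  have LL: "levy_law MT T (d' + (LINT t:cball 0 1|\<T>. t)) 0 \<T>" using S by (simp add: subordinator_law_def)
  have eq: "levy_exponent (d' + (LINT t:cball 0 1|\<T>. t)) 0 \<T> \<theta> = levy_exponent (d + m) 0 ?T \<theta>" for \<theta>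
  proof (rule exp_scale_unique)
    fix t :: real assume t: "0 \<le> t"
    show "exp (of_real t * levy_exponent (d' + (LINT t:cball 0 1|\<T>. t)) 0 \<T> \<theta>) = exp (of_real t * levy_exponent (d + m) 0 ?T \<theta>)"
      using LL cf[OF t, of \<theta>] t unfolding expo by (simp add: levy_law_def)
  qed
  have "levy_measure \<T>" using LL by (simp add: levy_law_def)
  then show T: "\<T> = ?T" by (rule levy_exponent_eq_imp_measure_eq[OF _ LT eq])
  have "(LINT t:cball 0 1|\<T>. t) = m"
    unfolding T set_lebesgue_integral_def m_def
    by (rule integral_star_image(2)[OF jump_measurable]) simp_all
  then have "(d' - d) \<bullet> \<theta> = 0" for \<theta>
    using eq[of \<theta>] unfolding T by (simp add: levy_exponent_def inner_add_left inner_diff_left)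
  from this[of "d' - d"] show "d' = d" by simp
qed

end

section \<open>The density of the variance-gamma Levy measure\<close>

text \<open>A vector on which a semidefinite form vanishes is orthogonal to everything for that
  form, hence lies in the kernel, and the kernel of an invertible matrix is trivial.\<close>

lemma covariance_matrix_pd:
  assumes A: "covariance_matrix A" and inv: "invertible A" and x: "x \<noteq> 0"
  shows "0 < qinner A x x"
proof (rule ccontr)
  have sym: "transpose A = A" and psd: "\<And>y. 0 \<le> qinner A y y" using A by (auto simp: covariance_matrix_def)
  assume "\<not> 0 < qinner A x x"
  then have x0: "qinner A x x = 0" using psd[of x] by simp
  have "qinner A x y = 0" for y
  proof (rule ccontr)
    assume xy: "qinner A x y \<noteq> 0"
    define q where "q = qinner A y y"
    \<comment> \<open>Chosen so that the cross term equals - (q + 1); the form then takes the value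
      - 1 at y + s x.\<close>
    define s where "s = - (q + 1) / (2 * qinner A x y)"
    have "qinner A (y + s *\<^sub>R x) (y + s *\<^sub>R x) = q + 2 * s * qinner A x y + s\<^sup>2 * qinner A x x"
      using qinner_sym[OF sym, of x y] by (simp add: qinner_bilinear q_def power2_eq_square distrib_left)
    also have "\<dots> = - 1" using xy x0 by (simp add: s_def field_simps)
    finally show False using psd[of "y + s *\<^sub>R x"] by simp
  qed
  then have "x v* A = 0"
    unfolding qinner_def by (metis inner_eq_zero_iff)
  then have "A *v x = 0"
    by (metis sym transpose_matrix_vector)
  then show False using inv x
    by (metis invertible_def matrix_left_invertible_ker)
qed

text \<open>With delta the least u_j over J and v = u - delta on J, min (u_k) (u_l) = delta + min
  (v_k) (v_l) there. So u diamond Sigma acts on \<open>coord_space J\<close> as delta Sigma, which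
  is definite, plus the semidefinite v diamond Sigma.\<close>

lemma coord_posdef_diamond:
  fixes A :: "real ^ 'n ^ 'n"
  assumes A: "covariance_matrix A" and inv: "invertible A" and u: "u \<in> C_set J" and J: "J \<noteq> {}"
  shows "coord_posdef J (u \<diamond>\<^sub>m A)"
proof
  have sym: "transpose A = A" using A by (simp add: covariance_matrix_def)
  have Asym: "A $ i $ j = A $ j $ i" for i j
  proof -
    have "transpose A $ i $ j = A $ j $ i" by (simp add: transpose_def)
    then show ?thesis by (simp add: sym)
  qed
  have uJ: "0 < u $ j" if "j \<in> J" for j using u that by (simp add: C_set_def)
  have u0: "u $ j = 0" if "j \<notin> J" for j using u that by (simp add: C_set_def coord_space_def)
  have unn: "0 \<le> u $ j" for j using uJ[of j] u0[of j] by (cases "j \<in> J") auto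
  show "transpose (u \<diamond>\<^sub>m A) = u \<diamond>\<^sub>m A"
    using Asym by (simp add: transpose_def diamond_mat_def vec_eq_iff min.commute)
  show "(u \<diamond>\<^sub>m A) $ i $ j = 0" if "i \<notin> J" for i j
    using u0[OF that] unn[of j] by (simp add: diamond_mat_def min_def)
  fix x :: "real ^ 'n" assume x: "x \<in> coord_space J" "x \<noteq> 0"
  define \<delta> where "\<delta> = Min ((\<lambda>j. u $ j) ` J)"
  have \<delta>le: "\<delta> \<le> u $ j" if "j \<in> J" for j unfolding \<delta>_def using that by (intro Min_le) auto
  have \<delta>: "0 < \<delta>" unfolding \<delta>_def using J uJ by (subst Min_gr_iff) auto
  define v where "v = (\<chi> j. if j \<in> J then u $ j - \<delta> else 0)"
  have v: "v \<in> orthant" using \<delta>le by (simp add: v_def orthant_def)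
  have "(u \<diamond>\<^sub>m A) $ k $ l * (x $ k * x $ l) = \<delta> * (A $ k $ l * (x $ k * x $ l)) + (v \<diamond>\<^sub>m A) $ k $ l * (x $ k * x $ l)" for k l
  proof (cases "k \<in> J \<and> l \<in> J")
    case True
    then have "min (u $ k) (u $ l) = \<delta> + min (v $ k) (v $ l)" by (simp add: v_def min_def)
    then show ?thesis by (simp add: diamond_mat_def algebra_simps)
  next
    case False
    then show ?thesis using x(1) by (auto simp: coord_space_def)
  qed
  then have "qinner (u \<diamond>\<^sub>m A) x x = \<delta> * qinner A x x + qinner (v \<diamond>\<^sub>m A) x x"
    by (simp add: qinner_sum sum.distrib sum_distrib_left)
  moreover have "0 \<le> qinner (v \<diamond>\<^sub>m A) x x"
    using diamond_mat_psd[OF A v] by (simp add: covariance_matrix_def)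
  moreover have "0 < \<delta> * qinner A x x"
    using \<delta> covariance_matrix_pd[OF A inv x(2)] by simp
  ultimately show "0 < qinner (u \<diamond>\<^sub>m A) x x" by linarith
qed

context coord_posdef
begin

lemma cramer_inv_linear:
  "cramer_inv J S (x + y) = cramer_inv J S x + cramer_inv J S y"
  "cramer_inv J S (x - y) = cramer_inv J S x - cramer_inv J S y"
  "cramer_inv J S (r *\<^sub>R x) = r *\<^sub>R cramer_inv J S x"
proof -
  have e: "block_ext J S *v cramer_inv J S x = x" for x by (simp add: cramer_inv_eq)
  show "cramer_inv J S (x + y) = cramer_inv J S x + cramer_inv J S y"
    by (rule cramer_inv_eq[THEN iffD1, symmetric]) (simp add: matrix_vector_right_distrib e)
  show "cramer_inv J S (x - y) = cramer_inv J S x - cramer_inv J S y"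
    by (rule cramer_inv_eq[THEN iffD1, symmetric]) (simp add: matrix_vector_mult_diff_distrib e)
  show "cramer_inv J S (r *\<^sub>R x) = r *\<^sub>R cramer_inv J S x"
    by (rule cramer_inv_eq[THEN iffD1, symmetric]) (simp add: matrix_vector_mult_scaleR e)
qed

lemma cramer_inv_sym: "cramer_inv J S x \<bullet> y = cramer_inv J S y \<bullet> x"
proof -
  have e: "block_ext J S *v cramer_inv J S x = x" for x by (simp add: cramer_inv_eq)
  have "cramer_inv J S x \<bullet> y = qinner (block_ext J S) (cramer_inv J S x) (cramer_inv J S y)"
    by (simp add: qinner_matrix_vector e)
  also have "\<dots> = qinner (block_ext J S) (cramer_inv J S y) (cramer_inv J S x)"
    by (rule qinner_sym[OF block_sym])
  also have "\<dots> = cramer_inv J S y \<bullet> x" by (simp add: qinner_matrix_vector e)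
  finally show ?thesis .
qed

lemma cramer_inv_pos: "x \<noteq> 0 \<Longrightarrow> 0 < cramer_inv J S x \<bullet> x"
proof -
  assume x: "x \<noteq> 0"
  have e: "block_ext J S *v cramer_inv J S x = x" by (simp add: cramer_inv_eq)
  then have "cramer_inv J S x \<noteq> 0" using x by auto
  from block_pd[OF this] show ?thesis by (simp add: qinner_matrix_vector e)
qed

lemma cramer_inv_nonneg: "0 \<le> cramer_inv J S x \<bullet> x"
  using cramer_inv_pos[of x] by (cases "x = 0") auto

lemma scaled:
  assumes g: "0 < g"
  shows "coord_posdef J (g *\<^sub>R S)"
proof
  show "transpose (g *\<^sub>R S) = g *\<^sub>R S" using sym by (simp add: transpose_def vec_eq_iff)
  show "(g *\<^sub>R S) $ i $ j = 0" if "i \<notin> J" for i j using supp[OF that] by simp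
  have "qinner (g *\<^sub>R S) x x = g * qinner S x x" for x by (simp add: qinner_sum sum_distrib_left mult.assoc)
  then show "0 < qinner (g *\<^sub>R S) x x" if "x \<in> coord_space J" "x \<noteq> 0" for x using pd[OF that] g by simp
qed

lemma scaled_det: "det_on J (g *\<^sub>R S) = g ^ card J * det_on J S"
  unfolding det_on_def by (simp add: prod.distrib sum_distrib_left mult_ac)

text \<open>Restricted to \<open>coord_space J\<close> because the identity block of the extension
  does not scale with g.\<close>

lemma scaled_cramer_inv:
  assumes g: "0 < g" and y: "y \<in> coord_space J"
  shows "cramer_inv J (g *\<^sub>R S) y = (1 / g) *\<^sub>R cramer_inv J S y"
proof -
  interpret G: coord_posdef J "g *\<^sub>R S" by (rule scaled[OF g])
  define x where "x = cramer_inv J S y"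
  have x: "x \<in> coord_space J" unfolding x_def by (rule cramer_inv_coord[OF y])
  then have x': "(1 / g) *\<^sub>R x \<in> coord_space J" by (simp add: coord_space_def)
  have "block_ext J (g *\<^sub>R S) *v ((1 / g) *\<^sub>R x) = ((1 / g) *\<^sub>R x) v* (g *\<^sub>R S)"
    by (rule G.block_mult_coord[OF x'])
  also have "\<dots> = x v* S"
    using g by (simp add: vector_matrix_mult_def vec_eq_iff)
  also have "\<dots> = y"
    using block_mult_coord[OF x] cramer_inv_eq[of x y] by (simp add: x_def)
  finally show ?thesis using G.cramer_inv_eq x_def by metis
qed

end

lemma diamond_scaleR:
  assumes "0 \<le> g"
  shows "(g *\<^sub>R u) \<diamond>\<^sub>m A = g *\<^sub>R (u \<diamond>\<^sub>m A)" "(g *\<^sub>R u) \<diamond>\<^sub>v \<mu> = g *\<^sub>R (u \<diamond>\<^sub>v \<mu>)"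
  using min_mult_distrib_left[of g] assms by (simp_all add: vec_eq_iff diamond_vec_def diamond_mat_def)

lemma C_set_orthant: "u \<in> C_set J \<Longrightarrow> u \<in> orthant"
  unfolding C_set_def orthant_def coord_space_def by (auto, metis less_imp_le order_refl)

lemma C_set_nonzero: "u \<in> C_set J \<Longrightarrow> J \<noteq> {} \<Longrightarrow> u \<noteq> 0"
  by (auto simp: C_set_def)

text \<open>The Gaussian density of B(g u) with the powers of g taken out of the determinant and the
  inverse, so that the dependence on g is explicit for the later integration over g.\<close>

definition bm_density :: "real ^ 'n \<Rightarrow> real ^ 'n ^ 'n \<Rightarrow> 'n set \<Rightarrow> real ^ 'n \<Rightarrow> real \<Rightarrow> real ^ 'n \<Rightarrow> real" where
  "bm_density \<mu> A J u g y =
     1 / sqrt (2 * pi) ^ card J / sqrt (g ^ card J * det_on J (u \<diamond>\<^sub>m A))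
     * exp (- (1 / g) * (cramer_inv J (u \<diamond>\<^sub>m A) (y - g *\<^sub>R (u \<diamond>\<^sub>v \<mu>)) \<bullet> (y - g *\<^sub>R (u \<diamond>\<^sub>v \<mu>))) / 2)"

lemma brownian_law_density:
  fixes B :: "real \<Rightarrow> 'b \<Rightarrow> real ^ 'n"
  assumes B: "brownian_motion MB B \<mu> A" and A: "covariance_matrix A" and inv: "invertible A"
    and u: "u \<in> C_set J" and J: "J \<noteq> {}" and g: "0 < g"
  shows "distr MB borel (multi_time B (g *\<^sub>R u)) = density (coord_lborel J) (\<lambda>y. ennreal (bm_density \<mu> A J u g y))"
proof -
  interpret S: coord_posdef J "u \<diamond>\<^sub>m A" by (rule coord_posdef_diamond[OF A inv u J])
  interpret G: coord_posdef J "g *\<^sub>R (u \<diamond>\<^sub>m A)" by (rule S.scaled[OF g])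
  have L: "levy_process MB B" using B by (simp add: brownian_motion_def levy_law_def)
  then interpret P: prob_space MB by (simp add: levy_process_def)
  have gu: "g *\<^sub>R u \<in> orthant" using C_set_orthant[OF u] g by (simp add: orthant_def)
  note [measurable] = measurable_multi_time[OF L gu]
  have m: "g *\<^sub>R (u \<diamond>\<^sub>v \<mu>) \<in> coord_space J"
    using u by (simp add: C_set_def coord_space_def diamond_vec_def)
  let ?N = "density (coord_lborel J) (\<lambda>y. ennreal (1 / sqrt (2 * pi) ^ card J / sqrt (det_on J (g *\<^sub>R (u \<diamond>\<^sub>m A)))
     * exp (- (cramer_inv J (g *\<^sub>R (u \<diamond>\<^sub>m A)) (y - g *\<^sub>R (u \<diamond>\<^sub>v \<mu>)) \<bullet> (y - g *\<^sub>R (u \<diamond>\<^sub>v \<mu>))) / 2)))"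
  note N = G.coord_gaussian[OF m]
  interpret N: prob_space ?N by (rule N(1))
  interpret D: prob_space "distr MB borel (multi_time B (g *\<^sub>R u))" by (rule P.prob_space_distr) simp
  have "distr MB borel (multi_time B (g *\<^sub>R u)) = ?N"
  proof (rule measure_eqI_cf)
    show "finite_measure ?N" by (rule N.finite_measure_axioms)
    show "finite_measure (distr MB borel (multi_time B (g *\<^sub>R u)))" by (rule D.finite_measure_axioms)
    fix \<theta>
    have "(\<integral>x. iexp (\<theta> \<bullet> x) \<partial>distr MB borel (multi_time B (g *\<^sub>R u))) = (\<integral>\<omega>. iexp (\<theta> \<bullet> multi_time B (g *\<^sub>R u) \<omega>) \<partial>MB)"
      by (subst integral_distr) simp_all
    also have "\<dots> = (\<integral>y. iexp (\<theta> \<bullet> y) \<partial>?N)"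
      unfolding multi_time_cf[OF B gu] N(2) using g by (simp add: diamond_scaleR)
    finally show "(\<integral>x. iexp (\<theta> \<bullet> x) \<partial>distr MB borel (multi_time B (g *\<^sub>R u))) = (\<integral>y. iexp (\<theta> \<bullet> y) \<partial>?N)" .
  qed simp_all
  also have "?N = density (coord_lborel J) (\<lambda>y. ennreal (bm_density \<mu> A J u g y))"
  proof -
    \<comment> \<open>Scaling of the inverse is known on \<open>coord_space J\<close> only, so the
      two densities are compared there; \<open>coord_lborel J\<close> has no mass elsewhere.\<close>
    have AEc: "AE y in coord_lborel J. y \<in> coord_space J"
    proof -
      have "{y \<in> space borel. y \<in> coord_space J} \<in> sets (borel :: (real ^ 'n) measure)"
        unfolding coord_space_def by measurable
      then show ?thesis
        unfolding coord_lborel_def by (subst AE_distr_iff) simp_all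
    qed
    have bm: "(\<lambda>y. ennreal (bm_density \<mu> A J u g y)) \<in> borel_measurable (coord_lborel J)"
      and Nm: "(\<lambda>y. ennreal (1 / sqrt (2 * pi) ^ card J / sqrt (det_on J (g *\<^sub>R (u \<diamond>\<^sub>m A)))
     * exp (- (cramer_inv J (g *\<^sub>R (u \<diamond>\<^sub>m A)) (y - g *\<^sub>R (u \<diamond>\<^sub>v \<mu>)) \<bullet> (y - g *\<^sub>R (u \<diamond>\<^sub>v \<mu>))) / 2))) \<in> borel_measurable (coord_lborel J)"
    proof -
      have lin: "cramer_inv J M \<in> borel_measurable borel" if "coord_posdef J M" for M
      proof -
        interpret M: coord_posdef J M by fact
        have "linear (cramer_inv J M)" by (rule linearI) (simp_all add: M.cramer_inv_linear)
        then show ?thesis by (intro borel_measurable_continuous_onI linear_continuous_on) (simp add: linear_conv_bounded_linear)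
      qed
      note [measurable] = lin[OF S.coord_posdef_axioms] lin[OF G.coord_posdef_axioms]
      show "(\<lambda>y. ennreal (bm_density \<mu> A J u g y)) \<in> borel_measurable (coord_lborel J)"
        unfolding bm_density_def by measurable
      show "(\<lambda>y. ennreal (1 / sqrt (2 * pi) ^ card J / sqrt (det_on J (g *\<^sub>R (u \<diamond>\<^sub>m A)))
     * exp (- (cramer_inv J (g *\<^sub>R (u \<diamond>\<^sub>m A)) (y - g *\<^sub>R (u \<diamond>\<^sub>v \<mu>)) \<bullet> (y - g *\<^sub>R (u \<diamond>\<^sub>v \<mu>))) / 2))) \<in> borel_measurable (coord_lborel J)"
        by measurable
    qed
    show ?thesis
    proof (rule density_cong[OF Nm bm])
      show "AE y in coord_lborel J. ennreal (1 / sqrt (2 * pi) ^ card J / sqrt (det_on J (g *\<^sub>R (u \<diamond>\<^sub>m A)))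
     * exp (- (cramer_inv J (g *\<^sub>R (u \<diamond>\<^sub>m A)) (y - g *\<^sub>R (u \<diamond>\<^sub>v \<mu>)) \<bullet> (y - g *\<^sub>R (u \<diamond>\<^sub>v \<mu>))) / 2)) = ennreal (bm_density \<mu> A J u g y)"
        using AEc
      proof eventually_elim
        fix y :: "real ^ 'n" assume y: "y \<in> coord_space J"
        have "y - g *\<^sub>R (u \<diamond>\<^sub>v \<mu>) \<in> coord_space J" using y m by (simp add: coord_space_def)
        then show "ennreal (1 / sqrt (2 * pi) ^ card J / sqrt (det_on J (g *\<^sub>R (u \<diamond>\<^sub>m A)))
     * exp (- (cramer_inv J (g *\<^sub>R (u \<diamond>\<^sub>m A)) (y - g *\<^sub>R (u \<diamond>\<^sub>v \<mu>)) \<bullet> (y - g *\<^sub>R (u \<diamond>\<^sub>v \<mu>))) / 2)) = ennreal (bm_density \<mu> A J u g y)"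
          unfolding bm_density_def S.scaled_det by (subst S.scaled_cramer_inv[OF g]) simp_all
      qed
    qed
  qed
  finally show ?thesis .
qed

text \<open>\<open>vgg_nu\<close> with Cramer's formula in place of \<open>inv_on\<close>, which
  makes joint measurability in (u, y) provable entry by entry; the two agree for u in C_J and y in
  \<open>coord_space J\<close>.\<close>

definition vgg_nu_cramer :: "real ^ 'n \<Rightarrow> real ^ 'n ^ 'n \<Rightarrow> 'n set \<Rightarrow> real ^ 'n \<Rightarrow> real ^ 'n \<Rightarrow> real" where
  "vgg_nu_cramer \<mu> A J u y =
     2 / (2 * pi) powr (real (card J) / 2)
     * (exp (cramer_inv J (u \<diamond>\<^sub>m A) y \<bullet> (u \<diamond>\<^sub>v \<mu>))
        / (sqrt (det_on J (u \<diamond>\<^sub>m A)) * sqrt (cramer_inv J (u \<diamond>\<^sub>m A) y \<bullet> y) ^ card J))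
     * frak_K (real (card J) / 2)
         (sqrt (cramer_inv J (u \<diamond>\<^sub>m A) y \<bullet> y)
          * sqrt (2 * (norm u)\<^sup>2 + (sqrt (cramer_inv J (u \<diamond>\<^sub>m A) (u \<diamond>\<^sub>v \<mu>) \<bullet> (u \<diamond>\<^sub>v \<mu>)))\<^sup>2))"

lemma vgg_nu_eq_cramer:
  assumes A: "covariance_matrix A" and inv: "invertible A" and u: "u \<in> C_set J" and J: "J \<noteq> {}"
    and y: "y \<in> coord_space J"
  shows "vgg_nu \<mu> A J u y = vgg_nu_cramer \<mu> A J u y"
proof -
  interpret S: coord_posdef J "u \<diamond>\<^sub>m A" by (rule coord_posdef_diamond[OF A inv u J])
  have m: "u \<diamond>\<^sub>v \<mu> \<in> coord_space J"
    using u by (simp add: C_set_def coord_space_def diamond_vec_def)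
  show ?thesis
    unfolding vgg_nu_def vgg_nu_cramer_def norm_inv_on_def inner_inv_on_def S.inv_on_eq[OF y] S.inv_on_eq[OF m] ..
qed

text \<open>Expanding the Gaussian exponent around y moves the exponential of the cross term of y
  and u diamond mu out of the integral. What remains is a generalized inverse Gaussian integral in g
  of order #J / 2, with a the squared inverse norm of y and kappa twice |u|^2 plus the squared
  inverse norm of u diamond mu.\<close>

lemma vg_density_integral:
  assumes A: "covariance_matrix A" and inv: "invertible A" and u: "u \<in> C_set J" and J: "J \<noteq> {}"
    and y: "y \<noteq> 0"
  shows "(\<integral>\<^sup>+g. ennreal (exp (- (norm u)\<^sup>2 * g) / g) * ennreal (bm_density \<mu> A J u g y) \<partial>pos_lborel)
    = ennreal (vgg_nu_cramer \<mu> A J u y)"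
proof -
  interpret S: coord_posdef J "u \<diamond>\<^sub>m A" by (rule coord_posdef_diamond[OF A inv u J])
  define R where "R = cramer_inv J (u \<diamond>\<^sub>m A)"
  define m where "m = u \<diamond>\<^sub>v \<mu>"
  define k where "k = card J"
  define D where "D = det_on J (u \<diamond>\<^sub>m A)"
  define a where "a = R y \<bullet> y"
  define c where "c = R m \<bullet> m"
  define \<kappa> where "\<kappa> = 2 * (norm u)\<^sup>2 + c"
  define Cst where "Cst = 1 / sqrt (2 * pi) ^ k / sqrt D * exp (R y \<bullet> m)"
  have D: "0 < D" by (simp add: D_def S.det_pos)
  have a: "0 < a" unfolding a_def R_def by (rule S.cramer_inv_pos[OF y])
  have c: "0 \<le> c" unfolding c_def R_def by (rule S.cramer_inv_nonneg)
  have \<kappa>: "0 < \<kappa>" using C_set_nonzero[OF u J] c by (simp add: \<kappa>_def add_pos_nonneg)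
  have Cst: "0 \<le> Cst" using D by (simp add: Cst_def)
  have integrand: "exp (- (norm u)\<^sup>2 * g) / g * bm_density \<mu> A J u g y
      = Cst * (g powr (- 1 - real k / 2) * exp (- a / (2 * g) - g * \<kappa> / 2))" if g: "0 < g" for g
  proof -
    have q: "R (y - g *\<^sub>R m) \<bullet> (y - g *\<^sub>R m) = a - 2 * g * (R y \<bullet> m) + g\<^sup>2 * c"
      using S.cramer_inv_sym[of m y]
      by (simp add: R_def a_def c_def S.cramer_inv_linear inner_diff_left inner_diff_right power2_eq_square algebra_simps)
    have sg: "sqrt (g ^ k * D) = g powr (real k / 2) * sqrt D"
      using g by (simp add: real_sqrt_mult powr_half_sqrt[symmetric] powr_powr powr_realpow[symmetric])
    have "1 / g / g powr (real k / 2) = g powr (- 1 - real k / 2)"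
      using g by (simp only: powr_diff powr_neg_one)
    moreover have "exp (- (norm u)\<^sup>2 * g) * exp (- (1 / g) * (a - 2 * g * (R y \<bullet> m) + g\<^sup>2 * c) / 2)
        = exp (R y \<bullet> m) * exp (- a / (2 * g) - g * \<kappa> / 2)"
    proof -
      have "- (norm u)\<^sup>2 * g + - (1 / g) * (a - 2 * g * (R y \<bullet> m) + g\<^sup>2 * c) / 2 = R y \<bullet> m + (- a / (2 * g) - g * \<kappa> / 2)"
        using g by (simp add: \<kappa>_def field_simps power2_eq_square)
      then show ?thesis by (simp only: exp_add[symmetric])
    qed
    moreover have "exp (- (norm u)\<^sup>2 * g) / g * bm_density \<mu> A J u g y
        = 1 / sqrt (2 * pi) ^ k / sqrt D * (1 / g / g powr (real k / 2))
          * (exp (- (norm u)\<^sup>2 * g) * exp (- (1 / g) * (a - 2 * g * (R y \<bullet> m) + g\<^sup>2 * c) / 2))"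
      unfolding bm_density_def k_def[symmetric] D_def[symmetric] R_def[symmetric] m_def[symmetric] q sg by simp
    ultimately show ?thesis by (simp add: Cst_def)
  qed
  have "(\<integral>\<^sup>+g. ennreal (exp (- (norm u)\<^sup>2 * g) / g) * ennreal (bm_density \<mu> A J u g y) \<partial>pos_lborel)
      = (\<integral>\<^sup>+g. ennreal Cst * ennreal (g powr (- 1 - real k / 2) * exp (- a / (2 * g) - g * \<kappa> / 2)) \<partial>pos_lborel)"
  proof (rule nn_integral_cong)
    fix g assume "g \<in> space pos_lborel"
    then have g: "0 < g" by simp
    have "ennreal (exp (- (norm u)\<^sup>2 * g) / g) * ennreal (bm_density \<mu> A J u g y)
        = ennreal (exp (- (norm u)\<^sup>2 * g) / g * bm_density \<mu> A J u g y)"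
      using g D by (intro ennreal_mult[symmetric]) (simp_all add: bm_density_def D_def)
    also have "\<dots> = ennreal Cst * ennreal (g powr (- 1 - real k / 2) * exp (- a / (2 * g) - g * \<kappa> / 2))"
      unfolding integrand[OF g] using Cst by (intro ennreal_mult) auto
    finally show "ennreal (exp (- (norm u)\<^sup>2 * g) / g) * ennreal (bm_density \<mu> A J u g y)
        = ennreal Cst * ennreal (g powr (- 1 - real k / 2) * exp (- a / (2 * g) - g * \<kappa> / 2))" .
  qed
  also have "\<dots> = ennreal Cst * (\<integral>\<^sup>+g. ennreal (g powr (- 1 - real k / 2) * exp (- a / (2 * g) - g * \<kappa> / 2)) \<partial>pos_lborel)"
    by (rule nn_integral_cmult) (rule measurable_pos_lborel, measurable)
  also have "\<dots> = ennreal Cst * ennreal (2 * (\<kappa> / a) powr (real k / 2 / 2) * bessel_K (real k / 2) (sqrt (a * \<kappa>)))"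
    by (subst nn_integral_generalized_inverse_gaussian[OF a \<kappa>]) simp_all
  also have "\<dots> = ennreal (Cst * (2 * (\<kappa> / a) powr (real k / 2 / 2) * bessel_K (real k / 2) (sqrt (a * \<kappa>))))"
    using Cst by (intro ennreal_mult[symmetric]) (simp_all add: bessel_K_nonneg)
  also have "Cst * (2 * (\<kappa> / a) powr (real k / 2 / 2) * bessel_K (real k / 2) (sqrt (a * \<kappa>))) = vgg_nu_cramer \<mu> A J u y"
  proof -
    have r: "sqrt a * sqrt \<kappa> = sqrt (a * \<kappa>)" by (simp add: real_sqrt_mult)
    have ck: "2 * (norm u)\<^sup>2 + (sqrt c)\<^sup>2 = \<kappa>" using c by (simp add: \<kappa>_def)
    have tp: "(2 * pi) powr (real k / 2) = sqrt (2 * pi) ^ k"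
      by (simp add: powr_half_sqrt[symmetric] powr_powr powr_realpow[symmetric])
    \<comment> \<open>The power of kappa / a produced by the Bessel integral is the power r^(k/2)
      contained in \<open>frak_K\<close> divided by the k-th power of the inverse norm of y.\<close>
    have "(sqrt (a * \<kappa>)) powr (real k / 2) / sqrt a ^ k = (\<kappa> / a) powr (real k / 2 / 2)"
    proof -
      have "(sqrt (a * \<kappa>)) powr (real k / 2) = a powr (real k / 4) * \<kappa> powr (real k / 4)"
        using a \<kappa> by (simp add: powr_half_sqrt[symmetric] powr_powr powr_mult)
      moreover have "sqrt a ^ k = a powr (real k / 4) * a powr (real k / 4)"
        using a by (simp add: powr_half_sqrt[symmetric] powr_realpow[symmetric] powr_powr powr_add[symmetric])
      moreover have "(\<kappa> / a) powr (real k / 2 / 2) = \<kappa> powr (real k / 4) / a powr (real k / 4)"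
        using a \<kappa> by (simp add: powr_divide)
      ultimately show ?thesis using a by simp
    qed
    then have e: "(\<kappa> / a) powr (real k / 2 / 2) = (sqrt (a * \<kappa>)) powr (real k / 2) / sqrt a ^ k" ..
    show ?thesis
      unfolding vgg_nu_cramer_def frak_K_def R_def[symmetric] m_def[symmetric] D_def[symmetric] k_def[symmetric]
        a_def[symmetric] c_def[symmetric] ck r tp Cst_def e
      by (simp add: mult_ac)
  qed
  finally show ?thesis .
qed

section \<open>Joint measurability of the densities\<close>

lemma measurable_det:
  fixes f :: "'a \<Rightarrow> real ^ 'n ^ 'n"
  assumes [measurable]: "\<And>i j. (\<lambda>x. f x $ i $ j) \<in> borel_measurable M"
  shows "(\<lambda>x. det (f x)) \<in> borel_measurable M"
  unfolding det_def by measurable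

lemma measurable_det_on:
  fixes f :: "'a \<Rightarrow> real ^ 'n ^ 'n"
  assumes [measurable]: "\<And>i j. (\<lambda>x. f x $ i $ j) \<in> borel_measurable M"
  shows "(\<lambda>x. det_on J (f x)) \<in> borel_measurable M"
  unfolding det_on_def by measurable

lemma measurable_cramer_inv:
  fixes f :: "'a \<Rightarrow> real ^ 'n ^ 'n"
  assumes f [measurable]: "\<And>i j. (\<lambda>x. f x $ i $ j) \<in> borel_measurable M"
    and [measurable]: "y \<in> borel_measurable M"
  shows "(\<lambda>x. cramer_inv J (f x) (y x)) \<in> borel_measurable M"
  unfolding cramer_inv_def
proof (rule borel_measurable_vec_lambda, rule borel_measurable_divide)
  show "(\<lambda>x. det_on J (f x)) \<in> borel_measurable M" by (rule measurable_det_on) measurable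
  fix k
  show "(\<lambda>x. det (\<chi> i j. if j = k then y x $ i else block_ext J (f x) $ i $ j)) \<in> borel_measurable M"
  proof (rule measurable_det)
    fix i j
    show "(\<lambda>x. (\<chi> i j. if j = k then y x $ i else block_ext J (f x) $ i $ j) $ i $ j) \<in> borel_measurable M"
      by (cases "j = k"; cases "i \<in> J \<and> j \<in> J") (auto simp: block_ext_def)
  qed
qed

lemma measurable_diamond_mat_entry [measurable]:
  "(\<lambda>u :: real ^ 'n. (u \<diamond>\<^sub>m A) $ i $ j) \<in> borel_measurable borel"
  unfolding diamond_mat_def by simp

lemma measurable_diamond_vec [measurable]:
  "(\<lambda>u :: real ^ 'n. u \<diamond>\<^sub>v \<mu>) \<in> borel_measurable borel"
  unfolding diamond_vec_def by (rule borel_measurable_vec_lambda) measurable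

lemma borel_measurable_frak_K [measurable]: "frak_K \<rho> \<in> borel_measurable borel"
  unfolding frak_K_def[abs_def] by measurable

lemma measurable_vgg_nu_cramer:
  fixes A :: "real ^ 'n ^ 'n"
  shows "(\<lambda>(u, y). vgg_nu_cramer \<mu> A J u y) \<in> borel_measurable (borel \<Otimes>\<^sub>M borel)"
proof -
  have [measurable]: "(\<lambda>x :: (real ^ 'n) \<times> (real ^ 'n). (fst x \<diamond>\<^sub>m A) $ i $ j) \<in> borel_measurable (borel \<Otimes>\<^sub>M borel)" for i j
    by (rule measurable_compose[OF measurable_fst measurable_diamond_mat_entry])
  have [measurable]: "(\<lambda>x :: (real ^ 'n) \<times> (real ^ 'n). fst x \<diamond>\<^sub>v \<mu>) \<in> borel_measurable (borel \<Otimes>\<^sub>M borel)"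
    by (rule measurable_compose[OF measurable_fst measurable_diamond_vec])
  note [measurable] = measurable_cramer_inv measurable_det_on
  show ?thesis unfolding vgg_nu_cramer_def case_prod_beta by measurable
qed

lemma measurable_bm_density:
  fixes A :: "real ^ 'n ^ 'n"
  shows "(\<lambda>(g, y). bm_density \<mu> A J u g y) \<in> borel_measurable (borel \<Otimes>\<^sub>M borel)"
proof -
  have [measurable]: "(\<lambda>x :: real \<times> (real ^ 'n). cramer_inv J (u \<diamond>\<^sub>m A) (snd x - fst x *\<^sub>R (u \<diamond>\<^sub>v \<mu>))) \<in> borel_measurable (borel \<Otimes>\<^sub>M borel)"
    by (rule measurable_cramer_inv) measurable
  show ?thesis unfolding bm_density_def case_prod_beta by measurable
qed

lemma V_set_borel [measurable]:
  fixes J :: "'n::finite set"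
  shows "V_set J \<in> sets borel"
proof -
  have "{y \<in> space borel. (\<forall>i. i \<notin> J \<longrightarrow> y $ i = 0) \<and> (\<forall>j\<in>J. y $ j \<noteq> 0)} \<in> sets (borel :: (real ^ 'n) measure)"
    by measurable
  also have "{y \<in> space borel. (\<forall>i. i \<notin> J \<longrightarrow> y $ i = 0) \<and> (\<forall>j\<in>J. y $ j \<noteq> 0)} = V_set J"
    by (auto simp: V_set_def coord_space_def)
  finally show ?thesis .
qed

lemma C_set_borel [measurable]:
  fixes J :: "'n::finite set"
  shows "C_set J \<in> sets borel"
proof -
  have "{y \<in> space borel. (\<forall>i. i \<notin> J \<longrightarrow> y $ i = 0) \<and> (\<forall>j\<in>J. 0 < y $ j)} \<in> sets (borel :: (real ^ 'n) measure)"
    by measurable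
  also have "{y \<in> space borel. (\<forall>i. i \<notin> J \<longrightarrow> y $ i = 0) \<and> (\<forall>j\<in>J. 0 < y $ j)} = C_set J"
    by (auto simp: C_set_def coord_space_def)
  finally show ?thesis .
qed

text \<open>Each hyperplane a_j = 0 with j in J is Lebesgue null, and J is finite. This allows
  densities to be compared on V_J alone, in particular away from y = 0 where the inverse norm
  vanishes.\<close>

lemma AE_coord_lborel_V:
  fixes J :: "'a::finite set"
  shows "AE y in coord_lborel J. y \<in> V_set J"
proof -
  interpret product_sigma_finite "\<lambda>_::'a. lborel :: real measure" ..
  have "AE a in (\<Pi>\<^sub>M j\<in>J. lborel). \<forall>j\<in>J. (a j :: real) \<noteq> 0"
  proof (subst AE_ball_countable)
    show "\<forall>j\<in>J. AE a in (\<Pi>\<^sub>M j\<in>J. lborel). (a j :: real) \<noteq> 0"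
    proof
      fix j assume j: "j \<in> J"
      define X where "X = (\<Pi>\<^sub>E i\<in>J. if i = j then {0 :: real} else UNIV)"
      have "emeasure (\<Pi>\<^sub>M j\<in>J. lborel) X = (\<Prod>i\<in>J. emeasure lborel (if i = j then {0 :: real} else UNIV))"
        unfolding X_def by (rule emeasure_PiM) auto
      also have "\<dots> = 0"
        by (rule prod_zero) (use j in \<open>auto intro!: bexI[of _ j]\<close>)
      finally have "X \<in> null_sets (\<Pi>\<^sub>M j\<in>J. lborel)"
        unfolding X_def by (auto intro!: sets_PiM_I_finite)
      from AE_not_in[OF this] AE_space[of "\<Pi>\<^sub>M j\<in>J. (lborel :: real measure)"]
      show "AE a in (\<Pi>\<^sub>M j\<in>J. lborel). (a j :: real) \<noteq> 0"
        by eventually_elim (auto simp: X_def space_PiM PiE_iff split: if_splits)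
    qed
  qed simp
  then show ?thesis
    unfolding coord_lborel_def
    by (subst AE_distr_iff) (auto simp: V_set_def coord_emb_def coord_space_def elim!: eventually_mono)
qed

text \<open>Tonelli brings the integral over g inside, where \<open>vg_density_integral\<close>
  evaluates it at every y other than 0; as J is nonempty, y = 0 is a null set.\<close>

lemma vg_measure_density:
  fixes B :: "real \<Rightarrow> 'b \<Rightarrow> real ^ 'n"
  assumes B: "brownian_motion MB B \<mu> A" and A: "covariance_matrix A" and inv: "invertible A"
    and u: "u \<in> C_set J" and J: "J \<noteq> {}" and C [measurable]: "C \<in> sets borel"
  shows "(\<integral>\<^sup>+g. ennreal (exp (- (norm u)\<^sup>2 * g) / g) * emeasure (distr MB borel (multi_time B (g *\<^sub>R u))) C \<partial>pos_lborel)
    = (\<integral>\<^sup>+a. ennreal (vgg_nu_cramer \<mu> A J u (coord_emb J a)) * indicator C (coord_emb J a) \<partial>(\<Pi>\<^sub>M j\<in>J. lborel))"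
proof -
  interpret L: product_sigma_finite "\<lambda>_::'n. lborel :: real measure" ..
  interpret pair_sigma_finite pos_lborel "\<Pi>\<^sub>M j\<in>J. (lborel :: real measure)"
    using sigma_finite_pos_lborel L.sigma_finite[OF finite] by (rule pair_sigma_finite.intro)
  define w where "w g = ennreal (exp (- (norm u)\<^sup>2 * g) / g)" for g
  have [measurable]: "w \<in> borel_measurable pos_lborel"
    unfolding w_def by (rule measurable_pos_lborel) measurable
  note measurable_ident_pos_lborel [measurable]
  have bm2 [measurable]: "(\<lambda>x. bm_density \<mu> A J u (fst x) (coord_emb J (snd x))) \<in> borel_measurable (pos_lborel \<Otimes>\<^sub>M (\<Pi>\<^sub>M j\<in>J. lborel))"
  proof -
    have "(\<lambda>x. (fst x, coord_emb J (snd x))) \<in> pos_lborel \<Otimes>\<^sub>M (\<Pi>\<^sub>M j\<in>J. lborel) \<rightarrow>\<^sub>M borel \<Otimes>\<^sub>M borel"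
      by measurable
    from measurable_compose[OF this measurable_bm_density[of \<mu> A J u]] show ?thesis by simp
  qed
  have "(\<integral>\<^sup>+g. w g * emeasure (distr MB borel (multi_time B (g *\<^sub>R u))) C \<partial>pos_lborel)
      = (\<integral>\<^sup>+g. \<integral>\<^sup>+a. w g * ennreal (bm_density \<mu> A J u g (coord_emb J a)) * indicator C (coord_emb J a) \<partial>(\<Pi>\<^sub>M j\<in>J. lborel) \<partial>pos_lborel)"
  proof (rule nn_integral_cong)
    fix g assume "g \<in> space pos_lborel"
    then have g: "0 < g" by simp
    have bm1: "bm_density \<mu> A J u g \<in> borel_measurable borel"
      using measurable_compose[OF measurable_Pair1' measurable_bm_density[of \<mu> A J u], of g] by simp
    note [measurable] = bm1
    have "emeasure (distr MB borel (multi_time B (g *\<^sub>R u))) C = (\<integral>\<^sup>+y. ennreal (bm_density \<mu> A J u g y) * indicator C y \<partial>coord_lborel J)"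
      unfolding brownian_law_density[OF B A inv u J g] by (subst emeasure_density) simp_all
    also have "\<dots> = (\<integral>\<^sup>+a. ennreal (bm_density \<mu> A J u g (coord_emb J a)) * indicator C (coord_emb J a) \<partial>(\<Pi>\<^sub>M j\<in>J. lborel))"
      unfolding coord_lborel_def by (subst nn_integral_distr) simp_all
    finally show "w g * emeasure (distr MB borel (multi_time B (g *\<^sub>R u))) C
        = (\<integral>\<^sup>+a. w g * ennreal (bm_density \<mu> A J u g (coord_emb J a)) * indicator C (coord_emb J a) \<partial>(\<Pi>\<^sub>M j\<in>J. lborel))"
      by (simp add: nn_integral_cmult[symmetric] mult.assoc)
  qed
  also have "\<dots> = (\<integral>\<^sup>+a. \<integral>\<^sup>+g. w g * ennreal (bm_density \<mu> A J u g (coord_emb J a)) * indicator C (coord_emb J a) \<partial>pos_lborel \<partial>(\<Pi>\<^sub>M j\<in>J. lborel))"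
    by (rule Fubini'[symmetric]) (simp add: case_prod_beta)
  also have "\<dots> = (\<integral>\<^sup>+a. ennreal (vgg_nu_cramer \<mu> A J u (coord_emb J a)) * indicator C (coord_emb J a) \<partial>(\<Pi>\<^sub>M j\<in>J. lborel))"
  proof (rule nn_integral_cong_AE)
    have "AE a in (\<Pi>\<^sub>M j\<in>J. lborel). coord_emb J a \<in> V_set J"
      using AE_coord_lborel_V[of J] unfolding coord_lborel_def by (subst (asm) AE_distr_iff) simp_all
    then show "AE a in (\<Pi>\<^sub>M j\<in>J. lborel). (\<integral>\<^sup>+g. w g * ennreal (bm_density \<mu> A J u g (coord_emb J a)) * indicator C (coord_emb J a) \<partial>pos_lborel)
        = ennreal (vgg_nu_cramer \<mu> A J u (coord_emb J a)) * indicator C (coord_emb J a)"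
    proof eventually_elim
      fix a assume "coord_emb J a \<in> V_set J"
      then have y: "coord_emb J a \<noteq> 0" using J by (auto simp: V_set_def)
      have "(\<lambda>g. bm_density \<mu> A J u g (coord_emb J a)) \<in> borel_measurable borel"
        using measurable_compose[OF measurable_Pair2' measurable_bm_density[of \<mu> A J u], of "coord_emb J a"] by simp
      then have [measurable]: "(\<lambda>g. bm_density \<mu> A J u g (coord_emb J a)) \<in> borel_measurable pos_lborel"
        by (rule measurable_pos_lborel)
      have "(\<integral>\<^sup>+g. w g * ennreal (bm_density \<mu> A J u g (coord_emb J a)) * indicator C (coord_emb J a) \<partial>pos_lborel)
          = (\<integral>\<^sup>+g. w g * ennreal (bm_density \<mu> A J u g (coord_emb J a)) \<partial>pos_lborel) * indicator C (coord_emb J a)"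
        by (rule nn_integral_multc) measurable
      then show "(\<integral>\<^sup>+g. w g * ennreal (bm_density \<mu> A J u g (coord_emb J a)) * indicator C (coord_emb J a) \<partial>pos_lborel)
          = ennreal (vgg_nu_cramer \<mu> A J u (coord_emb J a)) * indicator C (coord_emb J a)"
        unfolding w_def vg_density_integral[OF A inv u J y] .
    qed
  qed
  finally show ?thesis unfolding w_def .
qed

section \<open>Mixtures of kernels\<close>

lemma kernel_mix_simps [simp]:
  "sets (kernel_mix M N K) = sets N" "space (kernel_mix M N K) = space N"
  unfolding kernel_mix_def by (simp_all add: sets.space_closed sets.sigma_sets_eq)

text \<open>\<open>measure_of\<close> returns the given set function only when that function is a
  measure. Countable additivity comes from that of each K x together with interchanging the series
  and the integral.\<close>

lemma emeasure_kernel_mix: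
  assumes K: "\<And>x. x \<in> space M \<Longrightarrow> sets N \<subseteq> sets (K x)"
    and meas: "\<And>A. A \<in> sets N \<Longrightarrow> (\<lambda>x. emeasure (K x) A) \<in> borel_measurable M"
    and A: "A \<in> sets N"
  shows "emeasure (kernel_mix M N K) A = (\<integral>\<^sup>+x. emeasure (K x) A \<partial>M)"
proof (rule emeasure_measure_of[OF kernel_mix_def])
  show "positive (sets (kernel_mix M N K)) (\<lambda>A. \<integral>\<^sup>+x. emeasure (K x) A \<partial>M)"
    by (simp add: positive_def)
  show "countably_additive (sets (kernel_mix M N K)) (\<lambda>A. \<integral>\<^sup>+x. emeasure (K x) A \<partial>M)"
  proof (rule countably_additiveI)
    fix F :: "nat \<Rightarrow> _ set" assume F: "range F \<subseteq> sets (kernel_mix M N K)" "disjoint_family F"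
    then have FN: "F i \<in> sets N" for i by auto
    have "(\<Sum>i. \<integral>\<^sup>+x. emeasure (K x) (F i) \<partial>M) = (\<integral>\<^sup>+x. (\<Sum>i. emeasure (K x) (F i)) \<partial>M)"
      by (rule nn_integral_suminf[symmetric]) (rule meas[OF FN])
    also have "\<dots> = (\<integral>\<^sup>+x. emeasure (K x) (\<Union>i. F i) \<partial>M)"
      using F FN K by (intro nn_integral_cong suminf_emeasure) auto
    finally show "(\<Sum>i. \<integral>\<^sup>+x. emeasure (K x) (F i) \<partial>M) = (\<integral>\<^sup>+x. emeasure (K x) (\<Union>i. F i) \<partial>M)" .
  qed
qed (use A in \<open>auto simp: sets.space_closed\<close>)

lemma kernel_prod_simps [simp]:
  "sets (kernel_prod M N K) = sets (M \<Otimes>\<^sub>M N)" "space (kernel_prod M N K) = space M \<times> space N"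
  unfolding kernel_prod_def using sets.space_closed[of "M \<Otimes>\<^sub>M N"] sets.sigma_sets_eq[of "M \<Otimes>\<^sub>M N"]
  by (simp_all add: space_pair_measure)

lemma emeasure_kernel_prod:
  assumes K: "\<And>x. x \<in> space M \<Longrightarrow> sets N \<subseteq> sets (K x)"
    and meas: "\<And>C. C \<in> sets (M \<Otimes>\<^sub>M N) \<Longrightarrow> (\<lambda>x. emeasure (K x) (Pair x -` C)) \<in> borel_measurable M"
    and C: "C \<in> sets (M \<Otimes>\<^sub>M N)"
  shows "emeasure (kernel_prod M N K) C = (\<integral>\<^sup>+x. emeasure (K x) (Pair x -` C) \<partial>M)"
proof (rule emeasure_measure_of[OF kernel_prod_def])
  show "positive (sets (kernel_prod M N K)) (\<lambda>C. \<integral>\<^sup>+x. emeasure (K x) (Pair x -` C) \<partial>M)"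
    by (simp add: positive_def)
  show "countably_additive (sets (kernel_prod M N K)) (\<lambda>C. \<integral>\<^sup>+x. emeasure (K x) (Pair x -` C) \<partial>M)"
  proof (rule countably_additiveI)
    fix F :: "nat \<Rightarrow> _ set" assume F: "range F \<subseteq> sets (kernel_prod M N K)" "disjoint_family F"
    then have FN: "F i \<in> sets (M \<Otimes>\<^sub>M N)" for i by auto
    have "(\<Sum>i. \<integral>\<^sup>+x. emeasure (K x) (Pair x -` F i) \<partial>M) = (\<integral>\<^sup>+x. (\<Sum>i. emeasure (K x) (Pair x -` F i)) \<partial>M)"
      by (rule nn_integral_suminf[symmetric]) (rule meas[OF FN])
    also have "\<dots> = (\<integral>\<^sup>+x. emeasure (K x) (\<Union>i. Pair x -` F i) \<partial>M)"
    proof (rule nn_integral_cong, rule suminf_emeasure)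
      fix x assume x: "x \<in> space M"
      show "range (\<lambda>i. Pair x -` F i) \<subseteq> sets (K x)"
        using sets_Pair1[OF FN] K[OF x] by auto
      show "disjoint_family (\<lambda>i. Pair x -` F i)"
        using F(2) by (auto simp: disjoint_family_on_def)
    qed
    finally show "(\<Sum>i. \<integral>\<^sup>+x. emeasure (K x) (Pair x -` F i) \<partial>M) = (\<integral>\<^sup>+x. emeasure (K x) (Pair x -` (\<Union>i. F i)) \<partial>M)"
      by (simp add: vimage_UN)
  qed
  show "sets (M \<Otimes>\<^sub>M N) \<subseteq> Pow (space M \<times> space N)"
    using sets.space_closed[of "M \<Otimes>\<^sub>M N"] by (simp add: space_pair_measure)
qed (use C in auto)

section \<open>Splitting vectors\<close>

lemma sum_UNIV_Plus: "(\<Sum>k\<in>UNIV. f k) = (\<Sum>i\<in>UNIV. f (Inl i)) + (\<Sum>i\<in>UNIV. f (Inr (i :: 'b::finite) :: 'a::finite + 'b))"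
  by (subst UNIV_Plus_UNIV[symmetric], subst sum.Plus) simp_all

lemma vjoin_inner: "vjoin x y \<bullet> z = (\<Sum>i\<in>UNIV. x $ i * z $ Inl i) + y \<bullet> vsnd z"
  by (simp add: vjoin_def vsnd_def inner_vec_def sum_UNIV_Plus)

text \<open>The law of the second block of Z is read off from the transform of Z at frequencies of
  this form.\<close>

lemma vjoin_0_inner: "vjoin 0 \<theta> \<bullet> z = \<theta> \<bullet> vsnd z"
  by (simp add: vjoin_inner)

lemma vsnd_vjoin [simp]: "vsnd (vjoin x y) = y"
  by (simp add: vsnd_def vjoin_def vec_eq_iff)

lemma norm_vjoin: "(norm (vjoin x y))\<^sup>2 = (norm x)\<^sup>2 + (norm y)\<^sup>2"
  by (simp add: power2_norm_eq_inner vjoin_inner) (simp add: vjoin_def inner_vec_def)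

lemma qinner_lower_block: "qinner (lower_block X) (vjoin 0 \<theta>) (vjoin 0 \<theta>) = qinner X \<theta> \<theta>"
  by (simp add: qinner_sum sum_UNIV_Plus lower_block_def vjoin_def)

lemma measurable_vjoin [measurable (raw)]:
  assumes [measurable]: "f \<in> borel_measurable M" "g \<in> borel_measurable M"
  shows "(\<lambda>x. vjoin (f x) (g x)) \<in> borel_measurable M"
  unfolding vjoin_def
proof (rule borel_measurable_vec_lambda)
  fix k show "(\<lambda>x. case k of Inl i \<Rightarrow> f x $ i | Inr i \<Rightarrow> g x $ i) \<in> borel_measurable M"
    by (cases k) simp_all
qed

lemma measurable_vsnd [measurable]: "vsnd \<in> borel_measurable borel"
  unfolding vsnd_def[abs_def] by (rule borel_measurable_vec_lambda) measurable

lemma orthant_borel [measurable]: "(orthant :: (real ^ 'n) set) \<in> sets borel"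
proof -
  have "{x \<in> space borel. \<forall>i. 0 \<le> x $ i} \<in> sets (borel :: (real ^ 'n) measure)" by measurable
  then show ?thesis by (simp add: orthant_def)
qed

lemma orthant_star_borel [measurable]: "(orthant_star :: (real ^ 'n) set) \<in> sets borel"
  unfolding orthant_star_def by measurable

section \<open>Brownian motion run at the jumps of a Thorin subordinator\<close>

text \<open>The parameter b is a jointly measurable version of (t, omega) -> B(t)(omega). It makes
  Fubini applicable to (u, g, omega), and for each t in the orthant it has the law of
  \<open>multi_time B t\<close>.\<close>

locale vgg = thorin U for U :: "(real ^ 'n) measure" +
  fixes MB :: "'b measure" and B :: "real \<Rightarrow> 'b \<Rightarrow> real ^ 'n" and \<mu> :: "real ^ 'n" and A :: "real ^ 'n ^ 'n"
    and b :: "real ^ 'n \<Rightarrow> 'b \<Rightarrow> real ^ 'n"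
  assumes BM: "brownian_motion MB B \<mu> A" and A: "covariance_matrix A"
    and b_pair: "(\<lambda>(t, \<omega>). b t \<omega>) \<in> borel_measurable (borel \<Otimes>\<^sub>M MB)"
    and b_AE: "\<And>t. t \<in> orthant \<Longrightarrow> AE \<omega> in MB. b t \<omega> = multi_time B t \<omega>"
begin

lemma BM_levy: "levy_process MB B"
  using BM by (simp add: brownian_motion_def levy_law_def)

sublocale P: prob_space MB
  using BM_levy by (simp add: levy_process_def)

sublocale Q: pair_sigma_finite "thorin_mix U" MB
  using mix_sigma_finite P.sigma_finite_measure_axioms by (rule pair_sigma_finite.intro)

lemma measurable_b_comp [measurable (raw)]:
  assumes "f \<in> M \<rightarrow>\<^sub>M borel" "h \<in> M \<rightarrow>\<^sub>M MB"
  shows "(\<lambda>x. b (f x) (h x)) \<in> borel_measurable M"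
  using measurable_compose[OF measurable_Pair[OF assms] b_pair] by simp

lemma b_transfer:
  assumes t: "t \<in> orthant" and [measurable]: "f \<in> borel_measurable borel"
  shows "(\<integral>\<omega>. (f (b t \<omega>) :: 'c::{banach,second_countable_topology}) \<partial>MB) = (\<integral>\<omega>. f (multi_time B t \<omega>) \<partial>MB)"
    and "integrable MB (\<lambda>\<omega>. f (b t \<omega>)) \<longleftrightarrow> integrable MB (\<lambda>\<omega>. f (multi_time B t \<omega>))"
proof -
  note [measurable] = measurable_multi_time[OF BM_levy t]
  have "AE \<omega> in MB. f (b t \<omega>) = f (multi_time B t \<omega>)" using b_AE[OF t] by eventually_elim simp
  then show "(\<integral>\<omega>. f (b t \<omega>) \<partial>MB) = (\<integral>\<omega>. f (multi_time B t \<omega>) \<partial>MB)"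
    "integrable MB (\<lambda>\<omega>. f (b t \<omega>)) \<longleftrightarrow> integrable MB (\<lambda>\<omega>. f (multi_time B t \<omega>))"
    by (intro integral_cong_AE integrable_cong_AE; simp)+
qed

lemma b_law:
  assumes t: "t \<in> orthant"
  shows "distr MB borel (multi_time B t) = distr MB borel (b t)"
proof -
  note [measurable] = measurable_multi_time[OF BM_levy t]
  show ?thesis using b_AE[OF t] by (intro distr_cong_AE) auto
qed

lemma b_cf:
  assumes t: "t \<in> orthant"
  shows "(\<integral>\<omega>. iexp (\<theta> \<bullet> b t \<omega>) \<partial>MB) = exp (\<i> * of_real ((t \<diamond>\<^sub>v \<mu>) \<bullet> \<theta>) - of_real (qinner (t \<diamond>\<^sub>m A) \<theta> \<theta>) / 2)"
  by (subst b_transfer(1)[OF t]) (simp_all add: multi_time_cf[OF BM t])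

text \<open>The constants in |E B(t)| <= mom1 |t| and E |B(t)|^2 <= mom2 (|t| + |t|^2); in the
  second moment the drift contributes quadratically in t and the Gaussian part linearly.\<close>

definition mom1 :: real where "mom1 = (\<Sum>i\<in>UNIV. \<bar>\<mu> $ i\<bar>)"
definition mom2 :: real where "mom2 = (\<Sum>i\<in>UNIV. (\<mu> $ i)\<^sup>2) + (\<Sum>i\<in>UNIV. A $ i $ i)"

lemma mom_nonneg: "0 \<le> mom1" "0 \<le> mom2"
proof -
  have "0 \<le> A $ i $ i" for i
    using multi_time_moments(5)[OF BM A, of 0 i] by (simp add: orthant_def)
  then show "0 \<le> mom1" "0 \<le> mom2" unfolding mom1_def mom2_def by (auto intro!: sum_nonneg add_nonneg_nonneg)
qed

lemma b_mean:
  assumes t: "t \<in> orthant"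
  shows "integrable MB (b t)" and "norm (\<integral>\<omega>. b t \<omega> \<partial>MB) \<le> mom1 * norm t"
proof -
  have i1: "integrable MB (\<lambda>\<omega>. b t \<omega> $ i)" for i
    using multi_time_moments(1)[OF BM A t, of i] by (subst b_transfer(2)[OF t, of "\<lambda>x. x $ i"]) simp_all
  have bsum: "b t \<omega> = (\<Sum>i\<in>UNIV. (b t \<omega> $ i) *\<^sub>R axis i 1)" for \<omega>
    by (simp add: vec_eq_iff sum_component axis_def if_distrib[of "\<lambda>z. _ * z"] cong: if_cong)
  have "integrable MB (\<lambda>\<omega>. \<Sum>i\<in>UNIV. (b t \<omega> $ i) *\<^sub>R (axis i 1 :: real ^ 'n))"
    by (intro Bochner_Integration.integrable_sum integrable_scaleR_left i1)
  then show int: "integrable MB (b t)" by (subst (asm) bsum[symmetric])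
  have "(\<integral>\<omega>. b t \<omega> \<partial>MB) $ i = t $ i * \<mu> $ i" for i
  proof -
    have "(\<integral>\<omega>. b t \<omega> \<partial>MB) $ i = (\<integral>\<omega>. b t \<omega> \<partial>MB) \<bullet> axis i 1" by (simp add: inner_axis)
    also have "\<dots> = (\<integral>\<omega>. b t \<omega> \<bullet> axis i 1 \<partial>MB)" using int by (simp add: integral_inner_left)
    also have "\<dots> = (\<integral>\<omega>. multi_time B t \<omega> $ i \<partial>MB)"
      by (subst b_transfer(1)[OF t, of "\<lambda>x. x \<bullet> axis i 1"]) (simp_all add: inner_axis)
    finally show ?thesis by (simp add: multi_time_moments(2)[OF BM A t])
  qed
  then have "norm (\<integral>\<omega>. b t \<omega> \<partial>MB) \<le> (\<Sum>i\<in>UNIV. \<bar>t $ i * \<mu> $ i\<bar>)"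
    using norm_le_l1_cart[of "\<integral>\<omega>. b t \<omega> \<partial>MB"] by simp
  also have "\<dots> \<le> (\<Sum>i\<in>UNIV. norm t * \<bar>\<mu> $ i\<bar>)"
    unfolding abs_mult by (intro sum_mono mult_right_mono component_le_norm_cart) auto
  finally show "norm (\<integral>\<omega>. b t \<omega> \<partial>MB) \<le> mom1 * norm t"
    by (simp add: mom1_def sum_distrib_left mult.commute)
qed

lemma b_second_moment:
  assumes t: "t \<in> orthant"
  shows "integrable MB (\<lambda>\<omega>. (norm (b t \<omega>))\<^sup>2)" and "(\<integral>\<omega>. (norm (b t \<omega>))\<^sup>2 \<partial>MB) \<le> mom2 * (norm t + (norm t)\<^sup>2)"
proof -
  have n2: "(norm x)\<^sup>2 = (\<Sum>i\<in>UNIV. (x $ i)\<^sup>2)" for x :: "real ^ 'n"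
    unfolding power2_norm_eq_inner inner_vec_def by (simp add: power2_eq_square)
  have i2: "integrable MB (\<lambda>\<omega>. (b t \<omega> $ i)\<^sup>2)" for i
    using multi_time_moments(3)[OF BM A t, of i] by (subst b_transfer(2)[OF t, of "\<lambda>x. (x $ i)\<^sup>2"]) simp_all
  have e2: "(\<integral>\<omega>. (b t \<omega> $ i)\<^sup>2 \<partial>MB) = (t $ i * \<mu> $ i)\<^sup>2 + t $ i * A $ i $ i" for i
    using multi_time_moments(4)[OF BM A t, of i] by (subst b_transfer(1)[OF t, of "\<lambda>x. (x $ i)\<^sup>2"]) simp_all
  show "integrable MB (\<lambda>\<omega>. (norm (b t \<omega>))\<^sup>2)"
    unfolding n2 by (intro Bochner_Integration.integrable_sum i2)
  have "(\<integral>\<omega>. (norm (b t \<omega>))\<^sup>2 \<partial>MB) = (\<Sum>i\<in>UNIV. (t $ i * \<mu> $ i)\<^sup>2 + t $ i * A $ i $ i)"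
    unfolding n2 by (subst Bochner_Integration.integral_sum) (simp_all add: i2 e2)
  also have "\<dots> \<le> (\<Sum>i\<in>UNIV. (norm t)\<^sup>2 * (\<mu> $ i)\<^sup>2 + norm t * A $ i $ i)"
  proof (rule sum_mono, rule add_mono)
    fix i
    show "(t $ i * \<mu> $ i)\<^sup>2 \<le> (norm t)\<^sup>2 * (\<mu> $ i)\<^sup>2"
      unfolding power_mult_distrib using component_le_norm_cart[of t i]
      by (intro mult_right_mono) (auto simp: abs_le_square_iff[symmetric])
    show "t $ i * A $ i $ i \<le> norm t * A $ i $ i"
      using component_le_norm_cart[of t i] multi_time_moments(5)[OF BM A t, of i] by (intro mult_right_mono) auto
  qed
  also have "\<dots> = (norm t)\<^sup>2 * (\<Sum>i\<in>UNIV. (\<mu> $ i)\<^sup>2) + norm t * (\<Sum>i\<in>UNIV. A $ i $ i)"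
    by (simp add: sum.distrib sum_distrib_left)
  also have "\<dots> \<le> mom2 * (norm t + (norm t)\<^sup>2)"
  proof -
    have "0 \<le> (\<Sum>i\<in>UNIV. (\<mu> $ i)\<^sup>2)" "0 \<le> (\<Sum>i\<in>UNIV. A $ i $ i)"
      using multi_time_moments(5)[OF BM A t] by (auto intro!: sum_nonneg)
    then show ?thesis unfolding mom2_def by (simp add: distrib_left distrib_right mult.commute)
  qed
  finally show "(\<integral>\<omega>. (norm (b t \<omega>))\<^sup>2 \<partial>MB) \<le> mom2 * (norm t + (norm t)\<^sup>2)" .
qed

lemma b_second_moment_small:
  assumes t: "t \<in> orthant" and n: "norm t \<le> 1"
  shows "(\<integral>\<omega>. (norm (b t \<omega>))\<^sup>2 \<partial>MB) \<le> 2 * mom2 * norm t"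
proof -
  have "(norm t)\<^sup>2 \<le> norm t" using n mult_left_mono[of "norm t" 1 "norm t"] by (simp add: power2_eq_square)
  then have "mom2 * (norm t + (norm t)\<^sup>2) \<le> mom2 * (2 * norm t)" using mom_nonneg by (intro mult_left_mono) auto
  then show ?thesis using b_second_moment(2)[OF t] by linarith
qed

text \<open>The integrability that \<open>levy_measure\<close> demands of the image: averaged over
  B, min 1 |B(t)|^2 is O(min 1 |t|), which is integrable over the jumps of T.\<close>

lemma b_truncated_second_moment:
  assumes t: "t \<in> orthant"
  shows "integrable MB (\<lambda>\<omega>. min 1 ((norm (b t \<omega>))\<^sup>2))"
    and "(\<integral>\<omega>. min 1 ((norm (b t \<omega>))\<^sup>2) \<partial>MB) \<le> (1 + 2 * mom2) * min 1 (norm t)"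
proof -
  show i: "integrable MB (\<lambda>\<omega>. min 1 ((norm (b t \<omega>))\<^sup>2))"
    by (rule P.integrable_const_bound[where B=1]) auto
  show "(\<integral>\<omega>. min 1 ((norm (b t \<omega>))\<^sup>2) \<partial>MB) \<le> (1 + 2 * mom2) * min 1 (norm t)"
  proof (cases "norm t \<le> 1")
    case True
    have "(\<integral>\<omega>. min 1 ((norm (b t \<omega>))\<^sup>2) \<partial>MB) \<le> (\<integral>\<omega>. (norm (b t \<omega>))\<^sup>2 \<partial>MB)"
      by (intro integral_mono i b_second_moment t) auto
    also have "\<dots> \<le> 2 * mom2 * norm t" by (rule b_second_moment_small[OF t True])
    also have "\<dots> \<le> (1 + 2 * mom2) * min 1 (norm t)" using True by (simp add: distrib_right)
    finally show ?thesis .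
  next
    case False
    have "(\<integral>\<omega>. min 1 ((norm (b t \<omega>))\<^sup>2) \<partial>MB) \<le> (\<integral>\<omega>. 1 \<partial>MB)"
      by (intro integral_mono i) auto
    then show ?thesis using False mom_nonneg by (simp add: P.prob_space)
  qed
qed

text \<open>The mean of a Brownian increment truncated to a set \<open>E\<close> stays of order \<open>t\<close>, because the full mean is
  and the removed part is controlled by the second moment.\<close>

lemma b_truncated_mean:
  assumes t: "t \<in> orthant" and E [measurable]: "{\<omega> \<in> space MB. E \<omega>} \<in> sets MB"
    and n: "norm t \<le> 1"
    and out: "\<And>\<omega>. \<omega> \<in> space MB \<Longrightarrow> \<not> E \<omega> \<Longrightarrow> norm (b t \<omega>) \<le> 2 * (norm (b t \<omega>))\<^sup>2 + norm t"
  shows "norm (\<integral>\<omega>. of_bool (E \<omega>) *\<^sub>R b t \<omega> \<partial>MB) \<le> (1 + mom1 + 4 * mom2) * norm t"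
proof -
  have Em [measurable]: "Measurable.pred MB E" using E by (simp add: pred_def)
  have i1: "integrable MB (\<lambda>\<omega>. of_bool (E \<omega>) *\<^sub>R b t \<omega>)" and i2: "integrable MB (\<lambda>\<omega>. of_bool (\<not> E \<omega>) *\<^sub>R b t \<omega>)"
    by (rule Bochner_Integration.integrable_bound[OF b_mean(1)[OF t]]; auto simp: of_bool_def)+
  have "(\<integral>\<omega>. b t \<omega> \<partial>MB) = (\<integral>\<omega>. of_bool (E \<omega>) *\<^sub>R b t \<omega> + of_bool (\<not> E \<omega>) *\<^sub>R b t \<omega> \<partial>MB)"
    by (intro Bochner_Integration.integral_cong refl) auto
  also have "\<dots> = (\<integral>\<omega>. of_bool (E \<omega>) *\<^sub>R b t \<omega> \<partial>MB) + (\<integral>\<omega>. of_bool (\<not> E \<omega>) *\<^sub>R b t \<omega> \<partial>MB)"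
    by (rule Bochner_Integration.integral_add[OF i1 i2])
  finally have "(\<integral>\<omega>. of_bool (E \<omega>) *\<^sub>R b t \<omega> \<partial>MB) = (\<integral>\<omega>. b t \<omega> \<partial>MB) - (\<integral>\<omega>. of_bool (\<not> E \<omega>) *\<^sub>R b t \<omega> \<partial>MB)" by simp
  then have "norm (\<integral>\<omega>. of_bool (E \<omega>) *\<^sub>R b t \<omega> \<partial>MB) \<le> norm (\<integral>\<omega>. b t \<omega> \<partial>MB) + norm (\<integral>\<omega>. of_bool (\<not> E \<omega>) *\<^sub>R b t \<omega> \<partial>MB)"
    by (simp only: norm_triangle_ineq4)
  also have "norm (\<integral>\<omega>. of_bool (\<not> E \<omega>) *\<^sub>R b t \<omega> \<partial>MB) \<le> (\<integral>\<omega>. 2 * (norm (b t \<omega>))\<^sup>2 + norm t \<partial>MB)"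
  proof (rule order_trans[OF integral_norm_bound])
    show "(\<integral>\<omega>. norm (of_bool (\<not> E \<omega>) *\<^sub>R b t \<omega>) \<partial>MB) \<le> (\<integral>\<omega>. 2 * (norm (b t \<omega>))\<^sup>2 + norm t \<partial>MB)"
    proof (rule integral_mono)
      show "integrable MB (\<lambda>\<omega>. norm (of_bool (\<not> E \<omega>) *\<^sub>R b t \<omega>))" by (rule integrable_norm[OF i2])
      show "integrable MB (\<lambda>\<omega>. 2 * (norm (b t \<omega>))\<^sup>2 + norm t)" using b_second_moment(1)[OF t] by simp
      show "norm (of_bool (\<not> E \<omega>) *\<^sub>R b t \<omega>) \<le> 2 * (norm (b t \<omega>))\<^sup>2 + norm t" if "\<omega> \<in> space MB" for \<omega>
        using out[OF that] by (cases "E \<omega>") auto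
    qed
  qed
  also have "\<dots> = 2 * (\<integral>\<omega>. (norm (b t \<omega>))\<^sup>2 \<partial>MB) + norm t"
    using b_second_moment(1)[OF t] by (simp add: P.prob_space)
  also have "\<dots> \<le> 2 * (2 * mom2 * norm t) + norm t"
    using b_second_moment_small[OF t n] by (simp add: mult_ac)
  finally show ?thesis
    using b_mean(2)[OF t] by (simp add: algebra_simps)
qed

text \<open>Two truncated means occur: the location parameter of Y is truncated with the unit ball
  of R^n, that of (T, B o T) with the unit ball of R^(2n), which also involves t.\<close>

definition tmean :: "real ^ 'n \<Rightarrow> real ^ 'n" where
  "tmean t = (\<integral>\<omega>. indicator (cball 0 1) (b t \<omega>) *\<^sub>R b t \<omega> \<partial>MB)"

definition tmean_join :: "real ^ 'n \<Rightarrow> real ^ 'n" where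
  "tmean_join t = (\<integral>\<omega>. indicator (cball 0 1) (vjoin t (b t \<omega>)) *\<^sub>R b t \<omega> \<partial>MB)"

lemma cball_sets: "cball 0 1 \<in> sets (borel :: ('a::euclidean_space) measure)"
  by simp

lemma tmean_measurable [measurable]: "tmean \<in> borel_measurable borel" "tmean_join \<in> borel_measurable borel"
proof -
  note cball_sets [measurable]
  show "tmean \<in> borel_measurable borel"
    unfolding tmean_def[abs_def]
    by (rule P.borel_measurable_lebesgue_integral) (unfold split_beta', measurable)
  show "tmean_join \<in> borel_measurable borel"
    unfolding tmean_join_def[abs_def]
    by (rule P.borel_measurable_lebesgue_integral) (unfold split_beta', measurable)
qed

text \<open>For |t| <= 1 both bounds are instances of \<open>b_truncated_mean\<close>. For larger t
  the first mean is at most 1 by truncation, and the second vanishes, since (t, B(t)) then always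
  lies outside the ball.\<close>

lemma tmean_bound:
  assumes t: "t \<in> orthant"
  shows "norm (tmean t) \<le> (1 + mom1 + 4 * mom2) * min 1 (norm t)"
    and "norm (tmean_join t) \<le> (1 + mom1 + 4 * mom2) * min 1 (norm t)"
proof -
  note cball_sets [measurable]
  have b1: "norm (\<integral>\<omega>. indicator (cball 0 1) (b t \<omega>) *\<^sub>R b t \<omega> \<partial>MB) \<le> (\<integral>\<omega>. 1 \<partial>MB)"
  proof (rule order_trans[OF integral_norm_bound])
    show "(\<integral>\<omega>. norm (indicator (cball 0 1) (b t \<omega>) *\<^sub>R b t \<omega>) \<partial>MB) \<le> (\<integral>\<omega>. 1 \<partial>MB)"
      by (intro integral_mono P.integrable_const_bound[where B=1]) (auto simp: indicator_def)
  qed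
  show "norm (tmean t) \<le> (1 + mom1 + 4 * mom2) * min 1 (norm t)"
  proof (cases "norm t \<le> 1")
    case True
    have "norm (\<integral>\<omega>. of_bool (b t \<omega> \<in> cball 0 1) *\<^sub>R b t \<omega> \<partial>MB) \<le> (1 + mom1 + 4 * mom2) * norm t"
    proof (rule b_truncated_mean[OF t _ True])
      show "{\<omega> \<in> space MB. b t \<omega> \<in> cball 0 1} \<in> sets MB" by measurable
      fix \<omega> assume "\<not> b t \<omega> \<in> cball 0 1"
      then have "1 \<le> norm (b t \<omega>)" by simp
      then have "norm (b t \<omega>) * 1 \<le> norm (b t \<omega>) * norm (b t \<omega>)" by (intro mult_left_mono) auto
      moreover have "0 \<le> norm (b t \<omega>) * norm (b t \<omega>)" "0 \<le> norm t" by simp_all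
      ultimately show "norm (b t \<omega>) \<le> 2 * (norm (b t \<omega>))\<^sup>2 + norm t" unfolding power2_eq_square by linarith
    qed
    then show ?thesis using True by (simp add: tmean_def indicator_def of_bool_def)
  next
    case False
    then show ?thesis using b1 mom_nonneg by (simp add: tmean_def P.prob_space)
  qed
  show "norm (tmean_join t) \<le> (1 + mom1 + 4 * mom2) * min 1 (norm t)"
  proof (cases "norm t \<le> 1")
    case True
    have "norm (\<integral>\<omega>. of_bool (vjoin t (b t \<omega>) \<in> cball 0 1) *\<^sub>R b t \<omega> \<partial>MB) \<le> (1 + mom1 + 4 * mom2) * norm t"
    proof (rule b_truncated_mean[OF t _ True])
      show "{\<omega> \<in> space MB. vjoin t (b t \<omega>) \<in> cball 0 1} \<in> sets MB" by measurable
      fix \<omega> assume "\<not> vjoin t (b t \<omega>) \<in> cball 0 1"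
      then have "1 \<le> norm (vjoin t (b t \<omega>))" by simp
      then have ge: "1 \<le> (norm t)\<^sup>2 + (norm (b t \<omega>))\<^sup>2"
        using norm_vjoin[of t "b t \<omega>"] by (metis one_le_power)
      show "norm (b t \<omega>) \<le> 2 * (norm (b t \<omega>))\<^sup>2 + norm t"
      \<comment> \<open>The reason for the shape 2 r^2 + |t| of the bound, with r = |B(t)|: if r >=
        1 / 2 then r <= 2 r^2, and if r < 1 / 2 then |t| >= |t|^2 >= 1 - r^2 >= r.\<close>
      proof (cases "1 / 2 \<le> norm (b t \<omega>)")
        case True
        then have "norm (b t \<omega>) * (1 / 2) \<le> norm (b t \<omega>) * norm (b t \<omega>)" by (intro mult_left_mono) auto
        moreover have "0 \<le> norm t" by simp
        ultimately show ?thesis unfolding power2_eq_square by linarith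
      next
        case False
        have "(norm (b t \<omega>))\<^sup>2 \<le> norm (b t \<omega>) * (1 / 2)"
          unfolding power2_eq_square using False by (intro mult_left_mono) auto
        moreover have "(norm t)\<^sup>2 \<le> norm t" using True mult_left_mono[of "norm t" 1 "norm t"] by (simp add: power2_eq_square)
        ultimately show ?thesis using ge False zero_le_power2[of "norm (b t \<omega>)"] by linarith
      qed
    qed
    then show ?thesis using True by (simp add: tmean_join_def indicator_def of_bool_def)
  next
    case False
    have "vjoin t (b t \<omega>) \<notin> cball 0 1" for \<omega>
    proof
      assume "vjoin t (b t \<omega>) \<in> cball 0 1"
      then have "(norm (vjoin t (b t \<omega>)))\<^sup>2 \<le> 1" by (simp add: abs_square_le_1)
      then have "(norm t)\<^sup>2 \<le> 1" using norm_vjoin[of t "b t \<omega>"] zero_le_power2[of "norm (b t \<omega>)"] by linarith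
      then show False using False by (simp add: abs_square_le_1)
    qed
    then show ?thesis using mom_nonneg by (simp add: tmean_join_def)
  qed
qed

lemma tmean_integrable:
  "integrable (thorin_mix U) (\<lambda>x. tmean (jump x))" "integrable (thorin_mix U) (\<lambda>x. tmean_join (jump x))"
proof -
  have o: "jump x \<in> orthant" if "x \<in> space (thorin_mix U)" for x
    using jump_orthant[OF that] by (simp add: orthant_star_def)
  show "integrable (thorin_mix U) (\<lambda>x. tmean (jump x))" "integrable (thorin_mix U) (\<lambda>x. tmean_join (jump x))"
    by (rule jump_integrable_bound; use tmean_bound[OF o] in \<open>auto\<close>)+
qed

section \<open>The Levy measure of Y as an image\<close>

definition bj :: "((real ^ 'n) \<times> real) \<times> 'b \<Rightarrow> real ^ 'n" where
  "bj = (\<lambda>(x, \<omega>). b (jump x) \<omega>)"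

lemma bj_measurable [measurable]: "bj \<in> borel_measurable (thorin_mix U \<Otimes>\<^sub>M MB)"
  unfolding bj_def split_beta' by measurable

lemma jump_mem: "x \<in> space (thorin_mix U) \<Longrightarrow> jump x \<in> orthant"
  using jump_orthant[of x] by (simp add: orthant_star_def)

lemma Q_integrable:
  fixes f :: "((real ^ 'n) \<times> real) \<times> 'b \<Rightarrow> 'c::{banach,second_countable_topology}"
  assumes [measurable]: "f \<in> borel_measurable (thorin_mix U \<Otimes>\<^sub>M MB)"
    and i: "\<And>x. x \<in> space (thorin_mix U) \<Longrightarrow> integrable MB (\<lambda>\<omega>. f (x, \<omega>))"
    and le: "\<And>x. x \<in> space (thorin_mix U) \<Longrightarrow> (\<integral>\<omega>. norm (f (x, \<omega>)) \<partial>MB) \<le> K * min 1 (norm (jump x))"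
  shows "integrable (thorin_mix U \<Otimes>\<^sub>M MB) f"
proof (rule Q.Fubini_integrable)
  show "integrable (thorin_mix U) (\<lambda>x. \<integral>\<omega>. norm (f (x, \<omega>)) \<partial>MB)"
  proof (rule jump_integrable_bound[where K=K])
    show "(\<lambda>x. \<integral>\<omega>. norm (f (x, \<omega>)) \<partial>MB) \<in> borel_measurable (thorin_mix U)" by measurable
    fix x assume "x \<in> space (thorin_mix U)"
    then show "norm (\<integral>\<omega>. norm (f (x, \<omega>)) \<partial>MB) \<le> K * min 1 (norm (jump x))" using le by simp
  qed
  show "AE x in thorin_mix U. integrable MB (\<lambda>\<omega>. f (x, \<omega>))" using i by (rule AE_I2)
qed measurable

definition levyY :: "(real ^ 'n) measure" where
  "levyY = star_image (thorin_mix U \<Otimes>\<^sub>M MB) bj"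

lemma levyY_levy_measure: "levy_measure levyY"
  unfolding levyY_def
proof (rule levy_measure_star_image[OF bj_measurable])
  show "integrable (thorin_mix U \<Otimes>\<^sub>M MB) (\<lambda>x. min 1 ((norm (bj x))\<^sup>2))"
  proof (rule Q_integrable[where K="1 + 2 * mom2"])
    fix x assume "x \<in> space (thorin_mix U)"
    note o = jump_mem[OF this]
    show "integrable MB (\<lambda>\<omega>. min 1 ((norm (bj (x, \<omega>)))\<^sup>2))"
      using b_truncated_second_moment(1)[OF o] by (simp add: bj_def)
    show "(\<integral>\<omega>. norm (min 1 ((norm (bj (x, \<omega>)))\<^sup>2)) \<partial>MB) \<le> (1 + 2 * mom2) * min 1 (norm (jump x))"
      using b_truncated_second_moment(2)[OF o] by (simp add: bj_def abs_of_nonneg)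
  qed measurable
qed

section \<open>Variance-gamma kernels and their mixture over U\<close>

definition hit :: "(real ^ 'n) set \<Rightarrow> real ^ 'n \<Rightarrow> ennreal" where
  "hit C t = emeasure (distr MB borel (b t)) C"

lemma hit_eq: "C \<in> sets borel \<Longrightarrow> hit C t = (\<integral>\<^sup>+\<omega>. indicator C (b t \<omega>) \<partial>MB)"
  unfolding hit_def
  by (subst emeasure_distr) (auto simp: nn_integral_indicator[symmetric] intro!: nn_integral_cong simp: indicator_def)

lemma hit_measurable: "C \<in> sets borel \<Longrightarrow> hit C \<in> borel_measurable borel"
proof -
  assume [measurable]: "C \<in> sets borel"
  have "(\<lambda>t. \<integral>\<^sup>+\<omega>. indicator C (b t \<omega>) \<partial>MB) \<in> borel_measurable borel"
    by (rule P.borel_measurable_nn_integral) (unfold split_beta', measurable)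
  moreover have "hit C = (\<lambda>t. \<integral>\<^sup>+\<omega>. indicator C (b t \<omega>) \<partial>MB)"
    by (rule ext) (simp add: hit_eq)
  ultimately show ?thesis by simp
qed

lemma bm_marginal_hit:
  assumes u: "u \<in> orthant" and g: "0 \<le> g"
  shows "bm_marginal (u \<diamond>\<^sub>v \<mu>) (u \<diamond>\<^sub>m A) g = distr MB borel (b (g *\<^sub>R u))"
proof -
  have gu: "g *\<^sub>R u \<in> orthant" using u g by (simp add: orthant_def)
  show ?thesis unfolding bm_marginal_eq[OF BM u g] by (rule b_law[OF gu])
qed

text \<open>The factor |u|^2 is the parameter b of \<open>vg_measure\<close>; it cancels against the
  weight 1 / |u|^2 on U and leaves \<open>thorin_density\<close>.\<close>

definition vgw :: "real ^ 'n \<Rightarrow> real \<Rightarrow> real" where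
  "vgw u g = (norm u)\<^sup>2 * exp (- (norm u)\<^sup>2 * g) / g"

lemma vgw_measurable [measurable]: "vgw u \<in> borel_measurable pos_lborel"
  unfolding vgw_def[abs_def] by (rule measurable_pos_lborel) measurable

definition vg_base :: "real ^ 'n \<Rightarrow> (real \<times> 'b) measure" where
  "vg_base u = density pos_lborel (\<lambda>g. ennreal (vgw u g)) \<Otimes>\<^sub>M MB"

lemma vg_base_sigma_finite: "sigma_finite_measure (density pos_lborel (\<lambda>g. ennreal (vgw u g)))"
  by (subst sigma_finite_measure.sigma_finite_iff_density_finite[OF sigma_finite_pos_lborel]) simp_all

lemma measurable_bg [measurable]:
  "(\<lambda>(g, \<omega>). b (g *\<^sub>R u) \<omega>) \<in> borel_measurable (pos_lborel \<Otimes>\<^sub>M MB)"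
  "(\<lambda>(g, \<omega>). b (g *\<^sub>R u) \<omega>) \<in> borel_measurable (vg_base u)"
proof -
  note measurable_ident_pos_lborel [measurable]
  have [measurable]: "fst \<in> borel_measurable (pos_lborel \<Otimes>\<^sub>M MB)"
    by (rule measurable_compose[OF measurable_fst measurable_ident_pos_lborel])
  show 1: "(\<lambda>(g, \<omega>). b (g *\<^sub>R u) \<omega>) \<in> borel_measurable (pos_lborel \<Otimes>\<^sub>M MB)"
    unfolding split_beta' by measurable
  have "sets (vg_base u) = sets (pos_lborel \<Otimes>\<^sub>M MB)"
    unfolding vg_base_def by (rule sets_pair_measure_cong) simp_all
  then show "(\<lambda>(g, \<omega>). b (g *\<^sub>R u) \<omega>) \<in> borel_measurable (vg_base u)"
    using 1 measurable_cong_sets[OF _ refl] by blast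
qed

lemma hit_g_measurable: "C \<in> sets borel \<Longrightarrow> (\<lambda>g. hit C (g *\<^sub>R u)) \<in> borel_measurable pos_lborel"
  by (rule measurable_pos_lborel, rule measurable_compose[OF _ hit_measurable]) simp_all

lemma emeasure_vg_kernel:
  assumes u: "u \<in> orthant" and C: "C \<in> sets borel_star"
  shows "emeasure (vg_kernel \<mu> A u) C = (\<integral>\<^sup>+g. ennreal (vgw u g) * hit C (g *\<^sub>R u) \<partial>pos_lborel)"
proof -
  have Cb: "D \<in> sets borel" if "D \<in> sets borel_star" for D :: "(real ^ 'n) set" using sets_borel_starD[OF that] by simp
  have w: "(\<lambda>g. ennreal ((norm u)\<^sup>2 * exp (- (norm u)\<^sup>2 * g) / g)) = (\<lambda>g. ennreal (vgw u g))" by (simp add: vgw_def)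
  let ?M = "density pos_lborel (\<lambda>g. ennreal (vgw u g))"
  have k: "emeasure (bm_marginal (u \<diamond>\<^sub>v \<mu>) (u \<diamond>\<^sub>m A) g) D = hit D (g *\<^sub>R u)" if "g \<in> space ?M" for g D
    using that u by (simp add: bm_marginal_hit hit_def)
  have "emeasure (vg_kernel \<mu> A u) C = (\<integral>\<^sup>+g. emeasure (bm_marginal (u \<diamond>\<^sub>v \<mu>) (u \<diamond>\<^sub>m A) g) C \<partial>?M)"
    unfolding vg_kernel_def vg_measure_def pos_lborel_def[symmetric] w
  proof (rule emeasure_kernel_mix[OF _ _ C])
    show "sets borel_star \<subseteq> sets (bm_marginal (u \<diamond>\<^sub>v \<mu>) (u \<diamond>\<^sub>m A) g)" if "g \<in> space ?M" for g
      using that u Cb by (auto simp: bm_marginal_hit)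
    fix D :: "(real ^ 'n) set" assume "D \<in> sets borel_star"
    then have "(\<lambda>g. hit D (g *\<^sub>R u)) \<in> borel_measurable ?M" using hit_g_measurable[OF Cb] by simp
    then show "(\<lambda>g. emeasure (bm_marginal (u \<diamond>\<^sub>v \<mu>) (u \<diamond>\<^sub>m A) g) D) \<in> borel_measurable ?M"
      by (subst measurable_cong[OF k])
  qed
  also have "\<dots> = (\<integral>\<^sup>+g. hit C (g *\<^sub>R u) \<partial>?M)" by (rule nn_integral_cong) (rule k)
  also have "\<dots> = (\<integral>\<^sup>+g. ennreal (vgw u g) * hit C (g *\<^sub>R u) \<partial>pos_lborel)"
    by (rule nn_integral_density[OF _ hit_g_measurable[OF Cb[OF C]]]) measurable
  finally show ?thesis .
qed

lemma vg_kernel_star_image: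
  assumes u: "u \<in> orthant"
  shows "vg_kernel \<mu> A u = star_image (vg_base u) (\<lambda>(g, \<omega>). b (g *\<^sub>R u) \<omega>)"
proof (rule measure_eqI)
  have sK: "sets (vg_kernel \<mu> A u) = sets borel_star"
    by (simp add: vg_kernel_def vg_measure_def)
  then show "sets (vg_kernel \<mu> A u) = sets (star_image (vg_base u) (\<lambda>(g, \<omega>). b (g *\<^sub>R u) \<omega>))" by simp
  fix C assume "C \<in> sets (vg_kernel \<mu> A u)"
  then have C: "C \<in> sets borel_star" using sK by simp
  then have Cb [measurable]: "C \<in> sets borel" using sets_borel_starD by blast
  interpret D: pair_sigma_finite "density pos_lborel (\<lambda>g. ennreal (vgw u g))" MB
    using vg_base_sigma_finite P.sigma_finite_measure_axioms by (rule pair_sigma_finite.intro)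
  have "emeasure (star_image (vg_base u) (\<lambda>(g, \<omega>). b (g *\<^sub>R u) \<omega>)) C = (\<integral>\<^sup>+x. indicator C x \<partial>star_image (vg_base u) (\<lambda>(g, \<omega>). b (g *\<^sub>R u) \<omega>))"
    using C by simp
  also have "\<dots> = (\<integral>\<^sup>+x. indicator C (case x of (g, \<omega>) \<Rightarrow> b (g *\<^sub>R u) \<omega>) \<partial>vg_base u)"
    by (rule nn_integral_star_image) (use sets_borel_starD[OF C] in \<open>auto simp: indicator_def\<close>)
  also have "\<dots> = (\<integral>\<^sup>+g. \<integral>\<^sup>+\<omega>. indicator C (b (g *\<^sub>R u) \<omega>) \<partial>MB \<partial>density pos_lborel (\<lambda>g. ennreal (vgw u g)))"
    unfolding vg_base_def
    by (subst P.nn_integral_fst[symmetric]) (use measurable_bg(2)[of u] in \<open>auto simp: vg_base_def intro!: measurable_compose[of _ _ borel]\<close>)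
  also have "\<dots> = (\<integral>\<^sup>+g. hit C (g *\<^sub>R u) \<partial>density pos_lborel (\<lambda>g. ennreal (vgw u g)))"
    by (simp add: hit_eq)
  also have "\<dots> = (\<integral>\<^sup>+g. ennreal (vgw u g) * hit C (g *\<^sub>R u) \<partial>pos_lborel)"
    by (rule nn_integral_density[OF _ hit_g_measurable[OF Cb]]) measurable
  finally show "emeasure (vg_kernel \<mu> A u) C = emeasure (star_image (vg_base u) (\<lambda>(g, \<omega>). b (g *\<^sub>R u) \<omega>)) C"
    using emeasure_vg_kernel[OF u C] by simp
qed

text \<open>For g <= 1 the inequality r <= s + r^2 / s with s = sqrt g trades the first moment for
  the second, which is of order g; for g > 1 truncation bounds the moment by 1.\<close>

lemma vg_truncated_abs_moment:
  assumes u: "u \<in> orthant" and g: "0 < g"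
  shows "(\<integral>\<omega>. norm (indicator (cball 0 1) (b (g *\<^sub>R u) \<omega>) *\<^sub>R b (g *\<^sub>R u) \<omega>) \<partial>MB) \<le> (1 + mom2 * (norm u + (norm u)\<^sup>2)) * sqrt g"
proof -
  note cball_sets [measurable]
  have t: "g *\<^sub>R u \<in> orthant" using u g by (simp add: orthant_def)
  have i: "integrable MB (\<lambda>\<omega>. norm (indicator (cball 0 1) (b (g *\<^sub>R u) \<omega>) *\<^sub>R b (g *\<^sub>R u) \<omega>))"
    by (rule P.integrable_const_bound[where B=1]) (auto simp: indicator_def)
  have K: "0 \<le> mom2 * (norm u + (norm u)\<^sup>2)" using mom_nonneg by simp
  show ?thesis
  proof (cases "g \<le> 1")
    case True
    define s where "s = sqrt g"
    have s: "0 < s" "s\<^sup>2 = g" using g by (simp_all add: s_def)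
    have "(\<integral>\<omega>. norm (indicator (cball 0 1) (b (g *\<^sub>R u) \<omega>) *\<^sub>R b (g *\<^sub>R u) \<omega>) \<partial>MB) \<le> (\<integral>\<omega>. s + (1 / s) * (norm (b (g *\<^sub>R u) \<omega>))\<^sup>2 \<partial>MB)"
    proof (rule integral_mono[OF i])
      show "integrable MB (\<lambda>\<omega>. s + (1 / s) * (norm (b (g *\<^sub>R u) \<omega>))\<^sup>2)"
        using b_second_moment(1)[OF t] by simp
      fix \<omega>
      define r where "r = norm (b (g *\<^sub>R u) \<omega>)"
      have "0 \<le> (s - r)\<^sup>2 + s * r" using s by (simp add: r_def)
      then have "s * r \<le> s\<^sup>2 + r\<^sup>2" by (simp add: power2_eq_square algebra_simps)
      then have "r \<le> s + (1 / s) * r\<^sup>2" using s(1) by (simp add: field_simps power2_eq_square)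
      moreover have "norm (indicator (cball 0 1) (b (g *\<^sub>R u) \<omega>) *\<^sub>R b (g *\<^sub>R u) \<omega>) \<le> r"
        by (simp add: r_def indicator_def)
      ultimately show "norm (indicator (cball 0 1) (b (g *\<^sub>R u) \<omega>) *\<^sub>R b (g *\<^sub>R u) \<omega>) \<le> s + (1 / s) * (norm (b (g *\<^sub>R u) \<omega>))\<^sup>2"
        by (simp add: r_def)
    qed
    also have "\<dots> = s + (1 / s) * (\<integral>\<omega>. (norm (b (g *\<^sub>R u) \<omega>))\<^sup>2 \<partial>MB)"
      using b_second_moment(1)[OF t] P.prob_space by simp
    also have "\<dots> \<le> s + (1 / s) * (g * (mom2 * (norm u + (norm u)\<^sup>2)))"
    proof -
      have "(\<integral>\<omega>. (norm (b (g *\<^sub>R u) \<omega>))\<^sup>2 \<partial>MB) \<le> mom2 * (norm (g *\<^sub>R u) + (norm (g *\<^sub>R u))\<^sup>2)"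
        by (rule b_second_moment(2)[OF t])
      also have "\<dots> = mom2 * (g * (norm u + g * (norm u)\<^sup>2))"
        using g by (simp add: power2_eq_square algebra_simps)
      also have "\<dots> \<le> mom2 * (g * (norm u + 1 * (norm u)\<^sup>2))"
        using mom_nonneg g True by (intro mult_left_mono add_left_mono mult_right_mono) auto
      finally have "(\<integral>\<omega>. (norm (b (g *\<^sub>R u) \<omega>))\<^sup>2 \<partial>MB) \<le> g * (mom2 * (norm u + (norm u)\<^sup>2))"
        by (simp add: mult.left_commute)
      then show ?thesis using s by (intro add_left_mono mult_left_mono) auto
    qed
    also have "\<dots> = (1 + mom2 * (norm u + (norm u)\<^sup>2)) * s"
    proof -
      have "(1 / s) * (s\<^sup>2 * K) = K * s" for K using s(1) by (simp add: power2_eq_square)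
      then have "(1 / s) * (g * K) = K * s" for K by (simp only: s(2))
      then show ?thesis by (simp add: distrib_right)
    qed
    finally show ?thesis by (simp add: s_def)
  next
    case False
    have "(\<integral>\<omega>. norm (indicator (cball 0 1) (b (g *\<^sub>R u) \<omega>) *\<^sub>R b (g *\<^sub>R u) \<omega>) \<partial>MB) \<le> (\<integral>\<omega>. 1 \<partial>MB)"
      by (intro integral_mono i) (auto simp: indicator_def)
    also have "\<dots> = 1 * 1" using P.prob_space by simp
    also have "\<dots> \<le> (1 + mom2 * (norm u + (norm u)\<^sup>2)) * sqrt g"
      using K False by (intro mult_mono) auto
    finally show ?thesis .
  qed
qed

text \<open>For a single u the integral in y converges absolutely, because sqrt g / g is integrable
  near 0. The majorant depends on u, so this gives no absolute convergence jointly in (u,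
  y).\<close>

lemma vg_kernel_mean:
  assumes u: "u \<in> orthant_star"
  shows "set_integrable (vg_kernel \<mu> A u) (cball 0 1) (\<lambda>y. y)"
    and "(1 / (norm u)\<^sup>2) *\<^sub>R (LINT y:cball 0 1|vg_kernel \<mu> A u. y)
        = (\<integral>g. (exp (- (norm u)\<^sup>2 * g) / g) *\<^sub>R tmean (jump (u, g)) \<partial>pos_lborel)"
proof -
  note cball_sets [measurable]
  have uo: "u \<in> orthant" and u0: "u \<noteq> 0" using u by (auto simp: orthant_star_def)
  let ?D = "density pos_lborel (\<lambda>g. ennreal (vgw u g))"
  interpret D: pair_sigma_finite ?D MB
    using vg_base_sigma_finite P.sigma_finite_measure_axioms by (rule pair_sigma_finite.intro)
  let ?bg = "\<lambda>(g, \<omega>). b (g *\<^sub>R u) \<omega>"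
  let ?f = "\<lambda>y :: real ^ 'n. indicator (cball 0 1) y *\<^sub>R y"
  have fb: "?f \<in> borel_measurable borel" by measurable
  have fm: "(\<lambda>x. ?f (?bg x)) \<in> borel_measurable (?D \<Otimes>\<^sub>M MB)"
    using measurable_compose[OF measurable_bg(2)[of u] fb] by (simp add: vg_base_def)
  have pos: "AE g in pos_lborel. 0 \<le> vgw u g" by (rule AE_I2) (simp add: vgw_def)
  have int: "integrable (?D \<Otimes>\<^sub>M MB) (\<lambda>x. ?f (?bg x))"
  proof (rule D.Fubini_integrable[OF fm])
    show "AE g in ?D. integrable MB (\<lambda>\<omega>. ?f (?bg (g, \<omega>)))"
      by (intro AE_I2 P.integrable_const_bound[where B=1]) (auto simp: indicator_def)
    have m: "(\<lambda>g. \<integral>\<omega>. norm (?f (?bg (g, \<omega>))) \<partial>MB) \<in> borel_measurable pos_lborel"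
    proof -
      have "(\<lambda>x. norm (?f (?bg x))) \<in> borel_measurable (pos_lborel \<Otimes>\<^sub>M MB)"
        by (rule measurable_compose[OF measurable_compose[OF measurable_bg(1)[of u] fb] borel_measurable_norm])
      then show ?thesis by (intro P.borel_measurable_lebesgue_integral) simp
    qed
    have "integrable pos_lborel (\<lambda>g. vgw u g *\<^sub>R (\<integral>\<omega>. norm (?f (?bg (g, \<omega>))) \<partial>MB))"
    proof (rule Bochner_Integration.integrable_bound)
      let ?K = "(norm u)\<^sup>2 * (1 + mom2 * (norm u + (norm u)\<^sup>2))"
      show "integrable pos_lborel (\<lambda>g. ?K * (exp (- (norm u)\<^sup>2 * g) / sqrt g))"
        using u0 by (intro integrable_mult_right integrable_exp_div_sqrt_pos) simp
      show "(\<lambda>g. vgw u g *\<^sub>R (\<integral>\<omega>. norm (?f (?bg (g, \<omega>))) \<partial>MB)) \<in> borel_measurable pos_lborel"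
        using m by measurable
      show "AE g in pos_lborel. norm (vgw u g *\<^sub>R (\<integral>\<omega>. norm (?f (?bg (g, \<omega>))) \<partial>MB)) \<le> norm (?K * (exp (- (norm u)\<^sup>2 * g) / sqrt g))"
      proof (rule AE_I2)
        fix g assume "g \<in> space pos_lborel"
        then have g: "0 < g" by simp
        have K: "0 \<le> mom2 * (norm u + (norm u)\<^sup>2)" using mom_nonneg by simp
        have sg: "sqrt g / g = 1 / sqrt g" using g by (simp add: field_simps)
        have w0: "0 \<le> vgw u g" using g by (simp add: vgw_def)
        have "vgw u g * (\<integral>\<omega>. norm (?f (?bg (g, \<omega>))) \<partial>MB) \<le> vgw u g * ((1 + mom2 * (norm u + (norm u)\<^sup>2)) * sqrt g)"
          using vg_truncated_abs_moment[OF uo g] w0 by (intro mult_left_mono) simp_all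
        also have "\<dots> = ?K * (exp (- (norm u)\<^sup>2 * g) * (sqrt g / g))" by (simp add: vgw_def)
        also have "\<dots> = ?K * (exp (- (norm u)\<^sup>2 * g) / sqrt g)" unfolding sg by simp
        finally show "norm (vgw u g *\<^sub>R (\<integral>\<omega>. norm (?f (?bg (g, \<omega>))) \<partial>MB)) \<le> norm (?K * (exp (- (norm u)\<^sup>2 * g) / sqrt g))"
          using w0 K g by (simp add: abs_of_nonneg)
      qed
    qed
    then show "integrable ?D (\<lambda>g. \<integral>\<omega>. norm (?f (?bg (g, \<omega>))) \<partial>MB)"
      by (subst integrable_density[OF m _ pos]) simp_all
  qed
  have f0: "?f 0 = 0" by simp
  show "set_integrable (vg_kernel \<mu> A u) (cball 0 1) (\<lambda>y. y)"
    unfolding set_integrable_def vg_kernel_star_image[OF uo]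
    using integral_star_image(1)[OF measurable_bg(2) fb f0, of u] int by (simp add: vg_base_def)
  have tg: "(\<lambda>g. tmean (g *\<^sub>R u)) \<in> borel_measurable pos_lborel"
    by (rule measurable_pos_lborel) measurable
  have "(LINT y:cball 0 1|vg_kernel \<mu> A u. y) = (\<integral>x. ?f (?bg x) \<partial>(?D \<Otimes>\<^sub>M MB))"
    unfolding set_lebesgue_integral_def vg_kernel_star_image[OF uo]
    using integral_star_image(2)[OF measurable_bg(2) fb f0, of u] by (simp add: vg_base_def)
  also have "\<dots> = (\<integral>g. tmean (g *\<^sub>R u) \<partial>?D)"
    unfolding D.integral_fst'[OF int, symmetric] by (simp add: tmean_def)
  also have "\<dots> = (\<integral>g. vgw u g *\<^sub>R tmean (g *\<^sub>R u) \<partial>pos_lborel)"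
    by (rule integral_density[OF tg _ pos]) simp
  also have "(1 / (norm u)\<^sup>2) *\<^sub>R \<dots> = (\<integral>g. (1 / (norm u)\<^sup>2) *\<^sub>R (vgw u g *\<^sub>R tmean (g *\<^sub>R u)) \<partial>pos_lborel)"
    by (rule integral_scaleR_right[symmetric])
  also have "\<dots> = (\<integral>g. (exp (- (norm u)\<^sup>2 * g) / g) *\<^sub>R tmean (jump (u, g)) \<partial>pos_lborel)"
    using u0 by (simp add: vgw_def jump_def)
  finally show "(1 / (norm u)\<^sup>2) *\<^sub>R (LINT y:cball 0 1|vg_kernel \<mu> A u. y)
        = (\<integral>g. (exp (- (norm u)\<^sup>2 * g) / g) *\<^sub>R tmean (jump (u, g)) \<partial>pos_lborel)" .
qed

text \<open>Integrability in u rests on the bound for \<open>tmean\<close>, where averaging over B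
  has already produced the cancellation; this is why \<open>vgg_small_jump_mean\<close> integrates
  over y first.\<close>

lemma small_jump_mean:
  shows "integrable U (\<lambda>u. (1 / (norm u)\<^sup>2) *\<^sub>R (LINT y:cball 0 1|vg_kernel \<mu> A u. y))"
    and "vgg_small_jump_mean \<mu> A U = (\<integral>x. tmean (jump x) \<partial>thorin_mix U)"
proof -
  have eq: "(1 / (norm u)\<^sup>2) *\<^sub>R (LINT y:cball 0 1|vg_kernel \<mu> A u. y)
        = (\<integral>g. (exp (- (norm u)\<^sup>2 * g) / g) *\<^sub>R tmean (jump (u, g)) \<partial>pos_lborel)" if "u \<in> space U" for u
    using that space_thorin[OF U] by (intro vg_kernel_mean(2)) simp
  show "integrable U (\<lambda>u. (1 / (norm u)\<^sup>2) *\<^sub>R (LINT y:cball 0 1|vg_kernel \<mu> A u. y))"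
    using mix_fubini(1)[OF tmean_integrable(1)] by (subst Bochner_Integration.integrable_cong[OF refl eq])
  show "vgg_small_jump_mean \<mu> A U = (\<integral>x. tmean (jump x) \<partial>thorin_mix U)"
    unfolding vgg_small_jump_mean_def mix_fubini(2)[OF tmean_integrable(1)]
    by (rule Bochner_Integration.integral_cong[OF refl eq])
qed

lemma emeasure_levyY:
  assumes C: "C \<in> sets borel_star"
  shows "emeasure levyY C = (\<integral>\<^sup>+u. \<integral>\<^sup>+g. ennreal (exp (- (norm u)\<^sup>2 * g) / g) * hit C (g *\<^sub>R u) \<partial>pos_lborel \<partial>U)"
proof -
  have Cb [measurable]: "C \<in> sets borel" "0 \<notin> C" using sets_borel_starD[OF C] by auto
  have hj: "(\<lambda>x. hit C (jump x)) \<in> borel_measurable (U \<Otimes>\<^sub>M pos_lborel)"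
    using measurable_compose[OF measurable_pair_U[OF jump_measurable_borel] hit_measurable[OF Cb(1)]] .
  have "emeasure levyY C = (\<integral>\<^sup>+x. indicator C x \<partial>levyY)"
    unfolding levyY_def using C by simp
  also have "\<dots> = (\<integral>\<^sup>+x. indicator C (bj x) \<partial>(thorin_mix U \<Otimes>\<^sub>M MB))"
    unfolding levyY_def by (rule nn_integral_star_image) (use Cb in auto)
  also have "\<dots> = (\<integral>\<^sup>+x. \<integral>\<^sup>+\<omega>. indicator C (bj (x, \<omega>)) \<partial>MB \<partial>thorin_mix U)"
    by (rule P.nn_integral_fst[symmetric]) measurable
  also have "\<dots> = (\<integral>\<^sup>+x. hit C (jump x) \<partial>thorin_mix U)"
    by (simp add: bj_def hit_eq)
  also have "\<dots> = (\<integral>\<^sup>+u. \<integral>\<^sup>+g. ennreal (exp (- (norm u)\<^sup>2 * g) / g) * hit C (g *\<^sub>R u) \<partial>pos_lborel \<partial>U)"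
    unfolding nn_integral_mix[OF hj] by (simp add: jump_def)
  finally show ?thesis .
qed

lemma vg_kernel_weighted:
  assumes u: "u \<in> orthant_star" and C: "C \<in> sets borel_star"
  shows "emeasure (vg_kernel \<mu> A u) C * ennreal (1 / (norm u)\<^sup>2) = (\<integral>\<^sup>+g. ennreal (exp (- (norm u)\<^sup>2 * g) / g) * hit C (g *\<^sub>R u) \<partial>pos_lborel)"
proof -
  have uo: "u \<in> orthant" and u0: "u \<noteq> 0" using u by (auto simp: orthant_star_def)
  have Cb: "C \<in> sets borel" using sets_borel_starD[OF C] by auto
  note [measurable] = hit_g_measurable[OF Cb]
  have "emeasure (vg_kernel \<mu> A u) C * ennreal (1 / (norm u)\<^sup>2) = (\<integral>\<^sup>+g. ennreal (vgw u g) * hit C (g *\<^sub>R u) * ennreal (1 / (norm u)\<^sup>2) \<partial>pos_lborel)"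
    unfolding emeasure_vg_kernel[OF uo C] by (rule nn_integral_multc[symmetric]) measurable
  also have "\<dots> = (\<integral>\<^sup>+g. ennreal (exp (- (norm u)\<^sup>2 * g) / g) * hit C (g *\<^sub>R u) \<partial>pos_lborel)"
  proof (rule nn_integral_cong)
    fix g assume "g \<in> space pos_lborel"
    then have "ennreal (vgw u g) * ennreal (1 / (norm u)\<^sup>2) = ennreal (exp (- (norm u)\<^sup>2 * g) / g)"
      using u0 by (subst ennreal_mult[symmetric]) (simp_all add: vgw_def)
    then show "ennreal (vgw u g) * hit C (g *\<^sub>R u) * ennreal (1 / (norm u)\<^sup>2) = ennreal (exp (- (norm u)\<^sup>2 * g) / g) * hit C (g *\<^sub>R u)"
      by (metis mult.assoc mult.commute)
  qed
  finally show ?thesis .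
qed

lemma weighted_hit_measurable:
  assumes C: "C \<in> sets borel"
  shows "(\<lambda>u. \<integral>\<^sup>+g. ennreal (exp (- (norm u)\<^sup>2 * g) / g) * hit C (g *\<^sub>R u) \<partial>pos_lborel) \<in> borel_measurable U"
proof (rule Up.M2.borel_measurable_nn_integral)
  have "(\<lambda>(u, g). ennreal (exp (- (norm u)\<^sup>2 * g) / g) * hit C (g *\<^sub>R u)) \<in> borel_measurable (borel \<Otimes>\<^sub>M borel)"
  proof -
    have [measurable]: "(\<lambda>x :: (real ^ 'n) \<times> real. hit C (snd x *\<^sub>R fst x)) \<in> borel_measurable (borel \<Otimes>\<^sub>M borel)"
      by (rule measurable_compose[OF _ hit_measurable[OF C]]) measurable
    show ?thesis unfolding split_beta' by measurable
  qed
  then show "(\<lambda>(u, g). ennreal (exp (- (norm u)\<^sup>2 * g) / g) * hit C (g *\<^sub>R u)) \<in> borel_measurable (U \<Otimes>\<^sub>M pos_lborel)"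
    by (rule measurable_pair_U)
qed

lemma emeasure_levyY_kernel:
  assumes C: "C \<in> sets borel_star"
  shows "emeasure levyY C = (\<integral>\<^sup>+u. emeasure (vg_kernel \<mu> A u) C * ennreal (1 / (norm u)\<^sup>2) \<partial>U)"
  unfolding emeasure_levyY[OF C]
  by (rule nn_integral_cong) (simp add: vg_kernel_weighted[OF _ C] space_thorin[OF U])

text \<open>On the cylinders over C the computation is immediate. The work lies in showing that
  \<open>kernel_prod\<close> is a measure at all, which requires measurability in u of the kernel on
  the sections of every set D of the product sigma-algebra.\<close>

lemma vgg_levy_measure_eq: "vgg_levy_measure \<mu> A U = levyY"
proof (rule measure_eqI)
  show s: "sets (vgg_levy_measure \<mu> A U) = sets levyY" by (simp add: vgg_levy_measure_def levyY_def)
  let ?W = "density U (\<lambda>u. ennreal (1 / (norm u)\<^sup>2))"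
  have Wm [measurable]: "(\<lambda>u. ennreal (1 / (norm u)\<^sup>2)) \<in> borel_measurable U"
    by (rule measurable_thorin[OF U]) measurable
  have spW: "space ?W = orthant_star" by (simp add: space_thorin[OF U])
  have sK: "sets (vg_kernel \<mu> A u) = sets borel_star" for u by (simp add: vg_kernel_def vg_measure_def)
  fix C assume "C \<in> sets (vgg_levy_measure \<mu> A U)"
  then have C: "C \<in> sets borel_star" by (simp add: vgg_levy_measure_def)
  have pm: "(\<lambda>u. emeasure (vg_kernel \<mu> A u) (Pair u -` D)) \<in> borel_measurable ?W"
    if D: "D \<in> sets (?W \<Otimes>\<^sub>M borel_star)" for D
  proof -
    have D': "D \<in> sets (U \<Otimes>\<^sub>M borel_star)"
      using D sets_pair_measure_cong[of ?W U borel_star borel_star] by simp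
    have sect: "Pair u -` D \<in> sets borel_star" for u by (rule sets_Pair1[OF D'])
    \<comment> \<open>D lives over the punctured space while B may hit 0, so 0 is sent to some
      nonzero vector to obtain a map into \<open>borel_star\<close>. The second indicator in F
      removes the contribution of that artificial value.\<close>
    define \<beta> where "\<beta> x = (if x = 0 then axis undefined 1 else x)" for x :: "real ^ 'n"
    have \<beta>: "\<beta> \<in> borel \<rightarrow>\<^sub>M borel_star"
      unfolding borel_star_def
    proof (rule measurable_restrict_space2)
      show "\<beta> \<in> space borel \<rightarrow> - {0}" by (auto simp: \<beta>_def axis_eq_0_iff)
      show "\<beta> \<in> borel \<rightarrow>\<^sub>M borel" unfolding \<beta>_def[abs_def] by measurable
    qed
    let ?X = "(U \<Otimes>\<^sub>M pos_lborel) \<Otimes>\<^sub>M MB"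
    have bX: "(\<lambda>x. b (jump (fst x)) (snd x)) \<in> borel_measurable ?X"
      by (rule measurable_b_comp[OF measurable_compose[OF measurable_fst measurable_pair_U[OF jump_measurable_borel]] measurable_snd])
    have "(\<lambda>x. (fst (fst x), \<beta> (b (jump (fst x)) (snd x)))) \<in> ?X \<rightarrow>\<^sub>M U \<Otimes>\<^sub>M borel_star"
      by (rule measurable_Pair[OF measurable_compose[OF measurable_fst measurable_fst] measurable_compose[OF bX \<beta>]])
    then have DX [measurable]: "(\<lambda>x. indicator D (fst (fst x), \<beta> (b (jump (fst x)) (snd x))) :: ennreal) \<in> borel_measurable ?X"
      by (rule measurable_compose) (use D' in simp)
    have ZX [measurable]: "(\<lambda>x. indicator (- {0}) (b (jump (fst x)) (snd x)) :: ennreal) \<in> borel_measurable ?X"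
      by (rule measurable_compose[OF bX]) simp
    define F where "F y = (\<integral>\<^sup>+\<omega>. indicator D (fst y, \<beta> (b (jump y) \<omega>)) * indicator (- {0}) (b (jump y) \<omega>) \<partial>MB)" for y
    have F: "F \<in> borel_measurable (U \<Otimes>\<^sub>M pos_lborel)"
      unfolding F_def[abs_def] by (rule P.borel_measurable_nn_integral) (unfold split_beta', measurable)
    have Fhit: "hit (Pair u -` D) (g *\<^sub>R u) = F (u, g)" for u g
    proof -
      have "Pair u -` D \<in> sets borel" using sets_borel_starD[OF sect] by simp
      then have "hit (Pair u -` D) (g *\<^sub>R u) = (\<integral>\<^sup>+\<omega>. indicator (Pair u -` D) (b (g *\<^sub>R u) \<omega>) \<partial>MB)" by (rule hit_eq)
      also have "\<dots> = F (u, g)"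
        unfolding F_def
      proof (rule nn_integral_cong)
        fix \<omega>
        have "(u, 0) \<notin> D" using sets_borel_starD[OF sect[of u]] by auto
        then show "indicator (Pair u -` D) (b (g *\<^sub>R u) \<omega>)
            = (indicator D (fst (u, g), \<beta> (b (jump (u, g)) \<omega>)) * indicator (- {0}) (b (jump (u, g)) \<omega>) :: ennreal)"
          by (auto simp: indicator_def \<beta>_def jump_def)
      qed
      finally show ?thesis .
    qed
    have wm: "(\<lambda>(u, g). ennreal (vgw u g)) \<in> borel_measurable (U \<Otimes>\<^sub>M pos_lborel)"
      unfolding vgw_def by (rule measurable_pair_U) (unfold split_beta', measurable)
    have "(\<lambda>u. \<integral>\<^sup>+g. ennreal (vgw u g) * F (u, g) \<partial>pos_lborel) \<in> borel_measurable U"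
      using wm F by (intro Up.M2.borel_measurable_nn_integral) (simp add: split_beta')
    then show ?thesis
      by (subst measurable_cong[where g="\<lambda>u. \<integral>\<^sup>+g. ennreal (vgw u g) * F (u, g) \<partial>pos_lborel"])
         (auto simp: emeasure_vg_kernel[OF _ sect] Fhit space_thorin[OF U] orthant_star_def)
  qed
  let ?N = "kernel_prod ?W borel_star (vg_kernel \<mu> A)"
  have spS: "space borel_star = - {0 :: real ^ 'n}" by (simp add: borel_star_def space_restrict_space)
  have CX: "space ?W \<times> C \<in> sets (?W \<Otimes>\<^sub>M borel_star)" using C by (intro pair_measureI) auto
  have "snd \<in> ?N \<rightarrow>\<^sub>M borel_star"
  proof -
    have "sets ?N = sets (?W \<Otimes>\<^sub>M borel_star)" by simp
    from measurable_cong_sets[OF this refl] show ?thesis using measurable_snd by blast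
  qed
  then have "emeasure (vgg_levy_measure \<mu> A U) C = emeasure ?N (snd -` C \<inter> space ?N)"
    unfolding vgg_levy_measure_def using C by (rule emeasure_distr)
  also have "snd -` C \<inter> space ?N = space ?W \<times> C"
    using sets.sets_into_space[OF C] by auto
  also have "emeasure ?N (space ?W \<times> C) = (\<integral>\<^sup>+u. emeasure (vg_kernel \<mu> A u) (Pair u -` (space ?W \<times> C)) \<partial>?W)"
    by (rule emeasure_kernel_prod[OF _ pm CX]) (simp_all add: sK)
  also have "\<dots> = (\<integral>\<^sup>+u. emeasure (vg_kernel \<mu> A u) C \<partial>?W)"
    by (rule nn_integral_cong) (auto intro!: arg_cong2[where f=emeasure])
  also have "\<dots> = (\<integral>\<^sup>+u. ennreal (1 / (norm u)\<^sup>2) * emeasure (vg_kernel \<mu> A u) C \<partial>U)"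
  proof (rule nn_integral_density[OF Wm])
    have "space ?W \<times> C \<in> sets (?W \<Otimes>\<^sub>M borel_star)" by (rule CX)
    from pm[OF this] have "(\<lambda>u. emeasure (vg_kernel \<mu> A u) (Pair u -` (space U \<times> C))) \<in> borel_measurable U" by simp
    moreover have "Pair u -` (space U \<times> C) = C" if "u \<in> space U" for u using that by auto
    ultimately show "(\<lambda>u. emeasure (vg_kernel \<mu> A u) C) \<in> borel_measurable U"
      by (subst measurable_cong[where g="\<lambda>u. emeasure (vg_kernel \<mu> A u) (Pair u -` (space U \<times> C))"]) simp_all
  qed
  also have "\<dots> = emeasure levyY C"
    unfolding emeasure_levyY_kernel[OF C] by (simp add: mult.commute)
  finally show "emeasure (vgg_levy_measure \<mu> A U) C = emeasure levyY C" .
qed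

section \<open>Characteristic exponents\<close>

definition bm_cf :: "real ^ 'n \<Rightarrow> real ^ 'n \<Rightarrow> complex" where
  "bm_cf t \<theta> = exp (\<i> * of_real ((t \<diamond>\<^sub>v \<mu>) \<bullet> \<theta>) - of_real (qinner (t \<diamond>\<^sub>m A) \<theta> \<theta>) / 2)"

text \<open>Serves both Y (W = \<open>bj\<close>) and the joint process (W = \<open>zj\<close>, with
  frequency (0, theta)): the character sees W only through theta . b, and the truncations differ
  only in \<open>tm\<close>. Because \<open>tm\<close> is integrable over the jumps, the compensator
  splits off as a separate convergent integral.\<close>

lemma jump_integral:
  fixes W :: "((real ^ 'n) \<times> real) \<times> 'b \<Rightarrow> real ^ 'm" and \<theta> :: "real ^ 'n" and tm :: "(real ^ 'n) \<times> real \<Rightarrow> real ^ 'n"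
  assumes W [measurable]: "W \<in> borel_measurable (thorin_mix U \<Otimes>\<^sub>M MB)"
    and L: "levy_measure (star_image (thorin_mix U \<Otimes>\<^sub>M MB) W)"
    and dot: "\<And>x \<omega>. \<eta> \<bullet> W (x, \<omega>) = \<theta> \<bullet> b (jump x) \<omega>"
    and tm: "\<And>x. tm x = (\<integral>\<omega>. indicator (cball 0 1) (W (x, \<omega>)) *\<^sub>R b (jump x) \<omega> \<partial>MB)"
    and tmi: "integrable (thorin_mix U) tm"
  shows "integrable (thorin_mix U) (\<lambda>x. bm_cf (jump x) \<theta> - 1)"
    and "(\<integral>y. iexp (\<eta> \<bullet> y) - 1 - \<i> * of_real (\<eta> \<bullet> y) * indicator (cball 0 1) y \<partial>star_image (thorin_mix U \<Otimes>\<^sub>M MB) W)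
      = (\<integral>x. bm_cf (jump x) \<theta> - 1 \<partial>thorin_mix U) - \<i> * of_real (\<theta> \<bullet> (\<integral>x. tm x \<partial>thorin_mix U))"
proof -
  note cball_sets [measurable]
  define f where "f y = iexp (\<eta> \<bullet> y) - 1 - \<i> * of_real (\<eta> \<bullet> y) * indicator (cball 0 1) y" for y
  have fm: "f \<in> borel_measurable borel" unfolding f_def[abs_def] by (rule levy_integrand_measurable)
  have f0: "f 0 = 0" by (simp add: f_def)
  have int: "integrable (thorin_mix U \<Otimes>\<^sub>M MB) (\<lambda>p. f (W p))"
    using levy_integrand_integrable[OF L, of \<eta>] integral_star_image(1)[OF W fm f0] by (simp add: f_def)
  have inner: "(\<integral>\<omega>. f (W (x, \<omega>)) \<partial>MB) = (bm_cf (jump x) \<theta> - 1) - \<i> * of_real (\<theta> \<bullet> tm x)"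
    if x: "x \<in> space (thorin_mix U)" for x
  proof -
    have [measurable]: "(\<lambda>\<omega>. W (x, \<omega>)) \<in> borel_measurable MB" using x by measurable
    have i1: "integrable MB (\<lambda>\<omega>. iexp (\<theta> \<bullet> b (jump x) \<omega>) - 1)"
      by (intro Bochner_Integration.integrable_diff P.integrable_const P.integrable_const_bound[where B=1]) auto
    have i2: "integrable MB (\<lambda>\<omega>. indicator (cball 0 1) (W (x, \<omega>)) *\<^sub>R b (jump x) \<omega>)"
      by (rule Bochner_Integration.integrable_bound[OF b_mean(1)[OF jump_mem[OF x]]]) (auto simp: indicator_def)
    have i3: "integrable MB (\<lambda>\<omega>. complex_of_real (\<theta> \<bullet> (indicator (cball 0 1) (W (x, \<omega>)) *\<^sub>R b (jump x) \<omega>)))"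
      by (intro integrable_of_real integrable_inner_right i2)
    have "(\<integral>\<omega>. f (W (x, \<omega>)) \<partial>MB) = (\<integral>\<omega>. (iexp (\<theta> \<bullet> b (jump x) \<omega>) - 1)
        - \<i> * complex_of_real (\<theta> \<bullet> (indicator (cball 0 1) (W (x, \<omega>)) *\<^sub>R b (jump x) \<omega>)) \<partial>MB)"
      by (intro Bochner_Integration.integral_cong refl) (simp add: f_def dot indicator_def)
    also have "\<dots> = (\<integral>\<omega>. iexp (\<theta> \<bullet> b (jump x) \<omega>) - 1 \<partial>MB)
        - \<i> * (\<integral>\<omega>. complex_of_real (\<theta> \<bullet> (indicator (cball 0 1) (W (x, \<omega>)) *\<^sub>R b (jump x) \<omega>)) \<partial>MB)"
      by (subst Bochner_Integration.integral_diff[OF i1 integrable_mult_right[OF i3]]) (simp only: integral_mult_right_zero)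
    also have "(\<integral>\<omega>. complex_of_real (\<theta> \<bullet> (indicator (cball 0 1) (W (x, \<omega>)) *\<^sub>R b (jump x) \<omega>)) \<partial>MB) = of_real (\<theta> \<bullet> tm x)"
      unfolding tm integral_complex_of_real by (subst integral_inner_right) (use i2 in auto)
    also have "(\<integral>\<omega>. iexp (\<theta> \<bullet> b (jump x) \<omega>) - 1 \<partial>MB) = bm_cf (jump x) \<theta> - 1"
    proof -
      have "integrable MB (\<lambda>\<omega>. iexp (\<theta> \<bullet> b (jump x) \<omega>))"
        by (rule P.integrable_const_bound[where B=1]) auto
      then have "(\<integral>\<omega>. iexp (\<theta> \<bullet> b (jump x) \<omega>) - 1 \<partial>MB) = (\<integral>\<omega>. iexp (\<theta> \<bullet> b (jump x) \<omega>) \<partial>MB) - (\<integral>\<omega>. 1 \<partial>MB)"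
        by (rule Bochner_Integration.integral_diff) simp
      then show ?thesis using P.prob_space by (simp add: b_cf[OF jump_mem[OF x]] bm_cf_def)
    qed
    finally show ?thesis .
  qed
  have tc: "integrable (thorin_mix U) (\<lambda>x. \<i> * complex_of_real (\<theta> \<bullet> tm x))"
    by (intro integrable_mult_right integrable_of_real integrable_inner_right tmi)
  have "integrable (thorin_mix U) (\<lambda>x. \<integral>\<omega>. f (W (x, \<omega>)) \<partial>MB)" by (rule Q.integrable_fst'[OF int])
  then have "integrable (thorin_mix U) (\<lambda>x. (bm_cf (jump x) \<theta> - 1) - \<i> * of_real (\<theta> \<bullet> tm x))"
    by (subst (asm) Bochner_Integration.integrable_cong[OF refl inner])
  from Bochner_Integration.integrable_add[OF this tc]
  show i: "integrable (thorin_mix U) (\<lambda>x. bm_cf (jump x) \<theta> - 1)" by simp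
  have "(\<integral>y. f y \<partial>star_image (thorin_mix U \<Otimes>\<^sub>M MB) W) = (\<integral>p. f (W p) \<partial>(thorin_mix U \<Otimes>\<^sub>M MB))"
    by (rule integral_star_image(2)[OF W fm f0])
  also have "\<dots> = (\<integral>x. \<integral>\<omega>. f (W (x, \<omega>)) \<partial>MB \<partial>thorin_mix U)" by (rule Q.integral_fst'[OF int, symmetric])
  also have "\<dots> = (\<integral>x. (bm_cf (jump x) \<theta> - 1) - \<i> * of_real (\<theta> \<bullet> tm x) \<partial>thorin_mix U)"
    by (rule Bochner_Integration.integral_cong[OF refl inner])
  also have "\<dots> = (\<integral>x. bm_cf (jump x) \<theta> - 1 \<partial>thorin_mix U) - (\<integral>x. \<i> * of_real (\<theta> \<bullet> tm x) \<partial>thorin_mix U)"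
    by (rule Bochner_Integration.integral_diff[OF i tc])
  also have "(\<integral>x. \<i> * complex_of_real (\<theta> \<bullet> tm x) \<partial>thorin_mix U) = \<i> * of_real (\<theta> \<bullet> (\<integral>x. tm x \<partial>thorin_mix U))"
    unfolding integral_mult_right_zero integral_complex_of_real by (subst integral_inner_right) (use tmi in auto)
  finally show "(\<integral>y. iexp (\<eta> \<bullet> y) - 1 - \<i> * of_real (\<eta> \<bullet> y) * indicator (cball 0 1) y \<partial>star_image (thorin_mix U \<Otimes>\<^sub>M MB) W)
      = (\<integral>x. bm_cf (jump x) \<theta> - 1 \<partial>thorin_mix U) - \<i> * of_real (\<theta> \<bullet> (\<integral>x. tm x \<partial>thorin_mix U))"
    unfolding f_def .
qed

lemma levyY_exponent:
  shows "integrable (thorin_mix U) (\<lambda>x. bm_cf (jump x) \<theta> - 1)"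
    and "levy_exponent (a + vgg_small_jump_mean \<mu> A U) S levyY \<theta>
      = \<i> * of_real (a \<bullet> \<theta>) - of_real (qinner S \<theta> \<theta>) / 2 + (\<integral>x. bm_cf (jump x) \<theta> - 1 \<partial>thorin_mix U)"
proof -
  note J = jump_integral[OF bj_measurable levyY_levy_measure[unfolded levyY_def], of \<theta> \<theta> "\<lambda>x. tmean (jump x)",
      OF _ _ tmean_integrable(1)]
  show "integrable (thorin_mix U) (\<lambda>x. bm_cf (jump x) \<theta> - 1)"
    by (rule J(1)) (simp_all add: bj_def tmean_def)
  have "(\<integral>y. iexp (\<theta> \<bullet> y) - 1 - \<i> * of_real (\<theta> \<bullet> y) * indicator (cball 0 1) y \<partial>levyY)
      = (\<integral>x. bm_cf (jump x) \<theta> - 1 \<partial>thorin_mix U) - \<i> * of_real (\<theta> \<bullet> vgg_small_jump_mean \<mu> A U)"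
    unfolding levyY_def small_jump_mean(2) by (rule J(2)) (simp_all add: bj_def tmean_def)
  then show "levy_exponent (a + vgg_small_jump_mean \<mu> A U) S levyY \<theta>
      = \<i> * of_real (a \<bullet> \<theta>) - of_real (qinner S \<theta> \<theta>) / 2 + (\<integral>x. bm_cf (jump x) \<theta> - 1 \<partial>thorin_mix U)"
    unfolding levy_exponent_def by (simp add: inner_add_left inner_commute algebra_simps)
qed

lemma bm_cf_log_integral:
  shows "integrable U (\<lambda>u. Ln ((of_real ((norm u)\<^sup>2) - \<i> * of_real ((u \<diamond>\<^sub>v \<mu>) \<bullet> \<theta>)
           + of_real (qinner (u \<diamond>\<^sub>m A) \<theta> \<theta>) / 2) / of_real ((norm u)\<^sup>2)))"
    and "(\<integral>x. bm_cf (jump x) \<theta> - 1 \<partial>thorin_mix U) = - (\<integral>u. Ln ((of_real ((norm u)\<^sup>2) - \<i> * of_real ((u \<diamond>\<^sub>v \<mu>) \<bullet> \<theta>)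
           + of_real (qinner (u \<diamond>\<^sub>m A) \<theta> \<theta>) / 2) / of_real ((norm u)\<^sup>2)) \<partial>U)"
proof -
  let ?L = "\<lambda>u. Ln ((of_real ((norm u)\<^sup>2) - \<i> * of_real ((u \<diamond>\<^sub>v \<mu>) \<bullet> \<theta>) + of_real (qinner (u \<diamond>\<^sub>m A) \<theta> \<theta>) / 2) / of_real ((norm u)\<^sup>2))"
  have eq: "(\<integral>g. (exp (- (norm u)\<^sup>2 * g) / g) *\<^sub>R (bm_cf (jump (u, g)) \<theta> - 1) \<partial>pos_lborel) = - ?L u" if u: "u \<in> space U" for u
  proof -
    have uo: "u \<in> orthant" "u \<noteq> 0" using u by (auto simp: space_thorin[OF U] orthant_star_def)
    define z where "z = \<i> * of_real ((u \<diamond>\<^sub>v \<mu>) \<bullet> \<theta>) - complex_of_real (qinner (u \<diamond>\<^sub>m A) \<theta> \<theta>) / 2"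
    have "0 \<le> qinner (u \<diamond>\<^sub>m A) \<theta> \<theta>" using diamond_mat_psd[OF A uo(1)] by (simp add: covariance_matrix_def)
    then have Rz: "Re z \<le> 0" by (simp add: z_def)
    have "(\<integral>g. (exp (- (norm u)\<^sup>2 * g) / g) *\<^sub>R (bm_cf (jump (u, g)) \<theta> - 1) \<partial>pos_lborel)
        = (\<integral>g. of_real (exp (- (norm u)\<^sup>2 * g) / g) * (exp (of_real g * z) - 1) \<partial>pos_lborel)"
    proof (rule Bochner_Integration.integral_cong[OF refl])
      fix g assume "g \<in> space pos_lborel"
      then have g: "0 \<le> g" by simp
      have q: "qinner (g *\<^sub>R (u \<diamond>\<^sub>m A)) \<theta> \<theta> = g * qinner (u \<diamond>\<^sub>m A) \<theta> \<theta>"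
        by (simp add: qinner_sum sum_distrib_left mult.assoc)
      have "bm_cf (jump (u, g)) \<theta> = exp (of_real g * z)"
        unfolding bm_cf_def jump_def prod.case diamond_scaleR[OF g] q z_def by (simp add: algebra_simps)
      then show "(exp (- (norm u)\<^sup>2 * g) / g) *\<^sub>R (bm_cf (jump (u, g)) \<theta> - 1)
          = of_real (exp (- (norm u)\<^sup>2 * g) / g) * (exp (of_real g * z) - 1)"
        by (simp only: scaleR_conv_of_real)
    qed
    also have "\<dots> = - Ln (1 - z / of_real ((norm u)\<^sup>2))"
      using uo Rz by (intro frullani_complex) auto
    also have "1 - z / of_real ((norm u)\<^sup>2) = (of_real ((norm u)\<^sup>2) - \<i> * of_real ((u \<diamond>\<^sub>v \<mu>) \<bullet> \<theta>) + of_real (qinner (u \<diamond>\<^sub>m A) \<theta> \<theta>) / 2) / of_real ((norm u)\<^sup>2)"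
    proof -
      have "complex_of_real ((norm u)\<^sup>2) \<noteq> 0" using uo by simp
      then have "1 - z / of_real ((norm u)\<^sup>2) = (of_real ((norm u)\<^sup>2) - z) / of_real ((norm u)\<^sup>2)"
        by (simp add: diff_divide_distrib)
      then show ?thesis by (simp only: z_def diff_diff_eq2 diff_add_eq)
    qed
    finally show ?thesis .
  qed
  note i = levyY_exponent(1)[of \<theta>]
  have "integrable U (\<lambda>u. - ?L u)"
    using mix_fubini(1)[OF i] by (subst (asm) Bochner_Integration.integrable_cong[OF refl eq])
  from integrable_minus[OF this] show "integrable U ?L" by simp
  have "(\<integral>x. bm_cf (jump x) \<theta> - 1 \<partial>thorin_mix U) = (\<integral>u. - ?L u \<partial>U)"
    unfolding mix_fubini(2)[OF i] by (rule Bochner_Integration.integral_cong[OF refl eq])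
  also have "\<dots> = - (\<integral>u. ?L u \<partial>U)" by (rule integral_minus)
  finally show "(\<integral>x. bm_cf (jump x) \<theta> - 1 \<partial>thorin_mix U) = - (\<integral>u. ?L u \<partial>U)" .
qed

text \<open>Absolute integrability in y lifts to the product of \<open>thorin_mix U\<close> and
  \<open>MB\<close>, and Fubini there turns the plain mean into the iterated one.\<close>

lemma levyY_mean:
  assumes "set_integrable levyY (cball 0 1) (\<lambda>y. y)"
  shows "(LINT y:cball 0 1|levyY. y) = vgg_small_jump_mean \<mu> A U"
proof -
  note cball_sets [measurable]
  let ?f = "\<lambda>y :: real ^ 'n. indicator (cball 0 1) y *\<^sub>R y"
  have fb: "?f \<in> borel_measurable borel" by measurable
  have f0: "?f 0 = 0" by simp
  have int: "integrable (thorin_mix U \<Otimes>\<^sub>M MB) (\<lambda>p. ?f (bj p))"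
    using assms integral_star_image(1)[OF bj_measurable fb f0] by (simp add: set_integrable_def levyY_def)
  have "(LINT y:cball 0 1|levyY. y) = (\<integral>p. ?f (bj p) \<partial>(thorin_mix U \<Otimes>\<^sub>M MB))"
    unfolding set_lebesgue_integral_def levyY_def by (rule integral_star_image(2)[OF bj_measurable fb f0])
  also have "\<dots> = (\<integral>x. tmean (jump x) \<partial>thorin_mix U)"
    unfolding Q.integral_fst'[OF int, symmetric] by (simp add: tmean_def bj_def)
  finally show ?thesis by (simp add: small_jump_mean(2))
qed

section \<open>The weakly subordinated process\<close>

definition zj :: "((real ^ 'n) \<times> real) \<times> 'b \<Rightarrow> real ^ ('n + 'n)" where
  "zj = (\<lambda>(x, \<omega>). vjoin (jump x) (b (jump x) \<omega>))"

lemma zj_measurable [measurable]: "zj \<in> borel_measurable (thorin_mix U \<Otimes>\<^sub>M MB)"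
  unfolding zj_def split_beta' by measurable

text \<open>All jumps g u lie in \<open>orthant_star\<close>, so the restriction in
  \<open>weak_sub_measure\<close> loses no mass, and for each such t the law of B(t) may be computed
  with the version b.\<close>

lemma weak_sub_measure_eq:
  "weak_sub_measure MB B (star_image (thorin_mix U) jump) = star_image (thorin_mix U \<Otimes>\<^sub>M MB) zj"
proof (rule measure_eqI)
  let ?T = "star_image (thorin_mix U) jump"
  let ?R = "restrict_space ?T orthant_star"
  let ?K = "\<lambda>t. distr MB borel (\<lambda>\<omega>. vjoin t (multi_time B t \<omega>))"
  show "sets (weak_sub_measure MB B ?T) = sets (star_image (thorin_mix U \<Otimes>\<^sub>M MB) zj)"
    by (simp add: weak_sub_measure_def)
  fix C assume "C \<in> sets (weak_sub_measure MB B ?T)"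
  then have C: "C \<in> sets borel_star" by (simp add: weak_sub_measure_def)
  define p where "p D t = (\<integral>\<^sup>+\<omega>. indicator D (vjoin t (b t \<omega>)) \<partial>MB)" for D :: "(real ^ ('n + 'n)) set" and t
  have pm: "p D \<in> borel_measurable borel" if [measurable]: "D \<in> sets borel" for D
    unfolding p_def[abs_def] by (rule P.borel_measurable_nn_integral) (unfold split_beta', measurable)
  have spR: "space ?R \<subseteq> orthant_star" by (simp add: space_restrict_space)
  have Kp: "emeasure (?K t) D = p D t" if t: "t \<in> space ?R" and D [measurable]: "D \<in> sets borel" for t D
  proof -
    have to: "t \<in> orthant" using t spR by (auto simp: orthant_star_def)
    note [measurable] = measurable_multi_time[OF BM_levy to]
    have "emeasure (?K t) D = (\<integral>\<^sup>+y. indicator D y \<partial>?K t)" by simp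
    also have "\<dots> = (\<integral>\<^sup>+\<omega>. indicator D (vjoin t (multi_time B t \<omega>)) \<partial>MB)" by (rule nn_integral_distr) measurable
    also have "\<dots> = p D t"
      unfolding p_def by (rule nn_integral_cong_AE) (use b_AE[OF to] in eventually_elim, simp)
    finally show ?thesis .
  qed
  have emb: "(\<lambda>t :: real ^ 'n. t) \<in> ?R \<rightarrow>\<^sub>M borel"
  proof -
    have "(\<lambda>t :: real ^ 'n. t) \<in> borel_star \<rightarrow>\<^sub>M borel"
      unfolding borel_star_def by (rule measurable_restrict_space1) simp
    then have "(\<lambda>t :: real ^ 'n. t) \<in> ?T \<rightarrow>\<^sub>M borel"
      using measurable_cong_sets[OF sets_star_image refl] by blast
    then show ?thesis by (rule measurable_restrict_space1)
  qed
  have os: "orthant_star \<inter> space ?T \<in> sets ?T"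
    by (auto simp: borel_star_def sets_restrict_space orthant_star_def intro!: image_eqI[where x="orthant_star"])
  have "emeasure (weak_sub_measure MB B ?T) C = (\<integral>\<^sup>+t. emeasure (?K t) C \<partial>?R)"
    unfolding weak_sub_measure_def
  proof (rule emeasure_kernel_mix[OF _ _ C])
    show "sets borel_star \<subseteq> sets (?K t)" for t using sets_borel_starD by auto
    fix D :: "(real ^ ('n + 'n)) set" assume "D \<in> sets borel_star"
    then have D: "D \<in> sets borel" using sets_borel_starD by blast
    show "(\<lambda>t. emeasure (?K t) D) \<in> borel_measurable ?R"
      by (subst measurable_cong[OF Kp[OF _ D]]) (assumption, rule measurable_compose[OF emb pm[OF D]])
  qed
  also have "\<dots> = (\<integral>\<^sup>+t. p C t \<partial>?R)"
    by (rule nn_integral_cong) (rule Kp, use sets_borel_starD[OF C] in auto)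
  also have "\<dots> = (\<integral>\<^sup>+t. p C t * indicator orthant_star t \<partial>?T)"
    by (rule nn_integral_restrict_space[OF os])
  also have "\<dots> = (\<integral>\<^sup>+x. p C (jump x) * indicator orthant_star (jump x) \<partial>thorin_mix U)"
  proof (rule nn_integral_star_image[OF jump_measurable])
    have [measurable]: "p C \<in> borel_measurable borel" using pm[of C] sets_borel_starD[OF C] by simp
    note orthant_star_borel [measurable]
    show "(\<lambda>t. p C t * indicator orthant_star t) \<in> borel_measurable borel" by measurable
    show "p C 0 * indicator orthant_star 0 = 0" by (simp add: orthant_star_def)
  qed
  also have "\<dots> = (\<integral>\<^sup>+x. \<integral>\<^sup>+\<omega>. indicator C (zj (x, \<omega>)) \<partial>MB \<partial>thorin_mix U)"
    by (rule nn_integral_cong) (simp add: jump_orthant p_def zj_def)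
  also have "\<dots> = (\<integral>\<^sup>+y. indicator C (zj y) \<partial>(thorin_mix U \<Otimes>\<^sub>M MB))"
  proof (rule P.nn_integral_fst)
    have [measurable]: "C \<in> sets borel" using sets_borel_starD[OF C] by simp
    show "(\<lambda>y. indicator C (zj y)) \<in> borel_measurable (thorin_mix U \<Otimes>\<^sub>M MB)" by measurable
  qed
  also have "\<dots> = (\<integral>\<^sup>+y. indicator C y \<partial>star_image (thorin_mix U \<Otimes>\<^sub>M MB) zj)"
    by (rule nn_integral_star_image[symmetric]) (use sets_borel_starD[OF C] in auto)
  also have "\<dots> = emeasure (star_image (thorin_mix U \<Otimes>\<^sub>M MB) zj) C" using C by simp
  finally show "emeasure (weak_sub_measure MB B ?T) C = emeasure (star_image (thorin_mix U \<Otimes>\<^sub>M MB) zj) C" .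
qed

lemma joint_truncated_mean_eq:
  "(LINT t:orthant_star|star_image (thorin_mix U) jump.
      (\<integral>\<omega>. indicator (cball 0 1) (vjoin t (multi_time B t \<omega>)) *\<^sub>R multi_time B t \<omega> \<partial>MB))
    = (\<integral>x. tmean_join (jump x) \<partial>thorin_mix U)"
proof -
  note cball_sets [measurable]
  have "indicator orthant_star t *\<^sub>R (\<integral>\<omega>. indicator (cball 0 1) (vjoin t (multi_time B t \<omega>)) *\<^sub>R multi_time B t \<omega> \<partial>MB)
      = indicator orthant_star t *\<^sub>R tmean_join t" for t
  proof (cases "t \<in> orthant_star")
    case True
    then have to: "t \<in> orthant" by (simp add: orthant_star_def)
    have [measurable]: "(\<lambda>y. vjoin t y) \<in> borel_measurable borel" by (rule measurable_vjoin) simp_all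
    have "tmean_join t = (\<integral>\<omega>. indicator (cball 0 1) (vjoin t (multi_time B t \<omega>)) *\<^sub>R multi_time B t \<omega> \<partial>MB)"
      unfolding tmean_join_def by (rule b_transfer(1)[OF to, of "\<lambda>y. indicator (cball 0 1) (vjoin t y) *\<^sub>R y"]) measurable
    then show ?thesis by simp
  qed simp
  then have "(LINT t:orthant_star|star_image (thorin_mix U) jump.
      (\<integral>\<omega>. indicator (cball 0 1) (vjoin t (multi_time B t \<omega>)) *\<^sub>R multi_time B t \<omega> \<partial>MB))
      = (\<integral>t. indicator orthant_star t *\<^sub>R tmean_join t \<partial>star_image (thorin_mix U) jump)"
    unfolding set_lebesgue_integral_def by (simp only:)
  also have "\<dots> = (\<integral>x. indicator orthant_star (jump x) *\<^sub>R tmean_join (jump x) \<partial>thorin_mix U)"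
    by (rule integral_star_image(2)[OF jump_measurable]) (measurable, simp add: orthant_star_def)
  also have "\<dots> = (\<integral>x. tmean_join (jump x) \<partial>thorin_mix U)"
    by (rule Bochner_Integration.integral_cong) (simp_all add: jump_orthant)
  finally show ?thesis .
qed

text \<open>At the frequency (0, theta) the location of the T block is paired with 0, and the joint
  compensator produced by \<open>jump_integral\<close> cancels exactly against the integral of
  \<open>tmean_join\<close> in the second block. The result is free of any truncation and can be
  compared with the exponent built from \<open>levyY\<close>.\<close>

lemma weak_subordination_cf:
  fixes Z :: "real \<Rightarrow> 'z \<Rightarrow> real ^ ('n + 'n)"
  assumes W: "weak_subordination MB B \<mu> A MT T MZ Z" and G: "ggc_subordinator MT T d U" and t: "0 \<le> t"
  shows "(\<integral>\<omega>. iexp (\<theta> \<bullet> vsnd (Z t \<omega>)) \<partial>MZ)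
    = exp (of_real t * (\<i> * of_real ((d \<diamond>\<^sub>v \<mu>) \<bullet> \<theta>) - of_real (qinner (d \<diamond>\<^sub>m A) \<theta> \<theta>) / 2 + (\<integral>x. bm_cf (jump x) \<theta> - 1 \<partial>thorin_mix U)))"
proof -
  obtain d' \<T> where S: "subordinator_law MT T d' \<T>"
    and Z: "levy_law MZ Z
          (vjoin
            (d' + (LINT t:orthant_star|\<T>. measure MB {\<omega> \<in> space MB. vjoin t (multi_time B t \<omega>) \<in> cball 0 1} *\<^sub>R t))
            (d' \<diamond>\<^sub>v \<mu> + (LINT t:orthant_star|\<T>.
                    (\<integral>\<omega>. indicator (cball 0 1) (vjoin t (multi_time B t \<omega>)) *\<^sub>R multi_time B t \<omega> \<partial>MB))))
          (lower_block (d' \<diamond>\<^sub>m A)) (weak_sub_measure MB B \<T>)"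
    using W unfolding weak_subordination_def by blast
  note d' = thorin_subordinator_unique(1)[OF S G]
  note \<T> = thorin_subordinator_unique(2)[OF S G]
  let ?M = "star_image (thorin_mix U \<Otimes>\<^sub>M MB) zj"
  obtain m1 where Z': "levy_law MZ Z (vjoin m1 (d \<diamond>\<^sub>v \<mu> + (\<integral>x. tmean_join (jump x) \<partial>thorin_mix U))) (lower_block (d \<diamond>\<^sub>m A)) ?M"
    using Z unfolding d' \<T> weak_sub_measure_eq joint_truncated_mean_eq by blast
  have "(\<integral>\<omega>. iexp (vjoin 0 \<theta> \<bullet> Z t \<omega>) \<partial>MZ)
      = exp (of_real t * levy_exponent (vjoin m1 (d \<diamond>\<^sub>v \<mu> + (\<integral>x. tmean_join (jump x) \<partial>thorin_mix U))) (lower_block (d \<diamond>\<^sub>m A)) ?M (vjoin 0 \<theta>))"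
    using Z' t by (simp add: levy_law_def)
  also have "levy_exponent (vjoin m1 (d \<diamond>\<^sub>v \<mu> + (\<integral>x. tmean_join (jump x) \<partial>thorin_mix U))) (lower_block (d \<diamond>\<^sub>m A)) ?M (vjoin 0 \<theta>)
      = \<i> * of_real ((d \<diamond>\<^sub>v \<mu>) \<bullet> \<theta>) - of_real (qinner (d \<diamond>\<^sub>m A) \<theta> \<theta>) / 2 + (\<integral>x. bm_cf (jump x) \<theta> - 1 \<partial>thorin_mix U)"
  proof -
    have L: "levy_measure ?M" using Z' by (simp add: levy_law_def)
    have J: "(\<integral>y. iexp (vjoin 0 \<theta> \<bullet> y) - 1 - \<i> * of_real (vjoin 0 \<theta> \<bullet> y) * indicator (cball 0 1) y \<partial>?M)
        = (\<integral>x. bm_cf (jump x) \<theta> - 1 \<partial>thorin_mix U) - \<i> * of_real (\<theta> \<bullet> (\<integral>x. tmean_join (jump x) \<partial>thorin_mix U))"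
      by (rule jump_integral(2)[OF zj_measurable L _ _ tmean_integrable(2)]) (simp_all add: zj_def vjoin_0_inner tmean_join_def)
    have "vjoin m1 (d \<diamond>\<^sub>v \<mu> + (\<integral>x. tmean_join (jump x) \<partial>thorin_mix U)) \<bullet> vjoin 0 \<theta>
        = (d \<diamond>\<^sub>v \<mu> + (\<integral>x. tmean_join (jump x) \<partial>thorin_mix U)) \<bullet> \<theta>"
      using vjoin_0_inner[of \<theta> "vjoin m1 _"] by (simp add: inner_commute)
    then show ?thesis
      unfolding levy_exponent_def J qinner_lower_block by (simp add: inner_add_left inner_commute algebra_simps)
  qed
  finally show ?thesis by (simp only: vjoin_0_inner)
qed

section \<open>Decomposition of the Levy measure into absolutely continuous parts\<close>

lemma coord_lebesgue_eq: "coord_lebesgue J = star_image (\<Pi>\<^sub>M j\<in>J. lborel) (coord_emb J)"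
  by (simp add: coord_lebesgue_def star_image_def coord_emb_def[abs_def])

text \<open>A nonzero u in the orthant lies in C_J for exactly one J, its support.\<close>

lemma orthant_star_C_sets:
  assumes "u \<in> orthant_star"
  shows "(\<Sum>J | J \<noteq> {}. indicator (C_set J) u) = (1 :: ennreal)"
proof -
  define K where "K = {i. u $ i \<noteq> 0}"
  have "K \<noteq> {}" using assms by (auto simp: K_def orthant_star_def vec_eq_iff)
  have "u \<in> C_set J \<longleftrightarrow> J = K" for J
    using assms by (auto simp: C_set_def coord_space_def K_def orthant_star_def orthant_def less_le)
  then have "(\<Sum>J | J \<noteq> {}. indicator (C_set J) u) = (\<Sum>J | J \<noteq> {}. if J = K then 1 else (0 :: ennreal))"
    by (intro sum.cong) (auto simp: indicator_def)
  also have "\<dots> = 1" using \<open>K \<noteq> {}\<close> by simp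
  finally show ?thesis .
qed

text \<open>\<open>vgg_density\<close> with the integrand in Cramer form, so that it is visibly
  measurable.\<close>

definition vJ :: "'n set \<Rightarrow> real ^ 'n \<Rightarrow> ennreal" where
  "vJ J y = (\<integral>\<^sup>+u. ennreal (vgg_nu_cramer \<mu> A J u y) * indicator (C_set J) u \<partial>U) * indicator (V_set J) y"

lemma nu_pair_measurable:
  "(\<lambda>(y, u). ennreal (vgg_nu_cramer \<mu> A J u y) * indicator (C_set J) u) \<in> borel_measurable (borel \<Otimes>\<^sub>M U)"
proof -
  have "(\<lambda>p. (snd p, fst p)) \<in> borel \<Otimes>\<^sub>M U \<rightarrow>\<^sub>M borel \<Otimes>\<^sub>M borel"
    by (rule measurable_Pair[OF measurable_compose[OF measurable_snd measurable_ident_U] measurable_fst])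
  from measurable_compose[OF this measurable_vgg_nu_cramer[of \<mu> A J]]
  have [measurable]: "(\<lambda>p. vgg_nu_cramer \<mu> A J (snd p) (fst p)) \<in> borel_measurable (borel \<Otimes>\<^sub>M U)" by simp
  have [measurable]: "(\<lambda>p. indicator (C_set J) (snd p) :: ennreal) \<in> borel_measurable (borel \<Otimes>\<^sub>M U)"
    by (rule measurable_compose[OF measurable_compose[OF measurable_snd measurable_ident_U]]) simp
  show ?thesis unfolding split_beta' by measurable
qed

lemma vJ_measurable [measurable]: "vJ J \<in> borel_measurable borel"
proof -
  have [measurable]: "(\<lambda>y. \<integral>\<^sup>+u. ennreal (vgg_nu_cramer \<mu> A J u y) * indicator (C_set J) u \<partial>U) \<in> borel_measurable borel"
    by (rule sigma_finite_measure.borel_measurable_nn_integral[OF thorin_sigma_finite[OF U] nu_pair_measurable])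
  show ?thesis unfolding vJ_def[abs_def] by measurable
qed

lemma vgg_density_eq:
  assumes inv: "invertible A" and J: "J \<noteq> {}"
  shows "vgg_density \<mu> A U J = vJ J"
proof
  fix y
  show "vgg_density \<mu> A U J y = vJ J y"
  proof (cases "y \<in> V_set J")
    case True
    then have y: "y \<in> coord_space J" by (simp add: V_set_def)
    have "ennreal (vgg_nu \<mu> A J u y) * indicator (C_set J) u = ennreal (vgg_nu_cramer \<mu> A J u y) * indicator (C_set J) u" for u
      by (cases "u \<in> C_set J") (simp_all add: vgg_nu_eq_cramer[OF A inv _ J y])
    then show ?thesis by (simp add: vgg_density_def vJ_def)
  qed (simp add: vgg_density_def vJ_def)
qed

lemma emeasure_density_part:
  assumes J: "J \<noteq> {}" and C: "C \<in> sets borel_star"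
  shows "emeasure (density (coord_lebesgue J) (vJ J)) C = (\<integral>\<^sup>+y. vJ J y * indicator C y \<partial>coord_lebesgue J)"
    and "(\<integral>\<^sup>+y. vJ J y * indicator C y \<partial>coord_lebesgue J)
      = (\<integral>\<^sup>+a. \<integral>\<^sup>+u. ennreal (vgg_nu_cramer \<mu> A J u (coord_emb J a)) * indicator (C_set J) u * indicator C (coord_emb J a) \<partial>U \<partial>(\<Pi>\<^sub>M j\<in>J. lborel))"
proof -
  have Cb [measurable]: "C \<in> sets borel" "0 \<notin> C" using sets_borel_starD[OF C] by auto
  have m: "vJ J \<in> borel_measurable (coord_lebesgue J)"
  proof -
    have "vJ J \<in> borel_measurable borel_star"
      unfolding borel_star_def by (rule measurable_restrict_space1) measurable
    moreover have "sets (coord_lebesgue J) = sets borel_star" by (simp add: coord_lebesgue_eq)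
    ultimately show ?thesis using measurable_cong_sets[OF _ refl] by blast
  qed
  show "emeasure (density (coord_lebesgue J) (vJ J)) C = (\<integral>\<^sup>+y. vJ J y * indicator C y \<partial>coord_lebesgue J)"
    by (rule emeasure_density[OF m]) (simp add: coord_lebesgue_eq C)
  have "(\<integral>\<^sup>+y. vJ J y * indicator C y \<partial>coord_lebesgue J)
      = (\<integral>\<^sup>+a. vJ J (coord_emb J a) * indicator C (coord_emb J a) \<partial>(\<Pi>\<^sub>M j\<in>J. lborel))"
    unfolding coord_lebesgue_eq by (rule nn_integral_star_image) (use Cb in auto)
  also have "\<dots> = (\<integral>\<^sup>+a. \<integral>\<^sup>+u. ennreal (vgg_nu_cramer \<mu> A J u (coord_emb J a)) * indicator (C_set J) u * indicator C (coord_emb J a) \<partial>U \<partial>(\<Pi>\<^sub>M j\<in>J. lborel))"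
  proof (rule nn_integral_cong_AE)
    have "AE a in (\<Pi>\<^sub>M j\<in>J. lborel). coord_emb J a \<in> V_set J"
      using AE_coord_lborel_V[of J] unfolding coord_lborel_def by (subst (asm) AE_distr_iff) simp_all
    then show "AE a in (\<Pi>\<^sub>M j\<in>J. lborel). vJ J (coord_emb J a) * indicator C (coord_emb J a)
        = (\<integral>\<^sup>+u. ennreal (vgg_nu_cramer \<mu> A J u (coord_emb J a)) * indicator (C_set J) u * indicator C (coord_emb J a) \<partial>U)"
    proof eventually_elim
      fix a assume a: "coord_emb J a \<in> V_set J"
      have "(\<lambda>u. ennreal (vgg_nu_cramer \<mu> A J u (coord_emb J a)) * indicator (C_set J) u) \<in> borel_measurable U"
        using measurable_compose[OF measurable_Pair1' nu_pair_measurable[of J], of "coord_emb J a"] by simp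
      then show "vJ J (coord_emb J a) * indicator C (coord_emb J a)
          = (\<integral>\<^sup>+u. ennreal (vgg_nu_cramer \<mu> A J u (coord_emb J a)) * indicator (C_set J) u * indicator C (coord_emb J a) \<partial>U)"
        using a by (simp add: vJ_def nn_integral_multc)
    qed
  qed
  finally show "(\<integral>\<^sup>+y. vJ J y * indicator C y \<partial>coord_lebesgue J)
      = (\<integral>\<^sup>+a. \<integral>\<^sup>+u. ennreal (vgg_nu_cramer \<mu> A J u (coord_emb J a)) * indicator (C_set J) u * indicator C (coord_emb J a) \<partial>U \<partial>(\<Pi>\<^sub>M j\<in>J. lborel))" .
qed

text \<open>U is split according to the support J of u. On each piece the kernel has a density on
  \<open>coord_space J\<close>, and Tonelli moves the integral over U inside the one over the
  coordinates.\<close>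

lemma levyY_decomposition:
  assumes inv: "invertible A" and C: "C \<in> sets borel_star"
  shows "emeasure levyY C = (\<Sum>J | J \<noteq> {}. emeasure (density (coord_lebesgue J) (vJ J)) C)"
proof -
  have Cb [measurable]: "C \<in> sets borel" using sets_borel_starD[OF C] by auto
  define h where "h u = (\<integral>\<^sup>+g. ennreal (exp (- (norm u)\<^sup>2 * g) / g) * hit C (g *\<^sub>R u) \<partial>pos_lborel)" for u
  have hm [measurable]: "h \<in> borel_measurable U" unfolding h_def[abs_def] by (rule weighted_hit_measurable[OF Cb])
  have CU [measurable]: "(\<lambda>u. indicator (C_set J) u :: ennreal) \<in> borel_measurable U" for J
    by (rule measurable_thorin[OF U]) simp
  have "emeasure levyY C = (\<integral>\<^sup>+u. (\<Sum>J | J \<noteq> {}. h u * indicator (C_set J) u) \<partial>U)"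
    unfolding emeasure_levyY[OF C] h_def[symmetric]
    by (rule nn_integral_cong) (simp add: sum_distrib_left[symmetric] orthant_star_C_sets space_thorin[OF U])
  also have "\<dots> = (\<Sum>J | J \<noteq> {}. \<integral>\<^sup>+u. h u * indicator (C_set J) u \<partial>U)"
    by (rule nn_integral_sum) measurable
  also have "\<dots> = (\<Sum>J | J \<noteq> {}. emeasure (density (coord_lebesgue J) (vJ J)) C)"
  proof (rule sum.cong[OF refl])
    fix J :: "'n set" assume "J \<in> {J. J \<noteq> {}}"
    then have J: "J \<noteq> {}" by simp
    interpret L: product_sigma_finite "\<lambda>_::'n. lborel :: real measure" ..
    interpret UJ: pair_sigma_finite U "\<Pi>\<^sub>M j\<in>J. (lborel :: real measure)"
      using thorin_sigma_finite[OF U] L.sigma_finite[OF finite] by (rule pair_sigma_finite.intro)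
    have "(\<integral>\<^sup>+u. h u * indicator (C_set J) u \<partial>U)
        = (\<integral>\<^sup>+u. \<integral>\<^sup>+a. ennreal (vgg_nu_cramer \<mu> A J u (coord_emb J a)) * indicator (C_set J) u * indicator C (coord_emb J a) \<partial>(\<Pi>\<^sub>M j\<in>J. lborel) \<partial>U)"
    proof (rule nn_integral_cong)
      fix u assume "u \<in> space U"
      show "h u * indicator (C_set J) u
          = (\<integral>\<^sup>+a. ennreal (vgg_nu_cramer \<mu> A J u (coord_emb J a)) * indicator (C_set J) u * indicator C (coord_emb J a) \<partial>(\<Pi>\<^sub>M j\<in>J. lborel))"
      proof (cases "u \<in> C_set J")
        case u: True
        have "hit C (g *\<^sub>R u) = emeasure (distr MB borel (multi_time B (g *\<^sub>R u))) C" if "g \<in> space pos_lborel" for g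
        proof -
          have "g *\<^sub>R u \<in> orthant" using that C_set_orthant[OF u] by (simp add: orthant_def)
          then show ?thesis by (simp add: hit_def b_law)
        qed
        then have "h u = (\<integral>\<^sup>+g. ennreal (exp (- (norm u)\<^sup>2 * g) / g) * emeasure (distr MB borel (multi_time B (g *\<^sub>R u))) C \<partial>pos_lborel)"
          unfolding h_def by (intro nn_integral_cong) simp
        then show ?thesis using u vg_measure_density[OF BM A inv u J Cb] by simp
      qed simp
    qed
    also have "\<dots> = (\<integral>\<^sup>+a. \<integral>\<^sup>+u. ennreal (vgg_nu_cramer \<mu> A J u (coord_emb J a)) * indicator (C_set J) u * indicator C (coord_emb J a) \<partial>U \<partial>(\<Pi>\<^sub>M j\<in>J. lborel))"
    proof (rule UJ.Fubini'[symmetric])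
      have "(\<lambda>p. (coord_emb J (snd p), fst p)) \<in> U \<Otimes>\<^sub>M (\<Pi>\<^sub>M j\<in>J. lborel) \<rightarrow>\<^sub>M borel \<Otimes>\<^sub>M U" by measurable
      from measurable_compose[OF this nu_pair_measurable[of J]]
      have [measurable]: "(\<lambda>p. ennreal (vgg_nu_cramer \<mu> A J (fst p) (coord_emb J (snd p))) * indicator (C_set J) (fst p)) \<in> borel_measurable (U \<Otimes>\<^sub>M (\<Pi>\<^sub>M j\<in>J. lborel))"
        by simp
      show "(\<lambda>(u, a). ennreal (vgg_nu_cramer \<mu> A J u (coord_emb J a)) * indicator (C_set J) u * indicator C (coord_emb J a)) \<in> borel_measurable (U \<Otimes>\<^sub>M (\<Pi>\<^sub>M j\<in>J. lborel))"
        unfolding split_beta' by measurable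
    qed
    finally show "(\<integral>\<^sup>+u. h u * indicator (C_set J) u \<partial>U) = emeasure (density (coord_lebesgue J) (vJ J)) C"
      using emeasure_density_part[OF J C] by simp
  qed
  finally show ?thesis .
qed

end

section \<open>Transfer from the weakly subordinated process to Y\<close>

lemma equal_in_law_marginal:
  fixes X :: "real \<Rightarrow> 'v \<Rightarrow> real ^ 'n" and Y :: "real \<Rightarrow> 'w \<Rightarrow> real ^ 'n"
  assumes E: "equal_in_law M X N Y" and t: "0 \<le> t"
    and X: "X t \<in> borel_measurable M" and Y: "Y t \<in> borel_measurable N"
  shows "distr M borel (X t) = distr N borel (Y t)"
proof -
  have d: "distr M (\<Pi>\<^sub>M s\<in>{t}. borel) (\<lambda>\<omega>. \<lambda>s\<in>{t}. X s \<omega>) = distr N (\<Pi>\<^sub>M s\<in>{t}. borel) (\<lambda>\<omega>. \<lambda>s\<in>{t}. Y s \<omega>)"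
    using E t unfolding equal_in_law_def by auto
  have c: "(\<lambda>x. x t) \<in> (\<Pi>\<^sub>M s\<in>{t}. borel) \<rightarrow>\<^sub>M (borel :: (real ^ 'n) measure)" by (rule measurable_component_singleton) simp
  have mX: "(\<lambda>\<omega>. \<lambda>s\<in>{t}. X s \<omega>) \<in> M \<rightarrow>\<^sub>M (\<Pi>\<^sub>M s\<in>{t}. borel)" by (rule measurable_restrict) (use X in simp)
  have mY: "(\<lambda>\<omega>. \<lambda>s\<in>{t}. Y s \<omega>) \<in> N \<rightarrow>\<^sub>M (\<Pi>\<^sub>M s\<in>{t}. borel)" by (rule measurable_restrict) (use Y in simp)
  have "distr M borel (X t) = distr (distr M (\<Pi>\<^sub>M s\<in>{t}. borel) (\<lambda>\<omega>. \<lambda>s\<in>{t}. X s \<omega>)) borel (\<lambda>x. x t)"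
    using distr_distr[OF c mX] by (simp add: comp_def)
  also have "\<dots> = distr N borel (Y t)"
    unfolding d using distr_distr[OF c mY] by (simp add: comp_def)
  finally show ?thesis .
qed

theorem theorem4p1:
  fixes M :: "'w measure" and Y :: "real \<Rightarrow> 'w \<Rightarrow> real ^ 'n"
    and d \<mu> :: "real ^ 'n" and A :: "real ^ 'n ^ 'n" and \<U> :: "(real ^ 'n) measure"
    and MB :: "'b measure" and B :: "real \<Rightarrow> 'b \<Rightarrow> real ^ 'n"
    and MT :: "'t measure" and T :: "real \<Rightarrow> 't \<Rightarrow> real ^ 'n"
    and MZ :: "'z measure" and Z :: "real \<Rightarrow> 'z \<Rightarrow> real ^ ('n + 'n)"
  assumes "thorin_measure \<U>"
    and "d \<in> orthant"
    and "covariance_matrix A"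
    and "vgg_process M Y d \<mu> A \<U> MB B MT T MZ Z"
  shows "let \<Y> = vgg_levy_measure \<mu> A \<U>; m = d \<diamond>\<^sub>v \<mu> + vgg_small_jump_mean \<mu> A \<U> in
    levy_law M Y m (d \<diamond>\<^sub>m A) \<Y> \<and>
    (\<forall>C \<in> sets borel_star.
       emeasure \<Y> C = (\<integral>\<^sup>+ u. emeasure (vg_kernel \<mu> A u) C * ennreal (1 / (norm u)\<^sup>2) \<partial>\<U>)) \<and>
    (\<forall>u \<in> orthant_star. set_integrable (vg_kernel \<mu> A u) (cball 0 1) (\<lambda>y. y)) \<and>
    integrable \<U> (\<lambda>u. (1 / (norm u)\<^sup>2) *\<^sub>R (LINT y:cball 0 1|vg_kernel \<mu> A u. y)) \<and>
    (set_integrable \<Y> (cball 0 1) (\<lambda>y. y) \<longrightarrow> m = d \<diamond>\<^sub>v \<mu> + (LINT y:cball 0 1|\<Y>. y)) \<and>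
    (\<forall>\<theta>.
       integrable \<U> (\<lambda>u. Ln ((of_real ((norm u)\<^sup>2) - \<i> * of_real ((u \<diamond>\<^sub>v \<mu>) \<bullet> \<theta>)
           + of_real (qinner (u \<diamond>\<^sub>m A) \<theta> \<theta>) / 2) / of_real ((norm u)\<^sup>2))) \<and>
       levy_exponent m (d \<diamond>\<^sub>m A) \<Y> \<theta> =
         \<i> * of_real ((d \<diamond>\<^sub>v \<mu>) \<bullet> \<theta>) - of_real (qinner (d \<diamond>\<^sub>m A) \<theta> \<theta>) / 2
         - (\<integral>u. Ln ((of_real ((norm u)\<^sup>2) - \<i> * of_real ((u \<diamond>\<^sub>v \<mu>) \<bullet> \<theta>)
             + of_real (qinner (u \<diamond>\<^sub>m A) \<theta> \<theta>) / 2) / of_real ((norm u)\<^sup>2)) \<partial>\<U>)) \<and>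
    (invertible A \<longrightarrow>
       (\<exists>\<Y>\<^sub>J :: 'n set \<Rightarrow> (real ^ 'n) measure.
          (\<forall>C \<in> sets borel_star. emeasure \<Y> C = (\<Sum>J | J \<noteq> {}. emeasure (\<Y>\<^sub>J J) C)) \<and>
          (\<forall>J. J \<noteq> {} \<longrightarrow>
             sets (\<Y>\<^sub>J J) = sets borel_star \<and>
             emeasure (\<Y>\<^sub>J J) (- {0} - V_set J) = 0 \<and>
             absolutely_continuous (coord_lebesgue J) (\<Y>\<^sub>J J) \<and>
             vgg_density \<mu> A \<U> J \<in> borel_measurable (coord_lebesgue J) \<and>
             \<Y>\<^sub>J J = density (coord_lebesgue J) (vgg_density \<mu> A \<U> J))))"
proof -
  have LY: "levy_process M Y" and BM: "brownian_motion MB B \<mu> A" and G: "ggc_subordinator MT T d \<U>"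
    and W: "weak_subordination MB B \<mu> A MT T MZ Z" and E: "equal_in_law M Y MZ (\<lambda>t \<omega>. vsnd (Z t \<omega>))"
    using assms(4) by (auto simp: vgg_process_def)
  obtain b where b: "(\<lambda>(t, \<omega>). b t \<omega>) \<in> borel_measurable (borel \<Otimes>\<^sub>M MB)"
    "\<And>t. t \<in> orthant \<Longrightarrow> AE \<omega> in MB. b t \<omega> = multi_time B t \<omega>"
    using multi_time_jointly_measurable[of MB B] BM by (auto simp: brownian_motion_def levy_law_def)
  interpret vgg \<U> MB B \<mu> A b
    using assms(1,3) BM b by unfold_locales auto
  let ?m = "d \<diamond>\<^sub>v \<mu> + vgg_small_jump_mean \<mu> A \<U>"
  have expo: "levy_exponent ?m (d \<diamond>\<^sub>m A) levyY \<theta>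
      = \<i> * of_real ((d \<diamond>\<^sub>v \<mu>) \<bullet> \<theta>) - of_real (qinner (d \<diamond>\<^sub>m A) \<theta> \<theta>) / 2 + (\<integral>x. bm_cf (jump x) \<theta> - 1 \<partial>thorin_mix \<U>)" for \<theta>
    by (rule levyY_exponent(2))
  have LZ: "levy_process MZ Z" using W by (auto simp: weak_subordination_def levy_law_def)
  \<comment> \<open>One-time laws suffice here: beyond being a Levy process, which is given for Y,
    the transform condition in \<open>levy_law\<close> concerns single times.\<close>
  have cf: "(\<integral>\<omega>. iexp (\<theta> \<bullet> Y t \<omega>) \<partial>M) = exp (of_real t * levy_exponent ?m (d \<diamond>\<^sub>m A) levyY \<theta>)" if t: "0 \<le> t" for t \<theta>
  proof -
    have Ym: "Y t \<in> borel_measurable M" using LY t by (simp add: levy_process_def)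
    have "Z t \<in> borel_measurable MZ" using LZ t by (simp add: levy_process_def)
    then have Zm: "(\<lambda>\<omega>. vsnd (Z t \<omega>)) \<in> borel_measurable MZ" by measurable
    have "(\<integral>\<omega>. iexp (\<theta> \<bullet> Y t \<omega>) \<partial>M) = (\<integral>y. iexp (\<theta> \<bullet> y) \<partial>distr M borel (Y t))"
      by (rule integral_distr[symmetric, OF Ym]) measurable
    also have "\<dots> = (\<integral>\<omega>. iexp (\<theta> \<bullet> vsnd (Z t \<omega>)) \<partial>MZ)"
      unfolding equal_in_law_marginal[OF E t Ym Zm] by (rule integral_distr[OF Zm]) measurable
    finally show ?thesis unfolding weak_subordination_cf[OF W G t] expo .
  qed
  have 1: "levy_law M Y ?m (d \<diamond>\<^sub>m A) levyY"
    unfolding levy_law_def using LY diamond_mat_psd[OF assms(3,2)] levyY_levy_measure cf by blast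
  have 2: "\<exists>\<Y>\<^sub>J :: 'n set \<Rightarrow> (real ^ 'n) measure.
          (\<forall>C \<in> sets borel_star. emeasure levyY C = (\<Sum>J | J \<noteq> {}. emeasure (\<Y>\<^sub>J J) C)) \<and>
          (\<forall>J. J \<noteq> {} \<longrightarrow>
             sets (\<Y>\<^sub>J J) = sets borel_star \<and>
             emeasure (\<Y>\<^sub>J J) (- {0} - V_set J) = 0 \<and>
             absolutely_continuous (coord_lebesgue J) (\<Y>\<^sub>J J) \<and>
             vgg_density \<mu> A \<U> J \<in> borel_measurable (coord_lebesgue J) \<and>
             \<Y>\<^sub>J J = density (coord_lebesgue J) (vgg_density \<mu> A \<U> J))" if inv: "invertible A"
  proof (intro exI[of _ "\<lambda>J. density (coord_lebesgue J) (vJ J)"] conjI ballI allI impI)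
    show "emeasure levyY C = (\<Sum>J | J \<noteq> {}. emeasure (density (coord_lebesgue J) (vJ J)) C)" if "C \<in> sets borel_star" for C
      by (rule levyY_decomposition[OF inv that])
    fix J :: "'n set" assume J: "J \<noteq> {}"
    have s: "sets (coord_lebesgue J) = sets borel_star" by (simp add: coord_lebesgue_eq)
    then show "sets (density (coord_lebesgue J) (vJ J)) = sets borel_star" by simp
    have "vJ J \<in> borel_measurable borel_star"
      unfolding borel_star_def by (rule measurable_restrict_space1) measurable
    then have m: "vJ J \<in> borel_measurable (coord_lebesgue J)"
      using measurable_cong_sets[OF s refl] by blast
    show "vgg_density \<mu> A \<U> J \<in> borel_measurable (coord_lebesgue J)"
      unfolding vgg_density_eq[OF inv J] by (rule m)
    show "density (coord_lebesgue J) (vJ J) = density (coord_lebesgue J) (vgg_density \<mu> A \<U> J)"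
      unfolding vgg_density_eq[OF inv J] ..
    show "absolutely_continuous (coord_lebesgue J) (density (coord_lebesgue J) (vJ J))"
      by (rule absolutely_continuousI_density[OF m])
    have "- {0} - V_set J \<in> sets (borel_star :: (real ^ 'n) measure)"
      unfolding borel_star_def sets_restrict_space by (rule image_eqI[where x="- V_set J"]) auto
    then have "emeasure (density (coord_lebesgue J) (vJ J)) (- {0} - V_set J)
        = (\<integral>\<^sup>+y. vJ J y * indicator (- {0} - V_set J) y \<partial>coord_lebesgue J)"
      by (rule emeasure_density_part(1)[OF J])
    also have "\<dots> = (\<integral>\<^sup>+y. 0 \<partial>coord_lebesgue J)"
      by (rule nn_integral_cong) (auto simp: vJ_def indicator_def)
    finally show "emeasure (density (coord_lebesgue J) (vJ J)) (- {0} - V_set J) = 0" by simp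
  qed
  show ?thesis
    unfolding Let_def vgg_levy_measure_eq
  proof (intro conjI ballI allI impI)
    show "levy_law M Y ?m (d \<diamond>\<^sub>m A) levyY" by (rule 1)
    show "emeasure levyY C = (\<integral>\<^sup>+ u. emeasure (vg_kernel \<mu> A u) C * ennreal (1 / (norm u)\<^sup>2) \<partial>\<U>)" if "C \<in> sets borel_star" for C
      by (rule emeasure_levyY_kernel[OF that])
    show "set_integrable (vg_kernel \<mu> A u) (cball 0 1) (\<lambda>y. y)" if "u \<in> orthant_star" for u
      by (rule vg_kernel_mean(1)[OF that])
    show "integrable \<U> (\<lambda>u. (1 / (norm u)\<^sup>2) *\<^sub>R (LINT y:cball 0 1|vg_kernel \<mu> A u. y))"
      by (rule small_jump_mean(1))
    show "?m = d \<diamond>\<^sub>v \<mu> + (LINT y:cball 0 1|levyY. y)" if "set_integrable levyY (cball 0 1) (\<lambda>y. y)"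
      by (simp add: levyY_mean[OF that])
    fix \<theta>
    show "integrable \<U> (\<lambda>u. Ln ((of_real ((norm u)\<^sup>2) - \<i> * of_real ((u \<diamond>\<^sub>v \<mu>) \<bullet> \<theta>)
           + of_real (qinner (u \<diamond>\<^sub>m A) \<theta> \<theta>) / 2) / of_real ((norm u)\<^sup>2)))"
      by (rule bm_cf_log_integral(1))
    show "levy_exponent ?m (d \<diamond>\<^sub>m A) levyY \<theta> =
         \<i> * of_real ((d \<diamond>\<^sub>v \<mu>) \<bullet> \<theta>) - of_real (qinner (d \<diamond>\<^sub>m A) \<theta> \<theta>) / 2
         - (\<integral>u. Ln ((of_real ((norm u)\<^sup>2) - \<i> * of_real ((u \<diamond>\<^sub>v \<mu>) \<bullet> \<theta>)
             + of_real (qinner (u \<diamond>\<^sub>m A) \<theta> \<theta>) / 2) / of_real ((norm u)\<^sup>2)) \<partial>\<U>)"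
      unfolding expo bm_cf_log_integral(2) by simp
  qed (rule 2)
qed

end
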